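(* Let $d\ge1$, $a=0$, $0<\alpha<\infty$, $2<p\le\infty$, $0<\gamma<2d(\frac12-\frac1p)$, and fix $0<t\le T$. Denote the solution map of $(\#)$ by $\mathcal U(t):\psi_0\mapsto\psi(t)$, where $\psi_0=(\psi_{0,1},\dots,\psi_{0,N})$ and $\psi(t)=(\psi_1(t),\dots,\psi_N(t))$. Assume that $\mathcal U(t)$ is well-defined as a map acting in $(\widehat L^p(\mathbb R^d))^N$. Then $\mathcal U(t)$ is not $C^3$-smooth at $\psi_0=0$ in $(\widehat L^p(\mathbb R^d))^N$. (Here the assertion is made for each of the two systems denoted by $(\#)$.)
   Context: The symbol $(\#)$ denotes either of the following two systems for unknowns $\psi_k:\mathbb R^d\times\mathbb R\to\mathbb C$, $k=1,\dots,N$, with parameters $a\ge 0$, $\alpha>0$, $0<\gamma<d$ and a nonzero real constant $\kappa$. (i) Hartree-Fock equations, $N\ge 2$: $$i\partial_t\psi_k-(-\Delta)^{\alpha/2}\psi_k+H_\psi\psi_k-F_\psi(\psi_k)=0,\qquad \psi_k|_{t=0}=\psi_{0,k}.$$ (ii) Reduced Hartree-Fock equations, $N\ge 1$: $$i\partial_t\psi_k-(-\Delta)^{\alpha/2}\psi_k+H_\psi\psi_k=0,\qquad \psi_k|_{t=0}=\psi_{0,k}.$$ Here $H_\psi=\kappa\sum_{l=1}^N\left(\frac{e^{-a|x|}}{|x|^\gamma}*|\psi_l|^2\right)$ and $F_\psi(\psi_k)=\kappa\sum_{l=1}^N\psi_l\left(\frac{e^{-a|x|}}{|x|^\gamma}*(\overline{\psi_l}\psi_k)\right)$,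 with $*$ convolution in $\mathbb R^d$. The Fourier transform is $\mathcal F f(\xi)=\int_{\mathbb R^d}e^{-2\pi i x\cdot\xi}f(x)\,dx$; $(-\Delta)^{\alpha/2}$ is the Fourier multiplier with symbol $(2\pi)^\alpha|\xi|^\alpha$; $U_\alpha(t)=e^{-it(-\Delta)^{\alpha/2}}$ is the Fourier multiplier with symbol $e^{-i(2\pi)^\alpha|\xi|^\alpha t}$. Solutions are understood in the Duhamel sense: $\psi_k(t)=U_\alpha(t)\psi_{0,k}+i\int_0^tU_\alpha(t-s)(H_\psi\psi_k)(s)\,ds-i\int_0^tU_\alpha(t-s)(F_\psi(\psi_k))(s)\,ds$ (the last term being absent in case (ii)). For $1\le p\le\infty$, the Fourier-Lebesgue space is $\widehat L^p(\mathbb R^d)=\{f\in\mathcal S'(\mathbb R^d):\|f\|_{\widehat L^p}:=\|\mathcal F f\|_{L^{p'}}<\infty\}$, $\frac1p+\frac1{p'}=1$; $X^N$ carries the norm $\max_j\|\psi_j\|_X$. *)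

theory Defs
  imports "HOL-Analysis.Analysis"
begin

section \<open>Schwartz functions and tempered distributions\<close>

fun iter_partial :: "'a::euclidean_space list \<Rightarrow> ('a \<Rightarrow> complex) \<Rightarrow> 'a \<Rightarrow> complex" where
  "iter_partial [] f = f"
| "iter_partial (b # bs) f = (\<lambda>x. frechet_derivative (iter_partial bs f) (at x) b)"

text \<open>All iterated partial derivatives being (Frechet) differentiable is smoothness.\<close>

definition schwartz :: "('a::euclidean_space \<Rightarrow> complex) set" where
  "schwartz = {\<phi>. \<forall>bs \<in> lists Basis.
      (\<forall>x. iter_partial bs \<phi> differentiable (at x)) \<and>
      (\<forall>k. bounded (range (\<lambda>x. norm x ^ k * norm (iter_partial bs \<phi> x))))}"

definition schwartz_seminorm :: "nat \<times> 'a::euclidean_space list \<Rightarrow> ('a \<Rightarrow> complex) \<Rightarrow> real" where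
  "schwartz_seminorm i \<phi> = (SUP x. norm x ^ fst i * norm (iter_partial (snd i) \<phi> x))"

text \<open>
  The complex-linear functionals on Schwartz functions that are continuous, that is, bounded by
  finitely many of the seminorms. They are set to zero off the Schwartz space, so that
  equality in HOL is equality of distributions.
\<close>

definition tempered_functional :: "(('a::euclidean_space \<Rightarrow> complex) \<Rightarrow> complex) \<Rightarrow> bool" where
  "tempered_functional T \<longleftrightarrow>
     (\<forall>\<phi>. \<phi> \<notin> schwartz \<longrightarrow> T \<phi> = 0) \<and>
     (\<forall>\<phi>\<in>schwartz. \<forall>\<eta>\<in>schwartz. T (\<lambda>x. \<phi> x + \<eta> x) = T \<phi> + T \<eta>) \<and>
     (\<forall>c. \<forall>\<phi>\<in>schwartz. T (\<lambda>x. c * \<phi> x) = c * T \<phi>) \<and>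
     (\<exists>C I. finite I \<and> I \<subseteq> UNIV \<times> lists Basis \<and>
        (\<forall>\<phi>\<in>schwartz. norm (T \<phi>) \<le> C * (\<Sum>i\<in>I. schwartz_seminorm i \<phi>)))"

lemma schwartz_seminorm_nonneg:
  fixes \<phi> :: "'a::euclidean_space \<Rightarrow> complex"
  assumes "\<phi> \<in> schwartz" and "i \<in> UNIV \<times> lists Basis"
  shows "schwartz_seminorm i \<phi> \<ge> 0"
proof -
  have "bounded (range (\<lambda>x. norm x ^ fst i * norm (iter_partial (snd i) \<phi> x)))"
    using assms by (auto simp: schwartz_def)
  then have "bdd_above (range (\<lambda>x. norm x ^ fst i * norm (iter_partial (snd i) \<phi> x)))"
    by (rule bounded_imp_bdd_above)
  then have "norm (0::'a) ^ fst i * norm (iter_partial (snd i) \<phi> 0) \<le> schwartz_seminorm i \<phi>"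
    unfolding schwartz_seminorm_def by (rule cSUP_upper[OF UNIV_I])
  then show ?thesis
    by (rule order_trans[rotated]) simp
qed

lemma tempered_functional_zero: "tempered_functional (\<lambda>\<phi>. 0)"
  unfolding tempered_functional_def by (intro conjI exI[of _ 0] exI[of _ "{}"]) auto

lemma tempered_functionalD:
  assumes "tempered_functional T"
  shows "\<phi> \<notin> schwartz \<Longrightarrow> T \<phi> = 0"
    and "\<phi> \<in> schwartz \<Longrightarrow> \<eta> \<in> schwartz \<Longrightarrow> T (\<lambda>x. \<phi> x + \<eta> x) = T \<phi> + T \<eta>"
    and "\<phi> \<in> schwartz \<Longrightarrow> T (\<lambda>x. c * \<phi> x) = c * T \<phi>"
    and "\<exists>C I. finite I \<and> I \<subseteq> UNIV \<times> lists Basis \<and>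
        (\<forall>\<phi>\<in>schwartz. norm (T \<phi>) \<le> C * (\<Sum>i\<in>I. schwartz_seminorm i \<phi>))"
  using assms unfolding tempered_functional_def by simp_all

lemma tempered_functional_lincomb:
  assumes S: "tempered_functional S" and T: "tempered_functional T"
  shows "tempered_functional (\<lambda>\<phi>. a * S \<phi> + b * T \<phi>)"
proof -
  obtain C I where I: "finite I" "I \<subseteq> UNIV \<times> lists Basis"
    and CI: "\<And>\<phi>. \<phi> \<in> schwartz \<Longrightarrow> norm (S \<phi>) \<le> C * (\<Sum>i\<in>I. schwartz_seminorm i \<phi>)"
    using tempered_functionalD(4)[OF S] by metis
  obtain D J where J: "finite J" "J \<subseteq> UNIV \<times> lists Basis"
    and DJ: "\<And>\<phi>. \<phi> \<in> schwartz \<Longrightarrow> norm (T \<phi>) \<le> D * (\<Sum>i\<in>J. schwartz_seminorm i \<phi>)"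
    using tempered_functionalD(4)[OF T] by metis
  have "norm (a * S \<phi> + b * T \<phi>)
      \<le> (norm a * \<bar>C\<bar> + norm b * \<bar>D\<bar>) * (\<Sum>i\<in>I \<union> J. schwartz_seminorm i \<phi>)"
    if \<phi>: "\<phi> \<in> schwartz" for \<phi>
  proof -
    let ?s = "\<lambda>K. \<Sum>i\<in>K. schwartz_seminorm i \<phi>"
    have nn: "schwartz_seminorm i \<phi> \<ge> 0" if "i \<in> I \<union> J" for i
      using schwartz_seminorm_nonneg[OF \<phi>] that I(2) J(2) by blast
    have sI: "?s I \<le> ?s (I \<union> J)" and sJ: "?s J \<le> ?s (I \<union> J)"
      using I(1) J(1) nn by (auto intro!: sum_mono2)
    have pos: "0 \<le> ?s I" "0 \<le> ?s J"
      using nn by (auto intro!: sum_nonneg)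
    have 1: "norm (S \<phi>) \<le> \<bar>C\<bar> * ?s (I \<union> J)"
    proof -
      have "norm (S \<phi>) \<le> C * ?s I" by (rule CI[OF \<phi>])
      also have "\<dots> \<le> \<bar>C\<bar> * ?s I" using pos(1) by (intro mult_right_mono) auto
      also have "\<dots> \<le> \<bar>C\<bar> * ?s (I \<union> J)" using sI by (intro mult_left_mono) auto
      finally show ?thesis .
    qed
    have 2: "norm (T \<phi>) \<le> \<bar>D\<bar> * ?s (I \<union> J)"
    proof -
      have "norm (T \<phi>) \<le> D * ?s J" by (rule DJ[OF \<phi>])
      also have "\<dots> \<le> \<bar>D\<bar> * ?s J" using pos(2) by (intro mult_right_mono) auto
      also have "\<dots> \<le> \<bar>D\<bar> * ?s (I \<union> J)" using sJ by (intro mult_left_mono) auto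
      finally show ?thesis .
    qed
    have "norm (a * S \<phi> + b * T \<phi>) \<le> norm a * norm (S \<phi>) + norm b * norm (T \<phi>)"
      using norm_triangle_ineq[of "a * S \<phi>" "b * T \<phi>"] by (simp add: norm_mult)
    also have "\<dots> \<le> norm a * (\<bar>C\<bar> * ?s (I \<union> J)) + norm b * (\<bar>D\<bar> * ?s (I \<union> J))"
      using 1 2 by (intro add_mono mult_left_mono) auto
    finally show ?thesis by (simp add: algebra_simps)
  qed
  moreover have "finite (I \<union> J)" "I \<union> J \<subseteq> UNIV \<times> lists Basis"
    using I J by auto
  ultimately have "\<exists>C I. finite I \<and> I \<subseteq> UNIV \<times> lists Basis \<and>
      (\<forall>\<phi>\<in>schwartz. norm (a * S \<phi> + b * T \<phi>) \<le> C * (\<Sum>i\<in>I. schwartz_seminorm i \<phi>))"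
    by blast
  moreover have "a * S \<phi> + b * T \<phi> = 0" if "\<phi> \<notin> schwartz" for \<phi>
    using tempered_functionalD(1)[OF S] tempered_functionalD(1)[OF T] that by simp
  moreover have "a * S (\<lambda>x. \<phi> x + \<eta> x) + b * T (\<lambda>x. \<phi> x + \<eta> x)
      = (a * S \<phi> + b * T \<phi>) + (a * S \<eta> + b * T \<eta>)"
    if "\<phi> \<in> schwartz" "\<eta> \<in> schwartz" for \<phi> \<eta>
  proof -
    have "S (\<lambda>x. \<phi> x + \<eta> x) = S \<phi> + S \<eta>" "T (\<lambda>x. \<phi> x + \<eta> x) = T \<phi> + T \<eta>"
      using that by (simp_all add: tempered_functionalD(2)[OF S] tempered_functionalD(2)[OF T])
    then show ?thesis by (simp add: algebra_simps)
  qed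
  moreover have "a * S (\<lambda>x. c * \<phi> x) + b * T (\<lambda>x. c * \<phi> x) = c * (a * S \<phi> + b * T \<phi>)"
    if "\<phi> \<in> schwartz" for c \<phi>
  proof -
    have "S (\<lambda>x. c * \<phi> x) = c * S \<phi>" "T (\<lambda>x. c * \<phi> x) = c * T \<phi>"
      using that by (simp_all add: tempered_functionalD(3)[OF S] tempered_functionalD(3)[OF T])
    then show ?thesis by (simp add: algebra_simps)
  qed
  ultimately show ?thesis
    unfolding tempered_functional_def by (intro conjI allI ballI impI) simp_all
qed

typedef (overloaded) 'a::euclidean_space tempered =
    "{T :: ('a \<Rightarrow> complex) \<Rightarrow> complex. tempered_functional T}"
  morphisms apply_td Abs_td
  using tempered_functional_zero by blast

lemma tempered_functional_apply_td [simp]: "tempered_functional (apply_td T)"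
  using apply_td by blast

instantiation tempered :: (euclidean_space) real_vector
begin

definition "0 = Abs_td (\<lambda>\<phi>. 0)"
definition "S + T = Abs_td (\<lambda>\<phi>. apply_td S \<phi> + apply_td T \<phi>)"
definition "S - T = Abs_td (\<lambda>\<phi>. apply_td S \<phi> - apply_td T \<phi>)"
definition "- T = Abs_td (\<lambda>\<phi>. - apply_td T \<phi>)"
definition "c *\<^sub>R T = Abs_td (\<lambda>\<phi>. c *\<^sub>R apply_td T \<phi>)"

lemma apply_td_zero: "apply_td 0 = (\<lambda>\<phi>. 0)"
  by (simp add: zero_tempered_def Abs_td_inverse tempered_functional_zero)

lemma apply_td_add: "apply_td (S + T) = (\<lambda>\<phi>. apply_td S \<phi> + apply_td T \<phi>)"
  using tempered_functional_lincomb[of "apply_td S" "apply_td T" 1 1]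
  by (simp add: plus_tempered_def Abs_td_inverse)

lemma apply_td_diff: "apply_td (S - T) = (\<lambda>\<phi>. apply_td S \<phi> - apply_td T \<phi>)"
  using tempered_functional_lincomb[of "apply_td S" "apply_td T" 1 "-1"]
  by (simp add: minus_tempered_def Abs_td_inverse)

lemma apply_td_uminus: "apply_td (- T) = (\<lambda>\<phi>. - apply_td T \<phi>)"
  using tempered_functional_lincomb[of "apply_td T" "apply_td T" "-1" 0]
  by (simp add: uminus_tempered_def Abs_td_inverse)

lemma apply_td_scaleR: "apply_td (c *\<^sub>R T) = (\<lambda>\<phi>. c *\<^sub>R apply_td T \<phi>)"
  using tempered_functional_lincomb[of "apply_td T" "apply_td T" "of_real c" 0]
  by (simp add: scaleR_tempered_def Abs_td_inverse scaleR_conv_of_real)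

instance
proof
  fix R S T :: "'a tempered" and b c :: real
  note eqI = apply_td_inject[THEN iffD1]
  show "R + S + T = R + (S + T)" by (rule eqI) (simp add: apply_td_add add.assoc)
  show "S + T = T + S" by (rule eqI) (simp add: apply_td_add add.commute)
  show "0 + T = T" by (rule eqI) (simp add: apply_td_add apply_td_zero)
  show "- T + T = 0" by (rule eqI) (simp add: apply_td_add apply_td_zero apply_td_uminus)
  show "S - T = S + - T" by (rule eqI) (simp add: apply_td_add apply_td_diff apply_td_uminus)
  show "c *\<^sub>R (S + T) = c *\<^sub>R S + c *\<^sub>R T"
    by (rule eqI) (simp add: apply_td_add apply_td_scaleR scaleR_add_right)
  show "(b + c) *\<^sub>R T = b *\<^sub>R T + c *\<^sub>R T"
    by (rule eqI) (simp add: apply_td_add apply_td_scaleR scaleR_add_left)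
  show "b *\<^sub>R c *\<^sub>R T = (b * c) *\<^sub>R T" by (rule eqI) (simp add: apply_td_scaleR)
  show "1 *\<^sub>R T = T" by (rule eqI) (simp add: apply_td_scaleR)
qed

end

text \<open>The distribution \<^term>\<open>T\<close> is the function \<^term>\<open>u\<close>.\<close>

definition represents :: "('a::euclidean_space \<Rightarrow> complex) \<Rightarrow> 'a tempered \<Rightarrow> bool" where
  "represents u T \<longleftrightarrow> u \<in> borel_measurable borel \<and>
     (\<forall>\<phi>\<in>schwartz. integrable lborel (\<lambda>x. u x * \<phi> x) \<and>
        apply_td T \<phi> = (LINT x|lborel. u x * \<phi> x))"

section \<open>Fourier transform, Fourier multipliers, Fourier--Lebesgue spaces\<close>

definition fourier :: "('a::euclidean_space \<Rightarrow> complex) \<Rightarrow> 'a \<Rightarrow> complex" where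
  "fourier f \<xi> = (LINT x|lborel. exp (- (2 * of_real pi * \<i> * of_real (x \<bullet> \<xi>))) * f x)"

text \<open>
  The Fourier transform of \<^term>\<open>T\<close>, defined by duality, is the function \<^term>\<open>g\<close>.
\<close>

definition fourier_represents :: "('a::euclidean_space \<Rightarrow> complex) \<Rightarrow> 'a tempered \<Rightarrow> bool" where
  "fourier_represents g T \<longleftrightarrow> g \<in> borel_measurable borel \<and>
     (\<forall>\<phi>\<in>schwartz. integrable lborel (\<lambda>\<xi>. g \<xi> * \<phi> \<xi>) \<and>
        apply_td T (fourier \<phi>) = (LINT \<xi>|lborel. g \<xi> * \<phi> \<xi>))"

definition fourier_multiplier ::
    "('a::euclidean_space \<Rightarrow> complex) \<Rightarrow> 'a tempered \<Rightarrow> 'a tempered" where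
  "fourier_multiplier m T =
     (THE S. \<exists>g. fourier_represents g T \<and> fourier_represents (\<lambda>\<xi>. m \<xi> * g \<xi>) S)"

definition free_propagator :: "real \<Rightarrow> real \<Rightarrow> 'a::euclidean_space tempered \<Rightarrow> 'a tempered" where
  "free_propagator \<alpha> t =
     fourier_multiplier (\<lambda>\<xi>. exp (- (\<i> * of_real ((2 * pi) powr \<alpha> * norm \<xi> powr \<alpha> * t))))"

definition conj_exponent :: "ennreal \<Rightarrow> ennreal" where
  "conj_exponent p = inverse (1 - inverse p)"

definition Lp_space :: "ennreal \<Rightarrow> ('a::euclidean_space \<Rightarrow> complex) set" where
  "Lp_space q = {g \<in> borel_measurable borel.
     if q = \<infinity> then \<exists>C. AE x in lborel. norm (g x) \<le> C
     else integrable lborel (\<lambda>x. norm (g x) powr enn2real q)}"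

definition Lp_norm :: "ennreal \<Rightarrow> ('a::euclidean_space \<Rightarrow> complex) \<Rightarrow> real" where
  "Lp_norm q g =
     (if q = \<infinity> then Inf {C. 0 \<le> C \<and> (AE x in lborel. norm (g x) \<le> C)}
      else (LINT x|lborel. norm (g x) powr enn2real q) powr (1 / enn2real q))"

definition Lhat :: "ennreal \<Rightarrow> 'a::euclidean_space tempered set" where
  "Lhat p = {T. \<exists>g \<in> Lp_space (conj_exponent p). fourier_represents g T}"

text \<open>The representing function is unique up to null sets, so its choice does not matter.\<close>

definition Lhat_norm :: "ennreal \<Rightarrow> 'a::euclidean_space tempered \<Rightarrow> real" where
  "Lhat_norm p T = Lp_norm (conj_exponent p) (SOME g. fourier_represents g T)"

definition LhatN :: "ennreal \<Rightarrow> ('a::euclidean_space tempered ^ 'n) set" where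
  "LhatN p = {\<psi>. \<forall>k. \<psi> $ k \<in> Lhat p}"

definition LhatN_norm :: "ennreal \<Rightarrow> 'a::euclidean_space tempered ^ 'n \<Rightarrow> real" where
  "LhatN_norm p \<psi> = (MAX k. Lhat_norm p (\<psi> $ k))"

section \<open>The Hartree--Fock and reduced Hartree--Fock equations\<close>

datatype hf_system = Hartree_Fock | Reduced_Hartree_Fock

definition kernel :: "real \<Rightarrow> real \<Rightarrow> 'a::euclidean_space \<Rightarrow> complex" where
  "kernel a \<gamma> x = of_real (exp (- a * norm x) / norm x powr \<gamma>)"

definition convolution ::
    "('a::euclidean_space \<Rightarrow> complex) \<Rightarrow> ('a \<Rightarrow> complex) \<Rightarrow> 'a \<Rightarrow> complex" where
  "convolution f g x = (LINT y|lborel. f (x - y) * g y)"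

definition convolution_exists ::
    "('a::euclidean_space \<Rightarrow> complex) \<Rightarrow> ('a \<Rightarrow> complex) \<Rightarrow> bool" where
  "convolution_exists f g \<longleftrightarrow> (AE x in lborel. integrable lborel (\<lambda>y. f (x - y) * g y))"

definition hartree_potential ::
    "real \<Rightarrow> real \<Rightarrow> real \<Rightarrow> ('n::finite \<Rightarrow> 'a::euclidean_space \<Rightarrow> complex) \<Rightarrow> 'a \<Rightarrow> complex" where
  "hartree_potential \<kappa> a \<gamma> u x =
     of_real \<kappa> * (\<Sum>l\<in>UNIV. convolution (kernel a \<gamma>) (\<lambda>y. of_real ((norm (u l y))\<^sup>2)) x)"

definition exchange_function ::
    "real \<Rightarrow> real \<Rightarrow> real \<Rightarrow> ('n::finite \<Rightarrow> 'a::euclidean_space \<Rightarrow> complex) \<Rightarrow> 'n \<Rightarrow> 'a \<Rightarrow> complex" where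
  "exchange_function \<kappa> a \<gamma> u k x =
     of_real \<kappa> * (\<Sum>l\<in>UNIV. u l x * convolution (kernel a \<gamma>) (\<lambda>y. cnj (u l y) * u k y) x)"

text \<open>
  \<^term>\<open>is_hartree_term\<close> and \<^term>\<open>is_exchange_term\<close> say that the nonlinear term is meaningful at
  the given instant and equal to the distribution \<^term>\<open>W\<close>: the components are functions, the
  convolutions converge absolutely almost everywhere, the resulting function is a tempered
  distribution, and its Fourier transform is a function (so that the free propagator, whose
  symbol is not smooth, applies to it).
\<close>

definition is_hartree_term ::
    "real \<Rightarrow> real \<Rightarrow> real \<Rightarrow> 'a::euclidean_space tempered ^ 'n \<Rightarrow> 'n \<Rightarrow> 'a tempered \<Rightarrow> bool" where
  "is_hartree_term \<kappa> a \<gamma> \<Psi> k W \<longleftrightarrow>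
     (\<exists>u. (\<forall>l. represents (u l) (\<Psi> $ l)) \<and>
          (\<forall>l. convolution_exists (kernel a \<gamma>) (\<lambda>y. of_real ((norm (u l y))\<^sup>2))) \<and>
          represents (\<lambda>x. hartree_potential \<kappa> a \<gamma> u x * u k x) W) \<and>
     (\<exists>g. fourier_represents g W)"

definition is_exchange_term ::
    "real \<Rightarrow> real \<Rightarrow> real \<Rightarrow> 'a::euclidean_space tempered ^ 'n \<Rightarrow> 'n \<Rightarrow> 'a tempered \<Rightarrow> bool" where
  "is_exchange_term \<kappa> a \<gamma> \<Psi> k W \<longleftrightarrow>
     (\<exists>u. (\<forall>l. represents (u l) (\<Psi> $ l)) \<and>
          (\<forall>l. convolution_exists (kernel a \<gamma>) (\<lambda>y. cnj (u l y) * u k y)) \<and>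
          represents (exchange_function \<kappa> a \<gamma> u k) W) \<and>
     (\<exists>g. fourier_represents g W)"

text \<open>
  \<^term>\<open>I\<close> is the integral of the distribution-valued function \<^term>\<open>w\<close> over \<^term>\<open>A\<close>, in the
  weak sense.
\<close>

definition has_td_integral ::
    "(real \<Rightarrow> 'a::euclidean_space tempered) \<Rightarrow> 'a tempered \<Rightarrow> real set \<Rightarrow> bool" where
  "has_td_integral w I A \<longleftrightarrow>
     (\<forall>\<phi>\<in>schwartz. set_integrable lebesgue A (\<lambda>s. apply_td (w s) \<phi>) \<and>
        apply_td I \<phi> = (LINT s:A|lebesgue. apply_td (w s) \<phi>))"

text \<open>
  Solutions on \<^term>\<open>{0..T}\<close> are continuous curves in the space \<^term>\<open>LhatN p\<close> satisfying the
  Duhamel formula; the nonlinear terms need to be meaningful at almost every time only.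
\<close>

definition duhamel_solution ::
    "hf_system \<Rightarrow> real \<Rightarrow> real \<Rightarrow> real \<Rightarrow> real \<Rightarrow> ennreal \<Rightarrow> real \<Rightarrow>
     'a::euclidean_space tempered ^ 'n \<Rightarrow> (real \<Rightarrow> 'a tempered ^ 'n) \<Rightarrow> bool" where
  "duhamel_solution sys \<kappa> a \<gamma> \<alpha> p T \<psi>0 \<psi> \<longleftrightarrow>
     (\<forall>s\<in>{0..T}. \<psi> s \<in> LhatN p) \<and>
     (\<forall>s\<in>{0..T}. \<forall>\<epsilon>>0. \<exists>\<delta>>0. \<forall>r\<in>{0..T}. \<bar>r - s\<bar> < \<delta> \<longrightarrow> LhatN_norm p (\<psi> r - \<psi> s) < \<epsilon>) \<and>
     (\<exists>H F.
        (AE s in lebesgue. s \<in> {0..T} \<longrightarrow> (\<forall>k. is_hartree_term \<kappa> a \<gamma> (\<psi> s) k (H s k))) \<and>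
        (sys = Hartree_Fock \<longrightarrow>
           (AE s in lebesgue. s \<in> {0..T} \<longrightarrow> (\<forall>k. is_exchange_term \<kappa> a \<gamma> (\<psi> s) k (F s k)))) \<and>
        (\<forall>t\<in>{0..T}. \<forall>k. \<exists>IH IF.
           has_td_integral (\<lambda>s. free_propagator \<alpha> (t - s) (H s k)) IH {0..t} \<and>
           (case sys of
              Hartree_Fock \<Rightarrow> has_td_integral (\<lambda>s. free_propagator \<alpha> (t - s) (F s k)) IF {0..t}
            | Reduced_Hartree_Fock \<Rightarrow> IF = 0) \<and>
           (\<forall>\<phi>\<in>schwartz. apply_td (\<psi> t $ k) \<phi> =
              apply_td (free_propagator \<alpha> t (\<psi>0 $ k)) \<phi>
                + \<i> * apply_td IH \<phi> - \<i> * apply_td IF \<phi>)))"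

definition is_solution_value ::
    "hf_system \<Rightarrow> real \<Rightarrow> real \<Rightarrow> real \<Rightarrow> real \<Rightarrow> ennreal \<Rightarrow> real \<Rightarrow> real \<Rightarrow>
     'a::euclidean_space tempered ^ 'n \<Rightarrow> 'a tempered ^ 'n \<Rightarrow> bool" where
  "is_solution_value sys \<kappa> a \<gamma> \<alpha> p T t \<psi>0 v \<longleftrightarrow>
     (\<exists>\<psi>. duhamel_solution sys \<kappa> a \<gamma> \<alpha> p T \<psi>0 \<psi> \<and> v = \<psi> t)"

definition solution_map ::
    "hf_system \<Rightarrow> real \<Rightarrow> real \<Rightarrow> real \<Rightarrow> real \<Rightarrow> ennreal \<Rightarrow> real \<Rightarrow> real \<Rightarrow>
     'a::euclidean_space tempered ^ 'n \<Rightarrow> 'a tempered ^ 'n" where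
  "solution_map sys \<kappa> a \<gamma> \<alpha> p T t \<psi>0 = (THE v. is_solution_value sys \<kappa> a \<gamma> \<alpha> p T t \<psi>0 v)"

definition solution_map_well_defined ::
    "hf_system \<Rightarrow> real \<Rightarrow> real \<Rightarrow> real \<Rightarrow> real \<Rightarrow> ennreal \<Rightarrow> real \<Rightarrow> real \<Rightarrow>
     ('a::euclidean_space tempered ^ 'n) itself \<Rightarrow> bool" where
  "solution_map_well_defined sys \<kappa> a \<gamma> \<alpha> p T t _ \<longleftrightarrow>
     (\<forall>\<psi>0 \<in> (LhatN p :: ('a tempered ^ 'n) set). \<exists>!v. is_solution_value sys \<kappa> a \<gamma> \<alpha> p T t \<psi>0 v)"

section \<open>Maps of class C^m at a point of a normed space\<close>

text \<open>
  The space \<^term>\<open>LhatN p\<close> depends on a term parameter and is therefore not a type of class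
  \<^class>\<open>real_normed_vector\<close>. So Frechet derivatives are defined relative to a linear subspace
  \<^term>\<open>E\<close> with norm \<^term>\<open>nrm\<close>; the \<^term>\<open>k\<close>-th derivative at a point is a bounded
  \<^term>\<open>k\<close>-linear map, taking a list of \<^term>\<open>k\<close> vectors, the newest direction in front.
\<close>

definition bounded_multilinear_on ::
    "'v::real_vector set \<Rightarrow> ('v \<Rightarrow> real) \<Rightarrow> nat \<Rightarrow> ('v list \<Rightarrow> 'v) \<Rightarrow> bool" where
  "bounded_multilinear_on E nrm k M \<longleftrightarrow>
     (\<forall>vs. length vs = k \<and> set vs \<subseteq> E \<longrightarrow> M vs \<in> E) \<and>
     (\<forall>vs i v w c. length vs = k \<and> set vs \<subseteq> E \<and> i < k \<and> v \<in> E \<and> w \<in> E \<longrightarrow>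
        M (vs[i := v + w]) = M (vs[i := v]) + M (vs[i := w]) \<and>
        M (vs[i := c *\<^sub>R v]) = c *\<^sub>R M (vs[i := v])) \<and>
     (\<exists>C. \<forall>vs. length vs = k \<and> set vs \<subseteq> E \<longrightarrow> nrm (M vs) \<le> C * prod_list (map nrm vs))"

text \<open>The operator norm of the difference of the \<^term>\<open>k\<close>-linear maps is at most \<^term>\<open>c\<close>.\<close>

definition multilinear_close ::
    "'v::real_vector set \<Rightarrow> ('v \<Rightarrow> real) \<Rightarrow> nat \<Rightarrow> real \<Rightarrow> ('v list \<Rightarrow> 'v) \<Rightarrow> ('v list \<Rightarrow> 'v) \<Rightarrow> bool" where
  "multilinear_close E nrm k c M M' \<longleftrightarrow>
     (\<forall>vs. length vs = k \<and> set vs \<subseteq> E \<longrightarrow> nrm (M vs - M' vs) \<le> c * prod_list (map nrm vs))"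

text \<open>
  Near \<^term>\<open>x0\<close> the Frechet derivatives \<^term>\<open>D k\<close> up to order \<^term>\<open>m\<close> exist, and \<^term>\<open>D m\<close>
  is continuous at \<^term>\<open>x0\<close>.
\<close>

definition C_smooth_at ::
    "nat \<Rightarrow> 'v::real_vector set \<Rightarrow> ('v \<Rightarrow> real) \<Rightarrow> ('v \<Rightarrow> 'v) \<Rightarrow> 'v \<Rightarrow> bool" where
  "C_smooth_at m E nrm f x0 \<longleftrightarrow>
     (\<exists>r>0. \<exists>D :: nat \<Rightarrow> 'v \<Rightarrow> 'v list \<Rightarrow> 'v. let B = {x \<in> E. nrm (x - x0) < r} in
        (\<forall>x\<in>B. D 0 x [] = f x) \<and>
        (\<forall>x\<in>B. \<forall>k\<le>m. bounded_multilinear_on E nrm k (D k x)) \<and>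
        (\<forall>x\<in>B. \<forall>k<m. \<forall>\<epsilon>>0. \<exists>\<delta>>0. \<forall>y\<in>B. nrm (y - x) < \<delta> \<longrightarrow>
           multilinear_close E nrm k (\<epsilon> * nrm (y - x))
             (D k y) (\<lambda>vs. D k x vs + D (Suc k) x ((y - x) # vs))) \<and>
        (\<forall>\<epsilon>>0. \<exists>\<delta>>0. \<forall>y\<in>B. nrm (y - x0) < \<delta> \<longrightarrow>
           multilinear_close E nrm m \<epsilon> (D m y) (D m x0)))"

end

theory Submission
  imports Defs "HOL-Probability.Probability"
begin

text \<open>
  The obstruction is a mismatch of scaling at low frequency. Fix a profile \<open>F\<close> on the
  Fourier side and take data with Fourier transform \<open>\<epsilon> F(c \<xi>)\<close>, \<open>c
  \<ge> 1\<close>, which live at frequencies of size \<open>1/c\<close>. At time \<open>t\<close>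
  the solution is \<open>\<epsilon>\<close> times the free evolution, plus
  \<open>\<epsilon>\<^sup>3\<close> times a cubic term, the Duhamel integral of the nonlinearity
  along the free evolution, plus an error of fifth order. If the solution map were of class
  \<open>C\<^sup>3\<close> at the origin, the cubic term would be bounded by a constant,
  independent of \<open>c\<close>, times the cube of the norm of \<open>F(c \<xi>)\<close>
  (\<open>C3_smooth_cubic_bound\<close>). On the Fourier side, however, convolution with
  \<open>|x|\<close> to the power \<open>-\<gamma>\<close> is multiplication by a multiple of
  \<open>|\<eta>|\<close> to the power \<open>\<gamma> - d\<close>. By homogeneity the dilation
  multiplies the cubic term, apart from phases that tend to 1, by \<open>c\<close> to the power
  \<open>-(d + \<gamma>)\<close> and dilates its argument (\<open>duh_dilate\<close>), while the
  norm of a dilated function is multiplied by \<open>c\<close> to the power \<open>-d/q\<close>,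
  where \<open>1/q = 1 - 1/p\<close>. The ratio of the two sides is therefore of order
  \<open>c\<close> to the power \<open>-(d + \<gamma>) + 2d/q = d - 2d/p - \<gamma>\<close>, which
  is unbounded precisely because \<open>\<gamma> < 2d(1/2 - 1/p)\<close>. The size of the cubic
  term is measured by pairing it with a dilated Gaussian (\<open>Lhat_pairing_bound\<close>).

  Two points carry the work. First, the solution map is given only through existence and uniqueness
  of solutions in the sense of distributions, so the expansion has to be proved for genuine
  solutions. They are obtained on the Fourier side by a contraction in a weighted sup norm
  (\<open>small_solution\<close>), for which the weight has to be compatible with the singular
  kernel (\<open>K_weight_conv\<close>). That the result solves the Duhamel equation for
  distributions (\<open>duhamel_solution_td_of\<close>) rests on the formula for Riesz potentials
  on the Fourier side (\<open>riesz_potential_ifourier\<close>), which is derived by writing the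
  kernel as a superposition of Gaussians. By uniqueness the value of this solution is the value of
  the solution map (\<open>solution_map_expansion\<close>).

  Second, the leading coefficient must not vanish. For \<open>c \<rightarrow> \<infinity>\<close>
  the phases disappear and it becomes \<open>t\<close> times the nonlinearity evaluated at the
  profile. For the reduced equations one bump is enough. For the Hartree--Fock equations the direct
  and the exchange term cancel whenever only one component is present, so the profile has bumps in
  two different components, so far apart in frequency that the decay of the kernel makes the
  exchange term strictly smaller (\<open>exists_datum\<close>).
\<close>

section \<open>Integration over Euclidean space\<close>

lemma lborel_scale:
  fixes f :: "'a::euclidean_space \<Rightarrow> 'b::{banach, second_countable_topology}"
  assumes f[measurable]: "f \<in> borel_measurable borel" and c: "c \<noteq> 0"
  shows "integrable lborel (\<lambda>x. f (t + c *\<^sub>R x)) \<longleftrightarrow> integrable lborel f"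
    and "(LINT x|lborel. f x) = \<bar>c\<bar> ^ DIM('a) *\<^sub>R (LINT x|lborel. f (t + c *\<^sub>R x))"
proof -
  have "integrable (density (distr lborel borel (\<lambda>x. t + c *\<^sub>R x)) (\<lambda>_. ennreal (\<bar>c\<bar> ^ DIM('a)))) f
      \<longleftrightarrow> integrable lborel (\<lambda>x. f (t + c *\<^sub>R x))"
    (is "?L \<longleftrightarrow> ?R")
  proof -
    have "?L \<longleftrightarrow> integrable lborel (\<lambda>x. \<bar>c\<bar> ^ DIM('a) *\<^sub>R f (t + c *\<^sub>R x))"
      using c by (subst integrable_density) (simp_all add: integrable_distr_eq)
    also have "\<dots> \<longleftrightarrow> ?R"
    proof
      assume "integrable lborel (\<lambda>x. \<bar>c\<bar> ^ DIM('a) *\<^sub>R f (t + c *\<^sub>R x))"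
      from integrable_scaleR_right[OF this, of "inverse (\<bar>c\<bar> ^ DIM('a))"]
      show ?R using c by simp
    qed simp
    finally show ?thesis .
  qed
  then show "integrable lborel (\<lambda>x. f (t + c *\<^sub>R x)) \<longleftrightarrow> integrable lborel f"
    using lborel_affine[OF c, of t] by (simp add: ennreal_power)
  have "(LINT x|density (distr lborel borel (\<lambda>x. t + c *\<^sub>R x)) (\<lambda>_. ennreal (\<bar>c\<bar> ^ DIM('a))). f x)
      = \<bar>c\<bar> ^ DIM('a) *\<^sub>R (LINT x|lborel. f (t + c *\<^sub>R x))"
    using c by (simp add: integral_density integral_distr)
  then show "(LINT x|lborel. f x) = \<bar>c\<bar> ^ DIM('a) *\<^sub>R (LINT x|lborel. f (t + c *\<^sub>R x))"
    using lborel_affine[OF c, of t] by (simp add: ennreal_power)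
qed

lemma lborel_shift:
  fixes f :: "'a::euclidean_space \<Rightarrow> 'b::{banach, second_countable_topology}"
  assumes [measurable]: "f \<in> borel_measurable borel"
  shows "integrable lborel (\<lambda>x. f (x + t)) \<longleftrightarrow> integrable lborel f"
    and "(LINT x|lborel. f (x + t)) = (LINT x|lborel. f x)"
  using lborel_scale[OF assms, of 1 t] by (simp_all add: add.commute)

lemma lborel_reflect:
  fixes f :: "'a::euclidean_space \<Rightarrow> 'b::{banach, second_countable_topology}"
  assumes [measurable]: "f \<in> borel_measurable borel"
  shows "integrable lborel (\<lambda>x. f (t - x)) \<longleftrightarrow> integrable lborel f"
    and "(LINT x|lborel. f (t - x)) = (LINT x|lborel. f x)"
  using lborel_scale[OF assms, of "-1" t] by simp_all

text \<open>
  Lebesgue measure on a Euclidean space is the image of a product of one-dimensional Lebesgue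
  measures under the coordinate map. This is how both the integrability of the weight and the
  Gaussian integrals reduce to dimension one.
\<close>

lemma lborel_prod_Basis:
  fixes f :: "'a::euclidean_space \<Rightarrow> real \<Rightarrow> 'b::{real_normed_field, banach, second_countable_topology}"
  assumes f: "\<And>b. b \<in> Basis \<Longrightarrow> integrable lborel (f b)"
  shows "integrable lborel (\<lambda>x::'a. \<Prod>b\<in>Basis. f b (x \<bullet> b))"
    and "(LINT x|lborel. (\<Prod>b\<in>Basis. f b ((x::'a) \<bullet> b))) = (\<Prod>b\<in>Basis. LINT r|lborel. f b r)"
proof -
  interpret product_sigma_finite "\<lambda>_::'a. lborel :: real measure" by standard
  let ?T = "\<lambda>g. \<Sum>b\<in>Basis. g b *\<^sub>R (b::'a)"
  let ?P = "\<Pi>\<^sub>M b\<in>(Basis::'a set). (lborel :: real measure)"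
  have [measurable]: "f b \<in> borel_measurable borel" if "b \<in> Basis" for b
    using borel_measurable_integrable[OF f[OF that]] by simp
  have T[measurable]: "?T \<in> ?P \<rightarrow>\<^sub>M borel"
    by measurable
  have F[measurable]: "(\<lambda>x::'a. \<Prod>b\<in>Basis. f b (x \<bullet> b)) \<in> borel_measurable borel"
    by measurable
  have coord: "?T g \<bullet> b = g b" if "b \<in> Basis" for g b
    using that by (simp add: inner_sum_left inner_Basis if_distrib if_distribR sum.delta cong: if_cong)
  have eq: "(\<Prod>b\<in>Basis. f b (?T g \<bullet> b)) = (\<Prod>b\<in>Basis. f b (g b))" for g
    by (intro prod.cong) (simp_all only: coord)
  have "integrable ?P (\<lambda>g. \<Prod>b\<in>Basis. f b (g b))"
    by (intro product_integrable_prod) (auto intro: f)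
  then have "integrable (distr ?P borel ?T) (\<lambda>x::'a. \<Prod>b\<in>Basis. f b (x \<bullet> b))"
    by (subst integrable_distr_eq) (simp_all only: eq T F)
  then show "integrable lborel (\<lambda>x::'a. \<Prod>b\<in>Basis. f b (x \<bullet> b))"
    by (simp only: lborel_eq[symmetric])
  have "(LINT x|distr ?P borel ?T. (\<Prod>b\<in>Basis. f b (x \<bullet> b))) = (\<Prod>b\<in>Basis. LINT r|lborel. f b r)"
    by (subst integral_distr[OF T F], simp only: eq) (auto intro!: product_integral_prod f)
  then show "(LINT x|lborel. (\<Prod>b\<in>Basis. f b ((x::'a) \<bullet> b))) = (\<Prod>b\<in>Basis. LINT r|lborel. f b r)"
    by (simp only: lborel_eq[symmetric])
qed

text \<open>
  Dominated convergence along sequences. Continuity of the integrand is required only almost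
  everywhere, because a Duhamel integrand jumps at the moving end point of the time interval.
\<close>

lemma isCont_LINT:
  fixes F :: "'p::metric_space \<Rightarrow> 'b \<Rightarrow> 'c::{banach, second_countable_topology}"
  assumes "\<And>q. F q \<in> borel_measurable M" and "AE y in M. isCont (\<lambda>q. F q y) p"
    and "\<And>q. AE y in M. norm (F q y) \<le> B y" and "integrable M B"
  shows "isCont (\<lambda>q. LINT y|M. F q y) p"
  unfolding continuous_at_sequentially comp_def
proof (intro allI impI)
  fix X assume X: "X \<longlonglongrightarrow> p"
  have "AE y in M. (\<lambda>n. F (X n) y) \<longlonglongrightarrow> F p y"
    using assms(2)
  proof eventually_elim
    case (elim y)
    then show ?case using X isCont_tendsto_compose by fastforce
  qed
  then show "(\<lambda>n. LINT y|M. F (X n) y) \<longlonglongrightarrow> (LINT y|M. F p y)"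
    using assms by (intro integral_dominated_convergence[where w=B]) auto
qed

lemma continuous_LINT:
  fixes F :: "'p::metric_space \<Rightarrow> 'b \<Rightarrow> 'c::{banach, second_countable_topology}"
  assumes "\<And>q. F q \<in> borel_measurable M" and "\<And>y. continuous_on UNIV (\<lambda>q. F q y)"
    and "\<And>q y. norm (F q y) \<le> B y" and "integrable M B"
  shows "continuous_on UNIV (\<lambda>q. LINT y|M. F q y)"
  using assms by (auto simp: continuous_on_eq_continuous_at intro!: isCont_LINT[where B=B])

lemma borel_measurable_continuous: "continuous_on UNIV f \<Longrightarrow> f \<in> borel_measurable borel"
  by (rule borel_measurable_continuous_onI)

lemma LINT_Fubini:
  fixes f :: "'a::euclidean_space \<Rightarrow> 'b::euclidean_space \<Rightarrow> complex"
  assumes f[measurable]: "(\<lambda>(x, y). f x y) \<in> borel_measurable (borel \<Otimes>\<^sub>M borel)"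
    and bound: "\<And>x y. norm (f x y) \<le> g x * h y"
    and g: "integrable lborel g" and h: "integrable lborel h"
  shows "(LINT x|lborel. LINT y|lborel. f x y) = (LINT y|lborel. LINT x|lborel. f x y)"
    and "integrable lborel (\<lambda>x. LINT y|lborel. f x y)"
proof -
  have gh: "integrable (lborel \<Otimes>\<^sub>M lborel) (\<lambda>(x, y). g x * h y)"
  proof (rule lborel_pair.Fubini_integrable)
    have [measurable]: "g \<in> borel_measurable borel" "h \<in> borel_measurable borel"
      using g h by (auto dest: borel_measurable_integrable)
    show "(\<lambda>(x, y). g x * h y) \<in> borel_measurable (lborel \<Otimes>\<^sub>M lborel)" by measurable
    show "integrable lborel (\<lambda>x. LINT y|lborel. norm (case (x, y) of (x, y) \<Rightarrow> g x * h y))"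
      using g by (simp add: abs_mult)
    show "AE x in lborel. integrable lborel (\<lambda>y. case (x, y) of (x, y) \<Rightarrow> g x * h y)"
      using h by simp
  qed
  have int: "integrable (lborel \<Otimes>\<^sub>M lborel) (\<lambda>(x, y). f x y)"
    by (rule Bochner_Integration.integrable_bound[OF gh])
       (use bound in \<open>auto simp: abs_mult[symmetric] intro!: AE_I2 order_trans[OF bound abs_ge_self]\<close>)
  show "(LINT x|lborel. LINT y|lborel. f x y) = (LINT y|lborel. LINT x|lborel. f x y)"
    using lborel_pair.Fubini_integral[OF int] by simp
  show "integrable lborel (\<lambda>x. LINT y|lborel. f x y)"
    using lborel_pair.integrable_fst[OF int] by simp
qed

section \<open>An integrable weight\<close>

text \<open>
  With two powers for each coordinate, the weight is dominated by a product of integrable functions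
  of one coordinate each.
\<close>

definition weight :: "'a::euclidean_space \<Rightarrow> real" where
  "weight x = 1 / (1 + norm x) ^ (2 * DIM('a))"

lemma weight_pos: "weight x > 0"
  unfolding weight_def by (intro divide_pos_pos zero_less_power) (auto intro: add_pos_nonneg)

lemma weight_nonneg [simp]: "0 \<le> weight x"
  using weight_pos[of x] by simp

lemma weight_le_1: "weight x \<le> 1"
  unfolding weight_def by (subst divide_le_eq_1_pos) (auto intro!: one_le_power zero_less_power add_pos_nonneg)

lemma weight_minus [simp]: "weight (- x) = weight x"
  by (simp add: weight_def)

lemma continuous_weight: "continuous_on UNIV weight"
  unfolding weight_def
  by (intro continuous_intros) (metis add_pos_nonneg norm_ge_zero power_not_zero zero_less_one less_irrefl)

lemma borel_measurable_weight [measurable]: "weight \<in> borel_measurable borel"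
  by (intro borel_measurable_continuous continuous_weight)

lemma weight_le_prod: "weight (x::'a::euclidean_space) \<le> (\<Prod>b\<in>Basis. inverse (1 + (x \<bullet> b)\<^sup>2))"
proof -
  have "(\<Prod>b\<in>Basis. 1 + (x \<bullet> b)\<^sup>2) \<le> (\<Prod>b\<in>(Basis::'a set). (1 + norm x)\<^sup>2)"
  proof (rule prod_mono)
    fix b :: 'a assume b: "b \<in> Basis"
    have "\<bar>x \<bullet> b\<bar> \<le> norm x" using b by (rule Basis_le_norm)
    then have "(x \<bullet> b)\<^sup>2 \<le> (norm x)\<^sup>2" by (simp add: abs_le_square_iff[symmetric])
    also have "\<dots> \<le> (norm x)\<^sup>2 + 2 * 1 * norm x" by simp
    finally show "0 \<le> 1 + (x \<bullet> b)\<^sup>2 \<and> 1 + (x \<bullet> b)\<^sup>2 \<le> (1 + norm x)\<^sup>2"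
      unfolding power2_sum by (auto intro: add_nonneg_nonneg)
  qed
  also have "\<dots> = (1 + norm x) ^ (2 * DIM('a))" by (simp add: power_mult)
  finally have "(\<Prod>b\<in>Basis. 1 + (x \<bullet> b)\<^sup>2) \<le> (1 + norm x) ^ (2 * DIM('a))" .
  moreover have "(\<Prod>b\<in>Basis. 1 + (x \<bullet> b)\<^sup>2) > 0"
    by (intro prod_pos) (auto intro: add_pos_nonneg)
  ultimately show ?thesis
    unfolding weight_def prod_inversef[symmetric] comp_def
    by (simp add: prod_inversef[symmetric] inverse_eq_divide divide_left_mono prod_dividef frac_le)
qed

lemma lborel_integrable_inverse_1_plus_square: "integrable lborel (\<lambda>x::real. inverse (1 + x\<^sup>2))"
  using integrable_inverse_1_plus_square by (simp add: set_integrable_def)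

lemma integrable_weight: "integrable lborel (weight :: 'a::euclidean_space \<Rightarrow> real)"
proof (rule Bochner_Integration.integrable_bound)
  show "integrable lborel (\<lambda>x::'a. \<Prod>b\<in>Basis. inverse (1 + (x \<bullet> b)\<^sup>2))"
    by (rule lborel_prod_Basis) (rule lborel_integrable_inverse_1_plus_square)
  show "AE x::'a in lborel. norm (weight x) \<le> norm (\<Prod>b\<in>Basis. inverse (1 + (x \<bullet> b)\<^sup>2))"
    using weight_le_prod by (auto intro!: AE_I2 order_trans[OF _ abs_ge_self])
qed simp

lemma integrable_weight_bound:
  fixes f :: "'a::euclidean_space \<Rightarrow> 'b::{banach, second_countable_topology}"
  assumes "f \<in> borel_measurable borel" and "\<And>x. norm (f x) \<le> C * weight x"
  shows "integrable lborel f"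
  by (rule Bochner_Integration.integrable_bound[of _ "\<lambda>x. C * weight x"])
     (use assms integrable_weight in \<open>auto intro!: AE_I2 order_trans[OF assms(2) abs_ge_self]\<close>)

lemma weight_shift:
  fixes x :: "'a::euclidean_space"
  assumes "norm y \<le> 1"
  shows "weight (x + y) \<le> 2 ^ (2 * DIM('a)) * weight x"
proof -
  have "norm x \<le> norm (x + y) + norm y"
    using norm_triangle_ineq4[of "x + y" y] by simp
  then have "norm x \<le> norm (x + y) + 1" using assms by linarith
  then have "1 + norm x \<le> 2 * (1 + norm (x + y))"
    using norm_ge_zero[of "x + y"] unfolding distrib_left by linarith
  then have "(1 + norm x) ^ (2 * DIM('a)) \<le> (2 * (1 + norm (x + y))) ^ (2 * DIM('a))"
    by (intro power_mono) auto
  then have "(1 + norm x) ^ (2 * DIM('a)) \<le> 2 ^ (2 * DIM('a)) * (1 + norm (x + y)) ^ (2 * DIM('a))"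
    unfolding power_mult_distrib .
  moreover have "(1 + norm x) ^ (2 * DIM('a)) > 0" "(1 + norm (x + y)) ^ (2 * DIM('a)) > 0"
    by (auto intro!: zero_less_power add_pos_nonneg)
  ultimately show ?thesis unfolding weight_def by (simp add: divide_simps mult_ac)
qed

text \<open>
  One of two summands has at least half the norm of the sum, and the weight of that summand is
  comparable to the weight of the sum. Integrated in one of the variables, this gives that the
  convolution of two functions bounded by the weight is again bounded by the weight.
\<close>

lemma weight_mult_le:
  fixes x y :: "'a::euclidean_space"
  shows "weight x * weight y \<le> 2 ^ (2 * DIM('a)) * weight (x + y) * (weight x + weight y)"
proof -
  have *: "weight u \<le> 2 ^ (2 * DIM('a)) * weight (x + y)"
    if "norm (x + y) \<le> norm u + norm u" for u :: 'a
  proof -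
    have "1 + norm (x + y) \<le> 2 * (1 + norm u)" using that by simp
    then have "(1 + norm (x + y)) ^ (2 * DIM('a)) \<le> (2 * (1 + norm u)) ^ (2 * DIM('a))"
      by (intro power_mono) auto
    then have "(1 + norm (x + y)) ^ (2 * DIM('a)) \<le> 2 ^ (2 * DIM('a)) * (1 + norm u) ^ (2 * DIM('a))"
      unfolding power_mult_distrib .
    moreover have "(1 + norm u) ^ (2 * DIM('a)) > 0" "(1 + norm (x + y)) ^ (2 * DIM('a)) > 0"
      by (auto intro!: zero_less_power add_pos_nonneg)
    ultimately show ?thesis unfolding weight_def by (simp add: divide_simps mult_ac)
  qed
  have tri: "norm (x + y) \<le> norm x + norm y" by (rule norm_triangle_ineq)
  have nn: "0 \<le> 2 ^ (2 * DIM('a)) * weight (x + y)" by simp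
  show ?thesis
  proof (cases "norm x \<le> norm y")
    case True
    then have "weight y \<le> 2 ^ (2 * DIM('a)) * weight (x + y)" using * tri by simp
    then have "weight x * weight y \<le> weight x * (2 ^ (2 * DIM('a)) * weight (x + y))"
      by (intro mult_left_mono) auto
    also have "\<dots> \<le> 2 ^ (2 * DIM('a)) * weight (x + y) * (weight x + weight y)"
      using mult_nonneg_nonneg[OF nn weight_nonneg[of y]] by (simp add: distrib_left distrib_right mult_ac)
    finally show ?thesis .
  next
    case False
    then have "weight x \<le> 2 ^ (2 * DIM('a)) * weight (x + y)" using * tri by simp
    then have "weight x * weight y \<le> (2 ^ (2 * DIM('a)) * weight (x + y)) * weight y"
      by (intro mult_right_mono) auto
    also have "\<dots> \<le> 2 ^ (2 * DIM('a)) * weight (x + y) * (weight x + weight y)"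
      using mult_nonneg_nonneg[OF nn weight_nonneg[of x]] by (simp add: distrib_left distrib_right mult_ac)
    finally show ?thesis .
  qed
qed

section \<open>Characters\<close>

definition wave :: "real \<Rightarrow> complex" where
  "wave r = cis (2 * pi * r)"

lemma wave_0 [simp]: "wave 0 = 1" by (simp add: wave_def)
lemma norm_wave [simp]: "norm (wave r) = 1" by (simp add: wave_def)
lemma wave_add: "wave (r + s) = wave r * wave s" by (simp add: wave_def cis_mult distrib_left)
lemma cnj_wave: "cnj (wave r) = wave (- r)" by (simp add: wave_def cis_cnj)

lemma continuous_on_wave [continuous_intros]:
  "continuous_on S f \<Longrightarrow> continuous_on S (\<lambda>x. wave (f x))"
  unfolding wave_def by (intro continuous_intros)

lemma borel_measurable_wave [measurable]: "wave \<in> borel_measurable borel"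
  by (intro borel_measurable_continuous continuous_intros)

lemma fourier_eq: "fourier f \<xi> = (LINT x|lborel. wave (- (x \<bullet> \<xi>)) * f x)"
  unfolding fourier_def wave_def cis_conv_exp
  by (intro Bochner_Integration.integral_cong) (auto simp: mult_ac)

definition ifourier :: "('a::euclidean_space \<Rightarrow> complex) \<Rightarrow> 'a \<Rightarrow> complex" where
  "ifourier f x = (LINT \<xi>|lborel. wave (\<xi> \<bullet> x) * f \<xi>)"

lemma ifourier_fourier_minus: "ifourier f x = fourier f (- x)"
  by (simp add: ifourier_def fourier_eq)

lemma integrable_wave_mult:
  fixes f :: "'a::euclidean_space \<Rightarrow> complex"
  assumes "integrable lborel f" and "g \<in> borel_measurable borel"
  shows "integrable lborel (\<lambda>x. wave (g x) * f x)"
proof (rule Bochner_Integration.integrable_bound[OF assms(1)])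
  have [measurable]: "f \<in> borel_measurable borel" "g \<in> borel_measurable borel"
    using assms by (auto dest: borel_measurable_integrable)
  show "(\<lambda>x. wave (g x) * f x) \<in> borel_measurable lborel" by measurable
qed (simp add: norm_mult)

lemma norm_fourier_le:
  "norm (fourier f \<xi>) \<le> (LINT x|lborel. norm (f x))"
  unfolding fourier_eq using integral_norm_bound[of lborel "\<lambda>x. wave (- (x \<bullet> \<xi>)) * f x"]
  by (simp add: norm_mult)

lemma norm_ifourier_le:
  "norm (ifourier f \<xi>) \<le> (LINT x|lborel. norm (f x))"
  unfolding ifourier_fourier_minus by (rule norm_fourier_le)

lemma continuous_ifourier:
  fixes f :: "'a::euclidean_space \<Rightarrow> complex"
  assumes "integrable lborel f"
  shows "continuous_on UNIV (ifourier f)"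
  unfolding ifourier_def
proof (rule continuous_LINT[where B="\<lambda>x. norm (f x)"])
  have [measurable]: "f \<in> borel_measurable borel"
    using assms by (auto dest: borel_measurable_integrable)
  show "(\<lambda>\<xi>. wave (\<xi> \<bullet> q) * f \<xi>) \<in> borel_measurable lborel" for q by measurable
  show "continuous_on UNIV (\<lambda>q. wave (y \<bullet> q) * f y)" for y by (intro continuous_intros)
qed (use assms in \<open>auto simp: norm_mult\<close>)

section \<open>Schwartz functions\<close>

abbreviation partial :: "'a::euclidean_space \<Rightarrow> ('a \<Rightarrow> complex) \<Rightarrow> 'a \<Rightarrow> complex" where
  "partial b \<phi> \<equiv> \<lambda>x. frechet_derivative \<phi> (at x) b"

lemma partial_eqI: "(\<phi> has_derivative D) (at x) \<Longrightarrow> partial b \<phi> x = D b"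
  by (metis frechet_derivative_at)

text \<open>
  Membership in the Schwartz space is coinductive: it suffices to find a family of rapidly
  decreasing differentiable functions that is stable under partial derivatives.
\<close>

lemma schwartz_coinduct:
  assumes "\<phi> \<in> F"
    and diff: "\<And>\<phi> x. \<phi> \<in> F \<Longrightarrow> \<phi> differentiable (at x)"
    and step: "\<And>\<phi> b. \<phi> \<in> F \<Longrightarrow> b \<in> Basis \<Longrightarrow> partial b \<phi> \<in> F"
    and decay: "\<And>\<phi> k. \<phi> \<in> F \<Longrightarrow> \<exists>C. \<forall>x. norm x ^ k * norm (\<phi> x) \<le> C"
  shows "\<phi> \<in> schwartz"
proof -
  have F: "iter_partial bs \<phi> \<in> F" if "bs \<in> lists Basis" for bs
    using that by (induction bs) (auto intro: assms)
  have "bounded (range (\<lambda>x. norm x ^ k * norm (iter_partial bs \<phi> x)))" if "bs \<in> lists Basis" for bs k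
    using decay[OF F[OF that], of k] by (auto simp: bounded_iff abs_mult)
  with F diff show ?thesis unfolding schwartz_def by blast
qed

lemma schwartz_differentiable: "\<phi> \<in> schwartz \<Longrightarrow> \<phi> differentiable (at x)"
  unfolding schwartz_def using lists.Nil iter_partial.simps(1)[of \<phi>] by fastforce

lemma schwartz_has_derivative: "\<phi> \<in> schwartz \<Longrightarrow> (\<phi> has_derivative frechet_derivative \<phi> (at x)) (at x)"
  using schwartz_differentiable frechet_derivative_works by blast

lemma schwartz_decay:
  assumes "\<phi> \<in> schwartz" shows "\<exists>C. \<forall>x. norm x ^ k * norm (\<phi> x) \<le> C"
proof -
  have "bounded (range (\<lambda>x. norm x ^ k * norm (iter_partial [] \<phi> x)))"
    using assms lists.Nil unfolding schwartz_def by blast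
  then show ?thesis by (auto simp: bounded_iff abs_mult)
qed

lemma schwartz_partial:
  assumes "\<phi> \<in> schwartz" "b \<in> Basis"
  shows "partial b \<phi> \<in> schwartz"
proof -
  have eq: "iter_partial bs (partial b \<phi>) = iter_partial (bs @ [b]) \<phi>" for bs
    by (induction bs) auto
  have "bs @ [b] \<in> lists Basis" if "bs \<in> lists Basis" for bs
    using that assms by auto
  then show ?thesis
    using assms(1) unfolding schwartz_def eq mem_Collect_eq by blast
qed

lemma schwartz_lincomb:
  assumes "\<phi> \<in> schwartz" "\<eta> \<in> schwartz"
  shows "(\<lambda>x. c * \<phi> x + d * \<eta> x) \<in> schwartz"
proof (rule schwartz_coinduct[where F="{\<lambda>x. c * \<phi> x + d * \<eta> x | \<phi> \<eta>. \<phi> \<in> schwartz \<and> \<eta> \<in> schwartz}"])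
  have der: "((\<lambda>x. c * \<phi> x + d * \<eta> x) has_derivative
      (\<lambda>h. c * frechet_derivative \<phi> (at x) h + d * frechet_derivative \<eta> (at x) h)) (at x)"
    if "\<phi> \<in> schwartz" "\<eta> \<in> schwartz" for \<phi> \<eta> :: "'a \<Rightarrow> complex" and x
    by (intro has_derivative_add has_derivative_mult_right schwartz_has_derivative that)
  show "\<psi> differentiable (at x)"
    if psi: "\<psi> \<in> {\<lambda>x. c * \<phi> x + d * \<eta> x | \<phi> \<eta>. \<phi> \<in> schwartz \<and> \<eta> \<in> schwartz}" for \<psi> :: "'a \<Rightarrow> complex" and x
    using that der unfolding differentiable_def by blast
  show "partial b \<psi> \<in> {\<lambda>x. c * \<phi> x + d * \<eta> x | \<phi> \<eta>. \<phi> \<in> schwartz \<and> \<eta> \<in> schwartz}"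
    if psi: "\<psi> \<in> {\<lambda>x. c * \<phi> x + d * \<eta> x | \<phi> \<eta>. \<phi> \<in> schwartz \<and> \<eta> \<in> schwartz}" and b: "b \<in> Basis"
    for \<psi> :: "'a \<Rightarrow> complex" and b
  proof -
    obtain \<phi> \<eta> where *: "\<psi> = (\<lambda>x. c * \<phi> x + d * \<eta> x)" "\<phi> \<in> schwartz" "\<eta> \<in> schwartz"
      using psi by blast
    have "partial b \<psi> = (\<lambda>x. c * partial b \<phi> x + d * partial b \<eta> x)"
      unfolding *(1) by (rule ext, rule partial_eqI, rule der) (use * in auto)
    then show ?thesis
      by (intro CollectI exI[of _ "partial b \<phi>"] exI[of _ "partial b \<eta>"] conjI schwartz_partial * b)
  qed
  show "\<exists>C. \<forall>x. norm x ^ k * norm (\<psi> x) \<le> C"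
    if psi: "\<psi> \<in> {\<lambda>x. c * \<phi> x + d * \<eta> x | \<phi> \<eta>. \<phi> \<in> schwartz \<and> \<eta> \<in> schwartz}" for \<psi> :: "'a \<Rightarrow> complex" and k
  proof -
    obtain \<phi> \<eta> where *: "\<psi> = (\<lambda>x. c * \<phi> x + d * \<eta> x)" "\<phi> \<in> schwartz" "\<eta> \<in> schwartz"
      using psi by blast
    obtain C D where C: "\<And>x. norm x ^ k * norm (\<phi> x) \<le> C" and D: "\<And>x. norm x ^ k * norm (\<eta> x) \<le> D"
      using schwartz_decay[of _ k] * by metis
    have "norm x ^ k * norm (\<psi> x) \<le> norm c * C + norm d * D" for x
    proof -
      have "norm x ^ k * norm (\<psi> x) \<le> norm x ^ k * (norm c * norm (\<phi> x) + norm d * norm (\<eta> x))"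
        unfolding * by (intro mult_left_mono order_trans[OF norm_triangle_ineq]) (auto simp: norm_mult)
      also have "\<dots> = norm c * (norm x ^ k * norm (\<phi> x)) + norm d * (norm x ^ k * norm (\<eta> x))"
        by (simp add: algebra_simps)
      also have "\<dots> \<le> norm c * C + norm d * D" by (intro add_mono mult_left_mono C D) auto
      finally show ?thesis .
    qed
    then show ?thesis by blast
  qed
qed (use assms in blast)

lemma schwartz_mult: "\<phi> \<in> schwartz \<Longrightarrow> (\<lambda>x. c * \<phi> x) \<in> schwartz"
  using schwartz_lincomb[of \<phi> \<phi> c 0] by simp

lemma schwartz_coordinate:
  assumes "\<phi> \<in> schwartz" and "b \<in> Basis"
  shows "(\<lambda>x. of_real (x \<bullet> b) * \<phi> x) \<in> schwartz"
proof -
  let ?F = "{\<lambda>x. of_real (x \<bullet> b) * \<phi> x + \<eta> x | \<phi> \<eta>. \<phi> \<in> schwartz \<and> \<eta> \<in> schwartz}"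
  have der: "((\<lambda>x. of_real (x \<bullet> b) * \<phi> x + \<eta> x) has_derivative
      (\<lambda>h. of_real (x \<bullet> b) * frechet_derivative \<phi> (at x) h
         + (of_real (h \<bullet> b) * \<phi> x + frechet_derivative \<eta> (at x) h))) (at x)"
    if "\<phi> \<in> schwartz" "\<eta> \<in> schwartz" for \<phi> \<eta> :: "'a \<Rightarrow> complex" and x
    by (rule derivative_eq_intros refl schwartz_has_derivative that)+ (simp add: algebra_simps)
  show ?thesis
  proof (rule schwartz_coinduct[where F="?F"])
    have "(\<lambda>x::'a. 0) \<in> schwartz" using schwartz_mult[OF assms(1), of 0] by simp
    with assms show "(\<lambda>x. of_real (x \<bullet> b) * \<phi> x) \<in> ?F"
      by (intro CollectI exI[of _ \<phi>] exI[of _ "\<lambda>x. 0"]) simp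
    show "\<psi> differentiable (at x)" if psi: "\<psi> \<in> ?F" for \<psi> :: "'a \<Rightarrow> complex" and x
      using that der unfolding differentiable_def by blast
    show "partial c \<psi> \<in> ?F" if psi: "\<psi> \<in> ?F" and c: "c \<in> Basis" for \<psi> :: "'a \<Rightarrow> complex" and c
    proof -
      obtain \<phi> \<eta> where *: "\<psi> = (\<lambda>x. of_real (x \<bullet> b) * \<phi> x + \<eta> x)" "\<phi> \<in> schwartz" "\<eta> \<in> schwartz"
        using psi by blast
      have "partial c \<psi> = (\<lambda>x. of_real (x \<bullet> b) * partial c \<phi> x
          + (of_real (c \<bullet> b) * \<phi> x + 1 * partial c \<eta> x))"
        unfolding *(1) by (rule ext, subst partial_eqI, rule der) (use * in auto)
      moreover have "(\<lambda>x. of_real (c \<bullet> b) * \<phi> x + 1 * partial c \<eta> x) \<in> schwartz"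
        by (intro schwartz_lincomb schwartz_partial * c)
      ultimately show ?thesis
        by (intro CollectI exI[of _ "partial c \<phi>"] exI[of _ "\<lambda>x. of_real (c \<bullet> b) * \<phi> x + 1 * partial c \<eta> x"] conjI
            schwartz_partial * c)
    qed
    show "\<exists>C. \<forall>x. norm x ^ k * norm (\<psi> x) \<le> C" if psi: "\<psi> \<in> ?F" for \<psi> :: "'a \<Rightarrow> complex" and k
    proof -
      obtain \<phi> \<eta> where *: "\<psi> = (\<lambda>x. of_real (x \<bullet> b) * \<phi> x + \<eta> x)" "\<phi> \<in> schwartz" "\<eta> \<in> schwartz"
        using psi by blast
      obtain C D where C: "\<And>x. norm x ^ Suc k * norm (\<phi> x) \<le> C"
        and D: "\<And>x. norm x ^ k * norm (\<eta> x) \<le> D"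
        using schwartz_decay[of \<phi> "Suc k"] schwartz_decay[of \<eta> k] * by metis
      have "norm x ^ k * norm (\<psi> x) \<le> C + D" for x
      proof -
        have "norm (\<psi> x) \<le> norm x * norm (\<phi> x) + norm (\<eta> x)"
          unfolding * using Basis_le_norm[OF assms(2), of x]
          by (intro order_trans[OF norm_triangle_ineq] add_mono) (auto simp: norm_mult intro: mult_right_mono)
        then have "norm x ^ k * norm (\<psi> x) \<le> norm x ^ k * (norm x * norm (\<phi> x) + norm (\<eta> x))"
          by (intro mult_left_mono) auto
        also have "\<dots> = norm x ^ Suc k * norm (\<phi> x) + norm x ^ k * norm (\<eta> x)"
          by (simp add: algebra_simps)
        also have "\<dots> \<le> C + D" by (intro add_mono C D)
        finally show ?thesis .
      qed
      then show ?thesis by blast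
    qed
  qed
qed

lemma schwartz_reflect:
  assumes "\<phi> \<in> schwartz"
  shows "(\<lambda>x. \<phi> (- x)) \<in> schwartz"
proof -
  let ?F = "{\<lambda>x. \<phi> (- x) | \<phi>. \<phi> \<in> schwartz}"
  have der: "((\<lambda>x. \<phi> (- x)) has_derivative (\<lambda>h. frechet_derivative \<phi> (at (- x)) (- h))) (at x)"
    if "\<phi> \<in> schwartz" for \<phi> :: "'a \<Rightarrow> complex" and x
    by (rule has_derivative_compose[where f=uminus and g=\<phi>])
       (auto intro!: derivative_eq_intros schwartz_has_derivative that)
  show ?thesis
  proof (rule schwartz_coinduct[where F="?F"])
    show "\<psi> differentiable (at x)" if psi: "\<psi> \<in> ?F" for \<psi> :: "'a \<Rightarrow> complex" and x
      using that der unfolding differentiable_def by blast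
    show "partial c \<psi> \<in> ?F" if psi: "\<psi> \<in> ?F" and c: "c \<in> Basis" for \<psi> :: "'a \<Rightarrow> complex" and c
    proof -
      obtain \<phi> where *: "\<psi> = (\<lambda>x. \<phi> (- x))" "\<phi> \<in> schwartz" using psi by blast
      have "partial c \<psi> = (\<lambda>x. (-1) * partial c \<phi> (- x))"
        unfolding *(1)
        by (rule ext, subst partial_eqI, rule der)
           (auto simp: * linear_neg bounded_linear.linear[OF has_derivative_bounded_linear[OF schwartz_has_derivative]])
      then show ?thesis
        by (intro CollectI exI[of _ "\<lambda>x. (-1) * partial c \<phi> x"] conjI schwartz_mult schwartz_partial * c)
    qed
    show "\<exists>C. \<forall>x. norm x ^ k * norm (\<psi> x) \<le> C" if psi: "\<psi> \<in> ?F" for \<psi> :: "'a \<Rightarrow> complex" and k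
    proof -
      obtain \<phi> where *: "\<psi> = (\<lambda>x. \<phi> (- x))" "\<phi> \<in> schwartz" using psi by blast
      obtain C where C: "\<And>x. norm x ^ k * norm (\<phi> x) \<le> C" using schwartz_decay[OF *(2)] by metis
      show ?thesis unfolding * using C[of "- _"] by auto
    qed
  qed (use assms in blast)
qed

lemma schwartz_continuous: "\<phi> \<in> schwartz \<Longrightarrow> continuous_on S \<phi>"
  by (intro continuous_at_imp_continuous_on ballI differentiable_imp_continuous_within schwartz_differentiable)

lemma schwartz_measurable: "\<phi> \<in> schwartz \<Longrightarrow> \<phi> \<in> borel_measurable borel"
  by (intro borel_measurable_continuous schwartz_continuous)

text \<open>
  Turns two Schwartz seminorms, those of order 0 and of the order of the weight, into a bound
  by the weight.
\<close>

lemma weight_bound_seminorms: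
  fixes x :: "'a::euclidean_space"
  assumes "0 \<le> a"
  shows "a \<le> 2 ^ (2 * DIM('a)) * (a + norm x ^ (2 * DIM('a)) * a) * weight x"
proof -
  let ?n = "2 * DIM('a)"
  have "(1 + norm x) ^ ?n \<le> (2 * max 1 (norm x)) ^ ?n" by (intro power_mono) auto
  also have "\<dots> = 2 ^ ?n * max 1 (norm x) ^ ?n" by (rule power_mult_distrib)
  also have "max 1 (norm x) ^ ?n \<le> 1 + norm x ^ ?n" by (auto simp: max_def)
  finally have "(1 + norm x) ^ ?n \<le> 2 ^ ?n * (1 + norm x ^ ?n)" by simp
  then have "a * (1 + norm x) ^ ?n \<le> a * (2 ^ ?n * (1 + norm x ^ ?n))"
    using assms by (rule mult_left_mono)
  then have le: "(a * (1 + norm x) ^ ?n) * weight x \<le> (a * (2 ^ ?n * (1 + norm x ^ ?n))) * weight x"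
    by (rule mult_right_mono) simp
  have "0 < 1 + norm x" by (intro add_pos_nonneg) auto
  then have "a = (a * (1 + norm x) ^ ?n) * weight x" by (simp add: weight_def)
  also note le
  finally show ?thesis by (simp add: algebra_simps)
qed

lemma schwartz_weight_bound:
  assumes "\<phi> \<in> schwartz"
  shows "\<exists>C\<ge>0. \<forall>x. norm (\<phi> x) \<le> C * weight x"
proof -
  let ?n = "2 * DIM('a)"
  obtain C D where C: "\<And>x. norm x ^ 0 * norm (\<phi> x) \<le> C" and D: "\<And>x. norm x ^ ?n * norm (\<phi> x) \<le> D"
    using schwartz_decay[OF assms] by metis
  have "norm (\<phi> x) \<le> (2 ^ ?n * (\<bar>C\<bar> + \<bar>D\<bar>)) * weight x" for x
  proof -
    have "norm (\<phi> x) \<le> 2 ^ ?n * (norm (\<phi> x) + norm x ^ ?n * norm (\<phi> x)) * weight x"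
      by (rule weight_bound_seminorms) simp
    also have "\<dots> \<le> (2 ^ ?n * (\<bar>C\<bar> + \<bar>D\<bar>)) * weight x"
      using C[of x] D[of x] by (intro mult_right_mono mult_left_mono add_mono) auto
    finally show ?thesis .
  qed
  then show ?thesis by (intro exI[of _ "2 ^ ?n * (\<bar>C\<bar> + \<bar>D\<bar>)"]) auto
qed

lemma schwartz_integrable: "\<phi> \<in> schwartz \<Longrightarrow> integrable lborel \<phi>"
  using schwartz_weight_bound integrable_weight_bound schwartz_measurable by blast

lemma schwartz_bounded: "\<phi> \<in> schwartz \<Longrightarrow> \<exists>C. \<forall>x. norm (\<phi> x) \<le> C"
  using schwartz_decay[of \<phi> 0] by simp

section \<open>The Fourier transform preserves the Schwartz space\<close>

lemma wave_taylor: "norm (wave (r + s) - wave r - of_real s * (2 * of_real pi * \<i> * wave r)) \<le> (2 * pi * s)\<^sup>2"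
proof -
  have "norm (exp (\<i> * of_real (2 * pi * s)) - (\<Sum>k\<le>1. (\<i> * of_real (2 * pi * s)) ^ k / fact k))
      \<le> \<bar>2 * pi * s\<bar> ^ Suc 1 / fact (Suc 1)"
    by (rule iexp_approx1)
  also have "\<dots> = (2 * pi * s)\<^sup>2 / 2" by (simp add: power2_eq_square abs_mult)
  also have "\<dots> \<le> (2 * pi * s)\<^sup>2" by simp
  finally have *: "norm (wave s - 1 - of_real s * (2 * of_real pi * \<i>)) \<le> (2 * pi * s)\<^sup>2"
    by (simp add: wave_def cis_conv_exp mult_ac diff_diff_eq)
  have "wave (r + s) - wave r - of_real s * (2 * of_real pi * \<i> * wave r)
      = wave r * (wave s - 1 - of_real s * (2 * of_real pi * \<i>))"
    by (simp add: wave_add algebra_simps)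
  then show ?thesis using * by (simp add: norm_mult)
qed

text \<open>
  A quadratic bound of the remainder is what the second order Taylor estimate of a character
  provides; differentiating under the integral sign then needs no further limit.
\<close>

lemma has_derivative_quadratic:
  fixes f :: "'a::euclidean_space \<Rightarrow> complex"
  assumes D: "bounded_linear D" and bound: "\<And>h. norm (f (x + h) - f x - D h) \<le> C * (norm h)\<^sup>2"
  shows "(f has_derivative D) (at x)"
  unfolding has_derivative_at
proof (intro conjI D)
  have "((\<lambda>h::'a. C * norm h) \<longlongrightarrow> C * norm (0::'a)) (at 0)"
  proof -
    have "isCont (\<lambda>h::'a. C * norm h) 0" by (intro continuous_intros)
    then show ?thesis by (simp only: isCont_def)
  qed
  then have "((\<lambda>h::'a. C * norm h) \<longlongrightarrow> 0) (at 0)" by (simp only: norm_zero mult_zero_right)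
  then show "(\<lambda>h. norm (f (x + h) - f x - D h) / norm h) \<midarrow>0\<rightarrow> 0"
  proof (rule Lim_null_comparison[rotated, of "\<lambda>h. C * norm h"])
    show "\<forall>\<^sub>F h in at 0. norm (norm (f (x + h) - f x - D h) / norm h) \<le> C * norm h"
      using bound by (auto simp: eventually_at_filter divide_le_eq power2_eq_square mult_ac intro!: always_eventually)
  qed
qed

lemma wave_has_vector_derivative: "(wave has_vector_derivative 2 * of_real pi * \<i> * wave r) (at r)"
  unfolding has_vector_derivative_def
proof (rule has_derivative_quadratic[where C="(2 * pi)\<^sup>2"])
  show "norm (wave (r + h) - wave r - h *\<^sub>R (2 * of_real pi * \<i> * wave r)) \<le> (2 * pi)\<^sup>2 * (norm h)\<^sup>2" for h
    using wave_taylor[of r h] by (simp add: scaleR_conv_of_real power_mult_distrib)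
qed (intro bounded_linear_intros)

lemma fourier_has_derivative:
  fixes \<phi> :: "'a::euclidean_space \<Rightarrow> complex"
  assumes \<phi>: "\<phi> \<in> schwartz"
  shows "(fourier \<phi> has_derivative
           (\<lambda>h. \<Sum>b\<in>Basis. of_real (h \<bullet> b) * fourier (\<lambda>x. (- 2 * of_real pi * \<i>) * (of_real (x \<bullet> b) * \<phi> x)) \<xi>)) (at \<xi>)"
proof -
  let ?g = "\<lambda>b x. (- 2 * of_real pi * \<i>) * (of_real (x \<bullet> b) * \<phi> x)"
  have g: "?g b \<in> schwartz" if "b \<in> Basis" for b
    by (intro schwartz_mult schwartz_coordinate \<phi> that)
  have [measurable]: "\<phi> \<in> borel_measurable borel" by (rule schwartz_measurable[OF \<phi>])
  obtain C where C: "\<And>x. norm x ^ (2 * DIM('a) + 2) * norm (\<phi> x) \<le> C" using schwartz_decay[OF \<phi>] by metis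
  obtain D where D: "\<And>x. norm x ^ 2 * norm (\<phi> x) \<le> D" using schwartz_decay[OF \<phi>] by metis
  have int2: "integrable lborel (\<lambda>x. (norm x)\<^sup>2 * norm (\<phi> x))"
  proof (rule integrable_weight_bound)
    show "norm ((norm x)\<^sup>2 * norm (\<phi> x)) \<le> (2 ^ (2 * DIM('a)) * (\<bar>D\<bar> + \<bar>C\<bar>)) * weight x" for x
    proof -
      have "(norm x)\<^sup>2 * norm (\<phi> x) \<le> 2 ^ (2 * DIM('a)) * ((norm x)\<^sup>2 * norm (\<phi> x) + norm x ^ (2 * DIM('a)) * ((norm x)\<^sup>2 * norm (\<phi> x))) * weight x"
        by (rule weight_bound_seminorms) simp
      also have "\<dots> \<le> (2 ^ (2 * DIM('a)) * (\<bar>D\<bar> + \<bar>C\<bar>)) * weight x"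
      proof -
        have "norm x ^ (2 * DIM('a)) * ((norm x)\<^sup>2 * norm (\<phi> x)) \<le> \<bar>C\<bar>"
          by (rule order_trans[OF _ abs_ge_self], rule order_trans[OF _ C[of x]])
             (simp only: power_add mult.assoc order_refl)
        then show ?thesis using D[of x] by (intro mult_right_mono mult_left_mono add_mono) auto
      qed
      finally show ?thesis by simp
    qed
  qed measurable
  show ?thesis
  proof (rule has_derivative_quadratic)
    show "bounded_linear (\<lambda>h::'a. \<Sum>b\<in>Basis. of_real (h \<bullet> b) * fourier (?g b) \<xi>)"
      by (intro bounded_linear_sum bounded_linear_mult_const bounded_linear_compose[OF bounded_linear_of_real] bounded_linear_inner_left)
    fix h :: 'a
    have int\<phi>: "integrable lborel (\<lambda>x. wave (- (x \<bullet> u)) * \<phi> x)" for u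
      by (intro integrable_wave_mult schwartz_integrable \<phi>) measurable
    have intg: "integrable lborel (\<lambda>x. wave (- (x \<bullet> u)) * ?g b x)" if "b \<in> Basis" for u b
      by (intro integrable_wave_mult schwartz_integrable g that) measurable
    have sum: "(\<Sum>b\<in>Basis. of_real (h \<bullet> b) * (wave (- (x \<bullet> \<xi>)) * ?g b x))
        = of_real (- (x \<bullet> h)) * (2 * of_real pi * \<i> * wave (- (x \<bullet> \<xi>))) * \<phi> x" for x
    proof -
      have "x \<bullet> h = (\<Sum>b\<in>Basis. (h \<bullet> b) * (x \<bullet> b))"
        by (subst euclidean_inner) (simp add: mult_ac)
      then show ?thesis by (simp add: sum_distrib_left sum_distrib_right mult_ac sum_negf)
    qed
    have "fourier \<phi> (\<xi> + h) - fourier \<phi> \<xi> - (\<Sum>b\<in>Basis. of_real (h \<bullet> b) * fourier (?g b) \<xi>)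
        = (LINT x|lborel. wave (- (x \<bullet> (\<xi> + h))) * \<phi> x - wave (- (x \<bullet> \<xi>)) * \<phi> x
             - (\<Sum>b\<in>Basis. of_real (h \<bullet> b) * (wave (- (x \<bullet> \<xi>)) * ?g b x)))"
      unfolding fourier_eq using int\<phi> intg
      by (subst Bochner_Integration.integral_diff Bochner_Integration.integral_sum | intro Bochner_Integration.integrable_diff Bochner_Integration.integrable_sum integrable_mult_right | simp)+
    also have "\<dots> = (LINT x|lborel. (wave (- (x \<bullet> \<xi>) + - (x \<bullet> h)) - wave (- (x \<bullet> \<xi>))
             - of_real (- (x \<bullet> h)) * (2 * of_real pi * \<i> * wave (- (x \<bullet> \<xi>)))) * \<phi> x)"
      unfolding sum by (simp add: inner_add_right algebra_simps)
    also have "norm \<dots> \<le> (LINT x|lborel. (2 * pi * norm h)\<^sup>2 * ((norm x)\<^sup>2 * norm (\<phi> x)))"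
    proof (rule order_trans[OF integral_norm_bound integral_mono])
      show int: "integrable lborel (\<lambda>x. (2 * pi * norm h)\<^sup>2 * ((norm x)\<^sup>2 * norm (\<phi> x)))"
        using int2 by simp
      show le: "norm ((wave (- (x \<bullet> \<xi>) + - (x \<bullet> h)) - wave (- (x \<bullet> \<xi>))
             - of_real (- (x \<bullet> h)) * (2 * of_real pi * \<i> * wave (- (x \<bullet> \<xi>)))) * \<phi> x)
          \<le> (2 * pi * norm h)\<^sup>2 * ((norm x)\<^sup>2 * norm (\<phi> x))" for x
      proof -
        have "norm (wave (- (x \<bullet> \<xi>) + - (x \<bullet> h)) - wave (- (x \<bullet> \<xi>))
             - of_real (- (x \<bullet> h)) * (2 * of_real pi * \<i> * wave (- (x \<bullet> \<xi>)))) \<le> (2 * pi * - (x \<bullet> h))\<^sup>2"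
          by (rule wave_taylor)
        also have "\<dots> \<le> (2 * pi * (norm x * norm h))\<^sup>2"
          using Cauchy_Schwarz_ineq2[of x h] by (subst abs_le_square_iff[symmetric]) (simp add: abs_mult)
        also have "\<dots> = (2 * pi * norm h)\<^sup>2 * (norm x)\<^sup>2" by (simp add: power_mult_distrib)
        finally show ?thesis by (simp add: norm_mult mult.assoc[symmetric] mult_right_mono)
      qed
      show "integrable lborel (\<lambda>x. norm ((wave (- (x \<bullet> \<xi>) + - (x \<bullet> h)) - wave (- (x \<bullet> \<xi>))
             - of_real (- (x \<bullet> h)) * (2 * of_real pi * \<i> * wave (- (x \<bullet> \<xi>)))) * \<phi> x))"
        by (rule Bochner_Integration.integrable_bound[OF int], measurable)
           (rule AE_I2, subst real_norm_def, subst abs_norm_cancel, rule order_trans[OF le], simp)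
    qed
    also have "\<dots> = ((2 * pi)\<^sup>2 * (LINT x|lborel. (norm x)\<^sup>2 * norm (\<phi> x))) * (norm h)\<^sup>2"
      by (simp add: power_mult_distrib)
    finally show "norm (fourier \<phi> (\<xi> + h) - fourier \<phi> \<xi> - (\<Sum>b\<in>Basis. of_real (h \<bullet> b) * fourier (?g b) \<xi>))
      \<le> ((2 * pi)\<^sup>2 * (LINT x|lborel. (norm x)\<^sup>2 * norm (\<phi> x))) * (norm h)\<^sup>2" .
  qed
qed

text \<open>
  A directional derivative integrates to zero, since the difference quotients do by translation
  invariance; this replaces integration by parts.
\<close>

lemma integral_directional_derivative_zero:
  fixes f :: "'a::euclidean_space \<Rightarrow> complex"
  assumes der: "\<And>x r. ((\<lambda>r. f (x + r *\<^sub>R b)) has_vector_derivative f' (x + r *\<^sub>R b)) (at r)"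
    and b: "norm b \<le> 1" and f: "integrable lborel f"
    and f'[measurable]: "f' \<in> borel_measurable borel" and C: "0 \<le> C" "\<And>x. norm (f' x) \<le> C * weight x"
  shows "(LINT x|lborel. f' x) = 0"
proof -
  have [measurable]: "f \<in> borel_measurable borel" using f by (auto dest: borel_measurable_integrable)
  define q where "q n x = (f (x + (1 / real (Suc n)) *\<^sub>R b) - f x) /\<^sub>R (1 / real (Suc n))" for n x
  have q0: "(LINT x|lborel. q n x) = 0" for n
    using lborel_shift[of f "(1 / real (Suc n)) *\<^sub>R b"] f unfolding q_def by simp
  have lim: "(\<lambda>n. q n x) \<longlonglongrightarrow> f' x" for x
  proof -
    have "((\<lambda>r. (f (x + r *\<^sub>R b) - f x) /\<^sub>R r) \<longlongrightarrow> f' x) (at 0)"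
    proof -
      have "(\<lambda>r. norm (f (x + r *\<^sub>R b) - f x - r *\<^sub>R f' x) / norm r) \<midarrow>0\<rightarrow> 0"
        using der[of x 0] by (simp add: has_vector_derivative_def has_derivative_at)
      moreover have "\<forall>\<^sub>F r in at 0. norm (f (x + r *\<^sub>R b) - f x - r *\<^sub>R f' x) / norm r
          = norm ((f (x + r *\<^sub>R b) - f x) /\<^sub>R r - f' x)"
      proof -
        have "norm (f (x + r *\<^sub>R b) - f x - r *\<^sub>R f' x) / norm r
          = norm ((f (x + r *\<^sub>R b) - f x) /\<^sub>R r - f' x)" if "r \<noteq> 0" for r
        proof -
          have "(f (x + r *\<^sub>R b) - f x) /\<^sub>R r - f' x = (f (x + r *\<^sub>R b) - f x - r *\<^sub>R f' x) /\<^sub>R r"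
            using that by (simp add: scaleR_diff_right)
          then show ?thesis by (simp add: divide_inverse mult.commute)
        qed
        then show ?thesis unfolding eventually_at_filter by (intro always_eventually) blast
      qed
      ultimately have "(\<lambda>r. norm ((f (x + r *\<^sub>R b) - f x) /\<^sub>R r - f' x)) \<midarrow>0\<rightarrow> 0"
        by (rule Lim_transform_eventually)
      then show ?thesis by (rule LIM_zero_cancel[OF tendsto_norm_zero_cancel])
    qed
    moreover have "filterlim (\<lambda>n. 1 / real (Suc n)) (at 0) sequentially"
      using LIMSEQ_inverse_real_of_nat by (simp add: filterlim_at inverse_eq_divide)
    ultimately show ?thesis unfolding q_def by (rule filterlim_compose)
  qed
  have bound: "norm (q n x) \<le> (C * 2 ^ (2 * DIM('a))) * weight x" for n x
  proof -
    define h where "h = 1 / real (Suc n)"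
    have h: "0 < h" "h \<le> 1" unfolding h_def by auto
    have "norm (f (x + h *\<^sub>R b) - f (x + 0 *\<^sub>R b)) \<le> (C * 2 ^ (2 * DIM('a)) * weight x) * norm (h - 0)"
    proof (rule differentiable_bound[of "{0..h}" "\<lambda>r. f (x + r *\<^sub>R b)" "\<lambda>r s. s *\<^sub>R f' (x + r *\<^sub>R b)"])
      show "((\<lambda>r. f (x + r *\<^sub>R b)) has_derivative (\<lambda>s. s *\<^sub>R f' (x + r *\<^sub>R b))) (at r within {0..h})" for r
        using der[of x r] unfolding has_vector_derivative_def by (rule has_derivative_at_withinI)
      show "onorm (\<lambda>s. s *\<^sub>R f' (x + r *\<^sub>R b)) \<le> C * 2 ^ (2 * DIM('a)) * weight x" if "r \<in> {0..h}" for r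
      proof -
        have "norm (r *\<^sub>R b) \<le> 1 * 1" unfolding norm_scaleR using that h b by (intro mult_mono) auto
        then have "weight (x + r *\<^sub>R b) \<le> 2 ^ (2 * DIM('a)) * weight x" by (intro weight_shift) simp
        then have "C * weight (x + r *\<^sub>R b) \<le> C * (2 ^ (2 * DIM('a)) * weight x)"
          using C(1) by (rule mult_left_mono)
        then have "norm (f' (x + r *\<^sub>R b)) \<le> C * 2 ^ (2 * DIM('a)) * weight x"
          using C(2)[of "x + r *\<^sub>R b"] by (simp add: mult.assoc)
        then show ?thesis by (intro onorm_le) (simp add: mult.commute mult_left_mono)
      qed
    qed (use h in auto)
    then have "norm (f (x + h *\<^sub>R b) - f x) / h \<le> C * 2 ^ (2 * DIM('a)) * weight x"
      using h by (simp add: pos_divide_le_eq)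
    then show ?thesis unfolding q_def h_def[symmetric] using h by (simp add: divide_inverse mult_ac)
  qed
  have "(\<lambda>n. LINT x|lborel. q n x) \<longlonglongrightarrow> (LINT x|lborel. f' x)"
    by (rule integral_dominated_convergence[where w="\<lambda>x. (C * 2 ^ (2 * DIM('a))) * weight x"])
       (use lim bound integrable_weight in \<open>auto simp: q_def\<close>)
  then show ?thesis unfolding q0 by (simp add: LIMSEQ_const_iff)
qed

lemma fourier_partial:
  fixes \<phi> :: "'a::euclidean_space \<Rightarrow> complex"
  assumes \<phi>: "\<phi> \<in> schwartz" and b: "b \<in> Basis"
  shows "fourier (partial b \<phi>) \<xi> = (2 * of_real pi * \<i> * of_real (\<xi> \<bullet> b)) * fourier \<phi> \<xi>"
proof -
  let ?c = "2 * of_real pi * \<i> * of_real (\<xi> \<bullet> b)"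
  define f' where "f' x = wave (- (x \<bullet> \<xi>)) * partial b \<phi> x - ?c * (wave (- (x \<bullet> \<xi>)) * \<phi> x)" for x
  have \<phi>': "partial b \<phi> \<in> schwartz" by (intro schwartz_partial \<phi> b)
  have [measurable]: "\<phi> \<in> borel_measurable borel" "partial b \<phi> \<in> borel_measurable borel"
    using \<phi> \<phi>' schwartz_measurable by auto
  obtain C D where C: "0 \<le> C" "\<And>x. norm (\<phi> x) \<le> C * weight x"
    and D: "0 \<le> D" "\<And>x. norm (partial b \<phi> x) \<le> D * weight x"
    using schwartz_weight_bound[OF \<phi>] schwartz_weight_bound[OF \<phi>'] by metis
  have int: "integrable lborel (\<lambda>x. wave (- (x \<bullet> \<xi>)) * \<phi> x)"
    "integrable lborel (\<lambda>x. wave (- (x \<bullet> \<xi>)) * partial b \<phi> x)"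
    by (intro integrable_wave_mult schwartz_integrable \<phi> \<phi>'; measurable)+
  have "(LINT x|lborel. f' x) = 0"
  proof (rule integral_directional_derivative_zero[OF _ _ int(1), where C="D + norm ?c * C" and b=b])
    fix x :: 'a and r :: real
    have "((\<lambda>r. \<phi> (x + r *\<^sub>R b)) has_derivative (\<lambda>s. frechet_derivative \<phi> (at (x + r *\<^sub>R b)) (s *\<^sub>R b))) (at r)"
      by (rule has_derivative_compose[where g=\<phi>])
         (auto intro!: derivative_eq_intros schwartz_has_derivative \<phi>)
    then have 1: "((\<lambda>r. \<phi> (x + r *\<^sub>R b)) has_vector_derivative partial b \<phi> (x + r *\<^sub>R b)) (at r)"
      unfolding has_vector_derivative_def
      by (simp add: linear_scale bounded_linear.linear[OF has_derivative_bounded_linear[OF schwartz_has_derivative[OF \<phi>]]])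
    have 2: "((\<lambda>r. wave (- ((x + r *\<^sub>R b) \<bullet> \<xi>))) has_vector_derivative
        - (?c * wave (- ((x + r *\<^sub>R b) \<bullet> \<xi>)))) (at r)"
    proof -
      have "((\<lambda>r. - ((x + r *\<^sub>R b) \<bullet> \<xi>)) has_vector_derivative - (b \<bullet> \<xi>)) (at r)"
        unfolding has_vector_derivative_def by (auto intro!: derivative_eq_intros)
      from vector_diff_chain_at[OF this wave_has_vector_derivative]
      show ?thesis by (simp add: comp_def scaleR_conv_of_real inner_commute[of b \<xi>] mult_ac)
    qed
    show "((\<lambda>r. wave (- ((x + r *\<^sub>R b) \<bullet> \<xi>)) * \<phi> (x + r *\<^sub>R b)) has_vector_derivative f' (x + r *\<^sub>R b)) (at r)"
      unfolding f'_def by (rule has_vector_derivative_eq_rhs[OF has_vector_derivative_mult[OF 2 1]]) (simp add: algebra_simps)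
  next
    show "f' \<in> borel_measurable borel" unfolding f'_def by measurable
    show "norm (f' x) \<le> (D + norm ?c * C) * weight x" for x
    proof -
      have "norm (f' x) \<le> norm (partial b \<phi> x) + norm ?c * norm (\<phi> x)"
        unfolding f'_def by (intro order_trans[OF norm_triangle_ineq4]) (simp add: norm_mult)
      also have "\<dots> \<le> D * weight x + norm ?c * (C * weight x)"
        by (intro add_mono mult_left_mono C D) auto
      finally show ?thesis by (simp add: algebra_simps)
    qed
  qed (use b C D in \<open>auto intro!: add_nonneg_nonneg mult_nonneg_nonneg\<close>)
  then show ?thesis unfolding f'_def fourier_eq using int by simp
qed

text \<open>
  A power of the frequency is traded for a derivative of the function, one coordinate at a
  time.
\<close>

lemma fourier_decay:
  fixes \<phi> :: "'a::euclidean_space \<Rightarrow> complex"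
  assumes "\<phi> \<in> schwartz"
  shows "\<exists>C. \<forall>\<xi>. norm \<xi> ^ k * norm (fourier \<phi> \<xi>) \<le> C"
  using assms
proof (induction k arbitrary: \<phi>)
  case 0
  then show ?case using norm_fourier_le[of \<phi>] by auto
next
  case (Suc k)
  have "\<forall>b\<in>Basis. \<exists>C. \<forall>\<xi>. norm \<xi> ^ k * norm (fourier (partial b \<phi>) \<xi>) \<le> C"
    using Suc schwartz_partial by blast
  then obtain C where C: "\<And>b \<xi>. b \<in> Basis \<Longrightarrow> norm \<xi> ^ k * norm (fourier (partial b \<phi>) \<xi>) \<le> C b"
    by metis
  have "norm \<xi> ^ Suc k * norm (fourier \<phi> \<xi>) \<le> (\<Sum>b\<in>Basis. C b)" for \<xi>
  proof -
    have "norm \<xi> ^ Suc k * norm (fourier \<phi> \<xi>) = norm \<xi> ^ k * norm (fourier \<phi> \<xi>) * norm \<xi>" by simp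
    also have "\<dots> \<le> norm \<xi> ^ k * norm (fourier \<phi> \<xi>) * (\<Sum>b\<in>Basis. \<bar>\<xi> \<bullet> b\<bar>)"
      by (intro mult_left_mono norm_le_l1) auto
    also have "\<dots> = (\<Sum>b\<in>Basis. norm \<xi> ^ k * (\<bar>\<xi> \<bullet> b\<bar> * norm (fourier \<phi> \<xi>)))"
      by (simp add: sum_distrib_left mult_ac)
    also have "\<dots> \<le> (\<Sum>b\<in>Basis. norm \<xi> ^ k * norm (fourier (partial b \<phi>) \<xi>))"
    proof (intro sum_mono mult_left_mono)
      fix b :: 'a assume b: "b \<in> Basis"
      have "1 * (\<bar>\<xi> \<bullet> b\<bar> * norm (fourier \<phi> \<xi>)) \<le> (2 * pi) * (\<bar>\<xi> \<bullet> b\<bar> * norm (fourier \<phi> \<xi>))"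
        using pi_gt3 by (intro mult_right_mono) auto
      then show "\<bar>\<xi> \<bullet> b\<bar> * norm (fourier \<phi> \<xi>) \<le> norm (fourier (partial b \<phi>) \<xi>)"
        by (simp add: fourier_partial[OF Suc.prems b] norm_mult mult_ac)
    qed auto
    also have "\<dots> \<le> (\<Sum>b\<in>Basis. C b)" by (intro sum_mono C)
    finally show ?thesis .
  qed
  then show ?case by blast
qed

text \<open>
  The image of the Schwartz space is stable under partial derivatives, because differentiating
  a Fourier transform multiplies the function by a coordinate, and its members decay, because
  multiplying by a coordinate differentiates the function. So the coinduction principle applies
  to the image as a whole.
\<close>

theorem schwartz_fourier:
  fixes \<phi> :: "'a::euclidean_space \<Rightarrow> complex"
  assumes "\<phi> \<in> schwartz"
  shows "fourier \<phi> \<in> schwartz"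
proof (rule schwartz_coinduct[where F="fourier ` schwartz"])
  show "\<psi> differentiable (at x)" if psi: "\<psi> \<in> fourier ` schwartz" for \<psi> :: "'a \<Rightarrow> complex" and x
    using that fourier_has_derivative unfolding differentiable_def by blast
  show "partial b \<psi> \<in> fourier ` schwartz" if psi: "\<psi> \<in> fourier ` schwartz" and b: "b \<in> Basis"
    for \<psi> :: "'a \<Rightarrow> complex" and b
  proof -
    obtain \<phi> where \<phi>: "\<phi> \<in> schwartz" "\<psi> = fourier \<phi>" using psi by blast
    have eq: "partial b \<psi> = fourier (\<lambda>x. (- 2 * of_real pi * \<i>) * (of_real (x \<bullet> b) * \<phi> x))"
      unfolding \<phi>(2) using b
      by (intro ext partial_eqI[OF fourier_has_derivative[OF \<phi>(1)], THEN trans])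
         (simp add: inner_Basis if_distrib if_distribR sum.delta cong: if_cong)
    show ?thesis unfolding eq by (intro imageI schwartz_mult schwartz_coordinate \<phi> b)
  qed
qed (use assms fourier_decay in auto)

lemma schwartz_ifourier: "\<phi> \<in> schwartz \<Longrightarrow> ifourier \<phi> \<in> schwartz"
  using schwartz_reflect[OF schwartz_fourier] unfolding ifourier_fourier_minus[abs_def] .

section \<open>Gaussians\<close>

lemma power_le_fact_exp: "r ^ k \<le> fact k * exp r" if "0 \<le> (r::real)"
proof -
  have "(\<Sum>n\<in>{k}. r ^ n /\<^sub>R fact n) \<le> (\<Sum>n. r ^ n /\<^sub>R fact n)"
    by (rule sum_le_suminf[OF summable_exp_generic]) (use that in auto)
  then have "r ^ k / fact k \<le> exp r" by (simp add: exp_def divide_inverse mult.commute)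
  then show ?thesis by (simp add: pos_divide_le_eq mult.commute)
qed

lemma quadratic_le: "a * r - c * r\<^sup>2 \<le> a\<^sup>2 / (4 * c)" if "0 < c" for a r c :: real
proof -
  have "0 \<le> (2 * c * r - a)\<^sup>2" by simp
  then have "(a * r - c * r\<^sup>2) * (4 * c) \<le> a\<^sup>2" by (simp add: power2_eq_square algebra_simps)
  then show ?thesis using that by (subst pos_le_divide_eq) auto
qed

text \<open>Polynomials times a fixed Gaussian: stable under partial derivatives by construction.\<close>

inductive_set gauss_poly :: "real \<Rightarrow> 'a::euclidean_space \<Rightarrow> ('a \<Rightarrow> complex) set" for c a where
  base: "(\<lambda>x. of_real (exp (- c * (x \<bullet> x) + x \<bullet> a))) \<in> gauss_poly c a"
| coord: "\<phi> \<in> gauss_poly c a \<Longrightarrow> b \<in> Basis \<Longrightarrow> (\<lambda>x. of_real (x \<bullet> b) * \<phi> x) \<in> gauss_poly c a"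
| lincomb: "\<phi> \<in> gauss_poly c a \<Longrightarrow> \<eta> \<in> gauss_poly c a \<Longrightarrow> (\<lambda>x. k * \<phi> x + l * \<eta> x) \<in> gauss_poly c a"

lemma gauss_poly_partial:
  assumes "\<phi> \<in> gauss_poly c a"
  shows "(\<forall>x. \<phi> differentiable (at x)) \<and> (\<forall>b\<in>Basis. partial b \<phi> \<in> gauss_poly c a)"
  using assms
proof induction
  case base
  let ?g = "\<lambda>x. complex_of_real (exp (- c * (x \<bullet> x) + x \<bullet> a))"
  have der: "(?g has_derivative (\<lambda>h. of_real ((- 2 * c * (x \<bullet> h) + h \<bullet> a) * exp (- c * (x \<bullet> x) + x \<bullet> a)))) (at x)" for x
  proof -
    have "((\<lambda>x. exp (- c * (x \<bullet> x) + x \<bullet> a)) has_derivative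
        (\<lambda>h. (- 2 * c * (x \<bullet> h) + h \<bullet> a) * exp (- c * (x \<bullet> x) + x \<bullet> a))) (at x)"
      by (auto intro!: derivative_eq_intros simp: inner_commute algebra_simps)
    then show ?thesis by (rule has_derivative_of_real)
  qed
  moreover have "partial b ?g \<in> gauss_poly c a" if b: "b \<in> Basis" for b
  proof -
    have "partial b ?g = (\<lambda>x. of_real (- 2 * c) * (of_real (x \<bullet> b) * ?g x) + of_real (b \<bullet> a) * ?g x)"
      by (intro ext partial_eqI[OF der, THEN trans]) (simp add: algebra_simps)
    also have "\<dots> \<in> gauss_poly c a"
      by (intro gauss_poly.lincomb gauss_poly.coord gauss_poly.base b)
    finally show ?thesis .
  qed
  ultimately show ?case unfolding differentiable_def by blast
next
  case (coord \<phi> b)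
  have "\<And>x. (\<phi> has_derivative frechet_derivative \<phi> (at x)) (at x)"
    using coord.IH frechet_derivative_works by blast
  then have der: "((\<lambda>x. of_real (x \<bullet> b) * \<phi> x) has_derivative
      (\<lambda>h. of_real (x \<bullet> b) * frechet_derivative \<phi> (at x) h + of_real (h \<bullet> b) * \<phi> x)) (at x)" for x
    by (auto intro!: derivative_eq_intros)
  have "partial d (\<lambda>x. of_real (x \<bullet> b) * \<phi> x) \<in> gauss_poly c a" if d: "d \<in> Basis" for d
  proof -
    have "partial d (\<lambda>x. of_real (x \<bullet> b) * \<phi> x)
        = (\<lambda>x. 1 * (of_real (x \<bullet> b) * partial d \<phi> x) + of_real (d \<bullet> b) * \<phi> x)"
      by (intro ext partial_eqI[OF der, THEN trans]) simp
    also have "\<dots> \<in> gauss_poly c a"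
      using coord.IH coord.hyps d by (intro gauss_poly.lincomb gauss_poly.coord) auto
    finally show ?thesis .
  qed
  then show ?case using der unfolding differentiable_def by blast
next
  case (lincomb \<phi> \<eta> k l)
  have "\<And>x. (\<phi> has_derivative frechet_derivative \<phi> (at x)) (at x)"
    "\<And>x. (\<eta> has_derivative frechet_derivative \<eta> (at x)) (at x)"
    using lincomb.IH frechet_derivative_works by blast+
  then have der: "((\<lambda>x. k * \<phi> x + l * \<eta> x) has_derivative
      (\<lambda>h. k * frechet_derivative \<phi> (at x) h + l * frechet_derivative \<eta> (at x) h)) (at x)" for x
    by (auto intro!: derivative_eq_intros)
  have "partial d (\<lambda>x. k * \<phi> x + l * \<eta> x) \<in> gauss_poly c a" if d: "d \<in> Basis" for d
  proof -
    have "partial d (\<lambda>x. k * \<phi> x + l * \<eta> x) = (\<lambda>x. k * partial d \<phi> x + l * partial d \<eta> x)"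
      by (intro ext partial_eqI[OF der, THEN trans]) simp
    also have "\<dots> \<in> gauss_poly c a"
      using lincomb.IH d by (intro gauss_poly.lincomb) auto
    finally show ?thesis .
  qed
  then show ?case using der unfolding differentiable_def by blast
qed

lemma gauss_poly_decay:
  assumes "\<phi> \<in> gauss_poly c a" and c: "0 < c"
  shows "\<exists>C. \<forall>x. norm x ^ k * norm (\<phi> x) \<le> C"
  using assms(1)
proof (induction arbitrary: k)
  case base
  let ?A = "1 + norm a"
  have "norm x ^ k * norm (complex_of_real (exp (- c * (x \<bullet> x) + x \<bullet> a))) \<le> fact k * exp (?A\<^sup>2 / (4 * c))" for x
  proof -
    have "norm x ^ k * exp (- c * (x \<bullet> x) + x \<bullet> a) \<le> (fact k * exp (norm x)) * exp (- c * (x \<bullet> x) + x \<bullet> a)"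
      by (intro mult_right_mono power_le_fact_exp) auto
    also have "\<dots> = fact k * exp (norm x - c * (norm x)\<^sup>2 + x \<bullet> a)"
      by (simp add: exp_add exp_diff exp_minus power2_norm_eq_inner divide_inverse mult_ac)
    also have "\<dots> \<le> fact k * exp (?A\<^sup>2 / (4 * c))"
    proof -
      have "x \<bullet> a \<le> norm x * norm a" by (rule norm_cauchy_schwarz)
      moreover have "?A * norm x - c * (norm x)\<^sup>2 \<le> ?A\<^sup>2 / (4 * c)"
        by (rule quadratic_le[OF c])
      ultimately have "norm x - c * (norm x)\<^sup>2 + x \<bullet> a \<le> ?A\<^sup>2 / (4 * c)" by (simp add: algebra_simps)
      then show ?thesis by simp
    qed
    finally show ?thesis by simp
  qed
  then show ?case by blast
next
  case (coord \<phi> b)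
  obtain C where C: "\<And>x. norm x ^ Suc k * norm (\<phi> x) \<le> C" using coord.IH by metis
  have "norm x ^ k * norm (of_real (x \<bullet> b) * \<phi> x) \<le> C" for x
  proof -
    have "norm x ^ k * (\<bar>x \<bullet> b\<bar> * norm (\<phi> x)) \<le> norm x ^ k * (norm x * norm (\<phi> x))"
      by (intro mult_left_mono mult_right_mono Basis_le_norm coord.hyps) auto
    also have "\<dots> \<le> C" using C[of x] by (simp add: mult_ac)
    finally show ?thesis by (simp add: norm_mult)
  qed
  then show ?case by blast
next
  case (lincomb \<phi> \<eta> u v)
  obtain C D where C: "\<And>x. norm x ^ k * norm (\<phi> x) \<le> C" and D: "\<And>x. norm x ^ k * norm (\<eta> x) \<le> D"
    using lincomb.IH by metis
  have "norm x ^ k * norm (u * \<phi> x + v * \<eta> x) \<le> norm u * C + norm v * D" for x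
  proof -
    have "norm x ^ k * norm (u * \<phi> x + v * \<eta> x) \<le> norm x ^ k * (norm u * norm (\<phi> x) + norm v * norm (\<eta> x))"
      by (intro mult_left_mono order_trans[OF norm_triangle_ineq]) (auto simp: norm_mult)
    also have "\<dots> = norm u * (norm x ^ k * norm (\<phi> x)) + norm v * (norm x ^ k * norm (\<eta> x))"
      by (simp add: algebra_simps)
    also have "\<dots> \<le> norm u * C + norm v * D" by (intro add_mono mult_left_mono C D) auto
    finally show ?thesis .
  qed
  then show ?case by blast
qed

lemma schwartz_gauss:
  assumes "0 < c"
  shows "(\<lambda>x. of_real (exp (- c * (x \<bullet> x) + x \<bullet> a))) \<in> schwartz"
  by (rule schwartz_coinduct[OF gauss_poly.base[of c a]])
     (use gauss_poly_partial gauss_poly_decay assms in blast)+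

definition gauss :: "real \<Rightarrow> 'a::euclidean_space \<Rightarrow> real" where
  "gauss l x = exp (- (pi * l * (norm x)\<^sup>2))"

lemma gauss_pos: "0 < gauss l x" by (simp add: gauss_def)
lemma gauss_minus [simp]: "gauss l (- x) = gauss l x" by (simp add: gauss_def)
lemma gauss_le_1: "0 \<le> l \<Longrightarrow> gauss l x \<le> 1" by (simp add: gauss_def)

lemma continuous_gauss [continuous_intros]: "continuous_on S f \<Longrightarrow> continuous_on S (\<lambda>x. gauss l (f x))"
  unfolding gauss_def by (intro continuous_intros)

lemma borel_measurable_gauss [measurable]: "gauss l \<in> borel_measurable borel"
  by (intro borel_measurable_continuous continuous_intros)

text \<open>
  After rescaling this is the characteristic function of the standard normal distribution.
\<close>

lemma gaussian_wave_1:
  assumes l: "0 < l"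
  shows "integrable lborel (\<lambda>s. wave (s * r) * of_real (exp (- (pi * l * s\<^sup>2))))"
    and "(LINT s|lborel. wave (s * r) * of_real (exp (- (pi * l * s\<^sup>2)))) = of_real (exp (- (pi * r\<^sup>2 / l)) / sqrt l)"
proof -
  let ?k = "sqrt (2 * pi * l)" and ?t = "r * sqrt (2 * pi / l)"
  let ?f = "\<lambda>s. wave (s * r) * of_real (exp (- (pi * l * s\<^sup>2)))"
  have k: "?k > 0" using l by simp
  have f: "?f \<in> borel_measurable borel" by measurable
  have e: "?f (0 + (1 / ?k) *\<^sub>R x) = of_real (sqrt (2 * pi)) * (std_normal_density x *\<^sub>R iexp (?t * x))" for x
  proof -
    have 1: "2 * pi * ((1 / ?k * x) * r) = ?t * x"
    proof -
      have "2 * pi / ?k = sqrt (2 * pi / l)"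
        using l by (simp add: real_sqrt_mult real_sqrt_divide real_div_sqrt field_simps)
      moreover have "2 * pi * ((1 / ?k * x) * r) = (2 * pi / ?k) * (x * r)" by simp
      ultimately show ?thesis by (simp only: mult_ac)
    qed
    have 2: "pi * l * (1 / ?k * x)\<^sup>2 = x\<^sup>2 / 2"
      using l by (simp add: power_mult_distrib power_divide)
    show ?thesis
      unfolding wave_def cis_conv_exp std_normal_density_def using 1 2
      by (simp add: scaleR_conv_of_real mult_ac)
  qed
  have int: "integrable lborel (\<lambda>x. std_normal_density x *\<^sub>R iexp (?t * x))"
  proof (rule Bochner_Integration.integrable_bound)
    show "integrable lborel std_normal_density" by (simp add: integrable_normal_density)
  qed auto
  then have "integrable lborel (\<lambda>x. ?f (0 + (1 / ?k) *\<^sub>R x))"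
    unfolding e by (intro integrable_mult_right)
  moreover have "1 / ?k \<noteq> 0" using l by simp
  ultimately show "integrable lborel ?f"
    using lborel_scale(1)[OF f, of "1 / ?k" 0] by blast
  have "char std_normal_distribution ?t = (LINT x|lborel. std_normal_density x *\<^sub>R iexp (?t * x))"
    unfolding char_def by (subst integral_density) (auto simp: normal_density_nonneg)
  then have ch: "(LINT x|lborel. std_normal_density x *\<^sub>R iexp (?t * x)) = of_real (exp (- (?t\<^sup>2) / 2))"
    using char_std_normal_distribution by (simp add: fun_eq_iff)
  have "(LINT s|lborel. ?f s) = \<bar>1 / ?k\<bar> ^ DIM(real) *\<^sub>R (LINT x|lborel. ?f (0 + (1 / ?k) *\<^sub>R x))"
    by (rule lborel_scale(2)[OF f]) (use k in auto)
  also have "\<dots> = (1 / ?k) *\<^sub>R (of_real (sqrt (2 * pi)) * of_real (exp (- (?t\<^sup>2) / 2)))"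
  proof -
    have "(LINT x|lborel. ?f (0 + (1 / ?k) *\<^sub>R x)) = of_real (sqrt (2 * pi)) * of_real (exp (- (?t\<^sup>2) / 2))"
      unfolding e ch[symmetric] by (rule integral_mult_right_zero)
    moreover have "\<bar>1 / ?k\<bar> ^ DIM(real) = 1 / ?k" using k by simp
    ultimately show ?thesis by (simp only:)
  qed
  also have "\<dots> = of_real (exp (- (pi * r\<^sup>2 / l)) / sqrt l)"
    using l by (simp add: scaleR_conv_of_real real_sqrt_mult power_mult_distrib field_simps)
  finally show "(LINT s|lborel. ?f s) = of_real (exp (- (pi * r\<^sup>2 / l)) / sqrt l)" .
qed

lemma sqrt_power: "sqrt l ^ n = l powr (real n / 2)" if "0 < l"
proof -
  have "sqrt l ^ n = (l powr (1 / 2)) powr real n"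
    using that by (simp add: powr_half_sqrt powr_realpow)
  then show ?thesis by (simp add: powr_powr)
qed

lemma wave_sum: "finite A \<Longrightarrow> wave (\<Sum>a\<in>A. f a) = (\<Prod>a\<in>A. wave (f a))"
  by (induction A rule: finite_induct) (auto simp: wave_add)

lemma gaussian_wave:
  fixes \<xi> :: "'a::euclidean_space"
  assumes l: "0 < l"
  shows "integrable lborel (\<lambda>x. wave (x \<bullet> \<xi>) * of_real (gauss l x))"
    and "(LINT x|lborel. wave (x \<bullet> \<xi>) * of_real (gauss l x)) = of_real (l powr (- (DIM('a) / 2)) * gauss (1 / l) \<xi>)"
proof -
  have nsq: "(norm x)\<^sup>2 = (\<Sum>b\<in>Basis. (x \<bullet> b)\<^sup>2)" for x :: 'a
    unfolding power2_norm_eq_inner by (subst euclidean_inner) (simp add: power2_eq_square)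
  have eq: "wave (x \<bullet> \<xi>) * of_real (gauss l x)
      = (\<Prod>b\<in>Basis. wave ((x \<bullet> b) * (\<xi> \<bullet> b)) * of_real (exp (- (pi * l * (x \<bullet> b)\<^sup>2))))" for x :: 'a
  proof -
    have "wave (x \<bullet> \<xi>) = (\<Prod>b\<in>Basis. wave ((x \<bullet> b) * (\<xi> \<bullet> b)))"
      by (subst euclidean_inner) (simp add: wave_sum)
    moreover have "gauss l x = (\<Prod>b\<in>Basis. exp (- (pi * l * (x \<bullet> b)\<^sup>2)))"
    proof -
      have "(\<Sum>b\<in>(Basis::'a set). - (pi * l * (x \<bullet> b)\<^sup>2)) = - (pi * l * (norm x)\<^sup>2)"
        unfolding nsq sum_distrib_left sum_negf by simp
      then show ?thesis unfolding gauss_def by (simp only: exp_sum[symmetric] finite_Basis)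
    qed
    ultimately show ?thesis by (simp add: prod.distrib)
  qed
  show "integrable lborel (\<lambda>x. wave (x \<bullet> \<xi>) * of_real (gauss l x))"
    unfolding eq by (rule lborel_prod_Basis) (rule gaussian_wave_1[OF l])
  have "(LINT x|lborel. wave (x \<bullet> \<xi>) * of_real (gauss l x))
      = (\<Prod>b\<in>(Basis::'a set). of_real (exp (- (pi * (\<xi> \<bullet> b)\<^sup>2 / l)) / sqrt l))"
    unfolding eq by (subst lborel_prod_Basis) (auto simp: gaussian_wave_1[OF l] intro!: gaussian_wave_1[OF l])
  also have "\<dots> = of_real ((\<Prod>b\<in>(Basis::'a set). exp (- (pi * (\<xi> \<bullet> b)\<^sup>2 / l))) / sqrt l ^ DIM('a))"
    by (simp add: prod_dividef)
  also have "(\<Prod>b\<in>(Basis::'a set). exp (- (pi * (\<xi> \<bullet> b)\<^sup>2 / l))) = gauss (1 / l) \<xi>"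
  proof -
    have "(\<Sum>b\<in>(Basis::'a set). - (pi * (\<xi> \<bullet> b)\<^sup>2 / l)) = - (pi * (1 / l) * (norm \<xi>)\<^sup>2)"
      unfolding nsq sum_distrib_left sum_negf by simp
    then show ?thesis unfolding gauss_def by (simp only: exp_sum[symmetric] finite_Basis)
  qed
  also have "gauss (1 / l) \<xi> / sqrt l ^ DIM('a) = l powr (- (DIM('a) / 2)) * gauss (1 / l) \<xi>"
    using l by (simp only: sqrt_power powr_minus divide_inverse mult.commute)
  finally show "(LINT x|lborel. wave (x \<bullet> \<xi>) * of_real (gauss l x)) = of_real (l powr (- (DIM('a) / 2)) * gauss (1 / l) \<xi>)" .
qed

lemma gaussian_integral:
  assumes l: "0 < l"
  shows "integrable lborel (gauss l :: 'a::euclidean_space \<Rightarrow> real)"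
    and "(LINT x|lborel. gauss l (x::'a)) = l powr (- (DIM('a) / 2))"
proof -
  have i: "integrable lborel (\<lambda>x::'a. complex_of_real (gauss l x))" using gaussian_wave(1)[OF l, of "0::'a"] by simp
  then show "integrable lborel (gauss l :: 'a \<Rightarrow> real)" by (simp add: complex_of_real_integrable_eq)
  have "complex_of_real (LINT x|lborel. gauss l (x::'a)) = of_real (l powr (- (DIM('a) / 2)))"
    using gaussian_wave(2)[OF l, of "0::'a"] by (simp add: gauss_def)
  then show "(LINT x|lborel. gauss l (x::'a)) = l powr (- (DIM('a) / 2))" by (simp only: of_real_eq_iff)
qed

text \<open>
  Rescaling fixes the Gaussian and moves the argument of the function towards the given point, so
  dominated convergence applies.
\<close>

lemma gauss_approximate_identity:
  fixes f :: "'a::euclidean_space \<Rightarrow> complex"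
  assumes f: "continuous_on UNIV f" and C: "\<And>x. norm (f x) \<le> C"
  shows "(\<lambda>n. LINT z|lborel. f z * of_real (real (Suc n) powr (DIM('a) / 2) * gauss (real (Suc n)) (x - z))) \<longlonglongrightarrow> f x"
proof -
  have [measurable]: "f \<in> borel_measurable borel" by (rule borel_measurable_continuous[OF f])
  have eq: "(LINT z|lborel. f z * of_real (m powr (DIM('a) / 2) * gauss m (x - z)))
      = (LINT v|lborel. f (x + (1 / sqrt m) *\<^sub>R v) * of_real (gauss 1 v))" if m: "m > 0" for m
  proof -
    have "(LINT z|lborel. f z * of_real (m powr (DIM('a) / 2) * gauss m (x - z)))
        = \<bar>1 / sqrt m\<bar> ^ DIM('a) *\<^sub>R (LINT v|lborel. f (x + (1 / sqrt m) *\<^sub>R v) * of_real (m powr (DIM('a) / 2) * gauss m (x - (x + (1 / sqrt m) *\<^sub>R v))))"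
      by (rule lborel_scale(2)) (use m in auto)
    also have "\<dots> = \<bar>1 / sqrt m\<bar> ^ DIM('a) *\<^sub>R (LINT v|lborel. f (x + (1 / sqrt m) *\<^sub>R v) * of_real (m powr (DIM('a) / 2) * gauss 1 v))"
    proof -
      have "gauss m (x - (x + (1 / sqrt m) *\<^sub>R v)) = gauss 1 v" for v
        using m by (simp add: gauss_def power_divide)
      then show ?thesis by (simp only:)
    qed
    also have "\<bar>1 / sqrt m\<bar> ^ DIM('a) *\<^sub>R (LINT v|lborel. f (x + (1 / sqrt m) *\<^sub>R v) * of_real (m powr (DIM('a) / 2) * gauss 1 v))
        = (\<bar>1 / sqrt m\<bar> ^ DIM('a) * m powr (DIM('a) / 2)) *\<^sub>R (LINT v|lborel. f (x + (1 / sqrt m) *\<^sub>R v) * of_real (gauss 1 v))"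
    proof -
      have "f (x + (1 / sqrt m) *\<^sub>R v) * of_real (m powr (DIM('a) / 2) * gauss 1 v)
          = (m powr (DIM('a) / 2)) *\<^sub>R (f (x + (1 / sqrt m) *\<^sub>R v) * of_real (gauss 1 v))" for v
        unfolding scaleR_conv_of_real of_real_mult by (rule mult.left_commute)
      then show ?thesis by (simp only: integral_scaleR_right scaleR_scaleR)
    qed
    also have "\<bar>1 / sqrt m\<bar> ^ DIM('a) * m powr (DIM('a) / 2) = 1"
    proof -
      have "m powr (DIM('a) / 2) = sqrt m ^ DIM('a)"
        using m by (simp add: sqrt_power)
      then show ?thesis using m by (simp add: power_one_over power_mult_distrib[symmetric])
    qed
    finally show ?thesis by simp
  qed
  have "(\<lambda>n. LINT v|lborel. f (x + (1 / sqrt (real (Suc n))) *\<^sub>R v) * of_real (gauss 1 v))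
      \<longlonglongrightarrow> (LINT v|lborel. f x * of_real (gauss 1 (v::'a)))"
  proof (rule integral_dominated_convergence[where w="\<lambda>v. C * gauss 1 v"])
    show "integrable lborel (\<lambda>v::'a. C * gauss 1 v)" using gaussian_integral(1)[of 1, where 'a='a] by simp
    show "AE v in lborel. norm (f (x + (1 / sqrt (real (Suc n))) *\<^sub>R v) * of_real (gauss 1 v)) \<le> C * gauss 1 v" for n
      unfolding norm_mult norm_of_real abs_of_pos[OF gauss_pos]
      by (intro AE_I2 mult_right_mono C less_imp_le[OF gauss_pos])
    have "(\<lambda>n. 1 / sqrt (real (Suc n))) \<longlonglongrightarrow> 0"
      by real_asymp
    then have "(\<lambda>n. x + (1 / sqrt (real (Suc n))) *\<^sub>R v) \<longlonglongrightarrow> x" for v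
      using tendsto_add[OF tendsto_const[of x] tendsto_scaleR[OF _ tendsto_const[of v]]] by fastforce
    then have "(\<lambda>n. f (x + (1 / sqrt (real (Suc n))) *\<^sub>R v)) \<longlonglongrightarrow> f x" for v
      using f by (auto simp: continuous_on_eq_continuous_at intro: isCont_tendsto_compose)
    then show "AE v in lborel. (\<lambda>n. f (x + (1 / sqrt (real (Suc n))) *\<^sub>R v) * of_real (gauss 1 v)) \<longlonglongrightarrow> f x * of_real (gauss 1 v)"
      by (intro AE_I2 tendsto_intros)
  qed measurable
  also have "(LINT v|lborel. f x * of_real (gauss 1 (v::'a))) = f x"
    using gaussian_integral(2)[of 1, where 'a='a] by (simp only: integral_mult_right_zero integral_complex_of_real) simp
  finally show ?thesis by (subst eq) auto
qed

section \<open>Fourier inversion\<close>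

text \<open>
  Damping the outer integral by wide Gaussians makes Fubini applicable. Carrying out the
  frequency integral first gives the convolution of the function with narrow Gaussians, an
  approximate identity; as the damping is removed, the two sides have the asserted limits.
\<close>

theorem fourier_inversion:
  fixes f :: "'a::euclidean_space \<Rightarrow> complex"
  assumes f: "integrable lborel f" "continuous_on UNIV f" and C: "\<And>x. norm (f x) \<le> C"
    and ff: "integrable lborel (fourier f)"
  shows "ifourier (fourier f) x = f x"
proof (rule LIMSEQ_unique)
  have [measurable]: "f \<in> borel_measurable borel" "fourier f \<in> borel_measurable borel"
    using f(1) ff by (auto dest: borel_measurable_integrable)
  let ?S = "\<lambda>n. LINT y|lborel. wave (y \<bullet> x) * fourier f y * of_real (gauss (1 / real (Suc n)) y)"
  show "?S \<longlonglongrightarrow> ifourier (fourier f) x"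
    unfolding ifourier_def
  proof (rule integral_dominated_convergence[where w="\<lambda>y. norm (fourier f y)"])
    show "AE y in lborel. norm (wave (y \<bullet> x) * fourier f y * of_real (gauss (1 / real (Suc n)) y)) \<le> norm (fourier f y)" for n
    proof (rule AE_I2)
      fix y :: 'a
      have "norm (fourier f y) * gauss (1 / real (Suc n)) y \<le> norm (fourier f y)"
        by (intro mult_left_le gauss_le_1) auto
      then show "norm (wave (y \<bullet> x) * fourier f y * of_real (gauss (1 / real (Suc n)) y)) \<le> norm (fourier f y)"
        using gauss_pos[of "1 / real (Suc n)" y] by (simp add: norm_mult)
    qed
    have "(\<lambda>n. gauss (1 / real (Suc n)) y) \<longlonglongrightarrow> 1" for y :: 'a
    proof -
      have "(\<lambda>n. gauss (1 / real (Suc n)) y) \<longlonglongrightarrow> exp (- (pi * 0 * (norm y)\<^sup>2))"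
        unfolding gauss_def using LIMSEQ_inverse_real_of_nat
        by (intro tendsto_intros) (simp add: inverse_eq_divide)
      then show ?thesis by simp
    qed
    then have "(\<lambda>n. wave (y \<bullet> x) * fourier f y * of_real (gauss (1 / real (Suc n)) y)) \<longlonglongrightarrow> wave (y \<bullet> x) * fourier f y * of_real 1" for y
      by (intro tendsto_intros)
    then show "AE y in lborel. (\<lambda>n. wave (y \<bullet> x) * fourier f y * of_real (gauss (1 / real (Suc n)) y)) \<longlonglongrightarrow> wave (y \<bullet> x) * fourier f y"
      by simp
  qed (use ff in auto)
  have "?S n = (LINT z|lborel. f z * of_real (real (Suc n) powr (DIM('a) / 2) * gauss (real (Suc n)) (x - z)))" for n
  proof -
    let ?l = "1 / real (Suc n)"
    have l: "?l > 0" by simp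
    let ?F = "\<lambda>y z. wave (y \<bullet> (x - z)) * (f z * of_real (gauss ?l y))"
    have "?S n = (LINT y|lborel. LINT z|lborel. ?F y z)"
    proof (rule Bochner_Integration.integral_cong[OF refl])
      fix y :: 'a
      have "wave (y \<bullet> x) * fourier f y * of_real (gauss ?l y)
          = (LINT z|lborel. (wave (y \<bullet> x) * of_real (gauss ?l y)) * (wave (- (z \<bullet> y)) * f z))"
        unfolding fourier_eq integral_mult_right_zero by (simp only: mult_ac)
      also have "\<dots> = (LINT z|lborel. ?F y z)"
        by (intro Bochner_Integration.integral_cong)
           (auto simp: inner_diff_right wave_add[of _ "- _", simplified] inner_commute mult_ac)
      finally show "wave (y \<bullet> x) * fourier f y * of_real (gauss ?l y) = (LINT z|lborel. ?F y z)" .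
    qed
    also have "\<dots> = (LINT z|lborel. LINT y|lborel. ?F y z)"
    proof (rule LINT_Fubini(1)[where g="gauss ?l" and h="\<lambda>z. norm (f z)"])
      show "norm (?F y z) \<le> gauss ?l y * norm (f z)" for y z
        using gauss_pos[of ?l y] by (simp add: norm_mult)
    qed (use f gaussian_integral(1)[OF l] in auto)
    also have "\<dots> = (LINT z|lborel. f z * of_real (real (Suc n) powr (DIM('a) / 2) * gauss (real (Suc n)) (x - z)))"
    proof (rule Bochner_Integration.integral_cong[OF refl])
      fix z :: 'a
      have "(LINT y|lborel. ?F y z) = f z * (LINT y|lborel. wave (y \<bullet> (x - z)) * of_real (gauss ?l y))"
        by (simp add: mult.left_commute)
      also have "\<dots> = f z * of_real (?l powr (- (DIM('a) / 2)) * gauss (1 / ?l) (x - z))"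
        by (subst gaussian_wave(2)[OF l]) simp
      also have "?l powr (- (DIM('a) / 2)) = real (Suc n) powr (DIM('a) / 2)"
        by (simp add: powr_minus powr_divide)
      finally show "(LINT y|lborel. ?F y z) = f z * of_real (real (Suc n) powr (DIM('a) / 2) * gauss (real (Suc n)) (x - z))"
        by simp
    qed
    finally show ?thesis .
  qed
  then show "?S \<longlonglongrightarrow> f x"
    using gauss_approximate_identity[OF f(2) C, of x] by simp
qed

lemma ifourier_fourier: "\<phi> \<in> schwartz \<Longrightarrow> ifourier (fourier \<phi>) = \<phi>"
  using schwartz_bounded by (metis ext fourier_inversion schwartz_integrable schwartz_continuous schwartz_fourier)

lemma fourier_ifourier:
  assumes "\<phi> \<in> schwartz" shows "fourier (ifourier \<phi>) = \<phi>"
proof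
  fix x
  have "fourier (ifourier \<phi>) x = ifourier (\<lambda>y. fourier \<phi> (- y)) (- x)"
    by (simp add: ifourier_fourier_minus[abs_def])
  also have "\<dots> = ifourier (fourier \<phi>) x"
    unfolding ifourier_def using lborel_reflect(2)[of "\<lambda>\<xi>. wave (\<xi> \<bullet> x) * fourier \<phi> \<xi>" 0]
      schwartz_measurable[OF schwartz_fourier[OF assms]] by simp
  finally show "fourier (ifourier \<phi>) x = \<phi> x" by (simp add: ifourier_fourier[OF assms])
qed

section \<open>A function is determined by its pairings with Schwartz functions\<close>

text \<open>
  Boxes form a generator of the Borel sets that is stable under intersections, so the integral
  vanishes over every Borel set.
\<close>

lemma integral_box_zero_imp_AE_zero:
  fixes h :: "'a::euclidean_space \<Rightarrow> complex"
  assumes h: "integrable lborel h" and box: "\<And>a b. (LINT x:box a b|lborel. h x) = 0"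
  shows "AE x in lborel. h x = 0"
proof -
  have [measurable]: "h \<in> borel_measurable borel" using h by (auto dest: borel_measurable_integrable)
  have si: "set_integrable lborel A h" if "A \<in> sets lborel" for A
    unfolding set_integrable_def using h that by (intro integrable_mult_indicator) auto
  have U: "(LINT x|lborel. h x) = 0"
  proof (rule LIMSEQ_unique)
    let ?B = "\<lambda>n. box (- real n *\<^sub>R One) (real n *\<^sub>R One :: 'a)"
    show "(\<lambda>n. LINT x:?B n|lborel. h x) \<longlonglongrightarrow> (LINT x|lborel. h x)"
      unfolding set_lebesgue_integral_def
    proof (rule integral_dominated_convergence[where w="\<lambda>x. norm (h x)"])
      have "(\<lambda>n. indicat_real (?B n) x *\<^sub>R h x) \<longlonglongrightarrow> h x" for x
      proof (rule tendsto_eventually)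
        obtain m where m: "norm x < real m" using reals_Archimedean2 by blast
        have "x \<in> ?B n" if "n \<ge> m" for n
        proof -
          have "\<bar>x \<bullet> b\<bar> < real n" if "b \<in> Basis" for b
            using Basis_le_norm[OF that, of x] m \<open>n \<ge> m\<close> by linarith
          then show ?thesis by (force simp: mem_box inner_sum_left_Basis abs_less_iff)
        qed
        then show "\<forall>\<^sub>F n in sequentially. indicat_real (?B n) x *\<^sub>R h x = h x"
          unfolding eventually_sequentially by (intro exI[of _ m]) auto
      qed
      then show "AE x in lborel. (\<lambda>n. indicat_real (?B n) x *\<^sub>R h x) \<longlonglongrightarrow> h x" by simp
    qed (use h in \<open>auto intro!: AE_I2 simp: indicator_def\<close>)
    show "(\<lambda>n. LINT x:?B n|lborel. h x) \<longlonglongrightarrow> 0" by (simp add: box)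
  qed
  have all: "(LINT x:A|lborel. h x) = 0" if "A \<in> sets borel" for A
  proof -
    let ?G = "range (\<lambda>(a, b). box a b :: 'a set)"
    have G: "sets (borel :: 'a measure) = sigma_sets UNIV ?G"
      by (subst borel_eq_box) (simp add: sets_measure_of)
    have "Int_stable ?G"
      unfolding Int_stable_def by (auto simp: box_Int_box)
    moreover have "?G \<subseteq> Pow UNIV" by simp
    moreover have "A \<in> sigma_sets UNIV ?G"
      using that by (simp only: G)
    ultimately show ?thesis
    proof (induction rule: sigma_sets_induct_disjoint)
      case (basic A) then show ?case using box by auto
    next
      case empty then show ?case by (simp add: set_lebesgue_integral_def)
    next
      case (compl A)
      have A: "A \<in> sets lborel" using compl(1) by (simp only: G sets_lborel)
      have "(LINT x|lborel. h x) = (LINT x:A \<union> (UNIV - A)|lborel. h x)" by (simp add: set_lebesgue_integral_def)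
      also have "\<dots> = (LINT x:A|lborel. h x) + (LINT x:UNIV - A|lborel. h x)"
        using A by (intro set_integral_Un si) auto
      finally show ?case using compl U by simp
    next
      case (union A)
      have "A i \<in> sets lborel" for i using union(2) by (auto simp only: G sets_lborel)
      then have "(LINT x:(\<Union>i. A i)|lborel. h x) = (\<Sum>i. LINT x:A i|lborel. h x)"
        using union(1) by (intro lebesgue_integral_countable_add si) (auto simp: disjoint_family_on_def)
      then show ?case using union by simp
    qed
  qed
  show ?thesis
    using sigma_finite_measure.density_zero[OF lborel.sigma_finite_measure_axioms h] all by simp
qed

text \<open>
  A factor of a fixed Gaussian makes the function integrable, and a Gaussian times a translated
  Gaussian is a Schwartz function again. So the damped function is orthogonal to all translates
  of narrow Gaussians, hence, by Fubini and the approximate identity, to all bounded continuous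
  integrable functions, hence to indicators of boxes.
\<close>

theorem schwartz_pairing_determines:
  fixes g :: "'a::euclidean_space \<Rightarrow> complex"
  assumes g[measurable]: "g \<in> borel_measurable borel"
    and int: "\<And>\<phi>. \<phi> \<in> schwartz \<Longrightarrow> integrable lborel (\<lambda>x. g x * \<phi> x)"
    and zero: "\<And>\<phi>. \<phi> \<in> schwartz \<Longrightarrow> (LINT x|lborel. g x * \<phi> x) = 0"
  shows "AE x in lborel. g x = 0"
proof -
  define h where "h x = g x * of_real (gauss 1 x)" for x
  have gs: "(\<lambda>x::'a. complex_of_real (gauss 1 x)) \<in> schwartz"
    using schwartz_gauss[of pi "0::'a"] by (simp add: gauss_def power2_norm_eq_inner)
  have h: "integrable lborel h" unfolding h_def by (rule int[OF gs])
  have [measurable]: "h \<in> borel_measurable borel" unfolding h_def by measurable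
  have conv: "(LINT \<xi>|lborel. h \<xi> * of_real (gauss m (\<xi> - x))) = 0" if m: "m > 0" for m x
  proof -
    \<comment> \<open>The product of the two Gaussians, up to a factor that does not depend on
        the variable of integration.\<close>
    let ?\<phi> = "\<lambda>\<xi>. complex_of_real (exp (- (pi * (m + 1)) * (\<xi> \<bullet> \<xi>) + \<xi> \<bullet> ((2 * pi * m) *\<^sub>R x)))"
    have \<phi>: "?\<phi> \<in> schwartz" by (rule schwartz_gauss) (use m in simp)
    have "h \<xi> * of_real (gauss m (\<xi> - x)) = of_real (exp (- (pi * m * (x \<bullet> x)))) * (g \<xi> * ?\<phi> \<xi>)" for \<xi>
      unfolding h_def gauss_def power2_norm_eq_inner of_real_mult[symmetric] mult.assoc exp_add[symmetric]
      by (simp add: mult.left_commute[of _ "g \<xi>"] of_real_mult[symmetric] exp_add[symmetric] inner_diff_left inner_diff_right inner_commute algebra_simps del: of_real_mult)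
    then show ?thesis using zero[OF \<phi>] by simp
  qed
  have test: "(LINT \<xi>|lborel. h \<xi> * F \<xi>) = 0"
    if F: "integrable lborel F" "continuous_on UNIV F" and C: "\<And>x. norm (F x) \<le> C" for F and C :: real
  proof (rule LIMSEQ_unique)
    have [measurable]: "F \<in> borel_measurable borel" using F by (auto dest: borel_measurable_integrable)
    let ?E = "\<lambda>n \<xi>. LINT z|lborel. F z * of_real (real (Suc n) powr (DIM('a) / 2) * gauss (real (Suc n)) (\<xi> - z))"
    show "(\<lambda>n. LINT \<xi>|lborel. h \<xi> * ?E n \<xi>) \<longlonglongrightarrow> (LINT \<xi>|lborel. h \<xi> * F \<xi>)"
    proof (rule integral_dominated_convergence[where w="\<lambda>\<xi>. norm (h \<xi>) * C"])
      show "AE \<xi> in lborel. (\<lambda>n. h \<xi> * ?E n \<xi>) \<longlonglongrightarrow> h \<xi> * F \<xi>"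
        by (intro AE_I2 tendsto_mult tendsto_const gauss_approximate_identity[OF F(2) C])
      show "AE \<xi> in lborel. norm (h \<xi> * ?E n \<xi>) \<le> norm (h \<xi>) * C" for n
      proof (intro AE_I2)
        fix \<xi> :: 'a
        let ?m = "real (Suc n)"
        have m: "?m > 0" by simp
        have ig: "integrable lborel (\<lambda>z. C * (?m powr (DIM('a) / 2) * gauss ?m (\<xi> - z)))"
          using gaussian_integral(1)[OF m, where 'a='a] lborel_reflect(1)[of "gauss ?m" \<xi>] by simp
        have "norm (?E n \<xi>) \<le> (LINT z|lborel. C * (?m powr (DIM('a) / 2) * gauss ?m (\<xi> - z)))"
        proof (rule order_trans[OF integral_norm_bound integral_mono[OF _ ig]])
          show le: "norm (F z * of_real (?m powr (DIM('a) / 2) * gauss ?m (\<xi> - z))) \<le> C * (?m powr (DIM('a) / 2) * gauss ?m (\<xi> - z))" for z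
            unfolding norm_mult norm_of_real using C[of z] gauss_pos[of ?m "\<xi> - z"] by (auto simp: abs_mult intro!: mult_right_mono)
          show "integrable lborel (\<lambda>z. norm (F z * of_real (?m powr (DIM('a) / 2) * gauss ?m (\<xi> - z))))"
            by (rule Bochner_Integration.integrable_bound[OF ig], measurable)
               (rule AE_I2, subst real_norm_def, subst abs_norm_cancel, rule order_trans[OF le], simp)
        qed
        also have "\<dots> = C"
          using gaussian_integral(2)[OF m, where 'a='a] lborel_reflect(2)[of "gauss ?m" \<xi>]
          by (simp add: powr_minus)
        finally show "norm (h \<xi> * ?E n \<xi>) \<le> norm (h \<xi>) * C"
          unfolding norm_mult by (rule mult_left_mono) simp
      qed
    qed (use h in auto)
    have "(LINT \<xi>|lborel. h \<xi> * ?E n \<xi>) = 0" for n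
    proof -
      let ?m = "real (Suc n)"
      let ?c = "?m powr (DIM('a) / 2)"
      have "(LINT \<xi>|lborel. h \<xi> * ?E n \<xi>) = (LINT \<xi>|lborel. LINT z|lborel. h \<xi> * (F z * of_real (?c * gauss ?m (\<xi> - z))))"
        by simp
      also have "\<dots> = (LINT z|lborel. LINT \<xi>|lborel. h \<xi> * (F z * of_real (?c * gauss ?m (\<xi> - z))))"
      proof (rule LINT_Fubini(1)[where g="\<lambda>\<xi>. norm (h \<xi>)" and h="\<lambda>z. ?c * norm (F z)"])
        show "norm (h \<xi> * (F z * of_real (?c * gauss ?m (\<xi> - z)))) \<le> norm (h \<xi>) * (?c * norm (F z))" for \<xi> z
        proof -
          have "(?c * norm (F z)) * gauss ?m (\<xi> - z) \<le> ?c * norm (F z)"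
            by (intro mult_left_le gauss_le_1) auto
          moreover have "norm (F z * of_real (?c * gauss ?m (\<xi> - z))) = (?c * norm (F z)) * gauss ?m (\<xi> - z)"
            using gauss_pos[of ?m "\<xi> - z"] unfolding norm_mult norm_of_real abs_mult by simp
          ultimately show ?thesis unfolding norm_mult[of "h \<xi>"] by (intro mult_left_mono) auto
        qed
      qed (use h F in auto)
      also have "\<dots> = (LINT z|lborel. (F z * of_real ?c) * (LINT \<xi>|lborel. h \<xi> * of_real (gauss ?m (\<xi> - z))))"
        by (simp add: mult_ac flip: integral_mult_right_zero)
      also have "\<dots> = 0" by (simp add: conv)
      finally show ?thesis .
    qed
    then show "(\<lambda>n. LINT \<xi>|lborel. h \<xi> * ?E n \<xi>) \<longlonglongrightarrow> 0" by simp
  qed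
  have "(LINT x:box a b|lborel. h x) = 0" for a b
  proof (rule LIMSEQ_unique)
    \<comment> \<open>Continuous functions increasing to the indicator of the box.\<close>
    let ?F = "\<lambda>n x. min 1 (real n * infdist x (- box a b))"
    have bd: "0 \<le> ?F n x" "?F n x \<le> indicator (box a b) x" for n x
      by (auto simp: indicator_def infdist_nonneg)
    show "(\<lambda>n. LINT x|lborel. h x * of_real (?F n x)) \<longlonglongrightarrow> (LINT x:box a b|lborel. h x)"
      unfolding set_lebesgue_integral_def
    proof (rule integral_dominated_convergence[where w="\<lambda>x. norm (h x)"])
      have *: "(\<lambda>n. ?F n x) \<longlonglongrightarrow> indicator (box a b) x" for x
      proof (cases "x \<in> box a b")
        case True
        have ne: "- box a b \<noteq> {}"
          using bounded_box[of a b] not_bounded_UNIV[where 'a='a] by (metis Compl_empty_eq double_compl)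
        have "infdist x (- box a b) > 0"
          using True ne by (subst infdist_pos_not_in_closed) auto
        then obtain m where m: "1 < real m * infdist x (- box a b)" using reals_Archimedean3 by blast
        have "?F n x = 1" if "n \<ge> m" for n
        proof -
          have "real m * infdist x (- box a b) \<le> real n * infdist x (- box a b)"
            using that by (intro mult_right_mono) (auto simp: infdist_nonneg)
          then show ?thesis using m by simp
        qed
        then show ?thesis using True by (intro tendsto_eventually) (auto simp: eventually_sequentially)
      qed simp
      show "AE x in lborel. (\<lambda>n. h x * of_real (?F n x)) \<longlonglongrightarrow> indicat_real (box a b) x *\<^sub>R h x"
        using tendsto_mult[OF tendsto_const tendsto_of_real[OF *]]
        by (intro AE_I2) (auto simp: scaleR_conv_of_real mult.commute)
      show "AE x in lborel. norm (h x * of_real (?F n x)) \<le> norm (h x)" for n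
      proof (rule AE_I2)
        fix x
        have "\<bar>?F n x\<bar> \<le> 1" using bd[of n x] by (auto simp: indicator_def split: if_splits)
        then show "norm (h x * of_real (?F n x)) \<le> norm (h x)"
          unfolding norm_mult norm_of_real by (rule mult_left_le) simp
      qed
      have "continuous_on UNIV (?F n)" for n by (intro continuous_intros)
      then have [measurable]: "?F n \<in> borel_measurable borel" for n by (rule borel_measurable_continuous)
      show "(\<lambda>x. h x * of_real (?F n x)) \<in> borel_measurable lborel" for n by measurable
    qed (use h in auto)
    have "(LINT x|lborel. h x * of_real (?F n x)) = 0" for n
    proof (rule test)
      show c: "continuous_on UNIV (\<lambda>x. complex_of_real (?F n x))" by (intro continuous_intros)
      have e: "norm (complex_of_real (?F n x)) \<le> indicator (box a b) x" for x
        using bd[of n x] unfolding norm_of_real by linarith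
      then show "norm (complex_of_real (?F n x)) \<le> 1" for x
        by (rule order_trans) (auto simp: indicator_def)
      have "integrable lborel (indicat_real (box a b))"
        using emeasure_lborel_box_finite[of a b] by simp
      then show "integrable lborel (\<lambda>x. complex_of_real (?F n x))"
        by (rule Bochner_Integration.integrable_bound)
           (use e borel_measurable_continuous[OF c] in \<open>auto intro!: AE_I2 simp del: norm_of_real\<close>)
    qed
    then show "(\<lambda>n. LINT x|lborel. h x * of_real (?F n x)) \<longlonglongrightarrow> 0" by simp
  qed
  from integral_box_zero_imp_AE_zero[OF h this]
  have "AE x in lborel. h x = 0" .
  then show ?thesis by eventually_elim (use gauss_pos in \<open>auto simp: h_def less_le\<close>)
qed

section \<open>Distributions with an integrable Fourier transform\<close>

text \<open>
  The distribution whose Fourier transform is the function \<^term>\<open>g\<close>. Solutions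
  are constructed on the Fourier side and transported back by this map.
\<close>

definition td_of :: "('a::euclidean_space \<Rightarrow> complex) \<Rightarrow> 'a tempered" where
  "td_of g = Abs_td (\<lambda>\<phi>. if \<phi> \<in> schwartz then LINT x|lborel. ifourier g x * \<phi> x else 0)"

lemma ifourier_mult_schwartz_integrable:
  fixes g :: "'a::euclidean_space \<Rightarrow> complex"
  assumes g: "integrable lborel g" and \<phi>: "\<phi> \<in> schwartz"
  shows "integrable lborel (\<lambda>x. ifourier g x * \<phi> x)"
proof (rule Bochner_Integration.integrable_bound)
  have [measurable]: "ifourier g \<in> borel_measurable borel" "\<phi> \<in> borel_measurable borel"
    using borel_measurable_continuous[OF continuous_ifourier[OF g]] schwartz_measurable[OF \<phi>] by auto
  show "(\<lambda>x. ifourier g x * \<phi> x) \<in> borel_measurable lborel" by measurable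
  show "integrable lborel (\<lambda>x. (LINT x|lborel. norm (g x)) * norm (\<phi> x))"
    using schwartz_integrable[OF \<phi>] by simp
  show "AE x in lborel. norm (ifourier g x * \<phi> x) \<le> norm ((LINT x|lborel. norm (g x)) * norm (\<phi> x))"
    by (intro AE_I2) (auto simp: norm_mult intro!: mult_mono norm_ifourier_le order_trans[OF _ abs_ge_self])
qed

lemma tempered_functional_ifourier:
  fixes g :: "'a::euclidean_space \<Rightarrow> complex"
  assumes g: "integrable lborel g"
  shows "tempered_functional (\<lambda>\<phi>. if \<phi> \<in> schwartz then LINT x|lborel. ifourier g x * \<phi> x else 0)"
  unfolding tempered_functional_def
proof (intro conjI allI ballI impI)
  note int = ifourier_mult_schwartz_integrable[OF g]
  let ?T = "\<lambda>\<phi>. if \<phi> \<in> schwartz then LINT x|lborel. ifourier g x * \<phi> x else 0"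
  show "?T (\<lambda>x. \<phi> x + \<eta> x) = ?T \<phi> + ?T \<eta>" if "\<phi> \<in> schwartz" "\<eta> \<in> schwartz" for \<phi> \<eta>
    using schwartz_lincomb[OF that, of 1 1] that int by (simp add: distrib_left)
  show "?T (\<lambda>x. c * \<phi> x) = c * ?T \<phi>" for c \<phi>
  proof (cases "\<phi> \<in> schwartz")
    case True
    then show ?thesis using schwartz_mult[OF True, of c] by (simp add: mult.left_commute[of _ c])
  next
    case False
    show ?thesis
    proof (cases "c = 0")
      case False
      with \<open>\<phi> \<notin> schwartz\<close> have "(\<lambda>x. c * \<phi> x) \<notin> schwartz"
        using schwartz_mult[of "\<lambda>x. c * \<phi> x" "inverse c"] by (auto simp: mult.assoc[symmetric])
      with \<open>\<phi> \<notin> schwartz\<close> show ?thesis by simp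
    qed simp
  qed
  let ?n = "2 * DIM('a)"
  let ?I = "{(0, []), (?n, [])} :: (nat \<times> 'a list) set"
  let ?B = "(LINT x|lborel. norm (g x)) * (2 ^ ?n * (LINT x|lborel. weight (x::'a)))"
  have "norm (?T \<phi>) \<le> ?B * (\<Sum>i\<in>?I. schwartz_seminorm i \<phi>)" if \<phi>: "\<phi> \<in> schwartz" for \<phi>
  proof -
    let ?s = "schwartz_seminorm (0, []) \<phi> + schwartz_seminorm (?n, []) \<phi>"
    have le: "norm x ^ k * norm (\<phi> x) \<le> schwartz_seminorm (k, []) \<phi>" for x k
    proof -
      have "bounded (range (\<lambda>x. norm x ^ k * norm (\<phi> x)))"
        using schwartz_decay[OF \<phi>, of k] by (auto simp: bounded_iff abs_mult)
      from cSUP_upper[OF UNIV_I bounded_imp_bdd_above[OF this]]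
      show ?thesis unfolding schwartz_seminorm_def by simp
    qed
    have w: "norm (\<phi> x) \<le> 2 ^ ?n * ?s * weight x" for x
    proof -
      have "norm (\<phi> x) \<le> 2 ^ ?n * (norm (\<phi> x) + norm x ^ ?n * norm (\<phi> x)) * weight x"
        by (rule weight_bound_seminorms) simp
      also have "\<dots> \<le> 2 ^ ?n * ?s * weight x"
        using le[of x 0] le[of x ?n] by (intro mult_right_mono mult_left_mono add_mono) auto
      finally show ?thesis .
    qed
    have "norm (?T \<phi>) \<le> (LINT x|lborel. norm (ifourier g x * \<phi> x))" using \<phi> by simp
    also have "\<dots> \<le> (LINT x|lborel. (LINT x|lborel. norm (g x)) * (2 ^ ?n * ?s * weight (x::'a)))"
    proof (rule integral_mono)
      show "norm (ifourier g x * \<phi> x) \<le> (LINT x|lborel. norm (g x)) * (2 ^ ?n * ?s * weight x)" for x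
        unfolding norm_mult by (intro mult_mono norm_ifourier_le w) auto
    qed (use int[OF \<phi>] integrable_weight in auto)
    also have "\<dots> = ?B * ?s" by simp
    also have "?s = (\<Sum>i\<in>?I. schwartz_seminorm i \<phi>)" by (subst sum.insert) auto
    finally show ?thesis .
  qed
  then show "\<exists>C I. finite I \<and> I \<subseteq> UNIV \<times> lists Basis \<and>
      (\<forall>\<phi>\<in>schwartz. norm (?T \<phi>) \<le> C * (\<Sum>i\<in>I. schwartz_seminorm i \<phi>))"
    by (intro exI[of _ ?B] exI[of _ ?I]) auto
qed simp

lemma apply_td_of:
  assumes "integrable lborel g"
  shows "apply_td (td_of g) = (\<lambda>\<phi>. if \<phi> \<in> schwartz then LINT x|lborel. ifourier g x * \<phi> x else 0)"
  unfolding td_of_def using tempered_functional_ifourier[OF assms] by (simp add: Abs_td_inverse)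

lemma represents_td_of:
  assumes "integrable lborel g"
  shows "represents (ifourier g) (td_of g)"
  unfolding represents_def apply_td_of[OF assms]
  using ifourier_mult_schwartz_integrable[OF assms] borel_measurable_continuous[OF continuous_ifourier[OF assms]] by auto

text \<open>
  Parseval: the frequency integral and the space integral are exchanged by Fubini.
\<close>

lemma td_of_pairing:
  fixes g :: "'a::euclidean_space \<Rightarrow> complex"
  assumes g: "integrable lborel g" and \<phi>: "\<phi> \<in> schwartz"
  shows "apply_td (td_of g) \<phi> = (LINT \<xi>|lborel. g \<xi> * ifourier \<phi> \<xi>)"
proof -
  have [measurable]: "g \<in> borel_measurable borel" "\<phi> \<in> borel_measurable borel"
    using schwartz_measurable[OF \<phi>] g by (auto dest: borel_measurable_integrable)
  let ?F = "\<lambda>x \<xi>. wave (\<xi> \<bullet> x) * (g \<xi> * \<phi> x)"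
  have "apply_td (td_of g) \<phi> = (LINT x|lborel. LINT \<xi>|lborel. ?F x \<xi>)"
    using \<phi> unfolding apply_td_of[OF g] ifourier_def integral_mult_left_zero[symmetric]
    by (simp add: mult.assoc)
  also have "\<dots> = (LINT \<xi>|lborel. LINT x|lborel. ?F x \<xi>)"
    by (rule LINT_Fubini(1)[where g="\<lambda>x. norm (\<phi> x)" and h="\<lambda>\<xi>. norm (g \<xi>)"])
       (use g schwartz_integrable[OF \<phi>] in \<open>auto simp: norm_mult\<close>)
  also have "\<dots> = (LINT \<xi>|lborel. g \<xi> * ifourier \<phi> \<xi>)"
    unfolding ifourier_def integral_mult_right_zero[symmetric]
    by (simp add: mult_ac inner_commute)
  finally show ?thesis .
qed

lemma integrable_mult_bounded:
  fixes g h :: "'a::euclidean_space \<Rightarrow> complex"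
  assumes "integrable lborel g" "h \<in> borel_measurable borel" "\<And>x. norm (h x) \<le> C"
  shows "integrable lborel (\<lambda>x. g x * h x)"
proof (rule Bochner_Integration.integrable_bound[of _ "\<lambda>x. norm (g x) * C"])
  have [measurable]: "g \<in> borel_measurable borel" "h \<in> borel_measurable borel"
    using assms by (auto dest: borel_measurable_integrable)
  show "(\<lambda>x. g x * h x) \<in> borel_measurable lborel" by measurable
  show "AE x in lborel. norm (g x * h x) \<le> norm (norm (g x) * C)"
    using assms(3) by (intro AE_I2) (auto simp: norm_mult intro!: mult_left_mono order_trans[OF _ abs_ge_self])
qed (use assms in auto)

lemma fourier_represents_td_of:
  assumes g: "integrable lborel g"
  shows "fourier_represents g (td_of g)"
  unfolding fourier_represents_def
proof (intro conjI ballI)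
  show "g \<in> borel_measurable borel" using g by (auto dest: borel_measurable_integrable)
  fix \<phi> :: "'a \<Rightarrow> complex" assume \<phi>: "\<phi> \<in> schwartz"
  then obtain C where "\<And>x. norm (\<phi> x) \<le> C" using schwartz_bounded by blast
  then show "integrable lborel (\<lambda>\<xi>. g \<xi> * \<phi> \<xi>)"
    by (rule integrable_mult_bounded[OF g schwartz_measurable[OF \<phi>]])
  show "apply_td (td_of g) (fourier \<phi>) = (LINT \<xi>|lborel. g \<xi> * \<phi> \<xi>)"
    by (simp add: td_of_pairing[OF g schwartz_fourier[OF \<phi>]] ifourier_fourier[OF \<phi>])
qed

lemma fourier_represents_measurable: "fourier_represents g T \<Longrightarrow> g \<in> borel_measurable borel"
  unfolding fourier_represents_def by (rule conjunct1)

text \<open>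
  This makes the Fourier multipliers and the Fourier--Lebesgue norm independent of the choice
  of a representing function.
\<close>

lemma fourier_represents_unique:
  assumes g: "fourier_represents g T" and h: "fourier_represents h T"
  shows "AE \<xi> in lborel. g \<xi> = h \<xi>"
proof -
  have "AE \<xi> in lborel. g \<xi> - h \<xi> = 0"
  proof (rule schwartz_pairing_determines)
    show "(\<lambda>\<xi>. g \<xi> - h \<xi>) \<in> borel_measurable borel"
      using g h unfolding fourier_represents_def by (intro borel_measurable_diff) auto
    show "integrable lborel (\<lambda>x. (g x - h x) * \<phi> x)" "(LINT x|lborel. (g x - h x) * \<phi> x) = 0"
      if "\<phi> \<in> schwartz" for \<phi>
      using g h that unfolding fourier_represents_def by (auto simp: left_diff_distrib)
  qed
  then show ?thesis by simp
qed

lemma fourier_represents_AE: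
  assumes g: "fourier_represents g T" and h: "fourier_represents h S"
    and eq: "AE \<xi> in lborel. g \<xi> = h \<xi>"
  shows "T = S"
proof (rule apply_td_inject[THEN iffD1], rule ext)
  fix \<phi> :: "'a \<Rightarrow> complex"
  show "apply_td T \<phi> = apply_td S \<phi>"
  proof (cases "\<phi> \<in> schwartz")
    case True
    have i: "ifourier \<phi> \<in> schwartz" by (rule schwartz_ifourier[OF True])
    have "apply_td T (fourier (ifourier \<phi>)) = (LINT \<xi>|lborel. g \<xi> * ifourier \<phi> \<xi>)"
      using g i unfolding fourier_represents_def by blast
    also have "\<dots> = (LINT \<xi>|lborel. h \<xi> * ifourier \<phi> \<xi>)"
    proof (rule integral_cong_AE)
      have [measurable]: "g \<in> borel_measurable borel" "h \<in> borel_measurable borel" "ifourier \<phi> \<in> borel_measurable borel"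
        using g h schwartz_measurable[OF i] unfolding fourier_represents_def by auto
      show "(\<lambda>\<xi>. g \<xi> * ifourier \<phi> \<xi>) \<in> borel_measurable lborel" "(\<lambda>\<xi>. h \<xi> * ifourier \<phi> \<xi>) \<in> borel_measurable lborel"
        by measurable
      show "AE \<xi> in lborel. g \<xi> * ifourier \<phi> \<xi> = h \<xi> * ifourier \<phi> \<xi>" using eq by eventually_elim simp
    qed
    also have "\<dots> = apply_td S (fourier (ifourier \<phi>))"
      using h i unfolding fourier_represents_def by simp
    finally show ?thesis by (simp add: fourier_ifourier[OF True])
  next
    case False
    then show ?thesis by (simp add: tempered_functionalD(1)[OF tempered_functional_apply_td])
  qed
qed

lemma fourier_multiplier_td_of:
  fixes g :: "'a::euclidean_space \<Rightarrow> complex"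
  assumes g: "integrable lborel g" and m: "m \<in> borel_measurable borel" "\<And>\<xi>. norm (m \<xi>) \<le> 1"
  shows "fourier_multiplier m (td_of g) = td_of (\<lambda>\<xi>. m \<xi> * g \<xi>)"
  unfolding fourier_multiplier_def
proof (rule the_equality)
  have mg: "integrable lborel (\<lambda>\<xi>. m \<xi> * g \<xi>)"
    using integrable_mult_bounded[OF g m] by (simp add: mult.commute)
  show "\<exists>ga. fourier_represents ga (td_of g) \<and> fourier_represents (\<lambda>\<xi>. m \<xi> * ga \<xi>) (td_of (\<lambda>\<xi>. m \<xi> * g \<xi>))"
    using fourier_represents_td_of[OF g] fourier_represents_td_of[OF mg] by blast
  fix S assume "\<exists>ga. fourier_represents ga (td_of g) \<and> fourier_represents (\<lambda>\<xi>. m \<xi> * ga \<xi>) S"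
  then obtain h where h: "fourier_represents h (td_of g)" "fourier_represents (\<lambda>\<xi>. m \<xi> * h \<xi>) S" by blast
  have "AE \<xi> in lborel. m \<xi> * h \<xi> = m \<xi> * g \<xi>"
    using fourier_represents_unique[OF h(1) fourier_represents_td_of[OF g]] by eventually_elim simp
  then show "S = td_of (\<lambda>\<xi>. m \<xi> * g \<xi>)"
    by (rule fourier_represents_AE[OF h(2) fourier_represents_td_of[OF mg]])
qed

lemma fourier_represents_diff:
  assumes "fourier_represents g T" "fourier_represents h S"
  shows "fourier_represents (\<lambda>\<xi>. g \<xi> - h \<xi>) (T - S)"
  using assms unfolding fourier_represents_def by (auto simp: apply_td_diff left_diff_distrib)

lemma fourier_represents_scaleR:
  assumes "fourier_represents g T"
  shows "fourier_represents (\<lambda>\<xi>. c *\<^sub>R g \<xi>) (c *\<^sub>R T)"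
  using assms unfolding fourier_represents_def by (auto simp: apply_td_scaleR)

section \<open>The Fourier--Lebesgue norm\<close>

text \<open>
  Needed because the Fourier--Lebesgue norm is defined through an arbitrarily chosen
  representing function.
\<close>

lemma Lp_norm_AE:
  assumes "q \<noteq> \<infinity>" "g \<in> borel_measurable borel" "h \<in> borel_measurable borel" "AE \<xi> in lborel. g \<xi> = h \<xi>"
  shows "Lp_norm q g = Lp_norm q h"
proof -
  have "(LINT x|lborel. norm (g x) powr enn2real q) = (LINT x|lborel. norm (h x) powr enn2real q)"
    using assms by (intro integral_cong_AE) (auto elim: eventually_mono)
  then show ?thesis using assms(1) by (simp add: Lp_norm_def)
qed

lemma Lhat_norm_eq:
  assumes "conj_exponent p \<noteq> \<infinity>" "fourier_represents g T"
  shows "Lhat_norm p T = Lp_norm (conj_exponent p) g"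
proof -
  have "fourier_represents (SOME g. fourier_represents g T) T" using assms(2) by (rule someI[of "\<lambda>g. fourier_represents g T"])
  then show ?thesis unfolding Lhat_norm_def
    by (intro Lp_norm_AE assms(1) fourier_represents_unique[OF _ assms(2)]
        fourier_represents_measurable[OF assms(2)] fourier_represents_measurable)
qed

text \<open>
  For \<^term>\<open>p > 2\<close>, which includes \<^term>\<open>p = \<infinity>\<close>, both
  the conjugate exponent and the inverse of \<^term>\<open>p\<close> are finite. All later
  computations use these two real numbers, so that \<^term>\<open>p = \<infinity>\<close> is
  never a separate case.
\<close>

locale exponent =
  fixes p :: ennreal and q \<rho> :: real
  assumes p: "2 < p" and q_def: "q = enn2real (conj_exponent p)" and rho_def: "\<rho> = enn2real (inverse p)"
begin

lemma inverse_p: "inverse p = ennreal \<rho>" "0 \<le> \<rho>" "\<rho> < 1 / 2"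
proof -
  have "\<exists>s. inverse p = ennreal s \<and> 0 \<le> s \<and> s < 1 / 2"
  proof (cases p)
    case (real r)
    then have "ennreal 2 < ennreal r" using p by simp
    then have r: "2 < r" by (simp add: ennreal_less_iff)
    then have "inverse p = ennreal (inverse r)" unfolding real by (simp add: inverse_ennreal)
    moreover have "inverse r < 1 / 2" using r by (simp add: field_simps)
    ultimately show ?thesis using r by (intro exI[of _ "inverse r"]) simp
  next
    case top
    then show ?thesis by (intro exI[of _ 0]) simp
  qed
  then obtain s where s: "inverse p = ennreal s" "0 \<le> s" "s < 1 / 2" by blast
  then have "\<rho> = s" unfolding rho_def by simp
  with s show "inverse p = ennreal \<rho>" "0 \<le> \<rho>" "\<rho> < 1 / 2" by auto
qed

lemma conj_p: "conj_exponent p = ennreal q" "q = 1 / (1 - \<rho>)"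
proof -
  have "1 - inverse p = ennreal (1 - \<rho>)"
    unfolding inverse_p(1) using inverse_p(2) by (simp add: ennreal_minus flip: ennreal_1)
  then have e: "conj_exponent p = ennreal (1 / (1 - \<rho>))"
    unfolding conj_exponent_def using inverse_p(3) by (simp add: inverse_ennreal inverse_eq_divide)
  then show "q = 1 / (1 - \<rho>)" unfolding q_def e using inverse_p(3) by simp
  then show "conj_exponent p = ennreal q" using e by simp
qed

lemma q_ge_1: "1 \<le> q" "q \<le> 2" "0 < q"
  using inverse_p(2,3) by (auto simp: conj_p(2) pos_le_divide_eq pos_divide_le_eq)

lemma Lp_space_iff: "g \<in> Lp_space (conj_exponent p) \<longleftrightarrow>
    g \<in> borel_measurable borel \<and> integrable lborel (\<lambda>x. norm (g x) powr q)"
  using q_ge_1 by (simp add: Lp_space_def conj_p)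

lemma Lp_norm_iff: "Lp_norm (conj_exponent p) g = (LINT x|lborel. norm (g x) powr q) powr (1 / q)"
  using q_ge_1 by (simp add: Lp_norm_def conj_p)

lemma Lhat_norm: "fourier_represents g T \<Longrightarrow> Lhat_norm p T = (LINT x|lborel. norm (g x) powr q) powr (1 / q)"
  using Lhat_norm_eq[of p g T] conj_p(1) Lp_norm_iff by auto

lemma LhatE:
  assumes "T \<in> Lhat p"
  obtains g where "fourier_represents g T" "g \<in> borel_measurable borel" "integrable lborel (\<lambda>x. norm (g x) powr q)"
proof -
  from assms obtain g where "g \<in> Lp_space (conj_exponent p)" "fourier_represents g T"
    unfolding Lhat_def mem_Collect_eq by (elim bexE)
  then show ?thesis using that unfolding Lp_space_iff by simp
qed

lemma LhatI:
  assumes "fourier_represents g T" "integrable lborel (\<lambda>x. norm (g x) powr q)"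
  shows "T \<in> Lhat p"
  unfolding Lhat_def mem_Collect_eq
proof (rule bexI[of _ g])
  show "g \<in> Lp_space (conj_exponent p)"
    using assms unfolding Lp_space_iff fourier_represents_def by simp
qed (rule assms(1))

lemma Lhat_scaleR:
  assumes "T \<in> Lhat p"
  shows "c *\<^sub>R T \<in> Lhat p" and "Lhat_norm p (c *\<^sub>R T) = \<bar>c\<bar> * Lhat_norm p T"
proof -
  obtain g where g: "fourier_represents g T" "g \<in> borel_measurable borel" "integrable lborel (\<lambda>x. norm (g x) powr q)"
    using assms by (rule LhatE)
  note cg = fourier_represents_scaleR[OF g(1), of c]
  have e: "norm (c *\<^sub>R g x) powr q = \<bar>c\<bar> powr q * norm (g x) powr q" for x by (simp add: powr_mult)
  show "c *\<^sub>R T \<in> Lhat p" by (rule LhatI[OF cg]) (unfold e, intro integrable_mult_right g)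
  show "Lhat_norm p (c *\<^sub>R T) = \<bar>c\<bar> * Lhat_norm p T"
    unfolding Lhat_norm[OF cg] Lhat_norm[OF g(1)] e using q_ge_1
    by (simp add: powr_mult powr_powr)
qed

lemma Lhat_diff:
  assumes "T \<in> Lhat p" "S \<in> Lhat p"
  shows "T - S \<in> Lhat p"
proof -
  obtain g where g: "fourier_represents g T" "g \<in> borel_measurable borel" "integrable lborel (\<lambda>x. norm (g x) powr q)"
    using assms(1) by (rule LhatE)
  obtain h where h: "fourier_represents h S" "h \<in> borel_measurable borel" "integrable lborel (\<lambda>x. norm (h x) powr q)"
    using assms(2) by (rule LhatE)
  have [measurable]: "g \<in> borel_measurable borel" "h \<in> borel_measurable borel" by fact+
  have "integrable lborel (\<lambda>x. norm (g x - h x) powr q)"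
  proof (rule Bochner_Integration.integrable_bound)
    show "integrable lborel (\<lambda>x. 2 powr q * (norm (g x) powr q + norm (h x) powr q))"
      using g h by (intro integrable_mult_right Bochner_Integration.integrable_add) auto
    have "norm (g x - h x) powr q \<le> 2 powr q * (norm (g x) powr q + norm (h x) powr q)" for x
    proof -
      have "norm (g x - h x) \<le> 2 * max (norm (g x)) (norm (h x))"
        using norm_triangle_ineq4[of "g x" "h x"] by (auto simp: max_def)
      then have "norm (g x - h x) powr q \<le> (2 * max (norm (g x)) (norm (h x))) powr q"
        using q_ge_1 by (intro powr_mono2) auto
      also have "\<dots> = 2 powr q * max (norm (g x)) (norm (h x)) powr q" by (simp add: powr_mult)
      also have "\<dots> \<le> 2 powr q * (norm (g x) powr q + norm (h x) powr q)"
        by (intro mult_left_mono) (auto simp: max_def)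
      finally show ?thesis .
    qed
    then show "AE x in lborel. norm (norm (g x - h x) powr q) \<le> norm (2 powr q * (norm (g x) powr q + norm (h x) powr q))"
      by (intro AE_I2) (auto intro: order_trans[OF _ abs_ge_self])
  qed measurable
  then show ?thesis by (rule LhatI[OF fourier_represents_diff[OF g(1) h(1)]])
qed

text \<open>
  A weak form of Hoelder's inequality with a free parameter: pairing with \<^term>\<open>\<theta>\<close> is
  controlled by the L1 and sup norms of \<^term>\<open>\<theta>\<close>. Optimising the parameter gives
  the correct scaling under dilations of \<^term>\<open>\<theta>\<close>.
\<close>

lemma Lhat_pairing_bound:
  fixes \<theta> :: "'a::euclidean_space \<Rightarrow> complex"
  assumes T: "T \<in> Lhat p" and \<theta>: "\<theta> \<in> schwartz" and A: "\<And>x. norm (\<theta> x) \<le> A" and M: "0 < M"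
  shows "norm (apply_td T (fourier \<theta>))
    \<le> Lhat_norm p T * (M * (LINT x|lborel. norm (\<theta> x)) + M powr (1 - q) * A)"
proof -
  obtain g where g: "fourier_represents g T" "g \<in> borel_measurable borel" "integrable lborel (\<lambda>x. norm (g x) powr q)"
    using T by (rule LhatE)
  have [measurable]: "g \<in> borel_measurable borel" "\<theta> \<in> borel_measurable borel" using g schwartz_measurable[OF \<theta>] by auto
  have A0: "0 \<le> A" using A[of 0] norm_ge_zero order_trans by blast
  have ap: "apply_td T (fourier \<theta>) = (LINT \<xi>|lborel. g \<xi> * \<theta> \<xi>)"
    and int: "integrable lborel (\<lambda>\<xi>. g \<xi> * \<theta> \<xi>)"
    using g(1) \<theta> unfolding fourier_represents_def by auto
  let ?G = "LINT x|lborel. norm (g x) powr q"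
  define N where "N = ?G powr (1 / q)"
  have G0: "0 \<le> ?G" by simp
  have N: "Lhat_norm p T = N" unfolding N_def by (rule Lhat_norm[OF g(1)])
  show ?thesis
  proof (cases "?G = 0")
    case True
    then have "AE x in lborel. norm (g x) powr q = 0"
      using g(3) by (subst (asm) integral_nonneg_eq_0_iff_AE) auto
    then have "AE x in lborel. g x * \<theta> x = 0" by eventually_elim simp
    then have "(LINT x|lborel. g x * \<theta> x) = 0" by (rule integral_eq_zero_AE)
    then show ?thesis unfolding ap N using A0 M by (auto simp: N_def intro!: mult_nonneg_nonneg add_nonneg_nonneg)
  next
    case False
    then have Np: "0 < N" unfolding N_def using G0 by simp
    have Nq: "N powr q = ?G" unfolding N_def powr_powr using q_ge_1 G0 by simp
    define l where "l = N * M"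
    have l: "0 < l" using Np M by (simp add: l_def)
    \<comment> \<open>Above the level \<^term>\<open>l\<close> a power of \<^term>\<open>a /
        l\<close> is at least 1; scaling the level with the norm of the
        distribution makes the final bound homogeneous in it.\<close>
    have young: "a \<le> l + l powr (1 - q) * a powr q" if "0 \<le> a" for a
    proof (cases "a \<le> l")
      case True then show ?thesis by (auto intro: order_trans[OF True])
    next
      case False
      then have a: "0 < a" "l < a" using l by auto
      have "a = a powr (1 - q) * a powr q" using a by (simp flip: powr_add)
      also have "\<dots> \<le> l powr (1 - q) * a powr q"
        using a l q_ge_1 by (intro mult_right_mono powr_mono2') auto
      finally show ?thesis using l by linarith
    qed
    have "norm (LINT \<xi>|lborel. g \<xi> * \<theta> \<xi>) \<le> (LINT \<xi>|lborel. l * norm (\<theta> \<xi>) + (l powr (1 - q) * A) * norm (g \<xi>) powr q)"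
    proof (rule order_trans[OF integral_norm_bound integral_mono])
      show "integrable lborel (\<lambda>\<xi>. norm (g \<xi> * \<theta> \<xi>))" using int by (rule integrable_norm)
      show "integrable lborel (\<lambda>\<xi>. l * norm (\<theta> \<xi>) + (l powr (1 - q) * A) * norm (g \<xi>) powr q)"
        using g(3) schwartz_integrable[OF \<theta>] by (intro Bochner_Integration.integrable_add integrable_mult_right integrable_norm)
      fix \<xi> :: 'a
      have "norm (g \<xi> * \<theta> \<xi>) \<le> (l + l powr (1 - q) * norm (g \<xi>) powr q) * norm (\<theta> \<xi>)"
        unfolding norm_mult by (intro mult_right_mono young) auto
      also have "\<dots> = l * norm (\<theta> \<xi>) + (l powr (1 - q) * norm (g \<xi>) powr q) * norm (\<theta> \<xi>)" by (simp add: algebra_simps)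
      also have "\<dots> \<le> l * norm (\<theta> \<xi>) + (l powr (1 - q) * norm (g \<xi>) powr q) * A"
        by (intro add_left_mono mult_left_mono A) auto
      finally show "norm (g \<xi> * \<theta> \<xi>) \<le> l * norm (\<theta> \<xi>) + (l powr (1 - q) * A) * norm (g \<xi>) powr q"
        by (simp add: mult_ac)
    qed
    also have "\<dots> = l * (LINT \<xi>|lborel. norm (\<theta> \<xi>)) + (l powr (1 - q) * A) * ?G"
      using g(3) schwartz_integrable[OF \<theta>] by simp
    also have "\<dots> = N * (M * (LINT x|lborel. norm (\<theta> x)) + M powr (1 - q) * A)"
    proof -
      have "l powr (1 - q) * ?G = N powr (1 - q) * N powr q * M powr (1 - q)"
        unfolding l_def Nq[symmetric] using Np M by (simp add: powr_mult)
      also have "N powr (1 - q) * N powr q = N" using Np by (simp flip: powr_add)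
      finally have "(l powr (1 - q) * A) * ?G = N * (M powr (1 - q) * A)" by (simp add: mult_ac)
      then show ?thesis by (simp add: l_def distrib_left mult_ac)
    qed
    finally show ?thesis unfolding ap N .
  qed
qed

lemma Lhat_td_of:
  fixes g :: "'a::euclidean_space \<Rightarrow> complex"
  assumes [measurable]: "g \<in> borel_measurable borel" and bound: "\<And>x. norm (g x) \<le> C * weight x"
  shows "td_of g \<in> Lhat p" and "Lhat_norm p (td_of g) = (LINT x|lborel. norm (g x) powr q) powr (1 / q)"
    and "integrable lborel (\<lambda>x. norm (g x) powr q)"
proof -
  have g: "integrable lborel g" by (rule integrable_weight_bound[OF assms])
  have C: "0 \<le> C"
    using order_trans[OF norm_ge_zero bound, of 0] weight_pos[of "0::'a"] by (simp add: zero_le_mult_iff)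
  show i: "integrable lborel (\<lambda>x. norm (g x) powr q)"
  proof (rule integrable_weight_bound[where C="C powr q"])
    show "norm (norm (g x) powr q) \<le> C powr q * weight x" for x
    proof -
      have "norm (g x) powr q \<le> (C * weight x) powr q" using bound q_ge_1 by (intro powr_mono2) auto
      also have "\<dots> = C powr q * weight x powr q" using C by (simp add: powr_mult)
      also have "weight x powr q \<le> weight x powr 1"
        using weight_le_1 q_ge_1 by (intro powr_mono') auto
      finally show ?thesis by (simp add: mult_left_mono)
    qed
  qed measurable
  show "td_of g \<in> Lhat p"
    by (rule LhatI[OF fourier_represents_td_of[OF g] i])
  show "Lhat_norm p (td_of g) = (LINT x|lborel. norm (g x) powr q) powr (1 / q)"
    by (rule Lhat_norm[OF fourier_represents_td_of[OF g]])
qed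

end

section \<open>The Riesz kernel as a superposition of Gaussians\<close>

lemma LINT_Fubini_AE:
  fixes f :: "'a::euclidean_space \<Rightarrow> 'b::euclidean_space \<Rightarrow> complex"
  assumes f[measurable]: "(\<lambda>(x, y). f x y) \<in> borel_measurable (borel \<Otimes>\<^sub>M borel)"
    and 1: "AE x in lborel. integrable lborel (f x)"
    and 2: "integrable lborel (\<lambda>x. LINT y|lborel. norm (f x y))"
  shows "(LINT x|lborel. LINT y|lborel. f x y) = (LINT y|lborel. LINT x|lborel. f x y)"
    and "integrable lborel (\<lambda>y. LINT x|lborel. f x y)"
proof -
  have int: "integrable (lborel \<Otimes>\<^sub>M lborel) (\<lambda>(x, y). f x y)"
    by (rule lborel_pair.Fubini_integrable) (use 1 2 in auto)
  show "(LINT x|lborel. LINT y|lborel. f x y) = (LINT y|lborel. LINT x|lborel. f x y)"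
    using lborel_pair.Fubini_integral[OF int] by simp
  show "integrable lborel (\<lambda>y. LINT x|lborel. f x y)"
    using lborel_pair.integrable_snd[OF int] by simp
qed

definition riesz :: "real \<Rightarrow> 'a::euclidean_space \<Rightarrow> real" where
  "riesz s x = norm x powr (- s)"

lemma riesz_nonneg [simp]: "0 \<le> riesz s x" by (simp add: riesz_def)
lemma borel_measurable_riesz [measurable]: "riesz s \<in> borel_measurable borel"
  unfolding riesz_def by measurable
lemma kernel_riesz: "kernel 0 s x = of_real (riesz s x)"
  by (simp add: kernel_def riesz_def powr_minus_divide)
lemma riesz_scaleR: "riesz s (c *\<^sub>R x) = \<bar>c\<bar> powr (- s) * riesz s x"
  by (simp add: riesz_def powr_mult)

text \<open>
  The density with which Gaussians are superposed to give a homogeneous function.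
\<close>

definition subord :: "real \<Rightarrow> real \<Rightarrow> real" where
  "subord s l = indicator {0<..} l * l powr (s / 2 - 1)"

lemma subord_nonneg [simp]: "0 \<le> subord s l" by (simp add: subord_def)
lemma borel_measurable_subord [measurable]: "subord s \<in> borel_measurable borel"
  unfolding subord_def by measurable

text \<open>
  The integral of the density \<^term>\<open>subord s\<close> against the Gaussians at a point
  of norm 1.
\<close>

definition gamma_const :: "real \<Rightarrow> real" where
  "gamma_const s = Gamma (s / 2) * pi powr (- s / 2)"

lemma gamma_const_pos: "0 < s \<Longrightarrow> 0 < gamma_const s"
  by (simp add: gamma_const_def Gamma_real_pos)

lemma gauss_nonneg [simp]: "0 \<le> gauss l x"
  by (rule less_imp_le[OF gauss_pos])

lemma borel_measurable_gauss_of [measurable]: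
  "(\<lambda>x. gauss (f x) (g x)) \<in> borel_measurable M" if [measurable]: "f \<in> borel_measurable M" "g \<in> borel_measurable M"
  unfolding gauss_def by measurable

text \<open>
  The substitution of \<open>\<pi> |x|\<^sup>2 l\<close> for the variable turns Euler's
  integral for the Gamma function into a superposition of Gaussians.
\<close>

lemma gaussian_subordination:
  fixes x :: "'a::euclidean_space"
  assumes s: "0 < s" and x: "x \<noteq> 0"
  shows "(\<integral>\<^sup>+l. ennreal (subord s l * gauss l x) \<partial>lborel) = ennreal (gamma_const s * riesz s x)"
proof -
  define c where "c = pi * (norm x)\<^sup>2"
  have c: "0 < c" using x by (simp add: c_def)
  let ?z = "s / 2"
  let ?f = "\<lambda>t. ennreal (indicator {0..} t * t powr (?z - 1) / exp t)"
  have "ennreal (Gamma ?z) = (\<integral>\<^sup>+t. ?f t \<partial>lborel)"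
    using Gamma_conv_nn_integral_real[of ?z] s by simp
  also have "\<dots> = ennreal \<bar>c\<bar> * (\<integral>\<^sup>+l. ?f (0 + c * l) \<partial>lborel)"
    by (rule nn_integral_real_affine) (use c in auto)
  also have "(\<integral>\<^sup>+l. ?f (0 + c * l) \<partial>lborel) = (\<integral>\<^sup>+l. ennreal (c powr (?z - 1)) * ennreal (subord s l * gauss l x) \<partial>lborel)"
  proof (rule nn_integral_cong)
    fix l :: real
    have "indicator {0..} (0 + c * l) * (0 + c * l) powr (?z - 1) / exp (0 + c * l) = c powr (?z - 1) * (subord s l * gauss l x)"
    proof (cases "0 < l")
      case True
      have g: "gauss l x = inverse (exp (c * l))"
        unfolding gauss_def c_def exp_minus by (simp only: mult_ac)
      have cl: "0 + c * l = c * l" "indicator {0..} (c * l) = (1::real)" "subord s l = l powr (?z - 1)"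
        using True c by (auto simp: subord_def)
      show ?thesis
        unfolding cl g powr_mult divide_inverse by (simp only: mult_1 mult_ac)
    next
      case False
      then have "l = 0 \<or> c * l < 0" using c by (auto simp: mult_less_0_iff)
      then show ?thesis using False by (auto simp: subord_def indicator_def)
    qed
    then show "?f (0 + c * l) = ennreal (c powr (?z - 1)) * ennreal (subord s l * gauss l x)"
      by (simp add: ennreal_mult'[symmetric])
  qed
  also have "\<dots> = ennreal (c powr (?z - 1)) * (\<integral>\<^sup>+l. ennreal (subord s l * gauss l x) \<partial>lborel)"
    by (rule nn_integral_cmult) measurable
  finally have eq0: "ennreal (Gamma ?z) = ennreal \<bar>c\<bar> * (ennreal (c powr (?z - 1)) * (\<integral>\<^sup>+l. ennreal (subord s l * gauss l x) \<partial>lborel))" .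
  have eq: "ennreal (Gamma ?z) = ennreal (c powr ?z) * (\<integral>\<^sup>+l. ennreal (subord s l * gauss l x) \<partial>lborel)"
  proof -
    have "ennreal \<bar>c\<bar> * (ennreal (c powr (?z - 1)) * I) = ennreal (c powr ?z) * I" for I
    proof -
      have "c * c powr (?z - 1) = c powr ?z" using c by (simp add: powr_diff)
      then show ?thesis using c by (simp add: mult.assoc[symmetric] ennreal_mult'[symmetric])
    qed
    then show ?thesis using eq0 by simp
  qed
  have "ennreal (c powr (- ?z)) * ennreal (Gamma ?z) = (\<integral>\<^sup>+l. ennreal (subord s l * gauss l x) \<partial>lborel)"
    unfolding eq mult.assoc[symmetric] using c by (simp add: ennreal_mult'[symmetric] flip: powr_add)
  moreover have "c powr (- ?z) * Gamma ?z = gamma_const s * riesz s x"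
  proof -
    have "(norm x)\<^sup>2 powr (- ?z) = norm x powr (- s)" using x by (simp add: powr_powr flip: powr_numeral)
    then show ?thesis by (simp add: c_def gamma_const_def riesz_def powr_mult)
  qed
  ultimately show ?thesis by (simp add: ennreal_mult'[symmetric])
qed

definition dual_const :: "real \<Rightarrow> real" where
  "dual_const s = enn2real (\<integral>\<^sup>+l. ennreal (subord (- s) l * exp (- (pi / l))) \<partial>lborel)"

text \<open>
  Near 0 the exponential beats every power; at infinity the power is integrable because
  \<^term>\<open>s\<close> is positive.
\<close>

lemma dual_const:
  assumes s: "0 < s"
  shows "(\<integral>\<^sup>+l. ennreal (subord (- s) l * exp (- (pi / l))) \<partial>lborel) = ennreal (dual_const s)" and "0 < dual_const s"
proof -
  let ?f = "\<lambda>l. subord (- s) l * exp (- (pi / l))"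
  obtain k :: nat where k: "s / 2 + 1 \<le> real k" using real_arch_simple by blast
  have le: "?f l \<le> fact k * indicator {0..1} l + indicator {1<..} l * l powr (- s / 2 - 1)" for l
  proof -
    consider "l \<le> 0" | "0 < l" "l \<le> 1" | "1 < l" by linarith
    then show ?thesis
    proof cases
      case 1 then show ?thesis by (auto simp: subord_def indicator_def)
    next
      case 2
      have "(1 / l) ^ k \<le> (pi / l) ^ k" using 2 pi_gt3 by (intro power_mono divide_right_mono) auto
      also have "\<dots> \<le> fact k * exp (pi / l)" using 2 by (intro power_le_fact_exp) auto
      finally have "(1 / l) ^ k * exp (- (pi / l)) \<le> fact k"
        by (simp add: exp_minus divide_inverse[symmetric] pos_divide_le_eq)
      moreover have "l powr (- s / 2 - 1) \<le> (1 / l) ^ k"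
      proof -
        have "l powr (- s / 2 - 1) \<le> l powr (- real k)" using 2 k by (intro powr_mono') auto
        also have "\<dots> = (1 / l) ^ k" using 2 by (simp add: powr_minus powr_realpow power_one_over inverse_eq_divide)
        finally show ?thesis .
      qed
      then have "l powr (- s / 2 - 1) * exp (- (pi / l)) \<le> (1 / l) ^ k * exp (- (pi / l))" by (intro mult_right_mono) auto
      ultimately have "l powr (- s / 2 - 1) * exp (- (pi / l)) \<le> fact k" by linarith
      then show ?thesis using 2 by (simp add: subord_def)
    next
      case 3
      have "exp (- (pi / l)) \<le> 1" using 3 by simp
      then have "l powr (- s / 2 - 1) * exp (- (pi / l)) \<le> l powr (- s / 2 - 1)" by (intro mult_left_le) auto
      then show ?thesis using 3 by (simp add: subord_def)
    qed
  qed
  have i1: "integrable lborel (\<lambda>l. indicator {1<..} l * l powr (- s / 2 - 1))"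
  proof -
    have "((\<lambda>x. x powr (- s / 2 - 1)) has_integral -(1 powr (- s / 2 - 1 + 1)) / (- s / 2 - 1 + 1)) {1..}"
      using s by (intro has_integral_powr_to_inf) auto
    then have "(\<lambda>x. x powr (- s / 2 - 1)) absolutely_integrable_on {1..}"
      by (intro nonnegative_absolutely_integrable_1) (auto simp: integrable_on_def)
    then have "(\<lambda>x. x powr (- s / 2 - 1)) absolutely_integrable_on {1<..}"
      by (rule set_integrable_subset) auto
    then have "integrable lebesgue (\<lambda>l. indicator {1<..} l * l powr (- s / 2 - 1))"
      by (simp add: set_integrable_def)
    then show ?thesis by (subst (asm) integrable_completion) auto
  qed
  have int: "integrable lborel ?f"
  proof (rule Bochner_Integration.integrable_bound)
    show "integrable lborel (\<lambda>l. fact k * indicator {0..1} l + indicator {1<..} l * l powr (- s / 2 - 1))"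
      by (intro Bochner_Integration.integrable_add i1 integrable_mult_right) simp
    show "AE l in lborel. norm (?f l) \<le> norm (fact k * indicator {0..1} l + indicator {1<..} l * l powr (- s / 2 - 1))"
      by (intro AE_I2) (use le in \<open>auto intro: order_trans[OF _ abs_ge_self]\<close>)
  qed measurable
  have nn: "(\<integral>\<^sup>+l. ennreal (?f l) \<partial>lborel) = ennreal (LINT l|lborel. ?f l)"
    by (rule nn_integral_eq_integral[OF int]) auto
  then show "(\<integral>\<^sup>+l. ennreal (?f l) \<partial>lborel) = ennreal (dual_const s)"
    unfolding dual_const_def by simp
  have "(LINT l|lborel. ?f l) \<noteq> 0"
  proof
    assume "(LINT l|lborel. ?f l) = 0"
    then have "AE l in lborel. ?f l = 0" using int by (subst (asm) integral_nonneg_eq_0_iff_AE) auto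
    then have "AE l in lborel. l \<notin> {0<..<1::real}"
      by eventually_elim (auto simp: subord_def)
    then have "{0<..<1::real} \<in> null_sets lborel" by (subst AE_iff_null_sets) auto
    then have "emeasure lborel {0<..<1::real} = 0" by (rule null_setsD1)
    then show False using emeasure_lborel_Ioo[of 0 1] by simp
  qed
  moreover have "0 \<le> (LINT l|lborel. ?f l)" by (intro Bochner_Integration.integral_nonneg) auto
  ultimately have "0 < (LINT l|lborel. ?f l)" by linarith
  then show "0 < dual_const s" unfolding dual_const_def nn by simp
qed

text \<open>
  Integrating the Fourier transforms of the Gaussians against the same density gives a
  homogeneous function of the complementary degree; the constant is left as an integral.
\<close>

lemma gaussian_subordination_dual:
  fixes \<eta> :: "'a::euclidean_space" and s :: real
  assumes s: "s < DIM('a)" and eta: "\<eta> \<noteq> 0"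
  shows "(\<integral>\<^sup>+l. ennreal (subord s l * (l powr (- (DIM('a) / 2)) * gauss (1 / l) \<eta>)) \<partial>lborel)
    = ennreal (dual_const (DIM('a) - s) * riesz (DIM('a) - s) \<eta>)"
proof -
  let ?u = "DIM('a) - s"
  define c where "c = (norm \<eta>)\<^sup>2"
  have c: "0 < c" using eta by (simp add: c_def)
  have e: "subord s l * (l powr (- (DIM('a) / 2)) * gauss (1 / l) \<eta>) = subord (- ?u) l * exp (- (pi * c / l))" for l
  proof (cases "0 < l")
    case True
    then have "l powr (s / 2 - 1) * l powr (- (DIM('a) / 2)) = l powr (- ?u / 2 - 1)"
    proof -
      have "(s / 2 - 1) + - (DIM('a) / 2) = - ?u / 2 - 1" by (simp add: diff_divide_distrib)
      then show ?thesis by (simp only: powr_add[symmetric])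
    qed
    then show ?thesis using True by (simp add: subord_def gauss_def c_def mult.assoc[symmetric])
  qed (simp add: subord_def)
  have "(\<integral>\<^sup>+l. ennreal (subord (- ?u) l * exp (- (pi * c / l))) \<partial>lborel)
      = ennreal \<bar>c\<bar> * (\<integral>\<^sup>+l. ennreal (subord (- ?u) (0 + c * l) * exp (- (pi * c / (0 + c * l)))) \<partial>lborel)"
    by (rule nn_integral_real_affine) (use c in auto)
  also have "\<dots> = ennreal c * (\<integral>\<^sup>+l. ennreal (c powr (- ?u / 2 - 1)) * ennreal (subord (- ?u) l * exp (- (pi / l))) \<partial>lborel)"
  proof -
    have "subord (- ?u) (0 + c * l) * exp (- (pi * c / (0 + c * l))) = c powr (- ?u / 2 - 1) * (subord (- ?u) l * exp (- (pi / l)))" for l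
      using c by (auto simp: subord_def indicator_def powr_mult zero_less_mult_iff)
    then show ?thesis using c by (simp only: ennreal_mult'[symmetric] powr_ge_zero abs_of_pos)
  qed
  also have "\<dots> = ennreal c * (ennreal (c powr (- ?u / 2 - 1)) * ennreal (dual_const ?u))"
    using s dual_const(1)[of ?u] by (subst nn_integral_cmult) auto
  also have "\<dots> = ennreal (dual_const ?u * riesz ?u \<eta>)"
  proof -
    have "c * c powr (- ?u / 2 - 1) = c powr (- ?u / 2)" using c by (simp add: powr_diff)
    also have "\<dots> = norm \<eta> powr (- ?u)"
    proof -
      have "c = norm \<eta> powr 2" using eta by (simp add: c_def)
      moreover have "2 * (- ?u / 2) = - ?u" by simp
      ultimately show ?thesis by (simp only: powr_powr)
    qed
    finally have "c * (c powr (- ?u / 2 - 1) * dual_const ?u) = dual_const ?u * riesz ?u \<eta>"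
      by (simp add: riesz_def mult_ac)
    then show ?thesis using c dual_const(2)[of ?u] s by (simp add: ennreal_mult'[symmetric])
  qed
  finally show ?thesis unfolding e .
qed

lemma integrable_of_nn_integral:
  assumes "f \<in> borel_measurable M" "\<And>x. 0 \<le> f x" "(\<integral>\<^sup>+x. ennreal (f x) \<partial>M) = ennreal c" "0 \<le> c"
  shows "integrable M f" "(LINT x|M. f x) = c"
proof -
  show i: "integrable M f" using assms by (intro integrableI_nonneg) auto
  have "ennreal (LINT x|M. f x) = ennreal c"
    using nn_integral_eq_integral[OF i] assms by simp
  moreover have "0 \<le> (LINT x|M. f x)" using assms by (intro Bochner_Integration.integral_nonneg) auto
  ultimately show "(LINT x|M. f x) = c" using assms(4) by simp
qed

section \<open>Convolution on the Fourier side\<close>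

lemma borel_measurable_cnj [measurable]:
  "f \<in> borel_measurable M \<Longrightarrow> (\<lambda>x. cnj (f x)) \<in> borel_measurable M"
  by (rule measurable_compose[OF _ borel_measurable_continuous]) (auto intro!: continuous_intros)

definition conv :: "('a::euclidean_space \<Rightarrow> complex) \<Rightarrow> ('a \<Rightarrow> complex) \<Rightarrow> 'a \<Rightarrow> complex" where
  "conv k h \<xi> = (LINT \<eta>|lborel. k \<eta> * h (\<xi> - \<eta>))"

text \<open>
  The Fourier transform of \<open>u * cnj v\<close>, where \<^term>\<open>f\<close> and
  \<^term>\<open>g\<close> are the Fourier transforms of \<open>u\<close> and \<open>v\<close>.
\<close>

definition corr :: "('a::euclidean_space \<Rightarrow> complex) \<Rightarrow> ('a \<Rightarrow> complex) \<Rightarrow> 'a \<Rightarrow> complex" where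
  "corr f g \<eta> = (LINT \<zeta>|lborel. f (\<zeta> + \<eta>) * cnj (g \<zeta>))"

lemma ifourier_conv:
  fixes k h :: "'a::euclidean_space \<Rightarrow> complex"
  assumes k: "integrable lborel k" and h: "integrable lborel h"
  shows "integrable lborel (conv k h)" and "ifourier (conv k h) x = ifourier k x * ifourier h x"
proof -
  have m[measurable]: "k \<in> borel_measurable borel" "h \<in> borel_measurable borel"
    using k h by (auto dest: borel_measurable_integrable)
  have ih: "integrable lborel (\<lambda>\<xi>. wave (\<xi> \<bullet> x) * h (\<xi> - \<eta>))" for \<eta> x
    using lborel_shift(1)[OF m(2), of "- \<eta>"] h by (intro integrable_wave_mult) auto
  have nh: "(LINT \<xi>|lborel. norm (h (\<xi> - \<eta>))) = (LINT \<xi>|lborel. norm (h \<xi>))" for \<eta>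
    using lborel_shift(2)[of "\<lambda>x. norm (h x)" "- \<eta>"] by simp
  let ?F = "\<lambda>x \<eta> \<xi>. k \<eta> * (wave (\<xi> \<bullet> x) * h (\<xi> - \<eta>))"
  have 2: "integrable lborel (\<lambda>\<eta>. LINT \<xi>|lborel. norm (?F x \<eta> \<xi>))" for x
    using k by (simp add: norm_mult nh)
  have 1: "AE \<eta> in lborel. integrable lborel (?F x \<eta>)" for x
    by (intro AE_I2 integrable_mult_right ih)
  note F = LINT_Fubini_AE[of "?F _", OF _ 1 2]
  show "integrable lborel (conv k h)" using F(2)[of 0] unfolding conv_def by simp
  have "ifourier (conv k h) x = (LINT \<xi>|lborel. LINT \<eta>|lborel. ?F x \<eta> \<xi>)"
    unfolding ifourier_def conv_def integral_mult_right_zero[symmetric] by (simp add: mult.left_commute)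
  also have "\<dots> = (LINT \<eta>|lborel. LINT \<xi>|lborel. ?F x \<eta> \<xi>)" using F(1)[of x] by simp
  also have "\<dots> = (LINT \<eta>|lborel. k \<eta> * (wave (\<eta> \<bullet> x) * ifourier h x))"
  proof (rule Bochner_Integration.integral_cong[OF refl])
    fix \<eta> :: 'a
    have "(LINT \<xi>|lborel. wave (\<xi> \<bullet> x) * h (\<xi> - \<eta>)) = (LINT \<xi>|lborel. wave ((\<xi> + \<eta>) \<bullet> x) * h \<xi>)"
      using lborel_shift(2)[of "\<lambda>\<xi>. wave (\<xi> \<bullet> x) * h (\<xi> - \<eta>)" \<eta>] by simp
    also have "\<dots> = wave (\<eta> \<bullet> x) * ifourier h x"
      unfolding ifourier_def integral_mult_right_zero[symmetric] by (simp add: inner_add_left wave_add mult_ac)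
    finally show "(LINT \<xi>|lborel. ?F x \<eta> \<xi>) = k \<eta> * (wave (\<eta> \<bullet> x) * ifourier h x)" by simp
  qed
  also have "\<dots> = ifourier k x * ifourier h x"
    unfolding ifourier_def[of k] integral_mult_left_zero[symmetric] by (simp add: mult_ac)
  finally show "ifourier (conv k h) x = ifourier k x * ifourier h x" .
qed

lemma corr_eq_conv:
  fixes f g :: "'a::euclidean_space \<Rightarrow> complex"
  assumes [measurable]: "f \<in> borel_measurable borel" "g \<in> borel_measurable borel"
  shows "corr f g = conv (\<lambda>\<zeta>. cnj (g (- \<zeta>))) f"
proof
  fix \<eta>
  show "corr f g \<eta> = conv (\<lambda>\<zeta>. cnj (g (- \<zeta>))) f \<eta>"
  proof -
    have m: "(\<lambda>\<zeta>. cnj (g \<zeta>) * f (\<zeta> + \<eta>)) \<in> borel_measurable borel" by measurable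
    show ?thesis
      unfolding corr_def conv_def using lborel_reflect(2)[OF m, of 0] by (simp add: mult.commute)
  qed
qed

lemma ifourier_corr:
  fixes f g :: "'a::euclidean_space \<Rightarrow> complex"
  assumes f: "integrable lborel f" and g: "integrable lborel g"
  shows "integrable lborel (corr f g)" and "ifourier (corr f g) x = ifourier f x * cnj (ifourier g x)"
proof -
  have [measurable]: "f \<in> borel_measurable borel" "g \<in> borel_measurable borel"
    using f g by (auto dest: borel_measurable_integrable)
  have cg: "integrable lborel (\<lambda>\<zeta>. cnj (g (- \<zeta>)))"
    using g lborel_reflect(1)[of g 0] by simp
  show "integrable lborel (corr f g)" by (subst corr_eq_conv) (auto intro: ifourier_conv(1)[OF cg f])
  have "ifourier (\<lambda>\<zeta>. cnj (g (- \<zeta>))) x = (LINT \<zeta>|lborel. cnj (wave (\<zeta> \<bullet> x) * g \<zeta>))"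
    unfolding ifourier_def using lborel_reflect(2)[of "\<lambda>\<zeta>. cnj (wave (\<zeta> \<bullet> x) * g \<zeta>)" 0]
    by (simp add: cnj_wave)
  also have "\<dots> = cnj (ifourier g x)" by (simp add: ifourier_def del: complex_cnj_mult)
  finally show "ifourier (corr f g) x = ifourier f x * cnj (ifourier g x)"
    by (simp add: corr_eq_conv ifourier_conv(2)[OF cg f])
qed

text \<open>
  The Riesz formula with a single Gaussian in place of the kernel, where both integrals
  converge absolutely and Fubini applies.
\<close>

lemma gaussian_average_ifourier:
  fixes A :: "'a::euclidean_space \<Rightarrow> complex"
  assumes A: "integrable lborel A" and l: "0 < l"
  shows "integrable lborel (\<lambda>y. of_real (gauss l (x - y)) * ifourier A y)"
    and "(LINT y|lborel. of_real (gauss l (x - y)) * ifourier A y)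
    = (LINT \<eta>|lborel. of_real (l powr (- (DIM('a) / 2)) * gauss (1 / l) \<eta>) * (wave (\<eta> \<bullet> x) * A \<eta>))"
proof -
  have [measurable]: "A \<in> borel_measurable borel" "ifourier A \<in> borel_measurable borel"
    using A borel_measurable_continuous[OF continuous_ifourier[OF A]] by (auto dest: borel_measurable_integrable)
  have gi: "integrable lborel (\<lambda>y. gauss l (x - y))"
    using lborel_reflect(1)[of "gauss l" x] gaussian_integral(1)[OF l, where 'a='a] by simp
  show "integrable lborel (\<lambda>y. of_real (gauss l (x - y)) * ifourier A y)"
    by (rule integrable_mult_bounded[OF _ _ norm_ifourier_le]) (use gi in \<open>auto simp: complex_of_real_integrable_eq\<close>)
  let ?F = "\<lambda>y \<eta>. of_real (gauss l (x - y)) * (wave (\<eta> \<bullet> y) * A \<eta>)"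
  have "(LINT y|lborel. of_real (gauss l (x - y)) * ifourier A y) = (LINT y|lborel. LINT \<eta>|lborel. ?F y \<eta>)"
    by (simp add: ifourier_def)
  also have "\<dots> = (LINT \<eta>|lborel. LINT y|lborel. ?F y \<eta>)"
  proof (rule LINT_Fubini(1)[where g="\<lambda>y. gauss l (x - y)" and h="\<lambda>\<eta>. norm (A \<eta>)"])
    show "norm (?F y \<eta>) \<le> gauss l (x - y) * norm (A \<eta>)" for y \<eta>
      using less_imp_le[OF gauss_pos[of l "x - y"]] by (simp add: norm_mult)
  qed (use A gi in auto)
  also have "\<dots> = (LINT \<eta>|lborel. of_real (l powr (- (DIM('a) / 2)) * gauss (1 / l) \<eta>) * (wave (\<eta> \<bullet> x) * A \<eta>))"
  proof (rule Bochner_Integration.integral_cong[OF refl])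
    fix \<eta> :: 'a
    have "(LINT y|lborel. ?F y \<eta>) = (LINT y|lborel. (wave (y \<bullet> \<eta>) * of_real (gauss l (x - y))) * A \<eta>)"
      by (simp add: mult_ac inner_commute)
    also have "\<dots> = (LINT y|lborel. wave (y \<bullet> \<eta>) * of_real (gauss l (x - y))) * A \<eta>"
      by (rule integral_mult_left_zero)
    also have "(LINT y|lborel. wave (y \<bullet> \<eta>) * of_real (gauss l (x - y))) = (LINT y|lborel. wave ((x - y) \<bullet> \<eta>) * of_real (gauss l y))"
      using lborel_reflect(2)[of "\<lambda>y. wave ((x - y) \<bullet> \<eta>) * of_real (gauss l y)" x] by simp
    also have "\<dots> = (LINT y|lborel. wave (x \<bullet> \<eta>) * (wave (y \<bullet> (- \<eta>)) * of_real (gauss l y)))"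
      by (simp add: inner_diff_left wave_add[of _ "- _", simplified] mult.assoc)
    also have "\<dots> = wave (x \<bullet> \<eta>) * of_real (l powr (- (DIM('a) / 2)) * gauss (1 / l) \<eta>)"
      by (subst integral_mult_right_zero, subst gaussian_wave(2)[OF l]) simp
    finally show "(LINT y|lborel. ?F y \<eta>) = of_real (l powr (- (DIM('a) / 2)) * gauss (1 / l) \<eta>) * (wave (\<eta> \<bullet> x) * A \<eta>)"
      by (simp add: mult_ac inner_commute)
  qed
  finally show "(LINT y|lborel. of_real (gauss l (x - y)) * ifourier A y)
    = (LINT \<eta>|lborel. of_real (l powr (- (DIM('a) / 2)) * gauss (1 / l) \<eta>) * (wave (\<eta> \<bullet> x) * A \<eta>))" .
qed

section \<open>The Riesz potential on the Fourier side\<close>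

locale riesz_setting =
  fixes \<gamma> :: real and dim :: "'a::euclidean_space itself"
  assumes gamma: "0 < \<gamma>" "\<gamma> < DIM('a)"
begin

text \<open>
  Up to the constant \<open>rc\<close>, the kernel \<open>K\<close> is the Fourier transform of the Riesz kernel of
  degree \<^term>\<open>\<gamma>\<close>.
\<close>

abbreviation K :: "'a \<Rightarrow> real" where "K \<equiv> riesz (DIM('a) - \<gamma>)"

definition rc :: real where "rc = dual_const (DIM('a) - \<gamma>) / gamma_const \<gamma>"

lemma rc_pos: "0 < rc"
  unfolding rc_def using gamma dual_const(2) gamma_const_pos by simp

lemma AE_coordinates_nonzero: "AE x::'a in lborel. \<forall>b\<in>Basis. x \<bullet> b \<noteq> 0"
proof (rule AE_finite_allI)
  fix b :: 'a assume b: "b \<in> Basis"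
  have "{x. x \<bullet> b = 0} \<in> null_sets lebesgue"
    using negligible_standard_hyperplane[OF b, of 0] negligible_iff_null_sets by blast
  moreover have "{x. x \<bullet> b = 0} \<in> sets lborel" by measurable
  ultimately have "{x. x \<bullet> b = 0} \<in> null_sets lborel" by (simp add: null_sets_completion_iff)
  then show "AE x in lborel. x \<bullet> b \<noteq> 0" by (rule AE_I') auto
qed simp

lemma integrable_powr_inverse:
  assumes a: "0 < a" "a < 1"
  shows "integrable lborel (\<lambda>r::real. \<bar>r\<bar> powr (- a) * inverse (1 + r\<^sup>2))"
proof -
  let ?f = "\<lambda>r::real. indicator {0..1} r * r powr (- a)"
  have "(\<lambda>r. r powr (- a)) integrable_on {0..1}" using a by (intro integrable_on_powr_from_0) auto
  then have "(\<lambda>r. r powr (- a)) absolutely_integrable_on {0..1}"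
    by (intro nonnegative_absolutely_integrable_1) auto
  then have "integrable lebesgue ?f" by (simp add: set_integrable_def)
  then have f: "integrable lborel ?f" by (subst (asm) integrable_completion) auto
  have f': "integrable lborel (\<lambda>r. ?f (0 - r))" using f by (subst lborel_reflect(1)) auto
  show ?thesis
  proof (rule Bochner_Integration.integrable_bound)
    show "integrable lborel (\<lambda>r. ?f r + ?f (0 - r) + inverse (1 + r\<^sup>2))"
      by (intro Bochner_Integration.integrable_add f f' lborel_integrable_inverse_1_plus_square)
    have "\<bar>r\<bar> powr (- a) * inverse (1 + r\<^sup>2) \<le> ?f r + ?f (0 - r) + inverse (1 + r\<^sup>2)" for r :: real
    proof (cases "\<bar>r\<bar> \<le> 1")
      case True
      have "inverse (1 + r\<^sup>2) \<le> 1" by (simp add: inverse_le_1_iff)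
      then have "\<bar>r\<bar> powr (- a) * inverse (1 + r\<^sup>2) \<le> \<bar>r\<bar> powr (- a)" by (intro mult_left_le) auto
      also have "\<dots> \<le> ?f r + ?f (0 - r)" using True by (cases "0 \<le> r") auto
      finally show ?thesis by (simp add: add_increasing2)
    next
      case False
      then have "\<bar>r\<bar> powr (- a) \<le> \<bar>r\<bar> powr 0" using a by (intro powr_mono) auto
      also have "\<bar>r\<bar> powr 0 = 1" using False by auto
      finally have "\<bar>r\<bar> powr (- a) * inverse (1 + r\<^sup>2) \<le> 1 * inverse (1 + r\<^sup>2)"
        using False by (intro mult_right_mono) auto
      then show ?thesis using False by (auto simp: indicator_def)
    qed
    then show "AE r in lborel. norm (\<bar>r\<bar> powr (- a) * inverse (1 + r\<^sup>2)) \<le> norm (?f r + ?f (0 - r) + inverse (1 + r\<^sup>2))"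
      by (intro AE_I2) (auto intro: order_trans[OF _ abs_ge_self])
  qed measurable
qed

text \<open>
  The singularity of the kernel is split among the coordinates, each of which takes an
  integrable share of it.
\<close>

lemma integrable_K_weight: "integrable lborel (\<lambda>\<eta>. K \<eta> * weight \<eta>)"
proof (rule Bochner_Integration.integrable_bound)
  define a where "a = (DIM('a) - \<gamma>) / DIM('a)"
  have a: "0 < a" "a < 1" using gamma by (auto simp: a_def field_simps)
  show "integrable lborel (\<lambda>\<eta>::'a. \<Prod>b\<in>Basis. \<bar>\<eta> \<bullet> b\<bar> powr (- a) * inverse (1 + (\<eta> \<bullet> b)\<^sup>2))"
    by (rule lborel_prod_Basis) (rule integrable_powr_inverse[OF a])
  show "AE \<eta>::'a in lborel. norm (K \<eta> * weight \<eta>) \<le> norm (\<Prod>b\<in>Basis. \<bar>\<eta> \<bullet> b\<bar> powr (- a) * inverse (1 + (\<eta> \<bullet> b)\<^sup>2))"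
    using AE_coordinates_nonzero
  proof eventually_elim
    case (elim \<eta>)
    have "K \<eta> = (norm \<eta> powr (- a)) ^ DIM('a)"
    proof (cases "\<eta> = 0")
      case False
      have "(norm \<eta> powr (- a)) ^ DIM('a) = norm \<eta> powr (- a * DIM('a))"
        using False by (simp add: powr_realpow[symmetric] powr_powr)
      then show ?thesis by (simp add: riesz_def a_def)
    qed (simp add: riesz_def)
    also have "\<dots> = (\<Prod>b\<in>(Basis::'a set). norm \<eta> powr (- a))" by simp
    also have "\<dots> \<le> (\<Prod>b\<in>(Basis::'a set). \<bar>\<eta> \<bullet> b\<bar> powr (- a))"
    proof (rule prod_mono)
      fix b :: 'a assume b: "b \<in> Basis"
      then show "0 \<le> norm \<eta> powr (- a) \<and> norm \<eta> powr (- a) \<le> \<bar>\<eta> \<bullet> b\<bar> powr (- a)"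
        using elim a Basis_le_norm[OF b, of \<eta>] by (auto intro!: powr_mono2')
    qed
    finally have "K \<eta> * weight \<eta> \<le> (\<Prod>b\<in>(Basis::'a set). \<bar>\<eta> \<bullet> b\<bar> powr (- a)) * (\<Prod>b\<in>Basis. inverse (1 + (\<eta> \<bullet> b)\<^sup>2))"
      by (intro mult_mono weight_le_prod) (auto intro: prod_nonneg)
    then show ?case by (simp add: prod.distrib order_trans[OF _ abs_ge_self])
  qed
qed measurable

lemma integrable_K_bound:
  fixes A :: "'a \<Rightarrow> complex"
  assumes "A \<in> borel_measurable borel" "\<And>\<eta>. norm (A \<eta>) \<le> C * weight \<eta>"
  shows "integrable lborel (\<lambda>\<eta>. of_real (K \<eta>) * A \<eta>)"
proof (rule Bochner_Integration.integrable_bound)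
  have [measurable]: "A \<in> borel_measurable borel" by fact
  show "integrable lborel (\<lambda>\<eta>. C * (K \<eta> * weight \<eta>))" using integrable_K_weight by simp
  have "norm (of_real (K \<eta>) * A \<eta>) \<le> C * (K \<eta> * weight \<eta>)" for \<eta>
    using mult_left_mono[OF assms(2)[of \<eta>] riesz_nonneg[of "DIM('a) - \<gamma>" \<eta>]] by (simp add: norm_mult mult_ac)
  then show "AE \<eta> in lborel. norm (of_real (K \<eta>) * A \<eta>) \<le> norm (C * (K \<eta> * weight \<eta>))"
    by (intro AE_I2) (auto intro: order_trans[OF _ abs_ge_self])
  show "(\<lambda>\<eta>. complex_of_real (K \<eta>) * A \<eta>) \<in> borel_measurable lborel" by measurable
qed

lemma subordination_LINT:
  assumes "x \<noteq> 0"
  shows "integrable lborel (\<lambda>l. subord \<gamma> l * gauss l (x::'a))"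
    and "(LINT l|lborel. subord \<gamma> l * gauss l x) = gamma_const \<gamma> * riesz \<gamma> x"
  using integrable_of_nn_integral[OF _ _ gaussian_subordination[OF gamma(1) assms]]
    gamma_const_pos[OF gamma(1)] by (auto simp: less_imp_le[OF gauss_pos])

lemma subordination_dual_LINT:
  assumes "\<eta> \<noteq> 0"
  shows "integrable lborel (\<lambda>l. subord \<gamma> l * (l powr (- (DIM('a) / 2)) * gauss (1 / l) (\<eta>::'a)))"
    and "(LINT l|lborel. subord \<gamma> l * (l powr (- (DIM('a) / 2)) * gauss (1 / l) \<eta>)) = dual_const (DIM('a) - \<gamma>) * K \<eta>"
  using integrable_of_nn_integral[OF _ _ gaussian_subordination_dual[OF gamma(2) assms]]
    dual_const(2)[of "DIM('a) - \<gamma>"] gamma by (auto simp: less_imp_le[OF gauss_pos])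

text \<open>
  For a nonnegative inverse transform the Riesz potential converges: by Tonelli it is at most
  the absolutely convergent integral on the Fourier side.
\<close>

lemma riesz_potential_converges:
  fixes A :: "'a \<Rightarrow> complex" and P :: "'a \<Rightarrow> real"
  assumes A[measurable]: "A \<in> borel_measurable borel" and bound: "\<And>\<eta>. norm (A \<eta>) \<le> C * weight \<eta>"
    and P: "\<And>y. ifourier A y = of_real (P y)" and P0: "\<And>y. 0 \<le> P y"
  shows "integrable lborel (\<lambda>y. riesz \<gamma> (x - y) * P y)"
proof -
  have iA: "integrable lborel A" by (rule integrable_weight_bound[OF A bound])
  have [measurable]: "P \<in> borel_measurable borel"
  proof -
    have "(\<lambda>y. Re (ifourier A y)) \<in> borel_measurable borel"
      using borel_measurable_continuous[OF continuous_ifourier[OF iA]] by measurable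
    then show ?thesis by (simp add: P)
  qed
  let ?g = "\<lambda>l \<eta>. l powr (- (DIM('a) / 2)) * gauss (1 / l) (\<eta>::'a)"
  have g0: "0 \<le> ?g l \<eta>" for l \<eta> by simp
  have inner: "(\<integral>\<^sup>+y. ennreal (subord \<gamma> l * gauss l (x - y) * P y) \<partial>lborel) \<le> (\<integral>\<^sup>+\<eta>. ennreal (norm (A \<eta>) * (subord \<gamma> l * ?g l \<eta>)) \<partial>lborel)" for l
  proof (cases "0 < l")
    case l: True
    have iP: "integrable lborel (\<lambda>y. gauss l (x - y) * P y)"
      using gaussian_average_ifourier(1)[OF iA l, of x] unfolding P of_real_mult[symmetric] complex_of_real_integrable_eq .
    have ig: "integrable lborel (\<lambda>\<eta>. ?g l \<eta> * norm (A \<eta>))"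
    proof (rule Bochner_Integration.integrable_bound)
      show "integrable lborel (\<lambda>\<eta>. l powr (- (DIM('a) / 2)) * norm (A \<eta>))" using iA by simp
      show "AE \<eta> in lborel. norm (?g l \<eta> * norm (A \<eta>)) \<le> norm (l powr (- (DIM('a) / 2)) * norm (A \<eta>))"
        using gauss_le_1[of "1 / l"] l g0 less_imp_le[OF gauss_pos]
        by (intro AE_I2) (auto simp: abs_mult intro!: mult_left_mono mult_left_le_one_le)
    qed measurable
    have "complex_of_real (LINT y|lborel. gauss l (x - y) * P y) = (LINT y|lborel. of_real (gauss l (x - y)) * ifourier A y)"
      unfolding P by (simp flip: of_real_mult)
    also have "norm \<dots> \<le> (LINT \<eta>|lborel. ?g l \<eta> * norm (A \<eta>))"
      unfolding gaussian_average_ifourier(2)[OF iA l]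
      using integral_norm_bound[of lborel "\<lambda>\<eta>. of_real (?g l \<eta>) * (wave (\<eta> \<bullet> x) * A \<eta>)"] less_imp_le[OF gauss_pos]
      by (simp add: norm_mult abs_mult)
    finally have "(LINT y|lborel. gauss l (x - y) * P y) \<le> (LINT \<eta>|lborel. ?g l \<eta> * norm (A \<eta>))"
      unfolding norm_of_real by linarith
    then have "(\<integral>\<^sup>+y. ennreal (gauss l (x - y) * P y) \<partial>lborel) \<le> (\<integral>\<^sup>+\<eta>. ennreal (?g l \<eta> * norm (A \<eta>)) \<partial>lborel)"
      using nn_integral_eq_integral[OF iP] nn_integral_eq_integral[OF ig] P0 g0 less_imp_le[OF gauss_pos]
      by (simp add: ennreal_leI)
    then have "ennreal (subord \<gamma> l) * (\<integral>\<^sup>+y. ennreal (gauss l (x - y) * P y) \<partial>lborel)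
        \<le> ennreal (subord \<gamma> l) * (\<integral>\<^sup>+\<eta>. ennreal (?g l \<eta> * norm (A \<eta>)) \<partial>lborel)" by (rule mult_left_mono) simp
    then show ?thesis
      by (simp add: nn_integral_cmult[symmetric] ennreal_mult'[symmetric] mult_ac)
  qed (simp add: subord_def)
  have "(\<integral>\<^sup>+y. ennreal (gamma_const \<gamma> * riesz \<gamma> (x - y) * P y) \<partial>lborel)
      = (\<integral>\<^sup>+y. \<integral>\<^sup>+l. ennreal (subord \<gamma> l * gauss l (x - y) * P y) \<partial>lborel \<partial>lborel)"
  proof (rule nn_integral_cong_AE)
    show "AE y in lborel. ennreal (gamma_const \<gamma> * riesz \<gamma> (x - y) * P y) = (\<integral>\<^sup>+l. ennreal (subord \<gamma> l * gauss l (x - y) * P y) \<partial>lborel)"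
      using AE_lborel_singleton[of x]
    proof eventually_elim
      case (elim y)
      have "(\<integral>\<^sup>+l. ennreal (subord \<gamma> l * gauss l (x - y) * P y) \<partial>lborel)
          = (\<integral>\<^sup>+l. ennreal (subord \<gamma> l * gauss l (x - y)) \<partial>lborel) * ennreal (P y)"
        using P0[of y] less_imp_le[OF gauss_pos] by (subst nn_integral_multc[symmetric]) (auto simp: ennreal_mult'')
      also have "\<dots> = ennreal (gamma_const \<gamma> * riesz \<gamma> (x - y)) * ennreal (P y)"
        using elim by (subst gaussian_subordination[OF gamma(1)]) auto
      finally show ?case using P0[of y] by (simp add: ennreal_mult'')
    qed
  qed
  also have "\<dots> = (\<integral>\<^sup>+l. \<integral>\<^sup>+y. ennreal (subord \<gamma> l * gauss l (x - y) * P y) \<partial>lborel \<partial>lborel)"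
    by (rule lborel_pair.Fubini') measurable
  also have "\<dots> \<le> (\<integral>\<^sup>+l. \<integral>\<^sup>+\<eta>. ennreal (norm (A \<eta>) * (subord \<gamma> l * ?g l \<eta>)) \<partial>lborel \<partial>lborel)"
    by (intro nn_integral_mono inner)
  also have "\<dots> = (\<integral>\<^sup>+\<eta>. \<integral>\<^sup>+l. ennreal (norm (A \<eta>) * (subord \<gamma> l * ?g l \<eta>)) \<partial>lborel \<partial>lborel)"
    by (rule lborel_pair.Fubini') measurable
  also have "\<dots> = (\<integral>\<^sup>+\<eta>. ennreal (dual_const (DIM('a) - \<gamma>) * norm (of_real (K \<eta>) * A \<eta>)) \<partial>lborel)"
  proof (rule nn_integral_cong_AE)
    show "AE \<eta> in lborel. (\<integral>\<^sup>+l. ennreal (norm (A \<eta>) * (subord \<gamma> l * ?g l \<eta>)) \<partial>lborel) = ennreal (dual_const (DIM('a) - \<gamma>) * norm (of_real (K \<eta>) * A \<eta>))"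
      using AE_lborel_singleton[of 0]
    proof eventually_elim
      case (elim \<eta>)
      have "(\<integral>\<^sup>+l. ennreal (norm (A \<eta>) * (subord \<gamma> l * ?g l \<eta>)) \<partial>lborel) = ennreal (norm (A \<eta>)) * ennreal (dual_const (DIM('a) - \<gamma>) * K \<eta>)"
        unfolding gaussian_subordination_dual[OF gamma(2) elim, symmetric]
        by (subst nn_integral_cmult[symmetric]) (auto simp: ennreal_mult')
      then show ?case by (simp add: ennreal_mult'[symmetric] norm_mult mult_ac)
    qed
  qed
  also have "\<dots> < \<infinity>"
  proof -
    have "integrable lborel (\<lambda>\<eta>. dual_const (DIM('a) - \<gamma>) * norm (of_real (K \<eta>) * A \<eta>))"
      by (intro integrable_mult_right integrable_norm integrable_K_bound[OF A bound])
    then show ?thesis using dual_const(2)[of "DIM('a) - \<gamma>"] gamma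
      by (subst nn_integral_eq_integral) auto
  qed
  finally have "integrable lborel (\<lambda>y. gamma_const \<gamma> * riesz \<gamma> (x - y) * P y)"
    using P0 gamma_const_pos[OF gamma(1)] by (intro integrableI_nonneg) auto
  then have "integrable lborel (\<lambda>y. inverse (gamma_const \<gamma>) * (gamma_const \<gamma> * riesz \<gamma> (x - y) * P y))" by simp
  then show ?thesis using gamma_const_pos[OF gamma(1)] by (simp add: mult.assoc[symmetric])
qed

text \<open>
  Both kernels are superpositions of Gaussians with the same density, so the identity follows
  from the one for a single Gaussian by integrating over the width. The two exchanges of
  integrals are justified by the assumed convergence in space and by the integrability of the
  kernel against the weight in frequency.
\<close>

theorem riesz_potential_ifourier:
  fixes A :: "'a \<Rightarrow> complex"
  assumes A[measurable]: "A \<in> borel_measurable borel" and bound: "\<And>\<eta>. norm (A \<eta>) \<le> C * weight \<eta>"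
    and conv: "integrable lborel (\<lambda>y. of_real (riesz \<gamma> (x - y)) * ifourier A y)"
  shows "(LINT y|lborel. of_real (riesz \<gamma> (x - y)) * ifourier A y) = of_real rc * ifourier (\<lambda>\<eta>. of_real (K \<eta>) * A \<eta>) x"
proof -
  have iA: "integrable lborel A" by (rule integrable_weight_bound[OF A bound])
  have [measurable]: "ifourier A \<in> borel_measurable borel"
    by (rule borel_measurable_continuous[OF continuous_ifourier[OF iA]])
  let ?g = "\<lambda>l \<eta>. l powr (- (DIM('a) / 2)) * gauss (1 / l) (\<eta>::'a)"
  let ?F = "\<lambda>y l. of_real (subord \<gamma> l * gauss l (x - y)) * ifourier A y"
  let ?G = "\<lambda>\<eta> l. of_real (subord \<gamma> l * ?g l \<eta>) * (wave (\<eta> \<bullet> x) * A \<eta>)"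
  have g0: "0 \<le> gauss l u" for l and u :: 'a by simp
  have F1: "integrable lborel (?F y)" "(LINT l|lborel. ?F y l) = of_real (gamma_const \<gamma> * riesz \<gamma> (x - y)) * ifourier A y"
    "(LINT l|lborel. norm (?F y l)) = gamma_const \<gamma> * norm (of_real (riesz \<gamma> (x - y)) * ifourier A y)" if "y \<noteq> x" for y
  proof -
    have i: "integrable lborel (\<lambda>l. subord \<gamma> l * gauss l (x - y))"
      and e: "(LINT l|lborel. subord \<gamma> l * gauss l (x - y)) = gamma_const \<gamma> * riesz \<gamma> (x - y)"
      using subordination_LINT[of "x - y"] that by auto
    show "integrable lborel (?F y)"
      using i by (intro integrable_mult_left) (simp only: complex_of_real_integrable_eq)
    show "(LINT l|lborel. ?F y l) = of_real (gamma_const \<gamma> * riesz \<gamma> (x - y)) * ifourier A y"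
      by (simp only: integral_mult_left_zero integral_complex_of_real e)
    have "norm (?F y l) = (subord \<gamma> l * gauss l (x - y)) * norm (ifourier A y)" for l
      using g0 by (simp add: norm_mult abs_mult)
    then show "(LINT l|lborel. norm (?F y l)) = gamma_const \<gamma> * norm (of_real (riesz \<gamma> (x - y)) * ifourier A y)"
      by (simp only: integral_mult_left_zero e) (simp add: norm_mult)
  qed
  have G1: "integrable lborel (?G \<eta>)" "(LINT l|lborel. ?G \<eta> l) = of_real (dual_const (DIM('a) - \<gamma>) * K \<eta>) * (wave (\<eta> \<bullet> x) * A \<eta>)"
    "(LINT l|lborel. norm (?G \<eta> l)) = dual_const (DIM('a) - \<gamma>) * norm (of_real (K \<eta>) * A \<eta>)" if "\<eta> \<noteq> 0" for \<eta>
  proof -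
    note i = subordination_dual_LINT(1)[OF that] and e = subordination_dual_LINT(2)[OF that]
    show "integrable lborel (?G \<eta>)"
      using i by (intro integrable_mult_left) (simp only: complex_of_real_integrable_eq)
    show "(LINT l|lborel. ?G \<eta> l) = of_real (dual_const (DIM('a) - \<gamma>) * K \<eta>) * (wave (\<eta> \<bullet> x) * A \<eta>)"
      by (simp only: integral_mult_left_zero integral_complex_of_real e)
    have "norm (?G \<eta> l) = (subord \<gamma> l * ?g l \<eta>) * norm (A \<eta>)" for l
      using g0 by (simp add: norm_mult abs_mult)
    then show "(LINT l|lborel. norm (?G \<eta> l)) = dual_const (DIM('a) - \<gamma>) * norm (of_real (K \<eta>) * A \<eta>)"
      by (simp only: integral_mult_left_zero e) (simp add: norm_mult)
  qed
  have "of_real (gamma_const \<gamma>) * (LINT y|lborel. of_real (riesz \<gamma> (x - y)) * ifourier A y)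
      = (LINT y|lborel. of_real (gamma_const \<gamma> * riesz \<gamma> (x - y)) * ifourier A y)"
    by (simp only: of_real_mult mult.assoc integral_mult_right_zero)
  also have "\<dots> = (LINT y|lborel. LINT l|lborel. ?F y l)"
  proof (rule integral_cong_AE)
    show "AE y in lborel. of_real (gamma_const \<gamma> * riesz \<gamma> (x - y)) * ifourier A y = (LINT l|lborel. ?F y l)"
      using AE_lborel_singleton[of x] by eventually_elim (rule F1(2)[symmetric])
  qed measurable
  also have "\<dots> = (LINT l|lborel. LINT y|lborel. ?F y l)"
  proof (rule LINT_Fubini_AE(1))
    show "AE y in lborel. integrable lborel (?F y)"
      using AE_lborel_singleton[of x] by eventually_elim (rule F1(1))
    have "integrable lborel (\<lambda>y. gamma_const \<gamma> * norm (of_real (riesz \<gamma> (x - y)) * ifourier A y))"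
      using conv by (intro integrable_mult_right integrable_norm)
    then show "integrable lborel (\<lambda>y. LINT l|lborel. norm (?F y l))"
    proof (rule integrable_cong_AE_imp)
      show "AE y in lborel. gamma_const \<gamma> * norm (of_real (riesz \<gamma> (x - y)) * ifourier A y) = (LINT l|lborel. norm (?F y l))"
        using AE_lborel_singleton[of x] by eventually_elim (rule F1(3)[symmetric])
    qed measurable
  qed measurable
  also have "\<dots> = (LINT l|lborel. LINT \<eta>|lborel. ?G \<eta> l)"
  proof (rule Bochner_Integration.integral_cong[OF refl])
    fix l :: real
    show "(LINT y|lborel. ?F y l) = (LINT \<eta>|lborel. ?G \<eta> l)"
    proof (cases "0 < l")
      case True
      show ?thesis
        using gaussian_average_ifourier(2)[OF iA True, of x]
        by (simp only: of_real_mult mult.assoc integral_mult_right_zero)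
    qed (simp add: subord_def)
  qed
  also have "\<dots> = (LINT \<eta>|lborel. LINT l|lborel. ?G \<eta> l)"
  proof (rule LINT_Fubini_AE(1)[symmetric])
    show "AE \<eta> in lborel. integrable lborel (?G \<eta>)"
      using AE_lborel_singleton[of 0] by eventually_elim (rule G1(1))
    have "integrable lborel (\<lambda>\<eta>. dual_const (DIM('a) - \<gamma>) * norm (of_real (K \<eta>) * A \<eta>))"
      by (intro integrable_mult_right integrable_norm integrable_K_bound[OF A bound])
    then show "integrable lborel (\<lambda>\<eta>. LINT l|lborel. norm (?G \<eta> l))"
    proof (rule integrable_cong_AE_imp)
      show "AE \<eta> in lborel. dual_const (DIM('a) - \<gamma>) * norm (of_real (K \<eta>) * A \<eta>) = (LINT l|lborel. norm (?G \<eta> l))"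
        using AE_lborel_singleton[of 0] by eventually_elim (rule G1(3)[symmetric])
    qed measurable
  qed measurable
  also have "\<dots> = (LINT \<eta>|lborel. of_real (dual_const (DIM('a) - \<gamma>)) * (wave (\<eta> \<bullet> x) * (of_real (K \<eta>) * A \<eta>)))"
  proof (rule integral_cong_AE)
    show "AE \<eta> in lborel. (LINT l|lborel. ?G \<eta> l) = of_real (dual_const (DIM('a) - \<gamma>)) * (wave (\<eta> \<bullet> x) * (of_real (K \<eta>) * A \<eta>))"
      using AE_lborel_singleton[of 0] by eventually_elim (subst G1(2), assumption, simp add: mult_ac)
  qed measurable
  also have "\<dots> = of_real (dual_const (DIM('a) - \<gamma>)) * ifourier (\<lambda>\<eta>. of_real (K \<eta>) * A \<eta>) x"
    by (simp only: ifourier_def integral_mult_right_zero)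
  finally show ?thesis
    using gamma_const_pos[OF gamma(1)] by (simp add: rc_def field_simps)
qed

end

section \<open>The trilinear form in the weighted sup norm\<close>

definition weighted :: "real \<Rightarrow> ('a::euclidean_space \<Rightarrow> complex) \<Rightarrow> bool" where
  "weighted C f \<longleftrightarrow> f \<in> borel_measurable borel \<and> (\<forall>x. norm (f x) \<le> C * weight x)"

text \<open>Joint continuity in a parameter and in the frequency, with a uniform weighted bound.\<close>

definition weighted_family :: "real \<Rightarrow> ('p::metric_space \<Rightarrow> 'a::euclidean_space \<Rightarrow> complex) \<Rightarrow> bool" where
  "weighted_family C f \<longleftrightarrow> continuous_on UNIV (\<lambda>q. f (fst q) (snd q)) \<and> (\<forall>p x. norm (f p x) \<le> C * weight x)"

lemma weighted_integrable: "weighted C f \<Longrightarrow> integrable lborel f"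
  unfolding weighted_def using integrable_weight_bound by blast

lemma weighted_measurable: "weighted C f \<Longrightarrow> f \<in> borel_measurable borel"
  unfolding weighted_def by simp

lemma weighted_bound: "weighted C f \<Longrightarrow> norm (f x) \<le> C * weight x"
  unfolding weighted_def by simp

lemma weighted_nonneg:
  assumes "weighted C (f :: 'a::euclidean_space \<Rightarrow> complex)" shows "0 \<le> C"
  using order_trans[OF norm_ge_zero weighted_bound[OF assms, of 0]] weight_pos[of "0::'a"]
  by (simp add: zero_le_mult_iff)

lemma weighted_bound': "weighted C f \<Longrightarrow> norm (f x) \<le> C"
  using weighted_bound[of C f x] weighted_nonneg[of C f] weight_le_1[of x]
  by (meson mult_left_le order_trans)

lemma weighted_diff: "weighted C f \<Longrightarrow> weighted D g \<Longrightarrow> weighted (C + D) (\<lambda>x. f x - g x)"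
  unfolding weighted_def
  by (auto simp: distrib_right intro!: order_trans[OF norm_triangle_ineq4] add_mono)

lemma weighted_family_continuous:
  assumes "weighted_family C f" shows "continuous_on UNIV (f p)"
proof -
  have "continuous_on UNIV (\<lambda>x. f (fst (p, x)) (snd (p, x)))"
    using assms unfolding weighted_family_def
    by (intro continuous_on_compose2[of UNIV "\<lambda>q. f (fst q) (snd q)" UNIV "\<lambda>x. (p, x)"]) (auto intro!: continuous_intros)
  then show ?thesis by simp
qed

lemma weighted_family_weighted: "weighted_family C f \<Longrightarrow> weighted C (f p)"
  using weighted_family_continuous[of C f p] unfolding weighted_def weighted_family_def
  by (auto intro: borel_measurable_continuous)

lemma weighted_family_compose:
  assumes f: "weighted_family C f" and "continuous_on UNIV P" "continuous_on UNIV X"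
  shows "continuous_on UNIV (\<lambda>z. f (P z) (X z))"
  using continuous_on_compose2[of UNIV "\<lambda>q. f (fst q) (snd q)" UNIV "\<lambda>z. (P z, X z)"] assms
  unfolding weighted_family_def by (auto intro: continuous_on_Pair)

lemma weighted_family_nonneg: "weighted_family C f \<Longrightarrow> 0 \<le> C"
  using weighted_family_weighted weighted_nonneg by blast

lemma measurable_corr [measurable]:
  assumes [measurable]: "f \<in> borel_measurable borel" "g \<in> borel_measurable borel"
  shows "corr f g \<in> borel_measurable borel"
  unfolding corr_def by measurable

lemma measurable_conv [measurable]:
  assumes [measurable]: "f \<in> borel_measurable borel" "g \<in> borel_measurable borel"
  shows "conv f g \<in> borel_measurable borel"
  unfolding conv_def by measurable

definition corr_const :: "'a::euclidean_space itself \<Rightarrow> real" where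
  "corr_const _ = 2 ^ (2 * DIM('a)) * (2 * (LINT x|lborel. weight (x::'a)))"

lemma LINT_weight_nonneg: "0 \<le> (LINT x|lborel. weight (x::'a::euclidean_space))"
  by (intro Bochner_Integration.integral_nonneg) simp

lemma corr_integrand:
  fixes f g :: "'a::euclidean_space \<Rightarrow> complex"
  assumes f: "weighted A f" and g: "weighted B g"
  shows "norm (f (\<zeta> + \<eta>) * cnj (g \<zeta>)) \<le> A * B * weight \<zeta>"
    and "norm (f (\<zeta> + \<eta>) * cnj (g \<zeta>)) \<le> (A * B * 2 ^ (2 * DIM('a)) * weight \<eta>) * (weight (\<zeta> + \<eta>) + weight \<zeta>)"
    and "integrable lborel (\<lambda>\<zeta>. f (\<zeta> + \<eta>) * cnj (g \<zeta>))"
proof -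
  have A: "0 \<le> A" "0 \<le> B" using f g weighted_nonneg by auto
  have [measurable]: "f \<in> borel_measurable borel" "g \<in> borel_measurable borel"
    using f g weighted_measurable by auto
  show 1: "norm (f (\<zeta> + \<eta>) * cnj (g \<zeta>)) \<le> A * B * weight \<zeta>" for \<zeta> \<eta>
    using mult_mono[OF weighted_bound'[OF f] weighted_bound[OF g]] A by (simp add: norm_mult mult.assoc)
  have "norm (f (\<zeta> + \<eta>) * cnj (g \<zeta>)) \<le> (A * weight (\<zeta> + \<eta>)) * (B * weight (- \<zeta>))"
    using mult_mono[OF weighted_bound[OF f] weighted_bound[OF g]] A by (simp add: norm_mult)
  also have "\<dots> = (A * B) * (weight (\<zeta> + \<eta>) * weight (- \<zeta>))" by simp
  also have "\<dots> \<le> (A * B) * (2 ^ (2 * DIM('a)) * weight (\<zeta> + \<eta> + - \<zeta>) * (weight (\<zeta> + \<eta>) + weight (- \<zeta>)))"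
    using A by (intro mult_left_mono weight_mult_le) auto
  finally show "norm (f (\<zeta> + \<eta>) * cnj (g \<zeta>)) \<le> (A * B * 2 ^ (2 * DIM('a)) * weight \<eta>) * (weight (\<zeta> + \<eta>) + weight \<zeta>)"
    by (simp add: mult.assoc)
  show "integrable lborel (\<lambda>\<zeta>. f (\<zeta> + \<eta>) * cnj (g \<zeta>))"
    by (rule integrable_weight_bound[OF _ 1]) measurable
qed

lemma weighted_corr:
  fixes f g :: "'a::euclidean_space \<Rightarrow> complex"
  assumes f: "weighted A f" and g: "weighted B g"
  shows "weighted (A * B * corr_const TYPE('a)) (corr f g)"
  unfolding weighted_def
proof (intro conjI allI)
  show "corr f g \<in> borel_measurable borel"
    using f g weighted_measurable by (intro measurable_corr)
  fix \<eta> :: 'a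
  have i: "integrable lborel (\<lambda>\<zeta>. weight (\<zeta> + \<eta>) + weight (\<zeta>::'a))"
    using integrable_weight lborel_shift(1)[of weight \<eta>] by (intro Bochner_Integration.integrable_add) auto
  have "norm (corr f g \<eta>) \<le> (LINT \<zeta>|lborel. (A * B * 2 ^ (2 * DIM('a)) * weight \<eta>) * (weight (\<zeta> + \<eta>) + weight \<zeta>))"
    unfolding corr_def
    by (rule order_trans[OF integral_norm_bound integral_mono])
       (intro integrable_norm corr_integrand[OF f g] integrable_mult_right i)+
  also have "\<dots> = A * B * corr_const TYPE('a) * weight \<eta>"
    using integrable_weight[where 'a='a] lborel_shift[of "weight :: 'a \<Rightarrow> real" \<eta>]
    by (simp add: corr_const_def Bochner_Integration.integral_add)
  finally show "norm (corr f g \<eta>) \<le> A * B * corr_const TYPE('a) * weight \<eta>" .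
qed

lemma continuous_corr:
  fixes f g :: "'p::metric_space \<Rightarrow> 'a::euclidean_space \<Rightarrow> complex"
  assumes f: "weighted_family A f" and g: "weighted_family B g"
  shows "weighted_family (A * B * corr_const TYPE('a)) (\<lambda>p. corr (f p) (g p))"
  unfolding weighted_family_def
proof (intro conjI allI)
  show "norm (corr (f p) (g p) x) \<le> A * B * corr_const TYPE('a) * weight x" for p x
    using weighted_bound[OF weighted_corr] f g weighted_family_weighted by blast
  show "continuous_on UNIV (\<lambda>q. corr (f (fst q)) (g (fst q)) (snd q))"
    unfolding corr_def
  proof (rule continuous_LINT[where B="\<lambda>\<zeta>. A * B * weight \<zeta>"])
    fix q :: "'p \<times> 'a"
    show "(\<lambda>\<zeta>. f (fst q) (\<zeta> + snd q) * cnj (g (fst q) \<zeta>)) \<in> borel_measurable lborel"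
      using weighted_measurable[OF weighted_family_weighted[OF f]] weighted_measurable[OF weighted_family_weighted[OF g]]
      by measurable
    show "norm (f (fst q) (\<zeta> + snd q) * cnj (g (fst q) \<zeta>)) \<le> A * B * weight \<zeta>" for \<zeta>
      by (intro corr_integrand(1) weighted_family_weighted f g)
  next
    fix \<zeta> :: 'a
    show "continuous_on UNIV (\<lambda>q. f (fst q) (\<zeta> + snd q) * cnj (g (fst q) \<zeta>))"
      by (intro continuous_intros weighted_family_compose[OF f] weighted_family_compose[OF g])
  qed (use integrable_weight in auto)
qed

lemma corr_diff:
  fixes f g :: "'a::euclidean_space \<Rightarrow> complex"
  assumes f: "weighted A f" and f': "weighted A' f'" and g: "weighted B g" and g': "weighted B' g'"
  shows "corr f g \<eta> - corr f' g' \<eta> = corr (\<lambda>x. f x - f' x) g \<eta> + corr f' (\<lambda>x. g x - g' x) \<eta>"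
proof -
  note i = corr_integrand(3)
  have e: "f (\<zeta> + \<eta>) * cnj (g \<zeta>) - f' (\<zeta> + \<eta>) * cnj (g' \<zeta>)
      = (f (\<zeta> + \<eta>) - f' (\<zeta> + \<eta>)) * cnj (g \<zeta>) + f' (\<zeta> + \<eta>) * cnj (g \<zeta> - g' \<zeta>)" for \<zeta>
    by (simp add: left_diff_distrib right_diff_distrib)
  show ?thesis unfolding corr_def
    using i[OF f g, of \<eta>] i[OF f' g', of \<eta>] i[OF weighted_diff[OF f f'] g, of \<eta>] i[OF f' weighted_diff[OF g g'], of \<eta>]
    by (simp only: Bochner_Integration.integral_diff[symmetric] Bochner_Integration.integral_add[symmetric] e)
qed

lemma corr_scale: "corr (\<lambda>x. of_real c * f x) (\<lambda>x. of_real c * g x) \<eta> = of_real (c\<^sup>2) * corr f g \<eta>"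
  unfolding corr_def integral_mult_right_zero[symmetric]
  by (intro Bochner_Integration.integral_cong) (auto simp: power2_eq_square mult_ac)

context riesz_setting
begin

text \<open>
  Up to the constant \<^term>\<open>rc\<close>, the Fourier transform of the product of \<open>w\<close> with the Riesz
  potential of \<open>u * cnj v\<close>, when
  \<^term>\<open>f\<close>, \<^term>\<open>g\<close>, \<^term>\<open>h\<close> are the Fourier
  transforms of \<open>u\<close>, \<open>v\<close>, \<open>w\<close>.
\<close>

definition trilin :: "('a \<Rightarrow> complex) \<Rightarrow> ('a \<Rightarrow> complex) \<Rightarrow> ('a \<Rightarrow> complex) \<Rightarrow> 'a \<Rightarrow> complex" where
  "trilin f g h = conv (\<lambda>\<eta>. of_real (K \<eta>) * corr f g \<eta>) h"

definition trilin_const :: real where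
  "trilin_const = corr_const TYPE('a) * (2 ^ (2 * DIM('a)) *
     ((1 + 2 ^ (2 * DIM('a))) * (LINT \<eta>|lborel. K \<eta> * weight \<eta>) + (LINT x|lborel. weight (x::'a))))"

lemma LINT_K_weight_nonneg: "0 \<le> (LINT \<eta>|lborel. K \<eta> * weight \<eta>)"
  by (intro Bochner_Integration.integral_nonneg) simp

lemma trilin_const_nonneg: "0 \<le> trilin_const"
  unfolding trilin_const_def corr_const_def
  by (intro mult_nonneg_nonneg add_nonneg_nonneg LINT_weight_nonneg LINT_K_weight_nonneg) auto

lemma K_le_1: "1 \<le> norm \<eta> \<Longrightarrow> K \<eta> \<le> 1"
  unfolding riesz_def using gamma powr_mono[of "- (DIM('a) - \<gamma>)" 0 "norm \<eta>"]
  by (cases "\<eta> = 0") auto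

lemma weight_ge: "norm (\<eta>::'a) \<le> 1 \<Longrightarrow> 1 \<le> 2 ^ (2 * DIM('a)) * weight \<eta>"
  using weight_shift[of "- \<eta>" \<eta>] by (simp add: weight_def)

text \<open>
  The weighted sup norm survives the convolution with the singular kernel: after extracting the
  weight of the sum, the kernel meets either its own weight, or the other one. In the latter
  case it is at most 1 away from the unit ball, and inside the unit ball the weights are
  comparable to 1. Every term on the right is integrable, with an integral that does not depend
  on \<^term>\<open>\<xi>\<close>.
\<close>

lemma K_weight_conv:
  "K \<eta> * weight \<eta> * weight (\<xi> - \<eta>) \<le> (2 ^ (2 * DIM('a)) * weight \<xi>) * ((1 + 2 ^ (2 * DIM('a))) * (K \<eta> * weight \<eta>) + weight (\<xi> - \<eta>))"
proof -
  have "weight \<eta> * weight (\<xi> - \<eta>) \<le> 2 ^ (2 * DIM('a)) * weight \<xi> * (weight \<eta> + weight (\<xi> - \<eta>))"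
    using weight_mult_le[of \<eta> "\<xi> - \<eta>"] by simp
  then have "K \<eta> * (weight \<eta> * weight (\<xi> - \<eta>)) \<le> K \<eta> * (2 ^ (2 * DIM('a)) * weight \<xi> * (weight \<eta> + weight (\<xi> - \<eta>)))"
    by (rule mult_left_mono) simp
  also have "\<dots> = (2 ^ (2 * DIM('a)) * weight \<xi>) * (K \<eta> * weight \<eta> + K \<eta> * weight (\<xi> - \<eta>))"
    by (simp add: algebra_simps)
  also have "\<dots> \<le> (2 ^ (2 * DIM('a)) * weight \<xi>) * (K \<eta> * weight \<eta> + (2 ^ (2 * DIM('a)) * (K \<eta> * weight \<eta>) + weight (\<xi> - \<eta>)))"
  proof (intro mult_left_mono add_left_mono)
    show "K \<eta> * weight (\<xi> - \<eta>) \<le> 2 ^ (2 * DIM('a)) * (K \<eta> * weight \<eta>) + weight (\<xi> - \<eta>)"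
    proof (cases "norm \<eta> \<le> 1")
      case True
      have "K \<eta> * weight (\<xi> - \<eta>) \<le> K \<eta> * 1" by (intro mult_left_mono weight_le_1) simp
      also have "\<dots> \<le> K \<eta> * (2 ^ (2 * DIM('a)) * weight \<eta>)" by (intro mult_left_mono weight_ge True) simp
      finally show ?thesis by (simp add: mult_ac add_increasing2)
    next
      case False
      then have "K \<eta> * weight (\<xi> - \<eta>) \<le> 1 * weight (\<xi> - \<eta>)" by (intro mult_right_mono K_le_1) auto
      then show ?thesis by (simp add: add_increasing)
    qed
  qed simp
  finally show ?thesis by (simp add: algebra_simps)
qed

lemma trilin_integrand:
  assumes f: "weighted A f" and g: "weighted B g" and h: "weighted D h"
  shows "norm (of_real (K \<eta>) * corr f g \<eta> * h (\<xi> - \<eta>)) \<le> A * B * D * corr_const TYPE('a) * (K \<eta> * weight \<eta> * weight (\<xi> - \<eta>))"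
    and "norm (of_real (K \<eta>) * corr f g \<eta> * h (\<xi> - \<eta>)) \<le> A * B * D * corr_const TYPE('a) * (K \<eta> * weight \<eta>)"
    and "integrable lborel (\<lambda>\<eta>. of_real (K \<eta>) * corr f g \<eta> * h (\<xi> - \<eta>))"
proof -
  have [measurable]: "corr f g \<in> borel_measurable borel" "h \<in> borel_measurable borel"
    using weighted_measurable[OF weighted_corr[OF f g]] weighted_measurable[OF h] by auto
  have nn: "0 \<le> A * B * corr_const TYPE('a)" "0 \<le> D"
    using weighted_nonneg[OF weighted_corr[OF f g]] weighted_nonneg[OF h] by auto
  have "norm (of_real (K \<eta>) * corr f g \<eta> * h (\<xi> - \<eta>)) = K \<eta> * (norm (corr f g \<eta>) * norm (h (\<xi> - \<eta>)))" for \<eta>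
    by (simp add: norm_mult)
  also have "\<dots> \<eta> \<le> K \<eta> * ((A * B * corr_const TYPE('a) * weight \<eta>) * (D * weight (\<xi> - \<eta>)))" for \<eta>
    using nn by (intro mult_left_mono mult_mono weighted_bound[OF weighted_corr[OF f g]] weighted_bound[OF h]) auto
  finally show 1: "norm (of_real (K \<eta>) * corr f g \<eta> * h (\<xi> - \<eta>)) \<le> A * B * D * corr_const TYPE('a) * (K \<eta> * weight \<eta> * weight (\<xi> - \<eta>))" for \<eta>
    by (simp add: mult_ac)
  have "A * B * D * corr_const TYPE('a) * (K \<eta> * weight \<eta> * weight (\<xi> - \<eta>)) \<le> A * B * D * corr_const TYPE('a) * (K \<eta> * weight \<eta>)" for \<eta>
    using nn mult_nonneg_nonneg[OF nn] weight_le_1[of "\<xi> - \<eta>"]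
    by (intro mult_left_mono mult_left_le) (auto simp: mult_ac)
  with 1 show 2: "norm (of_real (K \<eta>) * corr f g \<eta> * h (\<xi> - \<eta>)) \<le> A * B * D * corr_const TYPE('a) * (K \<eta> * weight \<eta>)" for \<eta>
    using order_trans by blast
  show "integrable lborel (\<lambda>\<eta>. of_real (K \<eta>) * corr f g \<eta> * h (\<xi> - \<eta>))"
  proof (rule Bochner_Integration.integrable_bound)
    show "integrable lborel (\<lambda>\<eta>. A * B * D * corr_const TYPE('a) * (K \<eta> * weight \<eta>))"
      using integrable_K_weight by (intro integrable_mult_right)
    show "AE \<eta> in lborel. norm (of_real (K \<eta>) * corr f g \<eta> * h (\<xi> - \<eta>)) \<le> norm (A * B * D * corr_const TYPE('a) * (K \<eta> * weight \<eta>))"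
      by (intro AE_I2 order_trans[OF 2]) simp
  qed measurable
qed

lemma weighted_trilin:
  assumes f: "weighted A f" and g: "weighted B g" and h: "weighted D h"
  shows "weighted (A * B * D * trilin_const) (trilin f g h)"
  unfolding weighted_def
proof (intro conjI allI)
  have [measurable]: "corr f g \<in> borel_measurable borel" "h \<in> borel_measurable borel"
    using weighted_measurable[OF weighted_corr[OF f g]] weighted_measurable[OF h] by auto
  show "trilin f g h \<in> borel_measurable borel" unfolding trilin_def by measurable
  fix \<xi> :: 'a
  have nn: "0 \<le> A * B * D * corr_const TYPE('a)"
    using mult_nonneg_nonneg[OF weighted_nonneg[OF weighted_corr[OF f g]] weighted_nonneg[OF h]] by (simp add: mult_ac)
  let ?c = "A * B * D * corr_const TYPE('a) * (2 ^ (2 * DIM('a)) * weight \<xi>)"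
  let ?r = "\<lambda>\<eta>. (1 + 2 ^ (2 * DIM('a))) * (K \<eta> * weight \<eta>) + weight (\<xi> - \<eta>)"
  have ir: "integrable lborel ?r"
    using integrable_K_weight integrable_weight[where 'a='a] lborel_reflect(1)[of "weight::'a\<Rightarrow>real" \<xi>]
    by (intro Bochner_Integration.integrable_add integrable_mult_right) auto
  have le: "norm (of_real (K \<eta>) * corr f g \<eta> * h (\<xi> - \<eta>)) \<le> ?c * ?r \<eta>" for \<eta>
    using order_trans[OF trilin_integrand(1)[OF f g h] mult_left_mono[OF K_weight_conv nn]] by (simp add: mult.assoc)
  have "norm (trilin f g h \<xi>) \<le> (LINT \<eta>|lborel. ?c * ?r \<eta>)"
    unfolding trilin_def conv_def
    by (rule order_trans[OF integral_norm_bound integral_mono])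
       (intro integrable_norm trilin_integrand[OF f g h] integrable_mult_right ir le)+
  also have "\<dots> = A * B * D * trilin_const * weight \<xi>"
    using integrable_K_weight integrable_weight[where 'a='a] lborel_reflect[of "weight::'a\<Rightarrow>real" \<xi>]
    by (simp add: trilin_const_def)
  finally show "norm (trilin f g h \<xi>) \<le> A * B * D * trilin_const * weight \<xi>" .
qed

lemma weighted_family_trilin:
  fixes f g h :: "'p::metric_space \<Rightarrow> 'a \<Rightarrow> complex"
  assumes f: "weighted_family A f" and g: "weighted_family B g" and h: "weighted_family D h"
  shows "weighted_family (A * B * D * trilin_const) (\<lambda>p. trilin (f p) (g p) (h p))"
  unfolding weighted_family_def
proof (intro conjI allI)
  note w = weighted_family_weighted
  show "norm (trilin (f p) (g p) (h p) x) \<le> A * B * D * trilin_const * weight x" for p x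
    by (intro weighted_bound[OF weighted_trilin] w f g h)
  show "continuous_on UNIV (\<lambda>q. trilin (f (fst q)) (g (fst q)) (h (fst q)) (snd q))"
    unfolding trilin_def conv_def
  proof (rule continuous_LINT[where B="\<lambda>\<eta>. A * B * D * corr_const TYPE('a) * (K \<eta> * weight \<eta>)"])
    fix q :: "'p \<times> 'a"
    have [measurable]: "corr (f (fst q)) (g (fst q)) \<in> borel_measurable borel" "h (fst q) \<in> borel_measurable borel"
      using weighted_measurable[OF weighted_corr[OF w[OF f] w[OF g]]] weighted_measurable[OF w[OF h]] by auto
    show "(\<lambda>\<eta>. of_real (K \<eta>) * corr (f (fst q)) (g (fst q)) \<eta> * h (fst q) (snd q - \<eta>)) \<in> borel_measurable lborel"
      by measurable
    show "norm (of_real (K \<eta>) * corr (f (fst q)) (g (fst q)) \<eta> * h (fst q) (snd q - \<eta>)) \<le> A * B * D * corr_const TYPE('a) * (K \<eta> * weight \<eta>)" for \<eta>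
      by (intro trilin_integrand(2) w f g h)
  next
    fix \<eta> :: 'a
    show "continuous_on UNIV (\<lambda>q. of_real (K \<eta>) * corr (f (fst q)) (g (fst q)) \<eta> * h (fst q) (snd q - \<eta>))"
      by (intro continuous_intros weighted_family_compose[OF h] weighted_family_compose[OF continuous_corr[OF f g]])
  qed (use integrable_K_weight in auto)
qed

lemma trilin_diff:
  assumes f: "weighted A f" and f': "weighted A' f'" and g: "weighted B g" and g': "weighted B' g'"
    and h: "weighted D h" and h': "weighted D' h'"
  shows "trilin f g h \<xi> - trilin f' g' h' \<xi> =
    trilin (\<lambda>x. f x - f' x) g h \<xi> + trilin f' (\<lambda>x. g x - g' x) h \<xi> + trilin f' g' (\<lambda>x. h x - h' x) \<xi>"
proof -
  note i = trilin_integrand(3)[of _ _ _ _ _ _ \<xi>]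
  note d = weighted_diff[OF f f'] weighted_diff[OF g g'] weighted_diff[OF h h']
  have e: "of_real (K \<eta>) * corr f g \<eta> * h (\<xi> - \<eta>) - of_real (K \<eta>) * corr f' g' \<eta> * h' (\<xi> - \<eta>)
      = of_real (K \<eta>) * corr (\<lambda>x. f x - f' x) g \<eta> * h (\<xi> - \<eta>) + of_real (K \<eta>) * corr f' (\<lambda>x. g x - g' x) \<eta> * h (\<xi> - \<eta>)
        + of_real (K \<eta>) * corr f' g' \<eta> * (h (\<xi> - \<eta>) - h' (\<xi> - \<eta>))" for \<eta>
  proof -
    have *: "corr f g \<eta> = corr f' g' \<eta> + (corr (\<lambda>x. f x - f' x) g \<eta> + corr f' (\<lambda>x. g x - g' x) \<eta>)"
      using corr_diff[OF f f' g g', of \<eta>] by (simp add: algebra_simps)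
    show ?thesis unfolding * by (simp add: algebra_simps)
  qed
  show ?thesis unfolding trilin_def conv_def
    using i[OF f g h] i[OF f' g' h'] i[OF d(1) g h] i[OF f' d(2) h] i[OF f' g' d(3)]
    by (simp only: Bochner_Integration.integral_diff[symmetric] Bochner_Integration.integral_add[symmetric] Bochner_Integration.integrable_add e)
qed

lemma trilin_lipschitz:
  assumes f: "weighted R f" and f': "weighted R f'" and g: "weighted R g" and g': "weighted R g'"
    and h: "weighted R h" and h': "weighted R h'"
    and df: "weighted \<delta> (\<lambda>x. f x - f' x)" and dg: "weighted \<delta> (\<lambda>x. g x - g' x)" and dh: "weighted \<delta> (\<lambda>x. h x - h' x)"
  shows "norm (trilin f g h \<xi> - trilin f' g' h' \<xi>) \<le> 3 * R\<^sup>2 * \<delta> * trilin_const * weight \<xi>"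
proof -
  have "norm (trilin f g h \<xi> - trilin f' g' h' \<xi>) \<le> \<delta> * R * R * trilin_const * weight \<xi> + R * \<delta> * R * trilin_const * weight \<xi> + R * R * \<delta> * trilin_const * weight \<xi>"
    unfolding trilin_diff[OF f f' g g' h h']
    by (intro norm_triangle_le add_mono weighted_bound weighted_trilin df dg dh f f' g g' h h')
  then show ?thesis by (simp add: power2_eq_square algebra_simps)
qed

lemma trilin_scale:
  "trilin (\<lambda>x. of_real c * f x) (\<lambda>x. of_real c * g x) (\<lambda>x. of_real c * h x) \<xi> = of_real (c ^ 3) * trilin f g h \<xi>"
  unfolding trilin_def conv_def corr_scale integral_mult_right_zero[symmetric]
  by (intro Bochner_Integration.integral_cong) (auto simp: power2_eq_square power3_eq_cube mult_ac)

section \<open>The nonlinearity on the Fourier side\<close>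

text \<open>
  The coefficient \<^term>\<open>\<sigma>\<close> is 1 or 0 according to the presence of the exchange term.
\<close>

definition nonlin :: "real \<Rightarrow> real \<Rightarrow> ('n::finite \<Rightarrow> 'a \<Rightarrow> complex) \<Rightarrow> 'n \<Rightarrow> 'a \<Rightarrow> complex" where
  "nonlin \<kappa> \<sigma> f k \<xi> = of_real \<kappa> * ((\<Sum>l\<in>UNIV. trilin (f l) (f l) (f k) \<xi>) - of_real \<sigma> * (\<Sum>l\<in>UNIV. trilin (f k) (f l) (f l) \<xi>))"

definition nonlin_const :: "real \<Rightarrow> 'n::finite itself \<Rightarrow> real" where
  "nonlin_const \<kappa> _ = \<bar>\<kappa>\<bar> * (2 * CARD('n) * trilin_const)"

lemma nonlin_const_nonneg: "0 \<le> nonlin_const \<kappa> TYPE('n::finite)"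
  unfolding nonlin_const_def using trilin_const_nonneg by simp

lemma norm_sum_diff_le:
  fixes u v :: "'n::finite \<Rightarrow> complex" and \<kappa> \<sigma> c :: real
  assumes "\<And>l. norm (u l) \<le> c" "\<And>l. norm (v l) \<le> c" "\<bar>\<sigma>\<bar> \<le> 1"
  shows "norm (of_real \<kappa> * (sum u UNIV - of_real \<sigma> * sum v UNIV)) \<le> \<bar>\<kappa>\<bar> * (2 * CARD('n) * c)"
proof -
  have u: "norm (sum u UNIV) \<le> CARD('n) * c" by (rule sum_norm_le[THEN order_trans]) (use assms in \<open>auto intro!: sum_bounded_above[THEN order_trans]\<close>)
  have v: "norm (sum v UNIV) \<le> CARD('n) * c" by (rule sum_norm_le[THEN order_trans]) (use assms in \<open>auto intro!: sum_bounded_above[THEN order_trans]\<close>)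
  have "norm (of_real \<sigma> * sum v UNIV) \<le> norm (sum v UNIV)"
    using assms(3) by (simp add: norm_mult mult_left_le_one_le)
  then have "norm (sum u UNIV - of_real \<sigma> * sum v UNIV) \<le> 2 * CARD('n) * c"
    using u v norm_triangle_ineq4[of "sum u UNIV" "of_real \<sigma> * sum v UNIV"] by linarith
  then show ?thesis unfolding norm_mult norm_of_real by (rule mult_left_mono) simp
qed

lemma weighted_family_nonlin:
  fixes f :: "'n::finite \<Rightarrow> 'p::metric_space \<Rightarrow> 'a \<Rightarrow> complex"
  assumes f: "\<And>l. weighted_family R (f l)" and s: "\<bar>\<sigma>\<bar> \<le> 1"
  shows "weighted_family (nonlin_const \<kappa> TYPE('n) * R ^ 3) (\<lambda>p. nonlin \<kappa> \<sigma> (\<lambda>l. f l p) k)"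
  unfolding weighted_family_def
proof (intro conjI allI)
  note t = weighted_family_trilin[OF f f f]
  show "continuous_on UNIV (\<lambda>q. nonlin \<kappa> \<sigma> (\<lambda>l. f l (fst q)) k (snd q))"
    unfolding nonlin_def using t unfolding weighted_family_def by (intro continuous_intros) auto
  fix p x
  have "norm (nonlin \<kappa> \<sigma> (\<lambda>l. f l p) k x) \<le> \<bar>\<kappa>\<bar> * (2 * CARD('n) * (R * R * R * trilin_const * weight x))"
    unfolding nonlin_def using t unfolding weighted_family_def by (intro norm_sum_diff_le s) auto
  then show "norm (nonlin \<kappa> \<sigma> (\<lambda>l. f l p) k x) \<le> nonlin_const \<kappa> TYPE('n) * R ^ 3 * weight x"
    by (simp add: nonlin_const_def power3_eq_cube mult_ac)
qed

lemma nonlin_lipschitz: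
  fixes f f' :: "'n::finite \<Rightarrow> 'a \<Rightarrow> complex"
  assumes f: "\<And>l. weighted R (f l)" and f': "\<And>l. weighted R (f' l)" and s: "\<bar>\<sigma>\<bar> \<le> 1"
    and d: "\<And>l. weighted \<delta> (\<lambda>x. f l x - f' l x)"
  shows "norm (nonlin \<kappa> \<sigma> f k \<xi> - nonlin \<kappa> \<sigma> f' k \<xi>) \<le> nonlin_const \<kappa> TYPE('n) * (3 * R\<^sup>2 * \<delta>) * weight \<xi>"
proof -
  have "nonlin \<kappa> \<sigma> f k \<xi> - nonlin \<kappa> \<sigma> f' k \<xi>
      = of_real \<kappa> * ((\<Sum>l\<in>UNIV. trilin (f l) (f l) (f k) \<xi> - trilin (f' l) (f' l) (f' k) \<xi>)
          - of_real \<sigma> * (\<Sum>l\<in>UNIV. trilin (f k) (f l) (f l) \<xi> - trilin (f' k) (f' l) (f' l) \<xi>))"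
    unfolding nonlin_def by (simp add: sum_subtractf algebra_simps)
  also have "norm \<dots> \<le> \<bar>\<kappa>\<bar> * (2 * CARD('n) * (3 * R\<^sup>2 * \<delta> * trilin_const * weight \<xi>))"
    by (intro norm_sum_diff_le s trilin_lipschitz f f' d)
  finally show ?thesis by (simp add: nonlin_const_def mult_ac)
qed

lemma nonlin_scale:
  "nonlin \<kappa> \<sigma> (\<lambda>l x. of_real c * f l x) k \<xi> = of_real (c ^ 3) * nonlin \<kappa> \<sigma> f k \<xi>"
  unfolding nonlin_def trilin_scale by (simp add: sum_distrib_left[symmetric] algebra_simps)

end

section \<open>The Duhamel integral\<close>

lemma integrable_indicator_Icc [simp]: "integrable lborel (indicat_real {a..b::real})"
  by (rule integrable_real_indicator) (auto simp: emeasure_lborel_Icc_eq)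

text \<open>
  The symbol of the free evolution, for a dispersion relation \<^term>\<open>m\<close>.
\<close>

definition phase :: "('a::euclidean_space \<Rightarrow> real) \<Rightarrow> real \<Rightarrow> 'a \<Rightarrow> complex" where
  "phase m s \<xi> = cis (- (m \<xi> * s))"

lemma norm_phase [simp]: "norm (phase m s \<xi>) = 1" by (simp add: phase_def)

lemma continuous_phase:
  assumes "continuous_on UNIV m" "continuous_on UNIV s" "continuous_on UNIV x"
  shows "continuous_on UNIV (\<lambda>z. phase m (s z) (x z))"
  unfolding phase_def
  by (intro continuous_intros assms continuous_on_compose2[OF assms(1) assms(3)]) auto

definition duh :: "('a::euclidean_space \<Rightarrow> real) \<Rightarrow> (real \<Rightarrow> 'a \<Rightarrow> complex) \<Rightarrow> real \<Rightarrow> 'a \<Rightarrow> complex" where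
  "duh m q t \<xi> = (LINT \<tau>|lborel. indicator {0..t} \<tau> *\<^sub>R (phase m (t - \<tau>) \<xi> * q \<tau> \<xi>))"

lemma duh_integrand:
  fixes q :: "real \<Rightarrow> 'a::euclidean_space \<Rightarrow> complex"
  assumes m: "continuous_on UNIV m" and q: "weighted_family C q" and t: "t \<le> T"
  shows "(\<lambda>\<tau>. indicator {0..t} \<tau> *\<^sub>R (phase m (t - \<tau>) \<xi> * q \<tau> \<xi>)) \<in> borel_measurable borel"
    and "norm (indicator {0..t} \<tau> *\<^sub>R (phase m (t - \<tau>) \<xi> * q \<tau> \<xi>)) \<le> indicator {0..T} \<tau> * (C * weight \<xi>)"
    and "integrable lborel (\<lambda>\<tau>. indicator {0..t} \<tau> *\<^sub>R (phase m (t - \<tau>) \<xi> * q \<tau> \<xi>))"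
proof -
  have "continuous_on UNIV (\<lambda>\<tau>. phase m (t - \<tau>) \<xi> * q \<tau> \<xi>)"
    by (intro continuous_intros continuous_phase m weighted_family_compose[OF q])
  then have [measurable]: "(\<lambda>\<tau>. phase m (t - \<tau>) \<xi> * q \<tau> \<xi>) \<in> borel_measurable borel"
    by (rule borel_measurable_continuous)
  show 1: "(\<lambda>\<tau>. indicator {0..t} \<tau> *\<^sub>R (phase m (t - \<tau>) \<xi> * q \<tau> \<xi>)) \<in> borel_measurable borel"
    by measurable
  show 2: "norm (indicator {0..t} \<tau> *\<^sub>R (phase m (t - \<tau>) \<xi> * q \<tau> \<xi>)) \<le> indicator {0..T} \<tau> * (C * weight \<xi>)" for \<tau>
    using q t weighted_family_nonneg[OF q] unfolding weighted_family_def by (auto simp: indicator_def norm_mult)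
  show "integrable lborel (\<lambda>\<tau>. indicator {0..t} \<tau> *\<^sub>R (phase m (t - \<tau>) \<xi> * q \<tau> \<xi>))"
  proof (rule Bochner_Integration.integrable_bound)
    show "integrable lborel (\<lambda>\<tau>. indicator {0..T} \<tau> * (C * weight \<xi>))" by (intro integrable_mult_left) simp
    show "AE \<tau> in lborel. norm (indicator {0..t} \<tau> *\<^sub>R (phase m (t - \<tau>) \<xi> * q \<tau> \<xi>)) \<le> norm (indicator {0..T} \<tau> * (C * weight \<xi>))"
      by (intro AE_I2 order_trans[OF 2]) simp
  qed (use 1 in simp)
qed

lemma duh_bound:
  fixes q :: "real \<Rightarrow> 'a::euclidean_space \<Rightarrow> complex"
  assumes m: "continuous_on UNIV m" and q: "weighted_family C q" and t: "t \<le> T" "0 \<le> T"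
  shows "norm (duh m q t \<xi>) \<le> T * C * weight \<xi>"
proof -
  note i = duh_integrand[OF m q t(1)]
  have "norm (duh m q t \<xi>) \<le> (LINT \<tau>|lborel. indicator {0..T} \<tau> * (C * weight \<xi>))"
    unfolding duh_def
    by (rule order_trans[OF integral_norm_bound integral_mono])
       (intro integrable_norm i integrable_mult_left integrable_indicator_Icc)+
  also have "\<dots> = T * C * weight \<xi>" using t(2) by simp
  finally show ?thesis .
qed

text \<open>The time is clamped to the interval, so that the integral becomes a bounded function on all times.\<close>

lemma weighted_family_duh:
  fixes q :: "real \<Rightarrow> 'a::euclidean_space \<Rightarrow> complex"
  assumes m: "continuous_on UNIV m" and q: "weighted_family C q" and T: "0 \<le> T"
  shows "weighted_family (T * C) (\<lambda>s. duh m q (max 0 (min T s)))"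
  unfolding weighted_family_def
proof (intro conjI allI)
  let ?c = "\<lambda>s. max 0 (min T s)"
  show "norm (duh m q (?c s) \<xi>) \<le> T * C * weight \<xi>" for s \<xi>
    by (rule duh_bound[OF m q]) (use T in auto)
  show "continuous_on UNIV (\<lambda>z. duh m q (?c (fst z)) (snd z))"
    unfolding continuous_on_eq_continuous_at[OF open_UNIV]
  proof
    fix z0 :: "real \<times> 'a"
    show "isCont (\<lambda>z. duh m q (?c (fst z)) (snd z)) z0"
      unfolding duh_def
    proof (rule isCont_LINT[where B="\<lambda>\<tau>. indicator {0..T} \<tau> * C"])
      show "(\<lambda>\<tau>. indicator {0..?c (fst z)} \<tau> *\<^sub>R (phase m (?c (fst z) - \<tau>) (snd z) * q \<tau> (snd z))) \<in> borel_measurable lborel" for z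
        using duh_integrand(1)[OF m q, of "?c (fst z)" T] T by simp
      show "AE \<tau> in lborel. norm (indicator {0..?c (fst z)} \<tau> *\<^sub>R (phase m (?c (fst z) - \<tau>) (snd z) * q \<tau> (snd z))) \<le> indicator {0..T} \<tau> * C" for z
      proof (intro AE_I2)
        fix \<tau> :: real
        have "norm (indicator {0..?c (fst z)} \<tau> *\<^sub>R (phase m (?c (fst z) - \<tau>) (snd z) * q \<tau> (snd z))) \<le> indicator {0..T} \<tau> * (C * weight (snd z))"
          by (rule duh_integrand(2)[OF m q]) (use T in auto)
        also have "\<dots> \<le> indicator {0..T} \<tau> * C"
          using weighted_family_nonneg[OF q] weight_le_1 by (intro mult_left_mono mult_left_le) auto
        finally show "norm (indicator {0..?c (fst z)} \<tau> *\<^sub>R (phase m (?c (fst z) - \<tau>) (snd z) * q \<tau> (snd z))) \<le> indicator {0..T} \<tau> * C" .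
      qed
      show "integrable lborel (\<lambda>\<tau>. indicator {0..T} \<tau> * C)" by (intro integrable_mult_left) simp
      show "AE \<tau> in lborel. isCont (\<lambda>z. indicator {0..?c (fst z)} \<tau> *\<^sub>R (phase m (?c (fst z) - \<tau>) (snd z) * q \<tau> (snd z))) z0"
        using AE_lborel_singleton[of "?c (fst z0)"]
      proof eventually_elim
        case (elim \<tau>)
        have cc: "continuous_on UNIV (\<lambda>z::real \<times> 'a. ?c (fst z))" by (intro continuous_intros)
        have "isCont (\<lambda>z. phase m (?c (fst z) - \<tau>) (snd z) * q \<tau> (snd z)) z0"
        proof -
          have "continuous_on UNIV (\<lambda>z. phase m (?c (fst z) - \<tau>) (snd z) * q \<tau> (snd z))"
            by (intro continuous_intros continuous_phase m weighted_family_compose[OF q])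
          then show ?thesis by (rule continuous_on_interior) simp
        qed
        moreover have "isCont (\<lambda>z. indicat_real {0..?c (fst z)} \<tau>) z0"
        proof -
          have "isCont (indicat_real {\<tau>..}) (?c (fst z0))"
            using elim by (subst isCont_indicator) (auto simp: frontier_def)
          moreover have "isCont (\<lambda>z::real \<times> 'a. ?c (fst z)) z0"
            using cc by (rule continuous_on_interior) simp
          ultimately have "isCont (\<lambda>z. indicat_real {\<tau>..} (?c (fst z))) z0"
            by (rule isCont_o2[rotated])
          then have "isCont (\<lambda>z. indicat_real {0..} \<tau> * indicat_real {\<tau>..} (?c (fst z))) z0"
            by (intro continuous_intros)
          moreover have "indicat_real {0..?c (fst z)} \<tau> = indicat_real {0..} \<tau> * indicat_real {\<tau>..} (?c (fst z))" for z :: "real \<times> 'a"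
            by (auto simp: indicator_def)
          ultimately show ?thesis by simp
        qed
        ultimately show ?case by (intro continuous_scaleR)
      qed
    qed
  qed
qed

lemma duh_diff:
  assumes m: "continuous_on UNIV m" and q: "weighted_family C q" and q': "weighted_family C' q'"
    and d: "\<And>\<tau> \<xi>. norm (q \<tau> \<xi> - q' \<tau> \<xi>) \<le> D * weight \<xi>" and t: "0 \<le> t" "t \<le> T"
  shows "norm (duh m q t \<xi> - duh m q' t \<xi>) \<le> T * D * weight \<xi>"
proof -
  have "weighted_family D (\<lambda>\<tau> \<xi>. q \<tau> \<xi> - q' \<tau> \<xi>)"
    using q q' d unfolding weighted_family_def by (auto intro!: continuous_intros)
  from duh_bound[OF m this t(2)] t
  have "norm (duh m (\<lambda>\<tau> \<xi>. q \<tau> \<xi> - q' \<tau> \<xi>) t \<xi>) \<le> T * D * weight \<xi>" by simp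
  moreover have "duh m (\<lambda>\<tau> \<xi>. q \<tau> \<xi> - q' \<tau> \<xi>) t \<xi> = duh m q t \<xi> - duh m q' t \<xi>"
    unfolding duh_def using duh_integrand(3)[OF m q t(2)] duh_integrand(3)[OF m q' t(2)]
    by (simp add: right_diff_distrib scaleR_diff_right)
  ultimately show ?thesis by simp
qed

section \<open>Small solutions by contraction\<close>

lemma duh_cong: "(\<And>\<tau>. \<tau> \<in> {0..t} \<Longrightarrow> q \<tau> \<xi> = q' \<tau> \<xi>) \<Longrightarrow> duh m q t \<xi> = duh m q' t \<xi>"
  unfolding duh_def by (intro Bochner_Integration.integral_cong) (auto simp: indicator_def)

lemma duh_mult: "duh m (\<lambda>\<tau> \<xi>. c * q \<tau> \<xi>) t \<xi> = c * duh m q t \<xi>"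
  unfolding duh_def integral_mult_right_zero[symmetric]
  by (intro Bochner_Integration.integral_cong) auto

lemma norm_vec_le:
  fixes v :: "complex ^ 'n::finite" and c :: real
  assumes "\<And>k. norm (v $ k) \<le> c"
  shows "norm v \<le> CARD('n) * c"
proof -
  have "norm v \<le> (\<Sum>k\<in>UNIV. norm (v $ k))" unfolding norm_vec_def by (rule L2_set_le_sum) simp
  also have "\<dots> \<le> (\<Sum>k\<in>(UNIV::'n set). c)" by (intro sum_mono assms)
  finally show ?thesis by simp
qed

lemma weighted_family_mono: "weighted_family C f \<Longrightarrow> C \<le> D \<Longrightarrow> weighted_family D f"
  unfolding weighted_family_def by (meson mult_right_mono order_trans weight_nonneg)

lemma weighted_family_add:
  "weighted_family C f \<Longrightarrow> weighted_family D g \<Longrightarrow> weighted_family (C + D) (\<lambda>p x. f p x + g p x)"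
  unfolding weighted_family_def
  by (auto simp: distrib_right intro!: continuous_intros order_trans[OF norm_triangle_ineq] add_mono)

lemma weighted_family_diff:
  "weighted_family C f \<Longrightarrow> weighted_family D g \<Longrightarrow> weighted_family (C + D) (\<lambda>p x. f p x - g p x)"
  unfolding weighted_family_def
  by (auto simp: distrib_right intro!: continuous_intros order_trans[OF norm_triangle_ineq4] add_mono)

lemma weighted_family_mult:
  "weighted_family C f \<Longrightarrow> weighted_family (norm c * C) (\<lambda>p x. c * f p x)"
  unfolding weighted_family_def
  by (auto simp: norm_mult mult.assoc intro!: continuous_intros mult_left_mono)

lemma weighted_family_phase:
  fixes s :: "'p::metric_space \<Rightarrow> real"
  assumes m: "continuous_on UNIV m" and s: "continuous_on UNIV s" and f: "weighted_family C f"
  shows "weighted_family C (\<lambda>p x. phase m (s p) x * f p x)"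
  unfolding weighted_family_def
proof (intro conjI allI)
  show "continuous_on UNIV (\<lambda>q. phase m (s (fst q)) (snd q) * f (fst q) (snd q))"
    using f unfolding weighted_family_def
    by (intro continuous_intros continuous_phase m continuous_on_compose2[OF s]) auto
  show "norm (phase m (s p) x * f p x) \<le> C * weight x" for p x
    using f unfolding weighted_family_def by (simp add: norm_mult)
qed

lemma weighted_family_const:
  "continuous_on UNIV f \<Longrightarrow> (\<And>x. norm (f x) \<le> C * weight x) \<Longrightarrow> weighted_family C (\<lambda>p. f)"
  unfolding weighted_family_def
  by (intro conjI allI continuous_on_compose2[of UNIV f UNIV snd]) (auto intro: continuous_on_snd continuous_on_id)

context riesz_setting
begin

text \<open>
  The weighted sup norm turns the Duhamel equation into a fixed point problem in the Banach
  space of bounded continuous functions of time and frequency, in which the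
  nonlinearity is a bounded cubic form. Data of size \<^term>\<open>\<epsilon>\<close> give a solution of size
  \<^term>\<open>\<epsilon>\<close>; one Picard step after another yields the linear part, the cubic part, and an error
  of fifth order.
\<close>

theorem small_solution:
  fixes a :: "'n::finite \<Rightarrow> 'a \<Rightarrow> complex"
  assumes m: "continuous_on UNIV m" and a: "\<And>k. continuous_on UNIV (a k)" "\<And>k x. norm (a k x) \<le> M * weight x"
    and T: "0 \<le> T" and s: "\<bar>\<sigma>\<bar> \<le> 1"
  shows "\<exists>\<epsilon>0>0. \<exists>C. \<forall>\<epsilon>. \<bar>\<epsilon>\<bar> < \<epsilon>0 \<longrightarrow> (\<exists>R f. (\<forall>k. weighted_family R (f k)) \<and>
    (\<forall>k. \<forall>t\<in>{0..T}. \<forall>\<xi>. f k t \<xi> = of_real \<epsilon> * (phase m t \<xi> * a k \<xi>)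
        + \<i> * duh m (\<lambda>\<tau>. nonlin \<kappa> \<sigma> (\<lambda>l. f l \<tau>) k) t \<xi>) \<and>
    (\<forall>k. \<forall>t\<in>{0..T}. \<forall>\<xi>. norm (f k t \<xi> - (of_real \<epsilon> * (phase m t \<xi> * a k \<xi>)
        + of_real (\<epsilon> ^ 3) * (\<i> * duh m (\<lambda>\<tau>. nonlin \<kappa> \<sigma> (\<lambda>l \<xi>. phase m \<tau> \<xi> * a l \<xi>) k) t \<xi>))) \<le> C * \<bar>\<epsilon>\<bar> ^ 5 * weight \<xi>))"
proof -
  define n where "n = real CARD('n)"
  have n: "1 \<le> n" unfolding n_def by (simp add: Suc_leI)
  define L where "L = nonlin_const \<kappa> TYPE('n)"
  have L: "0 \<le> L" unfolding L_def by (rule nonlin_const_nonneg)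
  have M: "0 \<le> M" using weighted_family_nonneg[OF weighted_family_const[OF a, of undefined]] .
  \<comment> \<open>Solutions are sought in the ball of radius \<open>N |\<epsilon>|\<close>,
      twice the size of the free evolution; \<open>B\<close> times the square of
      \<open>\<epsilon>\<close> bounds the Lipschitz constant of the nonlinear
      part on this ball.\<close>
  define N where "N = 2 * n * M"
  define B where "B = 6 * n * T * L * N\<^sup>2"
  have N: "0 \<le> N" and B: "0 \<le> B" using n M T L by (auto simp: N_def B_def)
  define c where "c = (\<lambda>t. max 0 (min T t))"
  have cc: "continuous_on UNIV c" unfolding c_def by (intro continuous_intros)
  have cT: "0 \<le> c t" "c t \<le> T" for t using T by (auto simp: c_def)
  have c_id: "c t = t" if "t \<in> {0..T}" for t using that by (simp add: c_def)
  define \<phi> where "\<phi> k t \<xi> = phase m (c t) \<xi> * a k \<xi>" for k t \<xi>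
  have \<phi>: "weighted_family M (\<phi> k)" for k
    unfolding \<phi>_def by (intro weighted_family_phase m cc weighted_family_const a)
  have main: "\<exists>R f. (\<forall>k. weighted_family R (f k)) \<and>
    (\<forall>k. \<forall>t\<in>{0..T}. \<forall>\<xi>. f k t \<xi> = of_real \<epsilon> * (phase m t \<xi> * a k \<xi>)
        + \<i> * duh m (\<lambda>\<tau>. nonlin \<kappa> \<sigma> (\<lambda>l. f l \<tau>) k) t \<xi>) \<and>
    (\<forall>k. \<forall>t\<in>{0..T}. \<forall>\<xi>. norm (f k t \<xi> - (of_real \<epsilon> * (phase m t \<xi> * a k \<xi>)
        + of_real (\<epsilon> ^ 3) * (\<i> * duh m (\<lambda>\<tau>. nonlin \<kappa> \<sigma> (\<lambda>l \<xi>. phase m \<tau> \<xi> * a l \<xi>) k) t \<xi>))) \<le> (3 * T\<^sup>2 * L\<^sup>2 * N ^ 5) * \<bar>\<epsilon>\<bar> ^ 5 * weight \<xi>)"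
    if eps: "\<bar>\<epsilon>\<bar> < 1 / (B + 1)" for \<epsilon>
  proof -
    define R where "R = N * \<bar>\<epsilon>\<bar>"
    have R: "0 \<le> R" using N by (simp add: R_def)
    have e1: "\<bar>\<epsilon>\<bar> * (B + 1) < 1" using eps B by (simp add: pos_less_divide_eq)
    have "6 * n * T * L * R\<^sup>2 = B * \<bar>\<epsilon>\<bar> * \<bar>\<epsilon>\<bar>" by (simp add: B_def R_def power_mult_distrib power2_eq_square)
    also have "\<dots> \<le> 1 * 1"
    proof (intro mult_mono)
      show "B * \<bar>\<epsilon>\<bar> \<le> 1" using e1 by (simp add: distrib_left mult.commute)
      have "\<bar>\<epsilon>\<bar> \<le> \<bar>\<epsilon>\<bar> * (B + 1)" using B by (simp add: distrib_left)
      then show "\<bar>\<epsilon>\<bar> \<le> 1" using e1 by linarith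
    qed auto
    finally have small: "6 * n * T * L * R\<^sup>2 \<le> 1" by simp
    have Meps: "n * (\<bar>\<epsilon>\<bar> * M) = R / 2" by (simp add: R_def N_def)
    \<comment> \<open>Bounded continuous functions represent families bounded by the weight
        after division by the weight.\<close>
    define unpack where "unpack F k t \<xi> = of_real (weight \<xi>) * (apply_bcontfun F (t, \<xi>) $ k)"
      for F :: "(real \<times> 'a) \<Rightarrow>\<^sub>C (complex ^ 'n)" and k t \<xi>
    have unpack_bound: "norm (unpack F k t \<xi>) \<le> norm F * weight \<xi>" for F k t \<xi>
    proof -
      have "norm (apply_bcontfun F (t, \<xi>) $ k) \<le> norm F"
        using norm_bounded[of F "(t, \<xi>)"] Finite_Cartesian_Product.norm_nth_le[of "apply_bcontfun F (t, \<xi>)" k] by linarith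
      from mult_right_mono[OF this weight_nonneg] show ?thesis
        by (simp only: unpack_def norm_mult norm_of_real abs_of_nonneg[OF weight_nonneg] mult.commute[of _ "norm (_ $ k)"])
    qed
    have unpack: "weighted_family (norm F) (unpack F k)" for F k
      unfolding weighted_family_def
    proof (intro conjI allI unpack_bound)
      have "continuous_on UNIV (\<lambda>q. of_real (weight (snd q)) * (apply_bcontfun F q $ k))"
        by (intro continuous_intros continuous_on_compose2[OF continuous_weight] continuous_on_component) auto
      then show "continuous_on UNIV (\<lambda>q. unpack F k (fst q) (snd q))" by (simp add: unpack_def)
    qed
    define \<Psi> where "\<Psi> F k t \<xi> = of_real \<epsilon> * \<phi> k t \<xi> + \<i> * duh m (\<lambda>\<tau>. nonlin \<kappa> \<sigma> (\<lambda>l. unpack F l \<tau>) k) (c t) \<xi>"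
      for F k t \<xi>
    have nl: "weighted_family (L * norm F ^ 3) (\<lambda>\<tau>. nonlin \<kappa> \<sigma> (\<lambda>l. unpack F l \<tau>) k)" for F k
      unfolding L_def by (intro weighted_family_nonlin unpack s)
    have \<Psi>: "weighted_family (\<bar>\<epsilon>\<bar> * M + T * (L * norm F ^ 3)) (\<Psi> F k)" for F k
      using weighted_family_add[OF weighted_family_mult[OF \<phi>, of "of_real \<epsilon>"] weighted_family_mult[OF weighted_family_duh[OF m nl T], of \<i>]]
      by (simp add: \<Psi>_def[abs_def] c_def)
    define \<Phi> :: "((real \<times> 'a) \<Rightarrow>\<^sub>C (complex ^ 'n)) \<Rightarrow> ((real \<times> 'a) \<Rightarrow>\<^sub>C (complex ^ 'n))"
      where "\<Phi> F = Bcontfun (\<lambda>q. \<chi> k. of_real (inverse (weight (snd q))) * \<Psi> F k (fst q) (snd q))" for F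
    have w0: "weight x \<noteq> 0" for x :: 'a using weight_pos[of x] by simp
    have comp: "norm (of_real (inverse (weight x)) * z) \<le> C" if "norm z \<le> C * weight x" for x :: 'a and z :: complex and C
    proof -
      have "norm (of_real (inverse (weight x)) * z) = inverse (weight x) * norm z"
        unfolding norm_mult norm_of_real by simp
      also have "\<dots> \<le> inverse (weight x) * (C * weight x)" using that by (intro mult_left_mono) auto
      also have "\<dots> = C" using w0[of x] by simp
      finally show ?thesis .
    qed
    have vb: "norm (\<chi> k. of_real (inverse (weight x)) * \<Psi> F k t x :: complex ^ 'n) \<le> n * (\<bar>\<epsilon>\<bar> * M + T * (L * norm F ^ 3))" for F t x
      unfolding n_def using \<Psi> unfolding weighted_family_def
      by (intro norm_vec_le) (simp add: comp del: of_real_inverse)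
    have app: "apply_bcontfun (\<Phi> F) = (\<lambda>q. \<chi> k. of_real (inverse (weight (snd q))) * \<Psi> F k (fst q) (snd q))" for F
      unfolding \<Phi>_def
    proof (rule Bcontfun_inverse, rule bcontfun_normI)
      show "continuous_on UNIV (\<lambda>q. \<chi> k. of_real (inverse (weight (snd q))) * \<Psi> F k (fst q) (snd q) :: complex ^ 'n)"
        using \<Psi> w0 unfolding weighted_family_def
        by (intro continuous_on_vec_lambda continuous_intros continuous_on_compose2[OF continuous_weight]) auto
    qed (rule vb)
    have unpack_\<Phi>: "unpack (\<Phi> F) k t \<xi> = \<Psi> F k t \<xi>" for F k t \<xi>
      unfolding unpack_def app using w0[of \<xi>] by (simp add: mult.assoc[symmetric] flip: of_real_mult)
    have self: "\<Phi> ` cball 0 R \<subseteq> cball 0 R"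
    proof (intro image_subsetI)
      fix F :: "(real \<times> 'a) \<Rightarrow>\<^sub>C (complex ^ 'n)" assume "F \<in> cball 0 R"
      then have F: "norm F \<le> R" by simp
      have "norm (\<Phi> F) \<le> n * (\<bar>\<epsilon>\<bar> * M + T * (L * R ^ 3))"
      proof (rule norm_bound)
        fix q
        have "norm (apply_bcontfun (\<Phi> F) q) \<le> n * (\<bar>\<epsilon>\<bar> * M + T * (L * norm F ^ 3))"
          unfolding app by (rule vb)
        also have "\<dots> \<le> n * (\<bar>\<epsilon>\<bar> * M + T * (L * R ^ 3))"
          using F n T L by (intro mult_left_mono add_left_mono power_mono) auto
        finally show "norm (apply_bcontfun (\<Phi> F) q) \<le> n * (\<bar>\<epsilon>\<bar> * M + T * (L * R ^ 3))" .
      qed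
      also have "\<dots> = R / 2 + (6 * n * T * L * R\<^sup>2) * (R / 6)"
        using Meps by (simp add: distrib_left power2_eq_square power3_eq_cube)
      also have "\<dots> \<le> R / 2 + 1 * (R / 6)"
        using small R by (intro add_left_mono mult_right_mono) auto
      also have "\<dots> \<le> R" using R by simp
      finally show "\<Phi> F \<in> cball 0 R" by simp
    qed
    have lip: "dist (\<Phi> F) (\<Phi> G) \<le> (1 / 2) * dist F G" if "F \<in> cball 0 R" "G \<in> cball 0 R"
      for F G :: "(real \<times> 'a) \<Rightarrow>\<^sub>C (complex ^ 'n)"
    proof -
      have F: "norm F \<le> R" "norm G \<le> R" using that by auto
      have d: "weighted (dist F G) (\<lambda>x. unpack F l \<tau> x - unpack G l \<tau> x)" for l \<tau>
      proof -
        have "unpack F l \<tau> x - unpack G l \<tau> x = unpack (F - G) l \<tau> x" for x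
          by (simp add: unpack_def right_diff_distrib)
        then show ?thesis
          using weighted_family_weighted[OF unpack[of "F - G" l], of \<tau>] by (simp add: dist_norm)
      qed
      have wR: "weighted R (unpack H l \<tau>)" if "norm H \<le> R" for H l \<tau>
        by (rule weighted_family_weighted[OF weighted_family_mono[OF unpack that]])
      have comps: "norm (\<Psi> F k t x - \<Psi> G k t x) \<le> (T * (L * (3 * R\<^sup>2 * dist F G))) * weight x" for k t x
      proof -
        have "norm (\<Psi> F k t x - \<Psi> G k t x) = norm (duh m (\<lambda>\<tau>. nonlin \<kappa> \<sigma> (\<lambda>l. unpack F l \<tau>) k) (c t) x - duh m (\<lambda>\<tau>. nonlin \<kappa> \<sigma> (\<lambda>l. unpack G l \<tau>) k) (c t) x)"
          by (simp add: \<Psi>_def norm_mult flip: right_diff_distrib)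
        also have "\<dots> \<le> T * (L * (3 * R\<^sup>2 * dist F G)) * weight x"
          using nonlin_lipschitz[OF wR[OF F(1)] wR[OF F(2)] s d] unfolding L_def
          by (intro duh_diff[OF m nl nl]) (auto simp: cT)
        finally show ?thesis .
      qed
      have "dist (\<Phi> F) (\<Phi> G) \<le> n * (T * (L * (3 * R\<^sup>2 * dist F G)))"
      proof (rule dist_bound)
        fix q
        show "dist (apply_bcontfun (\<Phi> F) q) (apply_bcontfun (\<Phi> G) q) \<le> n * (T * (L * (3 * R\<^sup>2 * dist F G)))"
          unfolding dist_norm[where 'a="complex ^ 'n"] app n_def
        proof (rule norm_vec_le)
          fix k
          have "norm (of_real (inverse (weight (snd q))) * (\<Psi> F k (fst q) (snd q) - \<Psi> G k (fst q) (snd q))) \<le> T * (L * (3 * R\<^sup>2 * dist F G))"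
            by (rule comp[OF comps])
          then show "norm (((\<chi> k. of_real (inverse (weight (snd q))) * \<Psi> F k (fst q) (snd q)) - (\<chi> k. of_real (inverse (weight (snd q))) * \<Psi> G k (fst q) (snd q))) $ k) \<le> T * (L * (3 * R\<^sup>2 * dist F G))"
            by (simp only: vector_minus_component vec_lambda_beta right_diff_distrib)
        qed
      qed
      also have "\<dots> = (6 * n * T * L * R\<^sup>2) * (dist F G / 2)" by simp
      also have "\<dots> \<le> 1 * (dist F G / 2)" using small by (intro mult_right_mono) auto
      finally show ?thesis by simp
    qed
    have "\<exists>!F. F \<in> cball 0 R \<and> \<Phi> F = F"
      by (rule Banach_fix[OF complete_eq_closed[THEN iffD2, OF closed_cball] _ _ _ self lip]) (use R in auto)
    then obtain F where F: "norm F \<le> R" "\<Phi> F = F" by auto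
    have fixp: "unpack F k t \<xi> = \<Psi> F k t \<xi>" for k t \<xi>
      using unpack_\<Phi>[of F k t \<xi>] F(2) by simp
    have fR: "weighted_family R (unpack F k)" for k by (rule weighted_family_mono[OF unpack F(1)])
    let ?G = "\<lambda>k \<tau>. nonlin \<kappa> \<sigma> (\<lambda>l. unpack F l \<tau>) k"
    have G: "weighted_family (L * R ^ 3) (?G k)" for k
      unfolding L_def by (intro weighted_family_nonlin fR s)
    have eq: "unpack F k t \<xi> = of_real \<epsilon> * (phase m t \<xi> * a k \<xi>) + \<i> * duh m (?G k) t \<xi>" if "t \<in> {0..T}" for k t \<xi>
      unfolding fixp[of k t \<xi>] \<Psi>_def \<phi>_def using c_id[OF that] by simp
    \<comment> \<open>The solution is within third order of its linear part; inserting this into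
        the Duhamel integral leaves the cubic term up to fifth order.\<close>
    define g where "g k \<tau> \<xi> = of_real \<epsilon> * \<phi> k \<tau> \<xi>" for k \<tau> \<xi>
    have "\<bar>\<epsilon>\<bar> * M \<le> R"
    proof -
      have "1 * (\<bar>\<epsilon>\<bar> * M) \<le> n * (\<bar>\<epsilon>\<bar> * M)" using n M by (intro mult_right_mono) auto
      then show ?thesis using Meps R by simp
    qed
    then have g: "weighted_family R (g k)" for k
      using weighted_family_mono[OF weighted_family_mult[OF \<phi>, of "of_real \<epsilon>" k], of R] by (simp add: g_def[abs_def])
    have d1: "norm (unpack F k t \<xi> - g k t \<xi>) \<le> (T * (L * R ^ 3)) * weight \<xi>" for k t \<xi>
      unfolding fixp[of k t \<xi>] \<Psi>_def g_def using duh_bound[OF m G cT(2) T, of k t \<xi>] by (simp add: norm_mult)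
    have wd1: "weighted (T * (L * R ^ 3)) (\<lambda>x. unpack F k t x - g k t x)" for k t
      unfolding weighted_def
      using d1 weighted_measurable[OF weighted_family_weighted[OF fR]] weighted_measurable[OF weighted_family_weighted[OF g]]
      by auto
    let ?H = "\<lambda>k \<tau>. nonlin \<kappa> \<sigma> (\<lambda>l. g l \<tau>) k"
    have H: "weighted_family (L * R ^ 3) (?H k)" for k
      unfolding L_def by (intro weighted_family_nonlin g s)
    have err: "norm (unpack F k t \<xi> - (of_real \<epsilon> * (phase m t \<xi> * a k \<xi>)
        + of_real (\<epsilon> ^ 3) * (\<i> * duh m (\<lambda>\<tau>. nonlin \<kappa> \<sigma> (\<lambda>l \<xi>. phase m \<tau> \<xi> * a l \<xi>) k) t \<xi>))) \<le> (3 * T\<^sup>2 * L\<^sup>2 * N ^ 5) * \<bar>\<epsilon>\<bar> ^ 5 * weight \<xi>"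
      if t: "t \<in> {0..T}" for k t \<xi>
    proof -
      have "duh m (?H k) t \<xi> = duh m (\<lambda>\<tau> \<xi>. of_real (\<epsilon> ^ 3) * nonlin \<kappa> \<sigma> (\<lambda>l \<xi>. phase m \<tau> \<xi> * a l \<xi>) k \<xi>) t \<xi>"
      proof (rule duh_cong)
        fix \<tau> assume "\<tau> \<in> {0..t}"
        then have "c \<tau> = \<tau>" using t by (intro c_id) auto
        then show "?H k \<tau> \<xi> = of_real (\<epsilon> ^ 3) * nonlin \<kappa> \<sigma> (\<lambda>l \<xi>. phase m \<tau> \<xi> * a l \<xi>) k \<xi>"
          unfolding g_def \<phi>_def using nonlin_scale[of \<kappa> \<sigma> \<epsilon> "\<lambda>l \<xi>. phase m \<tau> \<xi> * a l \<xi>" k \<xi>] by simp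
      qed
      then have h: "duh m (?H k) t \<xi> = of_real (\<epsilon> ^ 3) * duh m (\<lambda>\<tau>. nonlin \<kappa> \<sigma> (\<lambda>l \<xi>. phase m \<tau> \<xi> * a l \<xi>) k) t \<xi>"
        by (simp only: duh_mult)
      have "norm (duh m (?G k) t \<xi> - duh m (?H k) t \<xi>) \<le> T * (L * (3 * R\<^sup>2 * (T * (L * R ^ 3)))) * weight \<xi>"
      proof (rule duh_diff[OF m G H])
        show "norm (?G k \<tau> \<xi> - ?H k \<tau> \<xi>) \<le> L * (3 * R\<^sup>2 * (T * (L * R ^ 3))) * weight \<xi>" for \<tau> \<xi>
          unfolding L_def
          by (intro nonlin_lipschitz weighted_family_weighted[OF fR] weighted_family_weighted[OF g] s wd1[unfolded L_def])
      qed (use t in auto)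
      also have "T * (L * (3 * R\<^sup>2 * (T * (L * R ^ 3)))) = (3 * T\<^sup>2 * L\<^sup>2 * N ^ 5) * \<bar>\<epsilon>\<bar> ^ 5"
        by (simp add: R_def power_mult_distrib power2_eq_square power3_eq_cube eval_nat_numeral mult_ac)
      finally have "norm (\<i> * (duh m (?G k) t \<xi> - duh m (?H k) t \<xi>)) \<le> (3 * T\<^sup>2 * L\<^sup>2 * N ^ 5) * \<bar>\<epsilon>\<bar> ^ 5 * weight \<xi>"
        by (simp add: norm_mult)
      then show ?thesis unfolding eq[OF t] h by (simp add: algebra_simps)
    qed
    show ?thesis
      by (intro exI[of _ R] exI[of _ "unpack F"] conjI allI ballI fR eq err) 
  qed
  show ?thesis
    by (rule exI[of _ "1 / (B + 1)"], rule conjI)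
       (use B in simp, rule exI[of _ "3 * T\<^sup>2 * L\<^sup>2 * N ^ 5"], intro allI impI, rule main)
qed

end

section \<open>From the Fourier side to solutions in the sense of distributions\<close>

definition symbol :: "real \<Rightarrow> 'a::euclidean_space \<Rightarrow> real" where
  "symbol \<alpha> \<xi> = (2 * pi) powr \<alpha> * norm \<xi> powr \<alpha>"

lemma continuous_symbol: "0 < \<alpha> \<Longrightarrow> continuous_on UNIV (symbol \<alpha>)"
  unfolding symbol_def
  by (intro continuous_on_mult continuous_on_const continuous_on_powr' continuous_on_norm continuous_on_id) auto

lemma free_propagator_td_of:
  fixes g :: "'a::euclidean_space \<Rightarrow> complex"
  assumes "0 < \<alpha>" "integrable lborel g"
  shows "free_propagator \<alpha> t (td_of g) = td_of (\<lambda>\<xi>. phase (symbol \<alpha>) t \<xi> * g \<xi>)"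
proof -
  have e: "(\<lambda>\<xi>::'a. exp (- (\<i> * of_real ((2 * pi) powr \<alpha> * norm \<xi> powr \<alpha> * t)))) = phase (symbol \<alpha>) t"
    by (auto simp: fun_eq_iff phase_def symbol_def cis_conv_exp)
  have "continuous_on UNIV (phase (symbol \<alpha>) t :: 'a \<Rightarrow> complex)"
    by (intro continuous_phase[where s="\<lambda>_. t" and x="\<lambda>x. x"] continuous_symbol assms continuous_intros)
  from borel_measurable_continuous[OF this] show ?thesis
    unfolding free_propagator_def e by (intro fourier_multiplier_td_of assms) simp_all
qed

lemma ifourier_sum:
  assumes "\<And>l. l \<in> S \<Longrightarrow> integrable lborel (f l)"
  shows "ifourier (\<lambda>\<xi>. \<Sum>l\<in>S. f l \<xi>) x = (\<Sum>l\<in>S. ifourier (f l) x)"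
proof -
  have "(LINT \<xi>|lborel. (\<Sum>l\<in>S. wave (\<xi> \<bullet> x) * f l \<xi>)) = (\<Sum>l\<in>S. (LINT \<xi>|lborel. wave (\<xi> \<bullet> x) * f l \<xi>))"
    by (intro Bochner_Integration.integral_sum integrable_wave_mult assms) measurable
  then show ?thesis by (simp add: ifourier_def sum_distrib_left)
qed

lemma ifourier_mult: "ifourier (\<lambda>\<xi>. c * f \<xi>) x = c * ifourier f x"
  unfolding ifourier_def integral_mult_right_zero[symmetric] by (simp add: mult.left_commute)

lemma convolution_riesz:
  "Defs.convolution (kernel 0 \<gamma>) P x = (LINT y|lborel. of_real (riesz \<gamma> (x - y)) * P y)"
  by (simp add: Defs.convolution_def kernel_riesz)

lemma LhatN_normI:
  assumes "\<And>k. Lhat_norm p (\<psi> $ k) < c"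
  shows "LhatN_norm p (\<psi> :: 'a::euclidean_space tempered ^ 'n::finite) < c"
  unfolding LhatN_norm_def using assms by (subst Max_less_iff) auto

context riesz_setting
begin

definition hartree_hat :: "real \<Rightarrow> ('n::finite \<Rightarrow> 'a \<Rightarrow> complex) \<Rightarrow> 'n \<Rightarrow> 'a \<Rightarrow> complex" where
  "hartree_hat \<kappa> f k \<xi> = of_real \<kappa> * (\<Sum>l\<in>UNIV. trilin (f l) (f l) (f k) \<xi>)"

definition exchange_hat :: "real \<Rightarrow> ('n::finite \<Rightarrow> 'a \<Rightarrow> complex) \<Rightarrow> 'n \<Rightarrow> 'a \<Rightarrow> complex" where
  "exchange_hat \<kappa> f k \<xi> = of_real \<kappa> * (\<Sum>l\<in>UNIV. trilin (f k) (f l) (f l) \<xi>)"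

lemma nonlin_split: "nonlin \<kappa> \<sigma> f k \<xi> = hartree_hat \<kappa> f k \<xi> - of_real \<sigma> * exchange_hat \<kappa> f k \<xi>"
  by (simp add: nonlin_def hartree_hat_def exchange_hat_def right_diff_distrib mult.left_commute)

lemma weighted_family_hartree_hat:
  fixes f :: "'n::finite \<Rightarrow> 'p::metric_space \<Rightarrow> 'a \<Rightarrow> complex"
  assumes "\<And>l. weighted_family R (f l)"
  shows "weighted_family (nonlin_const \<kappa> TYPE('n) * R ^ 3) (\<lambda>p. hartree_hat \<kappa> (\<lambda>l. f l p) k)"
  using weighted_family_nonlin[where \<sigma>=0 and \<kappa>=\<kappa> and k=k and f=f, OF assms] by (simp add: nonlin_split[abs_def])

lemma weighted_family_exchange_hat:
  fixes f :: "'n::finite \<Rightarrow> 'p::metric_space \<Rightarrow> 'a \<Rightarrow> complex"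
  assumes "\<And>l. weighted_family R (f l)"
  shows "\<exists>C. weighted_family C (\<lambda>p. exchange_hat \<kappa> (\<lambda>l. f l p) k)"
proof -
  have "weighted_family (nonlin_const \<kappa> TYPE('n) * R ^ 3 + nonlin_const \<kappa> TYPE('n) * R ^ 3)
      (\<lambda>p \<xi>. nonlin \<kappa> 0 (\<lambda>l. f l p) k \<xi> - nonlin \<kappa> 1 (\<lambda>l. f l p) k \<xi>)"
    by (intro weighted_family_diff weighted_family_nonlin assms) auto
  then show ?thesis by (auto simp: nonlin_split)
qed

text \<open>
  The squared absolute value of a function is nonnegative, so its Riesz potential converges by
  Tonelli. The mixed products of the exchange term are dominated by the squares.
\<close>

lemma riesz_square_integrable:
  fixes f :: "'a \<Rightarrow> complex"
  assumes f: "weighted A f"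
  shows "integrable lborel (\<lambda>y. riesz \<gamma> (x - y) * (norm (ifourier f y))\<^sup>2)"
proof -
  note c = weighted_corr[OF f f] and i = weighted_integrable[OF f]
  show ?thesis
  proof (rule riesz_potential_converges[of "corr f f"])
    show "corr f f \<in> borel_measurable borel" by (rule weighted_measurable[OF c])
    show "norm (corr f f \<eta>) \<le> A * A * corr_const TYPE('a) * weight \<eta>" for \<eta> by (rule weighted_bound[OF c])
    show "ifourier (corr f f) y = of_real ((norm (ifourier f y))\<^sup>2)" for y
      by (simp only: ifourier_corr(2)[OF i i] complex_norm_square)
  qed simp
qed

lemma riesz_product_integrable:
  fixes f g :: "'a \<Rightarrow> complex"
  assumes f: "weighted A f" and g: "weighted B g"
  shows "integrable lborel (\<lambda>y. of_real (riesz \<gamma> (x - y)) * (ifourier f y * cnj (ifourier g y)))"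
proof (rule Bochner_Integration.integrable_bound)
  have [measurable]: "ifourier f \<in> borel_measurable borel" "ifourier g \<in> borel_measurable borel"
    using continuous_ifourier weighted_integrable f g borel_measurable_continuous by blast+
  show "integrable lborel (\<lambda>y. riesz \<gamma> (x - y) * (norm (ifourier f y))\<^sup>2 + riesz \<gamma> (x - y) * (norm (ifourier g y))\<^sup>2)"
    by (intro Bochner_Integration.integrable_add riesz_square_integrable[OF f] riesz_square_integrable[OF g])
  have "norm (of_real (riesz \<gamma> (x - y)) * (ifourier f y * cnj (ifourier g y)))
      \<le> riesz \<gamma> (x - y) * (norm (ifourier f y))\<^sup>2 + riesz \<gamma> (x - y) * (norm (ifourier g y))\<^sup>2" for y
  proof -
    have "u * v \<le> u\<^sup>2 + v\<^sup>2" if "0 \<le> u" "0 \<le> v" for u v :: real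
      using sum_squares_bound[of u v] mult_nonneg_nonneg[OF that] by linarith
    then have "norm (ifourier f y) * norm (ifourier g y) \<le> (norm (ifourier f y))\<^sup>2 + (norm (ifourier g y))\<^sup>2" by simp
    then have "riesz \<gamma> (x - y) * (norm (ifourier f y) * norm (ifourier g y)) \<le> riesz \<gamma> (x - y) * ((norm (ifourier f y))\<^sup>2 + (norm (ifourier g y))\<^sup>2)"
      by (rule mult_left_mono) simp
    then show ?thesis by (simp add: norm_mult distrib_left)
  qed
  then show "AE y in lborel. norm (of_real (riesz \<gamma> (x - y)) * (ifourier f y * cnj (ifourier g y)))
      \<le> norm (riesz \<gamma> (x - y) * (norm (ifourier f y))\<^sup>2 + riesz \<gamma> (x - y) * (norm (ifourier g y))\<^sup>2)"
    by (intro AE_I2) (auto intro: order_trans[OF _ abs_ge_self])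
  show "(\<lambda>y. of_real (riesz \<gamma> (x - y)) * (ifourier f y * cnj (ifourier g y))) \<in> borel_measurable lborel" by measurable
qed

text \<open>
  Every summand of the direct and of the exchange term has the shape on the left.
\<close>

lemma riesz_product_eq:
  fixes f g h :: "'a \<Rightarrow> complex"
  assumes f: "weighted A f" and g: "weighted B g" and h: "weighted D h"
  shows "(LINT y|lborel. of_real (riesz \<gamma> (x - y)) * (ifourier f y * cnj (ifourier g y))) * ifourier h x
    = of_real rc * ifourier (trilin f g h) x"
proof -
  note c = weighted_corr[OF f g]
  note i = weighted_integrable[OF f] weighted_integrable[OF g] weighted_integrable[OF h]
  have P: "ifourier (corr f g) y = ifourier f y * cnj (ifourier g y)" for y
    by (rule ifourier_corr(2)[OF i(1,2)])
  have "(LINT y|lborel. of_real (riesz \<gamma> (x - y)) * (ifourier f y * cnj (ifourier g y)))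
      = of_real rc * ifourier (\<lambda>\<eta>. of_real (K \<eta>) * corr f g \<eta>) x"
    using riesz_potential_ifourier[OF weighted_measurable[OF c] weighted_bound[OF c], of x]
      riesz_product_integrable[OF f g] unfolding P by simp
  moreover have "ifourier (\<lambda>\<eta>. of_real (K \<eta>) * corr f g \<eta>) x * ifourier h x = ifourier (trilin f g h) x"
    unfolding trilin_def
    by (rule ifourier_conv(2)[symmetric, OF integrable_K_bound[OF weighted_measurable[OF c] weighted_bound[OF c]] i(3)])
  ultimately show ?thesis by (simp add: mult.assoc)
qed

lemma is_hartree_term_td_of:
  fixes f :: "'n::finite \<Rightarrow> 'a \<Rightarrow> complex"
  assumes f: "\<And>l. weighted R (f l)"
  shows "is_hartree_term \<kappa> 0 \<gamma> (\<chi> l. td_of (f l)) k (td_of (hartree_hat (\<kappa> * rc) f k))"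
  unfolding is_hartree_term_def
proof (intro conjI exI[of _ "\<lambda>l. ifourier (f l)"] allI)
  note i = weighted_integrable[OF f] and t = weighted_integrable[OF weighted_trilin[OF f f f]]
  show "represents (ifourier (f l)) ((\<chi> l. td_of (f l)) $ l)" for l using represents_td_of[OF i] by simp
  show "convolution_exists (kernel 0 \<gamma>) (\<lambda>y. of_real ((norm (ifourier (f l) y))\<^sup>2))" for l
    unfolding convolution_exists_def kernel_riesz of_real_mult[symmetric] complex_of_real_integrable_eq
    by (intro AE_I2 riesz_square_integrable[OF f])
  have hi: "integrable lborel (hartree_hat (\<kappa> * rc) f k)"
    unfolding hartree_hat_def by (intro integrable_mult_right Bochner_Integration.integrable_sum t)
  have "hartree_potential \<kappa> 0 \<gamma> (\<lambda>l. ifourier (f l)) x * ifourier (f k) x = ifourier (hartree_hat (\<kappa> * rc) f k) x" for x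
  proof -
    have "hartree_potential \<kappa> 0 \<gamma> (\<lambda>l. ifourier (f l)) x * ifourier (f k) x
        = of_real \<kappa> * (\<Sum>l\<in>UNIV. (LINT y|lborel. of_real (riesz \<gamma> (x - y)) * (ifourier (f l) y * cnj (ifourier (f l) y))) * ifourier (f k) x)"
      unfolding hartree_potential_def convolution_riesz complex_norm_square
      by (simp add: sum_distrib_right mult.assoc)
    also have "\<dots> = of_real (\<kappa> * rc) * (\<Sum>l\<in>UNIV. ifourier (trilin (f l) (f l) (f k)) x)"
      unfolding riesz_product_eq[OF f f f] by (simp add: sum_distrib_left mult.assoc)
    also have "\<dots> = ifourier (hartree_hat (\<kappa> * rc) f k) x"
      unfolding hartree_hat_def by (simp add: ifourier_mult ifourier_sum t del: of_real_mult)
    finally show ?thesis .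
  qed
  then show "represents (\<lambda>x. hartree_potential \<kappa> 0 \<gamma> (\<lambda>l. ifourier (f l)) x * ifourier (f k) x) (td_of (hartree_hat (\<kappa> * rc) f k))"
    using represents_td_of[OF hi] by simp
  show "\<exists>g. fourier_represents g (td_of (hartree_hat (\<kappa> * rc) f k))"
    using fourier_represents_td_of[OF hi] by blast
qed

lemma is_exchange_term_td_of:
  fixes f :: "'n::finite \<Rightarrow> 'a \<Rightarrow> complex"
  assumes f: "\<And>l. weighted R (f l)"
  shows "is_exchange_term \<kappa> 0 \<gamma> (\<chi> l. td_of (f l)) k (td_of (exchange_hat (\<kappa> * rc) f k))"
  unfolding is_exchange_term_def
proof (intro conjI exI[of _ "\<lambda>l. ifourier (f l)"] allI)
  note i = weighted_integrable[OF f] and t = weighted_integrable[OF weighted_trilin[OF f f f]]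
  show "represents (ifourier (f l)) ((\<chi> l. td_of (f l)) $ l)" for l using represents_td_of[OF i] by simp
  show "convolution_exists (kernel 0 \<gamma>) (\<lambda>y. cnj (ifourier (f l) y) * ifourier (f k) y)" for l
    unfolding convolution_exists_def kernel_riesz
    using riesz_product_integrable[OF f f, of _ k l] by (intro AE_I2) (simp add: mult.commute)
  have hi: "integrable lborel (exchange_hat (\<kappa> * rc) f k)"
    unfolding exchange_hat_def by (intro integrable_mult_right Bochner_Integration.integrable_sum t)
  have "exchange_function \<kappa> 0 \<gamma> (\<lambda>l. ifourier (f l)) k x = ifourier (exchange_hat (\<kappa> * rc) f k) x" for x
  proof -
    have "exchange_function \<kappa> 0 \<gamma> (\<lambda>l. ifourier (f l)) k x
        = of_real \<kappa> * (\<Sum>l\<in>UNIV. (LINT y|lborel. of_real (riesz \<gamma> (x - y)) * (ifourier (f k) y * cnj (ifourier (f l) y))) * ifourier (f l) x)"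
      by (simp add: exchange_function_def convolution_riesz mult.commute)
    also have "\<dots> = of_real (\<kappa> * rc) * (\<Sum>l\<in>UNIV. ifourier (trilin (f k) (f l) (f l)) x)"
      unfolding riesz_product_eq[OF f f f] by (simp add: sum_distrib_left mult.assoc)
    also have "\<dots> = ifourier (exchange_hat (\<kappa> * rc) f k) x"
      unfolding exchange_hat_def by (simp add: ifourier_mult ifourier_sum t del: of_real_mult)
    finally show ?thesis .
  qed
  then have "exchange_function \<kappa> 0 \<gamma> (\<lambda>l. ifourier (f l)) k = ifourier (exchange_hat (\<kappa> * rc) f k)"
    by (rule ext)
  then show "represents (exchange_function \<kappa> 0 \<gamma> (\<lambda>l. ifourier (f l)) k) (td_of (exchange_hat (\<kappa> * rc) f k))"
    using represents_td_of[OF hi] by simp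
  show "\<exists>g. fourier_represents g (td_of (exchange_hat (\<kappa> * rc) f k))"
    using fourier_represents_td_of[OF hi] by blast
qed

end

text \<open>
  Paired with a test function, the distribution-valued integral becomes a double integral over
  time and frequency, and Fubini applies.
\<close>

lemma has_td_integral_duh:
  fixes q :: "real \<Rightarrow> 'a::euclidean_space \<Rightarrow> complex"
  assumes al: "0 < \<alpha>" and q: "weighted_family C q"
  shows "has_td_integral (\<lambda>s. free_propagator \<alpha> (t - s) (td_of (q s))) (td_of (duh (symbol \<alpha>) q t)) {0..t}"
  unfolding has_td_integral_def
proof (intro ballI conjI)
  fix \<phi> :: "'a \<Rightarrow> complex" assume \<phi>: "\<phi> \<in> schwartz"
  let ?m = "symbol \<alpha>"
  have m: "continuous_on UNIV ?m" by (rule continuous_symbol[OF al])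
  have C: "0 \<le> C" by (rule weighted_family_nonneg[OF q])
  have q': "weighted_family C (\<lambda>s \<xi>. phase ?m (t - s) \<xi> * q s \<xi>)"
    by (intro weighted_family_phase m q continuous_intros)
  have sf: "ifourier \<phi> \<in> schwartz" by (rule schwartz_ifourier[OF \<phi>])
  have [measurable]: "ifourier \<phi> \<in> borel_measurable borel" by (rule schwartz_measurable[OF sf])
  obtain A where A: "\<And>\<xi>. norm (ifourier \<phi> \<xi>) \<le> A" using schwartz_bounded[OF sf] by blast
  have A0: "0 \<le> A" using order_trans[OF norm_ge_zero A] .
  let ?v = "\<lambda>s. LINT \<xi>|lborel. phase ?m (t - s) \<xi> * q s \<xi> * ifourier \<phi> \<xi>"
  have ap: "apply_td (free_propagator \<alpha> (t - s) (td_of (q s))) \<phi> = ?v s" for s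
    using td_of_pairing[OF weighted_integrable[OF weighted_family_weighted[OF q']] \<phi>]
    by (simp add: free_propagator_td_of[OF al weighted_integrable[OF weighted_family_weighted[OF q]]])
  have "continuous_on UNIV ?v"
  proof (rule continuous_LINT[where B="\<lambda>\<xi>. C * weight \<xi> * A"])
    show "(\<lambda>\<xi>. phase ?m (t - s) \<xi> * q s \<xi> * ifourier \<phi> \<xi>) \<in> borel_measurable lborel" for s
      using weighted_measurable[OF weighted_family_weighted[OF q']] by measurable
    show "continuous_on UNIV (\<lambda>s. phase ?m (t - s) \<xi> * q s \<xi> * ifourier \<phi> \<xi>)" for \<xi>
      by (intro continuous_intros weighted_family_compose[OF q'])
    show "norm (phase ?m (t - s) \<xi> * q s \<xi> * ifourier \<phi> \<xi>) \<le> C * weight \<xi> * A" for s \<xi>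
      unfolding norm_mult[of _ "ifourier \<phi> \<xi>"]
      by (intro mult_mono weighted_bound[OF weighted_family_weighted[OF q']] A) (use C in auto)
  qed (use integrable_weight in auto)
  then have "set_integrable lborel {0..t} ?v"
    by (intro borel_integrable_atLeastAtMost') (auto intro: continuous_on_subset)
  then have iv: "integrable lborel (\<lambda>s. indicator {0..t} s *\<^sub>R ?v s)" by (simp add: set_integrable_def)
  then have bm: "(\<lambda>s. indicator {0..t} s *\<^sub>R ?v s) \<in> borel_measurable lborel"
    by (rule borel_measurable_integrable)
  show "set_integrable lebesgue {0..t} (\<lambda>s. apply_td (free_propagator \<alpha> (t - s) (td_of (q s))) \<phi>)"
    unfolding ap set_integrable_def using iv by (subst integrable_completion[OF bm])
  have cont: "continuous_on UNIV (\<lambda>z::'a \<times> real. phase ?m (t - snd z) (fst z) * q (snd z) (fst z))"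
    by (intro continuous_intros weighted_family_compose[OF q'])
  then have [measurable]: "(\<lambda>z::'a \<times> real. phase ?m (t - snd z) (fst z) * q (snd z) (fst z)) \<in> borel_measurable (borel \<Otimes>\<^sub>M borel)"
    unfolding borel_prod by (rule borel_measurable_continuous)
  let ?F = "\<lambda>\<xi> s. indicator {0..t} s *\<^sub>R (phase ?m (t - s) \<xi> * q s \<xi>) * ifourier \<phi> \<xi>"
  have "integrable lborel (duh ?m q t)"
  proof -
    have "duh ?m q t \<in> borel_measurable borel"
      unfolding duh_def by measurable
    moreover have "norm (duh ?m q t \<xi>) \<le> (max 0 t * C) * weight \<xi>" for \<xi>
      by (rule duh_bound[OF m q]) auto
    ultimately show ?thesis by (rule integrable_weight_bound)
  qed
  then have "apply_td (td_of (duh ?m q t)) \<phi> = (LINT \<xi>|lborel. LINT s|lborel. ?F \<xi> s)"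
    by (simp only: td_of_pairing[OF _ \<phi>] duh_def integral_mult_left_zero)
  also have "\<dots> = (LINT s|lborel. LINT \<xi>|lborel. ?F \<xi> s)"
  proof (rule LINT_Fubini(1)[where g="\<lambda>\<xi>. C * weight \<xi> * A" and h="\<lambda>s. indicator {0..t} s"])
    show "(\<lambda>(\<xi>, s). ?F \<xi> s) \<in> borel_measurable (borel \<Otimes>\<^sub>M borel)" by (simp add: case_prod_beta')
    show "norm (?F \<xi> s) \<le> C * weight \<xi> * A * indicator {0..t} s" for \<xi> s
    proof -
      have "norm (phase ?m (t - s) \<xi> * q s \<xi> * ifourier \<phi> \<xi>) \<le> C * weight \<xi> * A"
        unfolding norm_mult[of _ "ifourier \<phi> \<xi>"]
        by (intro mult_mono weighted_bound[OF weighted_family_weighted[OF q']] A) (use C in auto)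
      then show ?thesis by (auto simp: indicator_def)
    qed
  qed (use integrable_weight in auto)
  also have "\<dots> = (LINT s|lborel. indicator {0..t} s *\<^sub>R ?v s)"
    by (simp add: mult.assoc)
  also have "\<dots> = (LINT s|lebesgue. indicator {0..t} s *\<^sub>R ?v s)"
    by (rule integral_completion[OF bm, symmetric])
  finally show "apply_td (td_of (duh ?m q t)) \<phi> = (LINT s:{0..t}|lebesgue. apply_td (free_propagator \<alpha> (t - s) (td_of (q s))) \<phi>)"
    unfolding ap set_lebesgue_integral_def .
qed

definition exchange_coeff :: "hf_system \<Rightarrow> real" where
  "exchange_coeff sys = (case sys of Hartree_Fock \<Rightarrow> 1 | Reduced_Hartree_Fock \<Rightarrow> 0)"

context riesz_setting
begin

text \<open>
  Dominated convergence with a power of the weight: a curve that is pointwise continuous in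
  frequency and uniformly bounded by the weight is continuous in the Fourier--Lebesgue norm.
\<close>

lemma LhatN_norm_continuous:
  fixes f :: "'n::finite \<Rightarrow> real \<Rightarrow> 'a \<Rightarrow> complex"
  assumes p: "2 < p" and f: "\<And>k. weighted_family R (f k)" and e: "0 < (\<epsilon>::real)"
  shows "\<exists>\<delta>>0. \<forall>r. \<bar>r - s\<bar> < \<delta> \<longrightarrow> LhatN_norm p ((\<chi> k. td_of (f k r)) - (\<chi> k. td_of (f k s))) < \<epsilon>"
proof -
  define q \<rho> where "q = enn2real (conj_exponent p)" and "\<rho> = enn2real (inverse p)"
  interpret exponent p q \<rho> by unfold_locales (use p q_def \<rho>_def in auto)
  have R: "0 \<le> R" using weighted_family_nonneg[OF f] .
  let ?I = "\<lambda>k r. LINT \<xi>|lborel. norm (f k r \<xi> - f k s \<xi>) powr q"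
  have d: "weighted_family (R + R) (\<lambda>r \<xi>. f k r \<xi> - f k s \<xi>)" for k
  proof -
    have "weighted_family R (\<lambda>r. f k s)"
      by (intro weighted_family_const weighted_family_continuous[OF f] weighted_bound[OF weighted_family_weighted[OF f]])
    then show ?thesis by (intro weighted_family_diff f)
  qed
  have cont: "continuous_on UNIV (?I k)" for k
  proof (rule continuous_LINT[where B="\<lambda>\<xi>. (R + R) powr q * weight \<xi>"])
    show "(\<lambda>\<xi>. norm (f k r \<xi> - f k s \<xi>) powr q) \<in> borel_measurable lborel" for r
      using weighted_measurable[OF weighted_family_weighted[OF d[of k]], of r] by measurable
    show "continuous_on UNIV (\<lambda>r. norm (f k r \<xi> - f k s \<xi>) powr q)" for \<xi>
      using q_ge_1 by (intro continuous_on_powr' continuous_intros weighted_family_compose[OF d]) auto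
    show "norm (norm (f k r \<xi> - f k s \<xi>) powr q) \<le> (R + R) powr q * weight \<xi>" for r \<xi>
    proof -
      have "norm (f k r \<xi> - f k s \<xi>) powr q \<le> ((R + R) * weight \<xi>) powr q"
        using q_ge_1 by (intro powr_mono2 weighted_bound[OF weighted_family_weighted[OF d]]) auto
      also have "\<dots> = (R + R) powr q * weight \<xi> powr q" using R by (simp add: powr_mult)
      also have "\<dots> \<le> (R + R) powr q * weight \<xi> powr 1"
        using weight_le_1 q_ge_1 by (intro mult_left_mono powr_mono') auto
      finally show ?thesis by simp
    qed
  qed (use integrable_weight in auto)
  have nrm: "Lhat_norm p (((\<chi> k. td_of (f k r)) - (\<chi> k. td_of (f k s))) $ k) = ?I k r powr (1 / q)" for k r
    using Lhat_norm[OF fourier_represents_diff[OF fourier_represents_td_of fourier_represents_td_of], of "f k r" "f k s"]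
      weighted_integrable[OF weighted_family_weighted[OF f]] by simp
  have lim: "((\<lambda>r. ?I k r powr (1 / q)) \<longlongrightarrow> ?I k s powr (1 / q)) (at s)" for k
  proof -
    have "continuous_on UNIV (\<lambda>r. ?I k r powr (1 / q))"
      using q_ge_1 by (intro continuous_on_powr' cont continuous_intros) (auto intro!: Bochner_Integration.integral_nonneg)
    then have "isCont (\<lambda>r. ?I k r powr (1 / q)) s" by (rule continuous_on_interior) simp
    then show ?thesis by (rule isContD)
  qed
  have z: "?I k s powr (1 / q) = 0" for k using q_ge_1 by simp
  have "\<forall>\<^sub>F r in at s. \<forall>k. ?I k r powr (1 / q) < \<epsilon>"
    using lim[unfolded z] e by (intro eventually_all_finite) (auto dest: order_tendstoD(2))
  then obtain \<delta> where "\<delta> > 0" and \<delta>: "\<And>r k. r \<noteq> s \<Longrightarrow> dist r s < \<delta> \<Longrightarrow> ?I k r powr (1 / q) < \<epsilon>"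
    unfolding eventually_at by blast
  show ?thesis
  proof (intro exI[of _ \<delta>] conjI allI impI \<open>\<delta> > 0\<close>)
    fix r assume r: "\<bar>r - s\<bar> < \<delta>"
    show "LhatN_norm p ((\<chi> k. td_of (f k r)) - (\<chi> k. td_of (f k s))) < \<epsilon>"
    proof (rule LhatN_normI)
      fix k
      show "Lhat_norm p (((\<chi> k. td_of (f k r)) - (\<chi> k. td_of (f k s))) $ k) < \<epsilon>"
        unfolding nrm using \<delta>[of r k] r z[of k] e by (cases "r = s") (auto simp: dist_real_def)
    qed
  qed
qed

text \<open>
  The direct and the exchange term are separate distributions in the Duhamel formula, so the
  Duhamel integral of the combined nonlinearity is split accordingly, each part being
  integrable by itself.
\<close>

theorem duhamel_solution_td_of:
  fixes a :: "'n::finite \<Rightarrow> 'a \<Rightarrow> complex" and f :: "'n \<Rightarrow> real \<Rightarrow> 'a \<Rightarrow> complex"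
  assumes p: "2 < p" and al: "0 < \<alpha>" and a: "\<And>k. weighted M (a k)"
    and f: "\<And>k. weighted_family R (f k)"
    and eq: "\<And>k t \<xi>. t \<in> {0..T} \<Longrightarrow> f k t \<xi> = phase (symbol \<alpha>) t \<xi> * a k \<xi>
        + \<i> * duh (symbol \<alpha>) (\<lambda>\<tau>. nonlin (\<kappa> * rc) (exchange_coeff sys) (\<lambda>l. f l \<tau>) k) t \<xi>"
  shows "duhamel_solution sys \<kappa> 0 \<gamma> \<alpha> p T (\<chi> k. td_of (a k)) (\<lambda>t. \<chi> k. td_of (f k t))"
  unfolding duhamel_solution_def
proof (intro conjI ballI allI impI)
  define q \<rho> where "q = enn2real (conj_exponent p)" and "\<rho> = enn2real (inverse p)"
  interpret exponent p q \<rho> by unfold_locales (use p q_def \<rho>_def in auto)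
  note w = weighted_family_weighted[OF f]
  show "(\<chi> k. td_of (f k s)) \<in> LhatN p" for s
    unfolding LhatN_def using Lhat_td_of(1)[OF weighted_measurable[OF w] weighted_bound[OF w]] by simp
  show "\<exists>\<delta>>0. \<forall>r\<in>{0..T}. \<bar>r - s\<bar> < \<delta> \<longrightarrow> LhatN_norm p ((\<chi> k. td_of (f k r)) - (\<chi> k. td_of (f k s))) < \<epsilon>"
    if "0 < \<epsilon>" for s \<epsilon>
    using LhatN_norm_continuous[where f=f and s=s, OF p f that] by blast
  let ?m = "symbol \<alpha> :: 'a \<Rightarrow> real"
  have m: "continuous_on UNIV ?m" by (rule continuous_symbol[OF al])
  let ?H = "\<lambda>s k. hartree_hat (\<kappa> * rc) (\<lambda>l. f l s) k" and ?E = "\<lambda>s k. exchange_hat (\<kappa> * rc) (\<lambda>l. f l s) k"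
  have H: "\<exists>C. weighted_family C (\<lambda>s. ?H s k)" for k using weighted_family_hartree_hat[where f=f, OF f] by blast
  have E: "\<exists>C. weighted_family C (\<lambda>s. ?E s k)" for k by (rule weighted_family_exchange_hat[OF f])
  show "\<exists>H F. (AE s in lebesgue. s \<in> {0..T} \<longrightarrow> (\<forall>k. is_hartree_term \<kappa> 0 \<gamma> (\<chi> k. td_of (f k s)) k (H s k))) \<and>
        (sys = Hartree_Fock \<longrightarrow>
           (AE s in lebesgue. s \<in> {0..T} \<longrightarrow> (\<forall>k. is_exchange_term \<kappa> 0 \<gamma> (\<chi> k. td_of (f k s)) k (F s k)))) \<and>
        (\<forall>t\<in>{0..T}. \<forall>k. \<exists>IH IF.
           has_td_integral (\<lambda>s. free_propagator \<alpha> (t - s) (H s k)) IH {0..t} \<and>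
           (case sys of
              Hartree_Fock \<Rightarrow> has_td_integral (\<lambda>s. free_propagator \<alpha> (t - s) (F s k)) IF {0..t}
            | Reduced_Hartree_Fock \<Rightarrow> IF = 0) \<and>
           (\<forall>\<phi>\<in>schwartz. apply_td ((\<chi> k. td_of (f k t)) $ k) \<phi> =
              apply_td (free_propagator \<alpha> t ((\<chi> k. td_of (a k)) $ k)) \<phi>
                + \<i> * apply_td IH \<phi> - \<i> * apply_td IF \<phi>))"
  proof (rule exI[of _ "\<lambda>s k. td_of (?H s k)"], rule exI[of _ "\<lambda>s k. td_of (?E s k)"], intro conjI impI AE_I2 allI ballI)
    show "is_hartree_term \<kappa> 0 \<gamma> (\<chi> k. td_of (f k s)) k (td_of (?H s k))" for s k by (rule is_hartree_term_td_of[OF w])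
    show "is_exchange_term \<kappa> 0 \<gamma> (\<chi> k. td_of (f k s)) k (td_of (?E s k))" for s k by (rule is_exchange_term_td_of[OF w])
    fix t k assume t: "t \<in> {0..T}"
    obtain CH CE where CH: "weighted_family CH (\<lambda>s. ?H s k)" and CE: "weighted_family CE (\<lambda>s. ?E s k)" using H E by metis
    let ?IH = "td_of (duh ?m (\<lambda>s. ?H s k) t)"
    let ?IE = "case sys of Hartree_Fock \<Rightarrow> td_of (duh ?m (\<lambda>s. ?E s k) t) | Reduced_Hartree_Fock \<Rightarrow> 0"
    have int: "integrable lborel (duh ?m q t)" if "weighted_family C q" for C and q :: "real \<Rightarrow> 'a \<Rightarrow> complex"
    proof -
      have "max 0 (min T t) = t" using t by auto
      then have "weighted (T * C) (duh ?m q t)"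
        using weighted_family_weighted[OF weighted_family_duh[OF m that, of T], of t] t by simp
      then show ?thesis by (rule weighted_integrable)
    qed
    show "\<exists>IH IF. has_td_integral (\<lambda>s. free_propagator \<alpha> (t - s) (td_of (?H s k))) IH {0..t} \<and>
           (case sys of
              Hartree_Fock \<Rightarrow> has_td_integral (\<lambda>s. free_propagator \<alpha> (t - s) (td_of (?E s k))) IF {0..t}
            | Reduced_Hartree_Fock \<Rightarrow> IF = 0) \<and>
           (\<forall>\<phi>\<in>schwartz. apply_td ((\<chi> k. td_of (f k t)) $ k) \<phi> =
              apply_td (free_propagator \<alpha> t ((\<chi> k. td_of (a k)) $ k)) \<phi>
                + \<i> * apply_td IH \<phi> - \<i> * apply_td IF \<phi>)"
    proof (rule exI[of _ ?IH], rule exI[of _ ?IE], intro conjI ballI)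
      show "has_td_integral (\<lambda>s. free_propagator \<alpha> (t - s) (td_of (?H s k))) ?IH {0..t}"
        by (rule has_td_integral_duh[OF al CH])
      show "case sys of
              Hartree_Fock \<Rightarrow> has_td_integral (\<lambda>s. free_propagator \<alpha> (t - s) (td_of (?E s k))) ?IE {0..t}
            | Reduced_Hartree_Fock \<Rightarrow> ?IE = 0"
        using has_td_integral_duh[OF al CE] by (cases sys) auto
      fix \<phi> :: "'a \<Rightarrow> complex" assume \<phi>: "\<phi> \<in> schwartz"
      let ?s = "exchange_coeff sys"
      have sf: "ifourier \<phi> \<in> schwartz" by (rule schwartz_ifourier[OF \<phi>])
      have ii: "integrable lborel (\<lambda>\<xi>. g \<xi> * ifourier \<phi> \<xi>)" if "integrable lborel g" for g
        using schwartz_bounded[OF sf] integrable_mult_bounded[OF that schwartz_measurable[OF sf]] by blast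
      have pa: "integrable lborel (\<lambda>\<xi>. phase ?m t \<xi> * a k \<xi>)"
      proof -
        have "continuous_on UNIV (phase ?m t)"
          by (intro continuous_phase[where s="\<lambda>_. t" and x="\<lambda>x. x"] m continuous_intros)
        from integrable_mult_bounded[OF weighted_integrable[OF a] borel_measurable_continuous[OF this], of 1 k]
        show ?thesis by (simp add: mult.commute)
      qed
      have IE: "apply_td ?IE \<phi> = of_real ?s * (LINT \<xi>|lborel. duh ?m (\<lambda>s. ?E s k) t \<xi> * ifourier \<phi> \<xi>)"
        using td_of_pairing[OF int[OF CE] \<phi>] by (cases sys) (auto simp: exchange_coeff_def apply_td_zero)
      have dd: "duh ?m (\<lambda>\<tau>. nonlin (\<kappa> * rc) ?s (\<lambda>l. f l \<tau>) k) t \<xi>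
          = duh ?m (\<lambda>s. ?H s k) t \<xi> - of_real ?s * duh ?m (\<lambda>s. ?E s k) t \<xi>" for \<xi>
      proof -
        have "duh ?m (\<lambda>\<tau>. nonlin (\<kappa> * rc) ?s (\<lambda>l. f l \<tau>) k) t \<xi>
            = (LINT \<tau>|lborel. indicator {0..t} \<tau> *\<^sub>R (phase ?m (t - \<tau>) \<xi> * ?H \<tau> k \<xi>)
                - of_real ?s * (indicator {0..t} \<tau> *\<^sub>R (phase ?m (t - \<tau>) \<xi> * ?E \<tau> k \<xi>)))"
          unfolding duh_def nonlin_split
          by (intro Bochner_Integration.integral_cong) (auto simp: right_diff_distrib scaleR_diff_right mult_ac)
        also have "\<dots> = duh ?m (\<lambda>s. ?H s k) t \<xi> - of_real ?s * duh ?m (\<lambda>s. ?E s k) t \<xi>"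
        proof -
          note i = duh_integrand(3)[OF m CH order_refl, of t \<xi>] duh_integrand(3)[OF m CE order_refl, of t \<xi>]
          show ?thesis
            unfolding duh_def
            by (simp only: Bochner_Integration.integral_diff[OF i(1) integrable_mult_right[OF i(2)]] integral_mult_right_zero)
        qed
        finally show ?thesis .
      qed
      have "apply_td (td_of (f k t)) \<phi> = (LINT \<xi>|lborel. phase ?m t \<xi> * a k \<xi> * ifourier \<phi> \<xi>
          + (\<i> * (duh ?m (\<lambda>s. ?H s k) t \<xi> * ifourier \<phi> \<xi>) - \<i> * (of_real ?s * (duh ?m (\<lambda>s. ?E s k) t \<xi> * ifourier \<phi> \<xi>))))"
        unfolding td_of_pairing[OF weighted_integrable[OF w] \<phi>] eq[OF t] dd
        by (intro Bochner_Integration.integral_cong) (auto simp: algebra_simps)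
      also have "\<dots> = (LINT \<xi>|lborel. phase ?m t \<xi> * a k \<xi> * ifourier \<phi> \<xi>)
          + (\<i> * (LINT \<xi>|lborel. duh ?m (\<lambda>s. ?H s k) t \<xi> * ifourier \<phi> \<xi>)
             - \<i> * (of_real ?s * (LINT \<xi>|lborel. duh ?m (\<lambda>s. ?E s k) t \<xi> * ifourier \<phi> \<xi>)))"
        using ii[OF pa] ii[OF int[OF CH]] ii[OF int[OF CE]] by simp
      also have "\<dots> = apply_td (free_propagator \<alpha> t (td_of (a k))) \<phi> + \<i> * apply_td ?IH \<phi> - \<i> * apply_td ?IE \<phi>"
        unfolding IE free_propagator_td_of[OF al weighted_integrable[OF a]] td_of_pairing[OF pa \<phi>] td_of_pairing[OF int[OF CH] \<phi>]
        by simp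
      finally show "apply_td ((\<chi> k. td_of (f k t)) $ k) \<phi> =
          apply_td (free_propagator \<alpha> t ((\<chi> k. td_of (a k)) $ k)) \<phi> + \<i> * apply_td ?IH \<phi> - \<i> * apply_td ?IE \<phi>"
        by simp
    qed
  qed
qed

end

section \<open>What third order smoothness implies along a line\<close>

lemma le_of_le_plus_quadratic:
  fixes A B c x0 :: real
  assumes "0 < x0" and le: "\<And>x. 0 < x \<Longrightarrow> x < x0 \<Longrightarrow> A \<le> B + c * x\<^sup>2"
  shows "A \<le> B"
proof (rule ccontr)
  assume "\<not> A \<le> B"
  then have d: "0 < A - B" by simp
  define x where "x = min (x0 / 2) (min 1 ((A - B) / (2 * (\<bar>c\<bar> + 1))))"
  have x: "0 < x" "x < x0" "x \<le> 1" "x \<le> (A - B) / (2 * (\<bar>c\<bar> + 1))"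
    using assms(1) d by (auto simp: x_def min_less_iff_disj)
  have "c * x\<^sup>2 \<le> (\<bar>c\<bar> + 1) * x"
  proof -
    have "c * x\<^sup>2 \<le> (\<bar>c\<bar> + 1) * x\<^sup>2" by (intro mult_right_mono) auto
    also have "\<dots> \<le> (\<bar>c\<bar> + 1) * x" using x by (intro mult_left_mono) (auto simp: power2_eq_square mult_left_le)
    finally show ?thesis .
  qed
  also have "\<dots> \<le> (\<bar>c\<bar> + 1) * ((A - B) / (2 * (\<bar>c\<bar> + 1)))" using x by (intro mult_left_mono) auto
  also have "\<dots> = (A - B) / 2"
    by (simp add: field_simps add_nonneg_eq_0_iff)
  finally have "c * x\<^sup>2 \<le> (A - B) / 2" .
  moreover have "A - B \<le> c * x\<^sup>2" using le[OF x(1,2)] by (simp add: algebra_simps)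
  ultimately have "A - B \<le> (A - B) / 2" by (rule order_trans[rotated])
  then show False using d by simp
qed

text \<open>
  The combination of values at four symmetric points cancels the terms of order zero, one and
  two of a Taylor polynomial and keeps the cubic one, so the lower coefficients of the two
  expansions need not be identified.
\<close>

lemma cubic_coefficient_le:
  fixes h :: "real \<Rightarrow> real"
  assumes r: "0 < r"
    and taylor: "\<And>x. \<bar>x\<bar> < r \<Longrightarrow> \<bar>h x - (a + b * x + c * x\<^sup>2)\<bar> \<le> M * \<bar>x\<bar> ^ 3"
    and expansion: "\<And>x. \<bar>x\<bar> < r \<Longrightarrow> \<bar>h x - (l1 * x + l3 * x ^ 3)\<bar> \<le> K * \<bar>x\<bar> ^ 5"
  shows "\<bar>l3\<bar> \<le> 2 * M"
proof (rule le_of_le_plus_quadratic[of "r / 2"])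
  fix x :: real assume x: "0 < x" "x < r / 2"
  \<comment> \<open>The central difference for the third derivative, scaled by \<open>2
      x\<^sup>3\<close>; it maps the cube to \<open>12 x\<^sup>3\<close>.\<close>
  let ?T = "h (2 * x) - 2 * h x + 2 * h (- x) - h (- (2 * x))"
  have t: "\<bar>h (2 * x) - (a + b * (2 * x) + c * (2 * x)\<^sup>2)\<bar> \<le> M * (8 * x ^ 3)" "\<bar>h x - (a + b * x + c * x\<^sup>2)\<bar> \<le> M * x ^ 3"
    "\<bar>h (- x) - (a + b * (- x) + c * (- x)\<^sup>2)\<bar> \<le> M * x ^ 3" "\<bar>h (- (2 * x)) - (a + b * (- (2 * x)) + c * (- (2 * x))\<^sup>2)\<bar> \<le> M * (8 * x ^ 3)"
    using taylor[of "2 * x"] taylor[of x] taylor[of "- x"] taylor[of "- (2 * x)"] x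
    by (simp_all add: power_mult_distrib abs_mult)
  have e: "\<bar>h (2 * x) - (l1 * (2 * x) + l3 * (2 * x) ^ 3)\<bar> \<le> K * (32 * x ^ 5)" "\<bar>h x - (l1 * x + l3 * x ^ 3)\<bar> \<le> K * x ^ 5"
    "\<bar>h (- x) - (l1 * (- x) + l3 * (- x) ^ 3)\<bar> \<le> K * x ^ 5" "\<bar>h (- (2 * x)) - (l1 * (- (2 * x)) + l3 * (- (2 * x)) ^ 3)\<bar> \<le> K * (32 * x ^ 5)"
    using expansion[of "2 * x"] expansion[of x] expansion[of "- x"] expansion[of "- (2 * x)"] x
    by (simp_all add: power_mult_distrib abs_mult)
  have "\<bar>?T\<bar> \<le> 20 * (M * x ^ 3)"
    using t by (simp add: power_mult_distrib abs_le_iff)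
  moreover have "\<bar>?T - 12 * (l3 * x ^ 3)\<bar> \<le> 68 * (K * x ^ 5)"
    using e by (simp add: power_mult_distrib abs_le_iff)
  ultimately have "12 * \<bar>l3 * x ^ 3\<bar> \<le> 20 * (M * x ^ 3) + 68 * (K * x ^ 5)" by linarith
  then have "12 * \<bar>l3\<bar> * x ^ 3 \<le> (20 * M + 68 * K * x\<^sup>2) * x ^ 3"
    using x by (simp add: abs_mult algebra_simps power2_eq_square eval_nat_numeral)
  then have "12 * \<bar>l3\<bar> \<le> 20 * M + 68 * K * x\<^sup>2" using x by (simp add: mult_le_cancel_right)
  moreover have "0 \<le> M"
    using order_trans[OF abs_ge_zero t(2)] x by (simp add: zero_le_mult_iff)
  ultimately show "\<bar>l3\<bar> \<le> 2 * M + (68 * K / 12) * x\<^sup>2" by (simp add: field_simps)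
next
  show "0 < r / 2" using r by simp
qed

text \<open>
  Composing with a bounded linear functional and restricting to a line reduces the claim to a
  real function of one variable, three times differentiable near 0. Its third derivative is
  bounded by the norm of the third derivative of the map near the origin, times the norm of the
  functional and the cube of the norm of the direction; Taylor's formula then controls the
  cubic coefficient. The constant depends on the map alone, which is what the scaling argument
  needs.
\<close>

theorem C3_smooth_cubic_bound:
  fixes E :: "'v::real_vector set" and nrm :: "'v \<Rightarrow> real" and f :: "'v \<Rightarrow> 'v"
  assumes smooth: "C_smooth_at 3 E nrm f 0" and E: "subspace E"
    and nn: "\<And>v. v \<in> E \<Longrightarrow> 0 \<le> nrm v" and hom: "\<And>c v. v \<in> E \<Longrightarrow> nrm (c *\<^sub>R v) = \<bar>c\<bar> * nrm v"
  shows "\<exists>C\<ge>0. \<forall>\<Lambda> L v l1 l3 K \<epsilon>0. linear \<Lambda> \<longrightarrow> (\<forall>w\<in>E. \<bar>\<Lambda> w\<bar> \<le> L * nrm w) \<longrightarrow> 0 \<le> L \<longrightarrow> v \<in> E \<longrightarrow> 0 < \<epsilon>0 \<longrightarrow>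
    (\<forall>\<epsilon>. \<bar>\<epsilon>\<bar> < \<epsilon>0 \<longrightarrow> \<bar>\<Lambda> (f (\<epsilon> *\<^sub>R v)) - (l1 * \<epsilon> + l3 * \<epsilon> ^ 3)\<bar> \<le> K * \<bar>\<epsilon>\<bar> ^ 5) \<longrightarrow>
    \<bar>l3\<bar> \<le> C * L * nrm v ^ 3"
proof -
  obtain r D where r: "0 < r" and D0: "\<And>x. x \<in> E \<Longrightarrow> nrm x < r \<Longrightarrow> D 0 x [] = f x"
    and ml: "\<And>x k. x \<in> E \<Longrightarrow> nrm x < r \<Longrightarrow> k \<le> 3 \<Longrightarrow> bounded_multilinear_on E nrm k (D k x)"
    and der: "\<And>x k e. x \<in> E \<Longrightarrow> nrm x < r \<Longrightarrow> k < 3 \<Longrightarrow> e > 0 \<Longrightarrow> \<exists>\<delta>>0. \<forall>y. y \<in> E \<longrightarrow> nrm y < r \<longrightarrow> nrm (y - x) < \<delta> \<longrightarrow>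
           multilinear_close E nrm k (e * nrm (y - x)) (D k y) (\<lambda>vs. D k x vs + D (Suc k) x ((y - x) # vs))"
    and cont: "\<And>e. e > 0 \<Longrightarrow> \<exists>\<delta>>0. \<forall>y. y \<in> E \<longrightarrow> nrm y < r \<longrightarrow> nrm y < \<delta> \<longrightarrow> multilinear_close E nrm 3 e (D 3 y) (D 3 0)"
  proof -
    obtain r D where r: "0 < r" and D: "\<forall>x\<in>{x \<in> E. nrm x < r}. D 0 x [] = f x"
        "\<forall>x\<in>{x \<in> E. nrm x < r}. \<forall>k\<le>3. bounded_multilinear_on E nrm k (D k x)"
        "\<forall>x\<in>{x \<in> E. nrm x < r}. \<forall>k<3. \<forall>\<epsilon>>0. \<exists>\<delta>>0. \<forall>y\<in>{x \<in> E. nrm x < r}. nrm (y - x) < \<delta> \<longrightarrow>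
           multilinear_close E nrm k (\<epsilon> * nrm (y - x)) (D k y) (\<lambda>vs. D k x vs + D (Suc k) x ((y - x) # vs))"
        "\<forall>\<epsilon>>0. \<exists>\<delta>>0. \<forall>y\<in>{x \<in> E. nrm x < r}. nrm y < \<delta> \<longrightarrow> multilinear_close E nrm 3 \<epsilon> (D 3 y) (D 3 0)"
      using smooth unfolding C_smooth_at_def Let_def diff_zero by (elim exE conjE) (rule that; assumption)
    show thesis
    proof (rule that[OF r, of D])
      show "D 0 x [] = f x" if "x \<in> E" "nrm x < r" for x using D(1) that by simp
      show "bounded_multilinear_on E nrm k (D k x)" if "x \<in> E" "nrm x < r" "k \<le> 3" for x k using D(2) that by simp
      show "\<exists>\<delta>>0. \<forall>y. y \<in> E \<longrightarrow> nrm y < r \<longrightarrow> nrm (y - x) < \<delta> \<longrightarrow>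
           multilinear_close E nrm k (e * nrm (y - x)) (D k y) (\<lambda>vs. D k x vs + D (Suc k) x ((y - x) # vs))"
        if "x \<in> E" "nrm x < r" "k < 3" "e > 0" for x k e
      proof -
        have "x \<in> {x \<in> E. nrm x < r}" using that by simp
        from D(3)[rule_format, OF this that(3,4)] show ?thesis by auto
      qed
      show "\<exists>\<delta>>0. \<forall>y. y \<in> E \<longrightarrow> nrm y < r \<longrightarrow> nrm y < \<delta> \<longrightarrow> multilinear_close E nrm 3 e (D 3 y) (D 3 0)"
        if "e > 0" for e
        using D(4)[rule_format, OF that] by auto
    qed
  qed
  have E0: "0 \<in> E" by (rule subspace_0[OF E])
  have n0: "nrm 0 = 0" using hom[OF E0, of 0] by simp
  obtain C0 where C0: "\<And>vs. length vs = 3 \<Longrightarrow> set vs \<subseteq> E \<Longrightarrow> nrm (D 3 0 vs) \<le> C0 * prod_list (map nrm vs)"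
  proof -
    have "bounded_multilinear_on E nrm 3 (D 3 0)" using ml[OF E0, of 3] r n0 by simp
    then have "\<exists>C. \<forall>vs. length vs = 3 \<and> set vs \<subseteq> E \<longrightarrow> nrm (D 3 0 vs) \<le> C * prod_list (map nrm vs)"
      unfolding bounded_multilinear_on_def by (elim conjE)
    then show thesis using that by blast
  qed
  obtain \<delta>1 where d1: "0 < \<delta>1" "\<And>y. y \<in> E \<Longrightarrow> nrm y < r \<Longrightarrow> nrm y < \<delta>1 \<Longrightarrow> multilinear_close E nrm 3 1 (D 3 y) (D 3 0)"
    using cont[of 1] by auto
  have closed: "D k x vs \<in> E" if "x \<in> E" "nrm x < r" "k \<le> 3" "length vs = k" "set vs \<subseteq> E" for k x vs
    using ml[OF that(1-3)] that(4,5) unfolding bounded_multilinear_on_def by blast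
  have scale: "D (Suc k) x (c *\<^sub>R v # vs) = c *\<^sub>R D (Suc k) x (v # vs)"
    if "x \<in> E" "nrm x < r" "Suc k \<le> 3" "length vs = k" "set vs \<subseteq> E" "v \<in> E" for k x vs c v
  proof -
    have lin: "\<And>vs i v w c. length vs = Suc k \<Longrightarrow> set vs \<subseteq> E \<Longrightarrow> i < Suc k \<Longrightarrow> v \<in> E \<Longrightarrow> w \<in> E \<Longrightarrow>
        D (Suc k) x (vs[i := c *\<^sub>R v]) = c *\<^sub>R D (Suc k) x (vs[i := v])"
      using ml[OF that(1-3)] unfolding bounded_multilinear_on_def by blast
    show ?thesis using lin[of "v # vs" 0 v v c] that by simp
  qed
  have main: "\<bar>l3\<bar> \<le> (\<bar>C0\<bar> + 1) * L * nrm v ^ 3"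
    if lin: "linear \<Lambda>" and L: "\<forall>w\<in>E. \<bar>\<Lambda> w\<bar> \<le> L * nrm w" and L0: "0 \<le> L" and v: "v \<in> E" and e0: "0 < \<epsilon>0"
      and ex: "\<forall>\<epsilon>. \<bar>\<epsilon>\<bar> < \<epsilon>0 \<longrightarrow> \<bar>\<Lambda> (f (\<epsilon> *\<^sub>R v)) - (l1 * \<epsilon> + l3 * \<epsilon> ^ 3)\<bar> \<le> K * \<bar>\<epsilon>\<bar> ^ 5"
    for \<Lambda> :: "'v \<Rightarrow> real" and L v l1 l3 K \<epsilon>0
  proof -
    define \<nu> where "\<nu> = nrm v"
    have nu: "0 \<le> \<nu>" unfolding \<nu>_def by (rule nn[OF v])
    \<comment> \<open>The denominator avoids a case distinction for a direction of norm 0.\<close>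
    define R where "R = min r \<delta>1 / (\<nu> + 1)"
    have R: "0 < R" using r d1 nu by (simp add: R_def)
    have in_E: "x *\<^sub>R v \<in> E" for x by (rule subspace_scale[OF E v])
    have nx: "nrm (x *\<^sub>R v) = \<bar>x\<bar> * \<nu>" for x unfolding \<nu>_def by (rule hom[OF v])
    have small: "\<bar>x\<bar> * \<nu> < s" if "\<bar>x\<bar> < s / (\<nu> + 1)" "0 < s" for x s
    proof -
      have "\<bar>x\<bar> * \<nu> \<le> \<bar>x\<bar> * (\<nu> + 1)" by (intro mult_left_mono) auto
      also have "\<dots> < s" using that nu by (simp add: pos_less_divide_eq)
      finally show ?thesis .
    qed
    have in_B: "nrm (x *\<^sub>R v) < r" "nrm (x *\<^sub>R v) < \<delta>1" if "\<bar>x\<bar> < R" for x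
      using small[of x "min r \<delta>1"] that r d1 unfolding nx R_def by auto
    have sv: "set (replicate k v) \<subseteq> E" for k using v by (auto simp: set_replicate_conv_if)
    define h where "h k x = \<Lambda> (D k (x *\<^sub>R v) (replicate k v))" for k x
    have deriv: "DERIV (h k) x :> h (Suc k) x" if k: "k < 3" and x: "\<bar>x\<bar> < R" for k x
      unfolding DERIV_def
    proof (rule LIM_I)
      fix e :: real assume e: "0 < e"
      define P where "P = L * \<nu> * \<nu> ^ k"
      have P: "0 \<le> P" using L0 nu by (simp add: P_def)
      define e' where "e' = e / (P + 1)"
      have e': "0 < e'" "e' * P < e"
      proof -
        show "0 < e'" using e P by (simp add: e'_def)
        have "e' * P < e' * (P + 1)" using \<open>0 < e'\<close> by simp
        then show "e' * P < e" using P by (simp add: e'_def)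
      qed
      obtain \<delta> where \<delta>: "0 < \<delta>" "\<And>y. y \<in> E \<Longrightarrow> nrm y < r \<Longrightarrow> nrm (y - x *\<^sub>R v) < \<delta> \<Longrightarrow>
           multilinear_close E nrm k (e' * nrm (y - x *\<^sub>R v)) (D k y) (\<lambda>vs. D k (x *\<^sub>R v) vs + D (Suc k) (x *\<^sub>R v) ((y - x *\<^sub>R v) # vs))"
        using der[OF in_E in_B(1)[OF x] k e'(1)] by blast
      show "\<exists>s>0. \<forall>z. z \<noteq> 0 \<and> norm (z - 0) < s \<longrightarrow> norm ((h k (x + z) - h k x) / z - h (Suc k) x) < e"
      proof (intro exI[of _ "min (R - \<bar>x\<bar>) (\<delta> / (\<nu> + 1))"] conjI allI impI)
        show "0 < min (R - \<bar>x\<bar>) (\<delta> / (\<nu> + 1))" using x \<delta>(1) nu by simp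
        fix z :: real assume "z \<noteq> 0 \<and> norm (z - 0) < min (R - \<bar>x\<bar>) (\<delta> / (\<nu> + 1))"
        then have z: "z \<noteq> 0" "\<bar>z\<bar> < R - \<bar>x\<bar>" "\<bar>z\<bar> < \<delta> / (\<nu> + 1)" by auto
        have xz: "\<bar>x + z\<bar> < R" using z(2) by linarith
        have diff: "(x + z) *\<^sub>R v - x *\<^sub>R v = z *\<^sub>R v" by (simp add: scaleR_add_left)
        have "nrm (z *\<^sub>R v) < \<delta>" unfolding nx by (rule small[OF z(3) \<delta>(1)])
        then have mc: "multilinear_close E nrm k (e' * nrm (z *\<^sub>R v)) (D k ((x + z) *\<^sub>R v)) (\<lambda>vs. D k (x *\<^sub>R v) vs + D (Suc k) (x *\<^sub>R v) (z *\<^sub>R v # vs))"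
          using \<delta>(2)[OF in_E in_B(1)[OF xz]] unfolding diff by blast
        let ?vs = "replicate k v"
        let ?w = "D k ((x + z) *\<^sub>R v) ?vs - (D k (x *\<^sub>R v) ?vs + D (Suc k) (x *\<^sub>R v) (z *\<^sub>R v # ?vs))"
        have "nrm ?w \<le> e' * nrm (z *\<^sub>R v) * prod_list (map nrm ?vs)"
          using mc sv unfolding multilinear_close_def by (metis length_replicate)
        then have w: "nrm ?w \<le> e' * (\<bar>z\<bar> * \<nu>) * \<nu> ^ k"
          unfolding nx by (simp add: \<nu>_def)
        have sc: "D (Suc k) (x *\<^sub>R v) (z *\<^sub>R v # ?vs) = z *\<^sub>R D (Suc k) (x *\<^sub>R v) (v # ?vs)"
          using k by (intro scale[OF in_E in_B(1)[OF x] _ _ sv v]) auto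
        have wE: "?w \<in> E"
          unfolding sc using k v sv[of k]
          by (intro subspace_diff[OF E] subspace_add[OF E] subspace_scale[OF E] closed in_E in_B(1)[OF x] in_B(1)[OF xz]) auto
        have lw: "\<Lambda> ?w = h k (x + z) - h k x - z * h (Suc k) x"
          unfolding sc h_def by (simp add: linear_diff[OF lin] linear_add[OF lin] linear_scale[OF lin])
        have "\<bar>h k (x + z) - h k x - z * h (Suc k) x\<bar> \<le> L * (e' * (\<bar>z\<bar> * \<nu>) * \<nu> ^ k)"
          using order_trans[OF L[rule_format, OF wE] mult_left_mono[OF w L0]] unfolding lw .
        also have "\<dots> = (e' * P) * \<bar>z\<bar>" by (simp add: P_def)
        also have "\<dots> < e * \<bar>z\<bar>" using e'(2) z(1) by (intro mult_strict_right_mono) auto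
        finally have "\<bar>h k (x + z) - h k x - z * h (Suc k) x\<bar> / \<bar>z\<bar> < e"
          using z(1) by (simp add: pos_divide_less_eq)
        moreover have "(h k (x + z) - h k x) / z - h (Suc k) x = (h k (x + z) - h k x - z * h (Suc k) x) / z"
          using z(1) by (simp add: field_simps)
        ultimately show "norm ((h k (x + z) - h k x) / z - h (Suc k) x) < e"
          by (simp add: abs_divide)
      qed
    qed
    define M where "M = L * ((\<bar>C0\<bar> + 1) * \<nu> ^ 3)"
    have h3: "\<bar>h 3 x\<bar> \<le> M" if x: "\<bar>x\<bar> < R" for x
    proof -
      let ?vs = "replicate 3 v"
      have a: "D 3 0 ?vs \<in> E" "D 3 (x *\<^sub>R v) ?vs \<in> E"
        using closed[OF in_E in_B(1)[OF x], of 3 ?vs] closed[OF E0, of 3 ?vs] r sv[of 3] n0 by auto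
      have p: "prod_list (map nrm ?vs) = \<nu> ^ 3" by (simp add: \<nu>_def)
      have "nrm (D 3 (x *\<^sub>R v) ?vs - D 3 0 ?vs) \<le> 1 * \<nu> ^ 3"
        using d1(2)[OF in_E in_B[OF x], unfolded multilinear_close_def, rule_format, of ?vs] sv[of 3]
        unfolding p by simp
      then have 1: "\<bar>\<Lambda> (D 3 (x *\<^sub>R v) ?vs - D 3 0 ?vs)\<bar> \<le> L * \<nu> ^ 3"
        using order_trans[OF L[rule_format, OF subspace_diff[OF E a(2) a(1)]] mult_left_mono[OF _ L0]] by simp
      have "nrm (D 3 0 ?vs) \<le> \<bar>C0\<bar> * \<nu> ^ 3"
      proof -
        have "nrm (D 3 0 ?vs) \<le> C0 * \<nu> ^ 3" using C0[of ?vs] sv[of 3] unfolding p by simp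
        also have "\<dots> \<le> \<bar>C0\<bar> * \<nu> ^ 3" using nu by (intro mult_right_mono) auto
        finally show ?thesis .
      qed
      then have 2: "\<bar>\<Lambda> (D 3 0 ?vs)\<bar> \<le> L * (\<bar>C0\<bar> * \<nu> ^ 3)"
        using order_trans[OF L[rule_format, OF a(1)] mult_left_mono[OF _ L0]] by simp
      have "h 3 x = \<Lambda> (D 3 (x *\<^sub>R v) ?vs - D 3 0 ?vs) + \<Lambda> (D 3 0 ?vs)"
        unfolding h_def by (simp add: linear_diff[OF lin])
      then show ?thesis using 1 2 by (simp add: M_def algebra_simps)
    qed
    have taylor: "\<bar>h 0 x - (h 0 0 + h 1 0 * x + h 2 0 / 2 * x\<^sup>2)\<bar> \<le> M / 6 * \<bar>x\<bar> ^ 3" if x: "\<bar>x\<bar> < R" for x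
    proof -
      have "\<exists>t. \<bar>t\<bar> \<le> \<bar>x\<bar> \<and> h 0 x = (\<Sum>m<3. h m 0 / fact m * x ^ m) + h 3 t / fact 3 * x ^ 3"
        by (rule Maclaurin_bi_le) (use deriv x in auto)
      then obtain t where t: "\<bar>t\<bar> \<le> \<bar>x\<bar>" "h 0 x = (\<Sum>m<3. h m 0 / fact m * x ^ m) + h 3 t / fact 3 * x ^ 3" by blast
      have "h 0 x - (h 0 0 + h 1 0 * x + h 2 0 / 2 * x\<^sup>2) = h 3 t / 6 * x ^ 3"
        unfolding t(2) by (simp add: eval_nat_numeral)
      moreover have "\<bar>h 3 t / 6 * x ^ 3\<bar> \<le> M / 6 * \<bar>x\<bar> ^ 3"
        using h3[of t] t(1) x unfolding abs_mult power_abs by (intro mult_right_mono) auto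
      ultimately show ?thesis by (simp only:)
    qed
    have h0: "h 0 x = \<Lambda> (f (x *\<^sub>R v))" if "\<bar>x\<bar> < R" for x
      unfolding h_def using D0[OF in_E in_B(1)[OF that]] by simp
    have "\<bar>l3\<bar> \<le> 2 * (M / 6)"
      by (rule cubic_coefficient_le[of "min R \<epsilon>0" "h 0" "h 0 0" "h 1 0" "h 2 0 / 2" _ l1 _ K])
         (use R e0 taylor ex h0 in auto)
    also have "\<dots> \<le> M" using L0 nu by (simp add: M_def)
    finally show ?thesis by (simp add: M_def \<nu>_def mult_ac)
  qed
  show ?thesis
    by (rule exI[of _ "\<bar>C0\<bar> + 1"]) (use main in auto)
qed

section \<open>Dilations\<close>

lemma corr_dilate:
  fixes f g :: "'a::euclidean_space \<Rightarrow> complex"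
  assumes [measurable]: "f \<in> borel_measurable borel" "g \<in> borel_measurable borel" and c: "0 < c"
  shows "corr (\<lambda>\<xi>. f (c *\<^sub>R \<xi>)) (\<lambda>\<xi>. g (c *\<^sub>R \<xi>)) \<eta> = of_real (c powr (- DIM('a))) * corr f g (c *\<^sub>R \<eta>)"
proof -
  have m: "(\<lambda>\<zeta>. f (\<zeta> + c *\<^sub>R \<eta>) * cnj (g \<zeta>)) \<in> borel_measurable borel" by measurable
  have "corr f g (c *\<^sub>R \<eta>) = c ^ DIM('a) *\<^sub>R corr (\<lambda>\<xi>. f (c *\<^sub>R \<xi>)) (\<lambda>\<xi>. g (c *\<^sub>R \<xi>)) \<eta>"
    unfolding corr_def using lborel_scale(2)[OF m, of c 0] c by (simp add: scaleR_add_right)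
  then show ?thesis using c by (simp add: scaleR_conv_of_real powr_minus powr_realpow flip: of_real_mult of_real_power)
qed

lemma symbol_dilate:
  assumes "0 < c"
  shows "symbol \<alpha> \<xi> = c powr (- \<alpha>) * symbol \<alpha> (c *\<^sub>R \<xi>)"
proof -
  have "c powr (- \<alpha>) * (c powr \<alpha> * norm \<xi> powr \<alpha>) = norm \<xi> powr \<alpha>"
    using assms by (simp add: mult.assoc[symmetric] flip: powr_add)
  then show ?thesis using assms by (simp add: symbol_def powr_mult mult.left_commute)
qed

lemma phase_dilate:
  assumes "0 < c"
  shows "phase (symbol \<alpha>) s \<xi> = phase (symbol \<alpha>) (c powr (- \<alpha>) * s) (c *\<^sub>R \<xi>)"
  unfolding phase_def by (subst symbol_dilate[OF assms]) (simp add: mult_ac)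

context riesz_setting
begin

text \<open>
  Two integrations over frequency contribute \<open>c\<close> to the power \<open>-2d\<close>,
  and the homogeneity of the kernel contributes \<open>c\<close> to the power \<open>d -
  \<gamma>\<close>.
\<close>

lemma trilin_dilate:
  assumes f: "f \<in> borel_measurable borel" and g: "g \<in> borel_measurable borel" and h: "h \<in> borel_measurable borel" and c: "0 < c"
  shows "trilin (\<lambda>\<xi>. f (c *\<^sub>R \<xi>)) (\<lambda>\<xi>. g (c *\<^sub>R \<xi>)) (\<lambda>\<xi>. h (c *\<^sub>R \<xi>)) \<xi>
    = of_real (c powr (- (DIM('a) + \<gamma>))) * trilin f g h (c *\<^sub>R \<xi>)"
proof -
  note [measurable] = f g h
  let ?F = "\<lambda>\<eta>. of_real (K \<eta>) * corr f g \<eta> * h (c *\<^sub>R \<xi> - \<eta>)"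
  have m: "?F \<in> borel_measurable borel" using measurable_corr[OF f g] by measurable
  have "trilin (\<lambda>\<xi>. f (c *\<^sub>R \<xi>)) (\<lambda>\<xi>. g (c *\<^sub>R \<xi>)) (\<lambda>\<xi>. h (c *\<^sub>R \<xi>)) \<xi>
      = (LINT \<eta>|lborel. of_real (c powr (- \<gamma>)) * ?F (c *\<^sub>R \<eta>))"
    unfolding trilin_def conv_def
  proof (rule Bochner_Integration.integral_cong[OF refl])
    fix \<eta> :: 'a
    have K: "K (c *\<^sub>R \<eta>) = c powr (- (DIM('a) - \<gamma>)) * K \<eta>" using c by (simp add: riesz_scaleR)
    have "c powr (- \<gamma>) * (c powr (- (DIM('a) - \<gamma>)) * K \<eta>) = c powr (- DIM('a)) * K \<eta>"
      by (simp add: mult.assoc[symmetric] flip: powr_add)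
    then show "of_real (K \<eta>) * corr (\<lambda>\<xi>. f (c *\<^sub>R \<xi>)) (\<lambda>\<xi>. g (c *\<^sub>R \<xi>)) \<eta> * h (c *\<^sub>R (\<xi> - \<eta>)) = of_real (c powr (- \<gamma>)) * ?F (c *\<^sub>R \<eta>)"
      unfolding corr_dilate[OF f g c] K scaleR_diff_right
      by (simp only: mult.assoc[symmetric] of_real_mult[symmetric]) (simp only: mult_ac)
  qed
  also have "\<dots> = of_real (c powr (- \<gamma>)) * (LINT \<eta>|lborel. ?F (c *\<^sub>R \<eta>))" by (rule integral_mult_right_zero)
  also have "(LINT \<eta>|lborel. ?F (c *\<^sub>R \<eta>)) = of_real (c powr (- DIM('a))) * trilin f g h (c *\<^sub>R \<xi>)"
  proof -
    have "trilin f g h (c *\<^sub>R \<xi>) = c ^ DIM('a) *\<^sub>R (LINT \<eta>|lborel. ?F (c *\<^sub>R \<eta>))"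
      unfolding trilin_def conv_def using lborel_scale(2)[OF m, of c 0] c by simp
    then show ?thesis using c by (simp add: scaleR_conv_of_real powr_minus powr_realpow flip: of_real_mult of_real_power)
  qed
  also have "of_real (c powr (- \<gamma>)) * (of_real (c powr (- DIM('a))) * trilin f g h (c *\<^sub>R \<xi>)) = of_real (c powr (- (DIM('a) + \<gamma>))) * trilin f g h (c *\<^sub>R \<xi>)"
    by (simp add: mult.assoc[symmetric] add.commute flip: of_real_mult powr_add)
  finally show ?thesis .
qed

lemma nonlin_dilate:
  assumes "\<And>l. f l \<in> borel_measurable borel" and "0 < c"
  shows "nonlin \<kappa> \<sigma> (\<lambda>l \<xi>. f l (c *\<^sub>R \<xi>)) k \<xi> = of_real (c powr (- (DIM('a) + \<gamma>))) * nonlin \<kappa> \<sigma> f k (c *\<^sub>R \<xi>)"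
  unfolding nonlin_def trilin_dilate[OF assms(1) assms(1) assms(1) assms(2)]
  by (simp add: sum_distrib_left[symmetric] right_diff_distrib mult.left_commute)

text \<open>
  The cubic term of the solution in the rescaled frequency variable; the scale only enters
  through the speed \<^term>\<open>\<mu>\<close> of the phases, which tends to zero at low frequency.
\<close>

definition scaled_cubic ::
    "real \<Rightarrow> real \<Rightarrow> real \<Rightarrow> ('n::finite \<Rightarrow> 'a \<Rightarrow> complex) \<Rightarrow> 'n \<Rightarrow> real \<Rightarrow> real \<Rightarrow> 'a \<Rightarrow> complex" where
  "scaled_cubic \<alpha> \<kappa> \<sigma> F k t \<mu> \<xi> = (LINT \<tau>|lborel. indicator {0..t} \<tau> *\<^sub>R
     (phase (symbol \<alpha>) (\<mu> * (t - \<tau>)) \<xi> * nonlin \<kappa> \<sigma> (\<lambda>l \<xi>. phase (symbol \<alpha>) (\<mu> * \<tau>) \<xi> * F l \<xi>) k \<xi>))"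

lemma duh_dilate:
  assumes al: "0 < \<alpha>" and F: "\<And>l. F l \<in> borel_measurable borel" and c: "0 < c"
  shows "duh (symbol \<alpha>) (\<lambda>\<tau>. nonlin \<kappa> \<sigma> (\<lambda>l \<xi>. phase (symbol \<alpha>) \<tau> \<xi> * F l (c *\<^sub>R \<xi>)) k) t \<xi>
    = of_real (c powr (- (DIM('a) + \<gamma>))) * scaled_cubic \<alpha> \<kappa> \<sigma> F k t (c powr (- \<alpha>)) (c *\<^sub>R \<xi>)"
proof -
  have "continuous_on UNIV (phase (symbol \<alpha>) s :: 'a \<Rightarrow> complex)" for s
    by (intro continuous_phase[where s="\<lambda>_. s" and x="\<lambda>x. x"] continuous_symbol al continuous_intros)
  note [measurable] = borel_measurable_continuous[OF this] F
  have "nonlin \<kappa> \<sigma> (\<lambda>l \<xi>. phase (symbol \<alpha>) \<tau> \<xi> * F l (c *\<^sub>R \<xi>)) k \<xi>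
      = of_real (c powr (- (DIM('a) + \<gamma>))) * nonlin \<kappa> \<sigma> (\<lambda>l \<xi>. phase (symbol \<alpha>) (c powr (- \<alpha>) * \<tau>) \<xi> * F l \<xi>) k (c *\<^sub>R \<xi>)" for \<tau> \<xi>
    using nonlin_dilate[where c=c and f="\<lambda>l \<xi>. phase (symbol \<alpha>) (c powr (- \<alpha>) * \<tau>) \<xi> * F l \<xi>", OF _ c]
    by (simp add: phase_dilate[OF c, symmetric])
  then show ?thesis
    unfolding duh_def scaled_cubic_def integral_mult_right_zero[symmetric]
    by (intro Bochner_Integration.integral_cong) (auto simp: phase_dilate[OF c, of \<alpha> _ \<xi>] mult_ac)
qed

text \<open>
  Continuity in the speed \<^term>\<open>\<mu>\<close>, including \<^term>\<open>\<mu> =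
  0\<close>, allows passing to the limit of
  low frequency.
\<close>

lemma weighted_family_scaled_cubic:
  fixes F :: "'n::finite \<Rightarrow> 'a \<Rightarrow> complex"
  assumes al: "0 < \<alpha>" and F: "\<And>l. continuous_on UNIV (F l)" "\<And>l x. norm (F l x) \<le> R * weight x"
    and s: "\<bar>\<sigma>\<bar> \<le> 1" and t: "0 \<le> t"
  shows "\<exists>C. weighted_family C (scaled_cubic \<alpha> \<kappa> \<sigma> F k t)"
proof -
  have m: "continuous_on UNIV (symbol \<alpha> :: 'a \<Rightarrow> real)" by (rule continuous_symbol[OF al])
  let ?g = "\<lambda>p::real \<times> real. nonlin \<kappa> \<sigma> (\<lambda>l \<xi>. phase (symbol \<alpha>) (fst p * snd p) \<xi> * F l \<xi>) k"
  define C where "C = nonlin_const \<kappa> TYPE('n) * R ^ 3"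
  have f: "weighted_family R (\<lambda>(p::real \<times> real) \<xi>. phase (symbol \<alpha>) (fst p * snd p) \<xi> * F l \<xi>)" for l
    by (intro weighted_family_phase m weighted_family_const F continuous_intros)
  have "weighted_family C ?g"
    unfolding C_def by (rule weighted_family_nonlin[where f="\<lambda>l (p::real \<times> real) \<xi>. phase (symbol \<alpha>) (fst p * snd p) \<xi> * F l \<xi>", OF f s])
  then have g: "weighted_family C (\<lambda>(p::real \<times> real) \<xi>. phase (symbol \<alpha>) (fst p * (t - snd p)) \<xi> * ?g p \<xi>)"
    by (intro weighted_family_phase m continuous_intros)
  note C0 = weighted_family_nonneg[OF g]
  let ?I = "\<lambda>\<mu> \<xi> \<tau>. indicator {0..t} \<tau> *\<^sub>R (phase (symbol \<alpha>) (\<mu> * (t - \<tau>)) \<xi> * ?g (\<mu>, \<tau>) \<xi>)"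
  have gb: "norm (phase (symbol \<alpha>) (\<mu> * (t - \<tau>)) \<xi> * ?g (\<mu>, \<tau>) \<xi>) \<le> C * weight \<xi>" for \<mu> \<tau> and \<xi> :: 'a
    using weighted_bound[OF weighted_family_weighted[OF g, of "(\<mu>, \<tau>)"], of \<xi>] by simp
  have bound: "norm (?I \<mu> \<xi> \<tau>) \<le> indicator {0..t} \<tau> * (C * weight \<xi>)" for \<mu> and \<xi> :: 'a and \<tau>
    using gb[of \<mu> \<tau> \<xi>] by (auto simp: indicator_def)
  have meas: "?I \<mu> \<xi> \<in> borel_measurable borel" for \<mu> and \<xi> :: 'a
  proof -
    have "continuous_on UNIV (\<lambda>\<tau>. phase (symbol \<alpha>) (\<mu> * (t - \<tau>)) \<xi> * ?g (\<mu>, \<tau>) \<xi>)"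
      using weighted_family_compose[OF g, of "\<lambda>\<tau>. (\<mu>, \<tau>)" "\<lambda>_. \<xi>"] by (simp add: continuous_on_Pair)
    note [measurable] = borel_measurable_continuous[OF this]
    show ?thesis by measurable
  qed
  have eq: "scaled_cubic \<alpha> \<kappa> \<sigma> F k t \<mu> \<xi> = (LINT \<tau>|lborel. ?I \<mu> \<xi> \<tau>)" for \<mu> \<xi>
    unfolding scaled_cubic_def by simp
  have "weighted_family (t * C) (scaled_cubic \<alpha> \<kappa> \<sigma> F k t)"
    unfolding weighted_family_def eq
  proof (intro conjI allI)
    show "continuous_on UNIV (\<lambda>q. LINT \<tau>|lborel. ?I (fst q) (snd q) \<tau>)"
    proof (rule continuous_LINT[where B="\<lambda>\<tau>. indicator {0..t} \<tau> * C"])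
      show "?I (fst q) (snd q) \<in> borel_measurable lborel" for q using meas by simp
      show "continuous_on UNIV (\<lambda>q. ?I (fst q) (snd q) \<tau>)" for \<tau>
        using weighted_family_compose[OF g, of "\<lambda>q. (fst q, \<tau>)" "\<lambda>q. snd q"]
        by (intro continuous_on_scaleR continuous_on_const) (simp add: continuous_on_Pair continuous_on_fst continuous_on_snd)
      show "norm (?I (fst q) (snd q) \<tau>) \<le> indicator {0..t} \<tau> * C" for q \<tau>
        using order_trans[OF bound mult_left_mono[OF mult_left_le[OF weight_le_1 C0]]] by simp
      show "integrable lborel (\<lambda>\<tau>. indicator {0..t} \<tau> * C)" by (intro integrable_mult_left integrable_indicator_Icc)
    qed
    fix \<mu> and \<xi> :: 'a
    have i: "integrable lborel (\<lambda>\<tau>. indicator {0..t} \<tau> * (C * weight \<xi>))"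
      by (intro integrable_mult_left integrable_indicator_Icc)
    have "integrable lborel (?I \<mu> \<xi>)"
    proof (rule Bochner_Integration.integrable_bound[OF i])
      show "?I \<mu> \<xi> \<in> borel_measurable lborel" using meas by simp
      show "AE \<tau> in lborel. norm (?I \<mu> \<xi> \<tau>) \<le> norm (indicator {0..t} \<tau> * (C * weight \<xi>))"
        by (rule AE_I2, rule order_trans[OF bound]) simp
    qed
    then have "norm (LINT \<tau>|lborel. ?I \<mu> \<xi> \<tau>) \<le> (LINT \<tau>|lborel. indicator {0..t} \<tau> * (C * weight \<xi>))"
      by (intro order_trans[OF integral_norm_bound integral_mono] integrable_norm i bound)
    also have "\<dots> = t * C * weight \<xi>" using t by simp
    finally show "norm (LINT \<tau>|lborel. ?I \<mu> \<xi> \<tau>) \<le> t * C * weight \<xi>" .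
  qed
  then show ?thesis by blast
qed

lemma scaled_cubic_0:
  assumes "0 \<le> t"
  shows "scaled_cubic \<alpha> \<kappa> \<sigma> F k t 0 \<xi> = of_real t * nonlin \<kappa> \<sigma> F k \<xi>"
proof -
  have "phase m 0 = (\<lambda>\<xi>. 1)" for m :: "'a \<Rightarrow> real" by (simp add: phase_def fun_eq_iff)
  then have "scaled_cubic \<alpha> \<kappa> \<sigma> F k t 0 \<xi> = (LINT \<tau>|lborel. indicat_real {0..t} \<tau> *\<^sub>R nonlin \<kappa> \<sigma> F k \<xi>)"
    by (simp add: scaled_cubic_def)
  then show ?thesis using assms by (simp add: scaleR_conv_of_real)
qed

end

section \<open>A datum with a nonvanishing cubic response\<close>

lemma LINT_pos_of_continuous:
  fixes f :: "'a::euclidean_space \<Rightarrow> real"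
  assumes f: "continuous_on UNIV f" "\<And>x. 0 \<le> f x" "integrable lborel f" and z: "0 < f z"
  shows "0 < (LINT x|lborel. f x)"
proof -
  have "(LINT x|lborel. f x) \<noteq> 0"
  proof
    assume "(LINT x|lborel. f x) = 0"
    then have AE: "AE x in lborel. f x = 0" using f by (subst (asm) integral_nonneg_eq_0_iff_AE) auto
    let ?U = "f -` {0<..}"
    have U: "open ?U" using f(1) by (intro open_vimage) (auto simp: continuous_on_eq_continuous_at)
    have "?U \<in> null_sets lborel"
      using U AE by (subst AE_iff_null_sets) (auto elim!: eventually_mono)
    then have "emeasure lborel ?U = 0" by (rule null_setsD1)
    obtain e where e: "0 < e" "ball z e \<subseteq> ?U" using U z by (auto elim: openE)
    have "emeasure lborel (ball z e) \<le> emeasure lborel ?U" using e U by (intro emeasure_mono) auto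
    moreover have "emeasure lborel (ball z e) > 0"
      using e by (simp add: emeasure_ball unit_ball_vol_pos)
    ultimately show False using \<open>emeasure lborel ?U = 0\<close> by simp
  qed
  moreover have "0 \<le> (LINT x|lborel. f x)" using f(2) by (intro Bochner_Integration.integral_nonneg) auto
  ultimately show ?thesis by linarith
qed

definition tent :: "'a::euclidean_space \<Rightarrow> real" where
  "tent x = max 0 (1 - norm x)"

lemma tent_simps: "0 \<le> tent x" "tent x \<le> 1" "tent 0 = 1" "1 \<le> norm x \<Longrightarrow> tent x = 0" "tent (- x) = tent x"
  by (auto simp: tent_def)

lemma continuous_tent [continuous_intros]: "continuous_on S f \<Longrightarrow> continuous_on S (\<lambda>x. tent (f x))"
  unfolding tent_def by (intro continuous_intros)

lemma borel_measurable_tent [measurable]: "tent \<in> borel_measurable borel"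
  by (intro borel_measurable_continuous continuous_intros)

context riesz_setting
begin

text \<open>
  The autocorrelation of a bump; its support is the ball of radius 2.
\<close>

definition tent2 :: "'a \<Rightarrow> real" where
  "tent2 \<eta> = (LINT \<zeta>|lborel. tent (\<zeta> + \<eta>) * tent \<zeta>)"

text \<open>
  What the trilinear form gives for three bumps when the kernel is replaced by 1, which is the
  common yardstick for the direct and the exchange term.
\<close>

definition tent3 :: "'a \<Rightarrow> real" where
  "tent3 \<xi> = (LINT \<eta>|lborel. tent2 \<eta> * tent (\<xi> - \<eta>))"

lemma tent_shift_weight: "\<exists>C. \<forall>x. norm (complex_of_real (tent (x - e))) \<le> C * weight (x::'a)"
proof -
  let ?n = "2 * DIM('a)"
  have "tent (x - e) \<le> (2 + norm e) ^ ?n * weight x" for x :: 'a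
  proof (cases "norm (x - e) \<le> 1")
    case True
    then have "norm x \<le> 1 + norm e" using norm_triangle_sub[of x e] by linarith
    then have "(1 + norm x) ^ ?n \<le> (2 + norm e) ^ ?n" by (intro power_mono) auto
    moreover have "0 < (1 + norm x) ^ ?n" by (intro zero_less_power) (auto intro: add_pos_nonneg)
    ultimately have "1 \<le> (2 + norm e) ^ ?n * weight x" by (simp add: weight_def)
    then show ?thesis using tent_simps(2)[of "x - e"] by linarith
  next
    case False
    then have "tent (x - e) = 0" by (intro tent_simps) simp
    then show ?thesis by simp
  qed
  then show ?thesis
    unfolding norm_of_real abs_of_nonneg[OF tent_simps(1)] by blast
qed

lemma continuous_tent_shift: "continuous_on UNIV (\<lambda>x::'a. complex_of_real (tent (x - e)))"
  by (intro continuous_intros)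

lemma weighted_tent: "\<exists>C. weighted C (\<lambda>x::'a. complex_of_real (tent (x - e)))"
  using tent_shift_weight[of e] borel_measurable_continuous[OF continuous_tent_shift] unfolding weighted_def by blast

lemma corr_tent: "corr (\<lambda>x. complex_of_real (tent (x - e))) (\<lambda>x. of_real (tent x)) \<eta> = of_real (tent2 (\<eta> - e))"
  unfolding corr_def tent2_def by (simp add: algebra_simps flip: of_real_mult)

lemma corr_tent_tent: "corr (\<lambda>x. complex_of_real (tent x)) (\<lambda>x. of_real (tent x)) \<eta> = of_real (tent2 \<eta>)"
  using corr_tent[of 0 \<eta>] by simp

lemma tent2_nonneg: "0 \<le> tent2 \<eta>"
  unfolding tent2_def by (intro Bochner_Integration.integral_nonneg mult_nonneg_nonneg tent_simps(1))

lemma tent2_eq_0: "2 \<le> norm \<eta> \<Longrightarrow> tent2 \<eta> = 0"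
proof -
  assume "2 \<le> norm \<eta>"
  then have *: "tent (\<zeta> + \<eta>) * tent \<zeta> = 0" for \<zeta>
  proof -
    have "norm \<eta> \<le> norm (\<zeta> + \<eta>) + norm \<zeta>" using norm_triangle_ineq4[of "\<zeta> + \<eta>" \<zeta>] by simp
    then have "1 \<le> norm (\<zeta> + \<eta>) \<or> 1 \<le> norm \<zeta>" using \<open>2 \<le> norm \<eta>\<close> by linarith
    then show ?thesis by (auto simp: tent_simps)
  qed
  show ?thesis unfolding tent2_def * by simp
qed

lemma tent2_weighted: "\<exists>C. weighted_family C (\<lambda>(p::real) \<eta>::'a. complex_of_real (tent2 \<eta>))"
proof -
  obtain C where C: "\<And>x. norm (complex_of_real (tent (x - 0))) \<le> C * weight (x::'a)" using tent_shift_weight by blast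
  have "weighted_family C (\<lambda>(p::real) x::'a. complex_of_real (tent (x - 0)))"
    by (intro weighted_family_const continuous_tent_shift C)
  then have f: "weighted_family C (\<lambda>(p::real) x::'a. complex_of_real (tent x))" by simp
  have "corr (\<lambda>x::'a. complex_of_real (tent x)) (\<lambda>x. of_real (tent x)) = (\<lambda>\<eta>. of_real (tent2 \<eta>))"
    by (rule ext) (rule corr_tent_tent)
  with continuous_corr[OF f f] show ?thesis by auto
qed

lemma tent2_continuous: "continuous_on UNIV tent2"
proof -
  obtain C where C: "weighted_family C (\<lambda>(p::real) \<eta>::'a. complex_of_real (tent2 \<eta>))" using tent2_weighted by blast
  have "continuous_on UNIV (\<lambda>\<eta>. Re (complex_of_real (tent2 \<eta>)))"
    by (intro continuous_on_Re weighted_family_continuous[OF C])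
  then show ?thesis by simp
qed

lemma tent2_integrable: "integrable lborel tent2"
proof -
  obtain C where C: "weighted_family C (\<lambda>(p::real) \<eta>::'a. complex_of_real (tent2 \<eta>))" using tent2_weighted by blast
  show ?thesis
    using weighted_integrable[OF weighted_family_weighted[OF C]] by (simp add: complex_of_real_integrable_eq)
qed

lemma measurable_tent2 [measurable]: "tent2 \<in> borel_measurable borel"
  by (rule borel_measurable_continuous[OF tent2_continuous])

lemma tent2_0: "0 < tent2 0"
  unfolding tent2_def
proof (rule LINT_pos_of_continuous[of _ 0])
  obtain C where C: "weighted C (\<lambda>x::'a. complex_of_real (tent (x - 0)))" using weighted_tent by blast
  then have i: "integrable lborel (tent :: 'a \<Rightarrow> real)"
    using weighted_integrable[OF C] by (simp add: complex_of_real_integrable_eq)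
  show "integrable lborel (\<lambda>\<zeta>::'a. tent (\<zeta> + 0) * tent \<zeta>)"
    by (rule Bochner_Integration.integrable_bound[OF i])
       (auto simp: tent_simps abs_mult intro!: mult_left_le AE_I2)
qed (auto simp: tent_simps intro!: continuous_intros)

lemma tent3_integrand: "integrable lborel (\<lambda>\<eta>. tent2 \<eta> * tent (\<xi> - \<eta>))"
  by (rule Bochner_Integration.integrable_bound[OF tent2_integrable])
     (auto simp: tent_simps abs_mult intro!: mult_left_le AE_I2)

lemma tent3_nonneg: "0 \<le> tent3 \<xi>"
  unfolding tent3_def by (intro Bochner_Integration.integral_nonneg mult_nonneg_nonneg tent_simps(1) tent2_nonneg)

lemma tent3_0: "0 < tent3 0"
  unfolding tent3_def
  by (rule LINT_pos_of_continuous[where z=0, OF _ _ tent3_integrand])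
     (auto simp: tent_simps tent2_0 tent2_nonneg intro!: continuous_intros continuous_on_compose2[OF tent2_continuous])

text \<open>
  In the direct term the first two arguments are the same bump, so the kernel is evaluated at
  frequencies of norm at most 2. In the exchange term they are bumps at distance 6, so it is
  evaluated at frequencies of norm at least 4, where it is smaller. This is why the exchange term
  cannot cancel the direct term.
\<close>

definition gap :: real where
  "gap = 2 powr (- (DIM('a) - \<gamma>)) - 4 powr (- (DIM('a) - \<gamma>))"

lemma gap_pos: "0 < gap"
  unfolding gap_def using gamma powr_less_mono2_neg[of "- (DIM('a) - \<gamma>)" 2 4] by simp

lemma trilin_tent_direct:
  "\<exists>R. trilin (\<lambda>x. of_real (tent x)) (\<lambda>x. of_real (tent x)) (\<lambda>x. of_real (tent (x - e))) \<xi> = of_real R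
    \<and> 2 powr (- (DIM('a) - \<gamma>)) * tent3 (\<xi> - e) \<le> R"
proof -
  let ?f = "\<lambda>\<eta>. K \<eta> * tent2 \<eta> * tent (\<xi> - \<eta> - e)"
  obtain A D where A: "weighted A (\<lambda>x::'a. complex_of_real (tent (x - 0)))" and D: "weighted D (\<lambda>x::'a. complex_of_real (tent (x - e)))"
    using weighted_tent by metis
  note A = A[unfolded diff_zero]
  have "integrable lborel (\<lambda>\<eta>. complex_of_real (?f \<eta>))"
    using trilin_integrand(3)[OF A A D, of \<xi>] by (simp add: corr_tent_tent)
  then have i: "integrable lborel ?f" by (simp only: complex_of_real_integrable_eq)
  have "trilin (\<lambda>x. of_real (tent x)) (\<lambda>x. of_real (tent x)) (\<lambda>x. of_real (tent (x - e))) \<xi> = of_real (LINT \<eta>|lborel. ?f \<eta>)"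
    unfolding trilin_def conv_def corr_tent_tent by (simp flip: of_real_mult)
  moreover have "2 powr (- (DIM('a) - \<gamma>)) * tent3 (\<xi> - e) \<le> (LINT \<eta>|lborel. ?f \<eta>)"
    unfolding tent3_def integral_mult_right_zero[symmetric]
  proof (rule integral_mono_AE)
    show "integrable lborel (\<lambda>\<eta>. 2 powr (- (DIM('a) - \<gamma>)) * (tent2 \<eta> * tent (\<xi> - e - \<eta>)))"
      by (intro integrable_mult_right tent3_integrand)
    show "AE \<eta> in lborel. 2 powr (- (DIM('a) - \<gamma>)) * (tent2 \<eta> * tent (\<xi> - e - \<eta>)) \<le> ?f \<eta>"
      using AE_lborel_singleton[of 0]
    proof eventually_elim
      case (elim \<eta>)
      show ?case
      proof (cases "2 \<le> norm \<eta>")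
        case False
        have "2 powr (- (DIM('a) - \<gamma>)) \<le> norm \<eta> powr (- (DIM('a) - \<gamma>))"
          using elim False gamma by (intro powr_mono2') auto
        then have "2 powr (- (DIM('a) - \<gamma>)) * (tent2 \<eta> * tent (\<xi> - \<eta> - e)) \<le> K \<eta> * (tent2 \<eta> * tent (\<xi> - \<eta> - e))"
          unfolding riesz_def using tent2_nonneg tent_simps(1) by (intro mult_right_mono mult_nonneg_nonneg) auto
        then show ?thesis by (simp add: algebra_simps)
      qed (simp add: tent2_eq_0)
    qed
  qed (rule i)
  ultimately show ?thesis by blast
qed

lemma trilin_tent_exchange:
  assumes e: "norm e = 6"
  shows "\<exists>R. trilin (\<lambda>x. of_real (tent (x - e))) (\<lambda>x. of_real (tent x)) (\<lambda>x. of_real (tent x)) \<xi> = of_real R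
    \<and> R \<le> 4 powr (- (DIM('a) - \<gamma>)) * tent3 (\<xi> - e)"
proof -
  let ?f = "\<lambda>\<eta>. K \<eta> * tent2 (\<eta> - e) * tent (\<xi> - \<eta>)"
  obtain A D where A: "weighted A (\<lambda>x::'a. complex_of_real (tent (x - 0)))" and D: "weighted D (\<lambda>x::'a. complex_of_real (tent (x - e)))"
    using weighted_tent by metis
  note A = A[unfolded diff_zero]
  have "integrable lborel (\<lambda>\<eta>. complex_of_real (?f \<eta>))"
    using trilin_integrand(3)[OF D A A, of \<xi>] by (simp add: corr_tent)
  then have i: "integrable lborel ?f" by (simp only: complex_of_real_integrable_eq)
  have "trilin (\<lambda>x. of_real (tent (x - e))) (\<lambda>x. of_real (tent x)) (\<lambda>x. of_real (tent x)) \<xi> = of_real (LINT \<eta>|lborel. ?f \<eta>)"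
    unfolding trilin_def conv_def corr_tent by (simp flip: of_real_mult)
  moreover have "(LINT \<eta>|lborel. ?f \<eta>) \<le> 4 powr (- (DIM('a) - \<gamma>)) * tent3 (\<xi> - e)"
  proof -
    have m: "(\<lambda>\<eta>. tent2 (\<eta> - e) * tent (\<xi> - \<eta>)) \<in> borel_measurable borel" by measurable
    have s: "tent3 (\<xi> - e) = (LINT \<eta>|lborel. tent2 (\<eta> - e) * tent (\<xi> - \<eta>))"
      unfolding tent3_def using lborel_shift(2)[OF m, of e] by (simp add: algebra_simps)
    have "integrable lborel (\<lambda>\<eta>. tent2 (\<eta> - e) * tent (\<xi> - \<eta>))"
      using lborel_shift(1)[OF m, of e] tent3_integrand[of "\<xi> - e"] by (simp add: algebra_simps)
    then have "integrable lborel (\<lambda>\<eta>. 4 powr (- (DIM('a) - \<gamma>)) * (tent2 (\<eta> - e) * tent (\<xi> - \<eta>)))"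
      by (rule integrable_mult_right)
    moreover have "?f \<eta> \<le> 4 powr (- (DIM('a) - \<gamma>)) * (tent2 (\<eta> - e) * tent (\<xi> - \<eta>))" for \<eta>
    proof (cases "2 \<le> norm (\<eta> - e)")
      case False
      then have "4 \<le> norm \<eta>" using e norm_triangle_sub[of e \<eta>] by (simp add: norm_minus_commute)
      then have "norm \<eta> powr (- (DIM('a) - \<gamma>)) \<le> 4 powr (- (DIM('a) - \<gamma>))"
        using gamma by (intro powr_mono2') auto
      then have "K \<eta> * (tent2 (\<eta> - e) * tent (\<xi> - \<eta>)) \<le> 4 powr (- (DIM('a) - \<gamma>)) * (tent2 (\<eta> - e) * tent (\<xi> - \<eta>))"
        unfolding riesz_def using tent2_nonneg tent_simps(1) by (intro mult_right_mono mult_nonneg_nonneg) auto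
      then show ?thesis by (simp add: mult.assoc)
    qed (simp add: tent2_eq_0)
    ultimately show ?thesis unfolding s integral_mult_right_zero[symmetric] by (intro integral_mono i)
  qed
  ultimately show ?thesis by blast
qed

lemma trilin_zero [simp]: "trilin (\<lambda>x. 0) (\<lambda>x. 0) h \<xi> = 0" "trilin f (\<lambda>x. 0) (\<lambda>x. 0) \<xi> = 0"
  by (simp_all add: trilin_def conv_def corr_def)

text \<open>
  For the reduced equations a single bump is enough. When the exchange term is present, the
  contributions of a component to itself cancel, so the observed component \<^term>\<open>k\<close> carries a bump
  at frequency \<open>x0\<close> and interacts with a bump at the origin in another component. The lower
  bound keeps the pairing of the response with a Gaussian away from 0.
\<close>

lemma exists_datum:
  assumes sys: "sys = Hartree_Fock \<Longrightarrow> CARD('n::finite) \<ge> 2"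
  shows "\<exists>(F :: 'n \<Rightarrow> 'a \<Rightarrow> complex) R k x0 P. (\<forall>l. continuous_on UNIV (F l)) \<and> (\<forall>l x. norm (F l x) \<le> R * weight x) \<and>
    (\<forall>\<kappa> \<xi>. nonlin \<kappa> (exchange_coeff sys) F k \<xi> = of_real (\<kappa> * P \<xi>)) \<and> (\<forall>\<xi>. gap * tent3 (\<xi> - x0) \<le> P \<xi>)"
proof (cases sys)
  case Reduced_Hartree_Fock
  fix k :: 'n
  define F where "F l x = (if l = k then complex_of_real (tent (x - 0)) else 0)" for l :: 'n and x :: 'a
  obtain R where R: "\<And>x. norm (complex_of_real (tent (x - 0))) \<le> R * weight (x::'a)" using tent_shift_weight by blast
  have R0: "0 \<le> R * weight x" for x :: 'a using order_trans[OF norm_ge_zero R] .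
  have "\<exists>P. \<forall>\<xi>. trilin (\<lambda>x. of_real (tent x)) (\<lambda>x. of_real (tent x)) (\<lambda>x. of_real (tent (x - 0))) \<xi> = of_real (P \<xi>)
    \<and> 2 powr (- (DIM('a) - \<gamma>)) * tent3 (\<xi> - 0) \<le> P \<xi>"
    by (rule choice) (use trilin_tent_direct in blast)
  then obtain P where P: "\<And>\<xi>. trilin (\<lambda>x. of_real (tent x)) (\<lambda>x. of_real (tent x)) (\<lambda>x. of_real (tent x)) \<xi> = of_real (P \<xi>)"
    "\<And>\<xi>. 2 powr (- (DIM('a) - \<gamma>)) * tent3 \<xi> \<le> P \<xi>" by auto
  have "(\<Sum>l\<in>UNIV. trilin (F l) (F l) (F k) \<xi>) = (\<Sum>l\<in>{k}. trilin (F l) (F l) (F k) \<xi>)" for \<xi>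
    by (rule sum.mono_neutral_right) (auto simp: F_def[abs_def])
  then have "nonlin \<kappa> (exchange_coeff sys) F k \<xi> = of_real (\<kappa> * P \<xi>)" for \<kappa> \<xi>
    using Reduced_Hartree_Fock P(1)[of \<xi>] by (simp add: nonlin_def exchange_coeff_def F_def[abs_def])
  moreover have "gap * tent3 (\<xi> - 0) \<le> P \<xi>" for \<xi>
  proof -
    have "gap * tent3 \<xi> \<le> 2 powr (- (DIM('a) - \<gamma>)) * tent3 \<xi>"
      by (intro mult_right_mono tent3_nonneg) (simp add: gap_def)
    then show ?thesis using P(2)[of \<xi>] by simp
  qed
  moreover have "continuous_on UNIV (F l)" for l
    using continuous_tent_shift[of 0] by (cases "l = k") (auto simp: F_def[abs_def])
  moreover have "norm (F l x) \<le> R * weight x" for l x using R[of x] R0[of x] by (simp add: F_def)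
  ultimately show ?thesis by blast
next
  case Hartree_Fock
  then have "2 \<le> CARD('n)" using sys by simp
  then obtain k j :: 'n where kj: "k \<noteq> j"
    by (metis (full_types) card_2_iff' card_le_Suc0_iff_eq finite not_less_eq_eq numeral_2_eq_2 UNIV_I)
  obtain b :: 'a where b: "b \<in> Basis" by (meson nonempty_Basis ex_in_conv)
  define e where "e = 6 *\<^sub>R b"
  have e: "norm e = 6" using b by (simp add: e_def)
  define F where "F l x = (if l = k then complex_of_real (tent (x - e)) else if l = j then of_real (tent (x - 0)) else 0)" for l :: 'n and x :: 'a
  obtain R1 R2 where R1: "\<And>x. norm (complex_of_real (tent (x - e))) \<le> R1 * weight (x::'a)"
    and R2: "\<And>x. norm (complex_of_real (tent (x - 0))) \<le> R2 * weight (x::'a)" using tent_shift_weight by metis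
  have R0: "0 \<le> R1 * weight x" "0 \<le> R2 * weight x" for x :: 'a
    using order_trans[OF norm_ge_zero R1] order_trans[OF norm_ge_zero R2] by auto
  have "\<exists>P. \<forall>\<xi>. trilin (\<lambda>x. of_real (tent x)) (\<lambda>x. of_real (tent x)) (\<lambda>x. of_real (tent (x - e))) \<xi> = of_real (P \<xi>)
    \<and> 2 powr (- (DIM('a) - \<gamma>)) * tent3 (\<xi> - e) \<le> P \<xi>"
    by (rule choice) (use trilin_tent_direct in blast)
  then obtain P where P: "\<And>\<xi>. trilin (\<lambda>x. of_real (tent x)) (\<lambda>x. of_real (tent x)) (\<lambda>x. of_real (tent (x - e))) \<xi> = of_real (P \<xi>)"
    "\<And>\<xi>. 2 powr (- (DIM('a) - \<gamma>)) * tent3 (\<xi> - e) \<le> P \<xi>" by blast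
  have "\<exists>Q. \<forall>\<xi>. trilin (\<lambda>x. of_real (tent (x - e))) (\<lambda>x. of_real (tent x)) (\<lambda>x. of_real (tent x)) \<xi> = of_real (Q \<xi>)
    \<and> Q \<xi> \<le> 4 powr (- (DIM('a) - \<gamma>)) * tent3 (\<xi> - e)"
    by (rule choice) (use trilin_tent_exchange[OF e] in blast)
  then obtain Q where Q: "\<And>\<xi>. trilin (\<lambda>x. of_real (tent (x - e))) (\<lambda>x. of_real (tent x)) (\<lambda>x. of_real (tent x)) \<xi> = of_real (Q \<xi>)"
    "\<And>\<xi>. Q \<xi> \<le> 4 powr (- (DIM('a) - \<gamma>)) * tent3 (\<xi> - e)" by blast
  have Fk: "F k = (\<lambda>x. of_real (tent (x - e)))" and Fj: "F j = (\<lambda>x. of_real (tent x))"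
    and F0: "\<And>l. l \<noteq> k \<Longrightarrow> l \<noteq> j \<Longrightarrow> F l = (\<lambda>x. 0)"
    using kj by (auto simp: F_def fun_eq_iff)
  have s1: "(\<Sum>l\<in>UNIV. trilin (F l) (F l) (F k) \<xi>) = (\<Sum>l\<in>{k, j}. trilin (F l) (F l) (F k) \<xi>)" for \<xi>
    by (rule sum.mono_neutral_right) (auto simp: F0)
  have s2: "(\<Sum>l\<in>UNIV. trilin (F k) (F l) (F l) \<xi>) = (\<Sum>l\<in>{k, j}. trilin (F k) (F l) (F l) \<xi>)" for \<xi>
    by (rule sum.mono_neutral_right) (auto simp: F0)
  have "nonlin \<kappa> (exchange_coeff sys) F k \<xi> = of_real (\<kappa> * (P \<xi> - Q \<xi>))" for \<kappa> \<xi>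
    unfolding nonlin_def s1 s2 using Hartree_Fock kj P(1)[of \<xi>] Q(1)[of \<xi>]
    by (simp add: exchange_coeff_def Fk Fj)
  then have 1: "\<forall>\<kappa> \<xi>. nonlin \<kappa> (exchange_coeff sys) F k \<xi> = of_real (\<kappa> * (P \<xi> - Q \<xi>))" by blast
  have 2: "\<forall>\<xi>. gap * tent3 (\<xi> - e) \<le> P \<xi> - Q \<xi>"
    unfolding gap_def left_diff_distrib by (intro allI diff_mono P(2) Q(2))
  have 3: "continuous_on UNIV (F l)" for l
    using continuous_tent_shift[of 0] continuous_tent_shift[of e] unfolding F_def[abs_def]
    by (cases "l = k"; cases "l = j") auto
  have 4: "norm (F l x) \<le> (R1 + R2) * weight x" for l x
    using R1[of x] R2[of x] R0[of x] unfolding F_def distrib_right by (auto simp: add_increasing add_increasing2)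
  show ?thesis
    by (rule exI[of _ F], rule exI[of _ "R1 + R2"], rule exI[of _ k], rule exI[of _ e], rule exI[of _ "\<lambda>\<xi>. P \<xi> - Q \<xi>"])
       (use 1 2 3 4 in blast)
qed

end

section \<open>The Fourier--Lebesgue space as a normed space\<close>

lemma td_of_scaleR:
  assumes "integrable lborel g"
  shows "c *\<^sub>R td_of g = td_of (\<lambda>\<xi>. of_real c * g \<xi>)"
proof (rule fourier_represents_AE[OF fourier_represents_scaleR[OF fourier_represents_td_of[OF assms]] fourier_represents_td_of])
  show "integrable lborel (\<lambda>\<xi>. complex_of_real c * g \<xi>)" using assms by simp
qed (simp add: scaleR_conv_of_real)

context exponent
begin

lemma Lhat_add:
  assumes "T \<in> Lhat p" "S \<in> Lhat p" shows "T + S \<in> Lhat p"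
  using Lhat_diff[OF assms(1) Lhat_scaleR(1)[OF assms(2), of "-1"]] by simp

lemma Lhat_0: "(0 :: 'a::euclidean_space tempered) \<in> Lhat p"
proof -
  have "td_of (\<lambda>x::'a. 0) \<in> Lhat p" by (rule Lhat_td_of(1)[where C=0]) auto
  from Lhat_scaleR(1)[OF this, of 0] show ?thesis by simp
qed

lemma subspace_LhatN: "subspace (LhatN p :: ('a::euclidean_space tempered ^ 'n::finite) set)"
  unfolding subspace_def LhatN_def by (auto intro: Lhat_0 Lhat_add Lhat_scaleR(1))

lemma Lhat_norm_nonneg: "T \<in> Lhat p \<Longrightarrow> 0 \<le> Lhat_norm p T"
  by (elim LhatE) (simp add: Lhat_norm)

lemma LhatN_norm_ge: "Lhat_norm p (\<psi> $ k) \<le> LhatN_norm p (\<psi> :: 'a::euclidean_space tempered ^ 'n::finite)"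
  unfolding LhatN_norm_def by (intro Max_ge) auto

lemma LhatN_norm_nonneg: "\<psi> \<in> LhatN p \<Longrightarrow> 0 \<le> LhatN_norm p (\<psi> :: 'a::euclidean_space tempered ^ 'n::finite)"
  using order_trans[OF Lhat_norm_nonneg LhatN_norm_ge] unfolding LhatN_def by blast

lemma LhatN_norm_le: "(\<And>k. Lhat_norm p (\<psi> $ k) \<le> c) \<Longrightarrow> LhatN_norm p (\<psi> :: 'a::euclidean_space tempered ^ 'n::finite) \<le> c"
  unfolding LhatN_norm_def by (subst Max_le_iff) auto

lemma LhatN_norm_scaleR:
  assumes "\<psi> \<in> LhatN p"
  shows "LhatN_norm p (c *\<^sub>R (\<psi> :: 'a::euclidean_space tempered ^ 'n::finite)) = \<bar>c\<bar> * LhatN_norm p \<psi>"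
proof -
  have "Lhat_norm p ((c *\<^sub>R \<psi>) $ k) = \<bar>c\<bar> * Lhat_norm p (\<psi> $ k)" for k
    using assms Lhat_scaleR(2)[of "\<psi> $ k" c] unfolding LhatN_def by simp
  moreover have "mono (\<lambda>x. \<bar>c\<bar> * x)" by (intro monoI mult_left_mono) auto
  ultimately show ?thesis unfolding LhatN_norm_def
    by (simp add: mono_Max_commute[of "\<lambda>x. \<bar>c\<bar> * x"] image_image)
qed

end

section \<open>The cubic expansion of the solution map and its scaling\<close>

lemma weight_dilate:
  assumes "1 \<le> c"
  shows "weight (c *\<^sub>R x) \<le> weight (x :: 'a::euclidean_space)"
proof -
  have "1 * norm x \<le> norm (c *\<^sub>R x)" using assms unfolding norm_scaleR by (intro mult_right_mono) auto
  then have "(1 + norm x) ^ (2 * DIM('a)) \<le> (1 + norm (c *\<^sub>R x)) ^ (2 * DIM('a))" by (intro power_mono) auto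
  moreover have "0 < (1 + norm x) ^ (2 * DIM('a))" by (intro zero_less_power) (auto intro: add_pos_nonneg)
  moreover have "0 < (1 + norm (c *\<^sub>R x)) ^ (2 * DIM('a))" by (intro zero_less_power) (auto intro: add_pos_nonneg)
  ultimately show ?thesis unfolding weight_def by (intro divide_left_mono mult_pos_pos) auto
qed

lemma apply_td_of_fourier:
  assumes "integrable lborel g" "\<theta> \<in> schwartz"
  shows "apply_td (td_of g) (fourier \<theta>) = (LINT \<xi>|lborel. g \<xi> * \<theta> \<xi>)"
  using fourier_represents_td_of[OF assms(1)] assms(2) unfolding fourier_represents_def by blast

lemma linear_Im_apply_td:
  "linear (\<lambda>w :: 'a::euclidean_space tempered ^ 'n::finite. Im (apply_td (w $ k) \<phi>))"
  by (rule linearI) (simp_all add: apply_td_add apply_td_scaleR)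

lemma gauss_test_function:
  assumes "0 < c"
  shows "(\<lambda>\<xi>::'a::euclidean_space. complex_of_real (gauss 1 (c *\<^sub>R \<xi>))) \<in> schwartz"
    and "(LINT \<xi>|lborel. gauss 1 (c *\<^sub>R (\<xi>::'a))) = c powr (- DIM('a))"
proof -
  have "(\<lambda>\<xi>::'a. complex_of_real (exp (- (pi * c\<^sup>2) * (\<xi> \<bullet> \<xi>) + \<xi> \<bullet> 0))) \<in> schwartz"
    by (rule schwartz_gauss) (use assms in simp)
  moreover have "gauss 1 (c *\<^sub>R \<xi>) = exp (- (pi * c\<^sup>2) * (\<xi> \<bullet> \<xi>) + \<xi> \<bullet> 0)" for \<xi> :: 'a
    by (simp add: gauss_def power_mult_distrib power2_norm_eq_inner)
  ultimately show "(\<lambda>\<xi>::'a. complex_of_real (gauss 1 (c *\<^sub>R \<xi>))) \<in> schwartz" by simp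
  have "(1::real) = (LINT \<xi>|lborel. gauss 1 (\<xi>::'a))" using gaussian_integral(2)[of 1, where 'a='a] by simp
  also have "\<dots> = c ^ DIM('a) *\<^sub>R (LINT \<xi>|lborel. gauss 1 (c *\<^sub>R (\<xi>::'a)))"
    using lborel_scale(2)[of "gauss 1 :: 'a \<Rightarrow> real" c 0] assms by simp
  finally show "(LINT \<xi>|lborel. gauss 1 (c *\<^sub>R (\<xi>::'a))) = c powr (- DIM('a))"
    using assms by (simp add: powr_minus powr_realpow field_simps)
qed

context riesz_setting
begin

text \<open>
  The solution constructed on the Fourier side is a solution in the sense of distributions, so
  uniqueness identifies it with the value of the solution map. The factor \<open>\<i>\<close>
  of the Duhamel integral is why the imaginary part of the pairing picks the real part of the
  cubic integral.
\<close>

lemma solution_map_expansion: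
  fixes a :: "'n::finite \<Rightarrow> 'a \<Rightarrow> complex"
  assumes p: "2 < p" and al: "0 < \<alpha>" and a: "\<And>l. continuous_on UNIV (a l)" "\<And>l x. norm (a l x) \<le> M * weight x"
    and t: "0 < t" "t \<le> T"
    and wd: "solution_map_well_defined sys \<kappa> 0 \<gamma> \<alpha> p T t TYPE('a tempered ^ 'n)"
    and \<theta>: "\<theta> \<in> schwartz" "\<And>\<xi>. norm (\<theta> \<xi>) \<le> 1"
  shows "\<exists>\<epsilon>0>0. \<exists>C. \<forall>\<epsilon>. \<bar>\<epsilon>\<bar> < \<epsilon>0 \<longrightarrow>
    \<bar>Im (apply_td (solution_map sys \<kappa> 0 \<gamma> \<alpha> p T t (\<epsilon> *\<^sub>R (\<chi> l. td_of (a l))) $ k) (fourier \<theta>))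
      - (Im (LINT \<xi>|lborel. phase (symbol \<alpha>) t \<xi> * a k \<xi> * \<theta> \<xi>) * \<epsilon>
         + Re (LINT \<xi>|lborel. duh (symbol \<alpha>) (\<lambda>\<tau>. nonlin (\<kappa> * rc) (exchange_coeff sys) (\<lambda>l \<xi>. phase (symbol \<alpha>) \<tau> \<xi> * a l \<xi>) k) t \<xi> * \<theta> \<xi>) * \<epsilon> ^ 3)\<bar>
      \<le> C * \<bar>\<epsilon>\<bar> ^ 5"
proof -
  define q \<rho> where "q = enn2real (conj_exponent p)" and "\<rho> = enn2real (inverse p)"
  interpret exponent p q \<rho> by unfold_locales (use p q_def \<rho>_def in auto)
  let ?m = "symbol \<alpha> :: 'a \<Rightarrow> real" and ?s = "exchange_coeff sys"
  have m: "continuous_on UNIV ?m" by (rule continuous_symbol[OF al])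
  have s: "\<bar>?s\<bar> \<le> 1" by (cases sys) (auto simp: exchange_coeff_def)
  have T: "0 \<le> T" using t by simp
  have tT: "t \<in> {0..T}" using t by simp
  let ?B = "duh ?m (\<lambda>\<tau>. nonlin (\<kappa> * rc) ?s (\<lambda>l \<xi>. phase ?m \<tau> \<xi> * a l \<xi>) k) t"
  obtain \<epsilon>0 C where e0: "0 < \<epsilon>0" and sol: "\<And>\<epsilon>. \<bar>\<epsilon>\<bar> < \<epsilon>0 \<Longrightarrow> \<exists>R f. (\<forall>k. weighted_family R (f k)) \<and>
    (\<forall>k. \<forall>t\<in>{0..T}. \<forall>\<xi>. f k t \<xi> = of_real \<epsilon> * (phase ?m t \<xi> * a k \<xi>)
        + \<i> * duh ?m (\<lambda>\<tau>. nonlin (\<kappa> * rc) ?s (\<lambda>l. f l \<tau>) k) t \<xi>) \<and>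
    (\<forall>k. \<forall>t\<in>{0..T}. \<forall>\<xi>. norm (f k t \<xi> - (of_real \<epsilon> * (phase ?m t \<xi> * a k \<xi>)
        + of_real (\<epsilon> ^ 3) * (\<i> * duh ?m (\<lambda>\<tau>. nonlin (\<kappa> * rc) ?s (\<lambda>l \<xi>. phase ?m \<tau> \<xi> * a l \<xi>) k) t \<xi>))) \<le> C * \<bar>\<epsilon>\<bar> ^ 5 * weight \<xi>)"
    using small_solution[where a=a and \<kappa>="\<kappa> * rc", OF m a T s] by blast
  have aw: "weighted M (a l)" for l unfolding weighted_def using a borel_measurable_continuous by blast
  have ai: "integrable lborel (a l)" for l by (rule weighted_integrable[OF aw])
  have th[measurable]: "\<theta> \<in> borel_measurable borel" by (rule schwartz_measurable[OF \<theta>(1)])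
  have pa: "weighted_family M (\<lambda>\<tau> \<xi>. phase ?m \<tau> \<xi> * a l \<xi>)" for l
    by (intro weighted_family_phase m weighted_family_const a continuous_intros)
  have Bi: "integrable lborel ?B"
  proof -
    have n: "weighted_family (nonlin_const (\<kappa> * rc) TYPE('n) * M ^ 3) (\<lambda>\<tau>. nonlin (\<kappa> * rc) ?s (\<lambda>l \<xi>. phase ?m \<tau> \<xi> * a l \<xi>) k)"
      by (rule weighted_family_nonlin[where f="\<lambda>l \<tau> \<xi>. phase ?m \<tau> \<xi> * a l \<xi>", OF pa s])
    have "max 0 (min T t) = t" using t by simp
    then show ?thesis
      using weighted_integrable[OF weighted_family_weighted[OF weighted_family_duh[OF m n T], of t]] by simp
  qed
  have i1: "integrable lborel (\<lambda>\<xi>. phase ?m t \<xi> * a k \<xi> * \<theta> \<xi>)"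
    by (rule integrable_mult_bounded[OF weighted_integrable[OF weighted_family_weighted[OF pa]] th \<theta>(2)])
  have i2: "integrable lborel (\<lambda>\<xi>. ?B \<xi> * \<theta> \<xi>)"
    by (rule integrable_mult_bounded[OF Bi th \<theta>(2)])
  let ?W = "LINT x|lborel. weight (x::'a)"
  have main: "\<bar>Im (apply_td (solution_map sys \<kappa> 0 \<gamma> \<alpha> p T t (\<epsilon> *\<^sub>R (\<chi> l. td_of (a l))) $ k) (fourier \<theta>))
      - (Im (LINT \<xi>|lborel. phase ?m t \<xi> * a k \<xi> * \<theta> \<xi>) * \<epsilon> + Re (LINT \<xi>|lborel. ?B \<xi> * \<theta> \<xi>) * \<epsilon> ^ 3)\<bar>
      \<le> (C * ?W) * \<bar>\<epsilon>\<bar> ^ 5" if eps: "\<bar>\<epsilon>\<bar> < \<epsilon>0" for \<epsilon>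
  proof -
    obtain R f where f: "\<And>k. weighted_family R (f k)"
      and eq: "\<And>k t \<xi>. t \<in> {0..T} \<Longrightarrow> f k t \<xi> = of_real \<epsilon> * (phase ?m t \<xi> * a k \<xi>)
        + \<i> * duh ?m (\<lambda>\<tau>. nonlin (\<kappa> * rc) ?s (\<lambda>l. f l \<tau>) k) t \<xi>"
      and err: "\<And>\<xi>. norm (f k t \<xi> - (of_real \<epsilon> * (phase ?m t \<xi> * a k \<xi>) + of_real (\<epsilon> ^ 3) * (\<i> * ?B \<xi>))) \<le> C * \<bar>\<epsilon>\<bar> ^ 5 * weight \<xi>"
      using sol[OF eps] tT by (elim exE conjE) blast
    let ?a = "\<lambda>l \<xi>. of_real \<epsilon> * a l \<xi>"
    have data: "\<epsilon> *\<^sub>R (\<chi> l. td_of (a l)) = (\<chi> l. td_of (?a l))"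
      by (simp add: vec_eq_iff td_of_scaleR[OF ai])
    have wa: "weighted (\<bar>\<epsilon>\<bar> * M) (?a l)" for l
      using aw[of l] unfolding weighted_def by (auto simp: norm_mult mult.assoc intro!: mult_left_mono)
    have "duhamel_solution sys \<kappa> 0 \<gamma> \<alpha> p T (\<chi> l. td_of (?a l)) (\<lambda>t. \<chi> l. td_of (f l t))"
    proof (rule duhamel_solution_td_of[where f=f and a="?a", OF p al wa f])
      show "f k t \<xi> = phase ?m t \<xi> * (of_real \<epsilon> * a k \<xi>) + \<i> * duh ?m (\<lambda>\<tau>. nonlin (\<kappa> * rc) ?s (\<lambda>l. f l \<tau>) k) t \<xi>"
        if "t \<in> {0..T}" for k t \<xi>
        by (subst eq[OF that]) (simp add: mult.left_commute)
    qed
    then have val: "is_solution_value sys \<kappa> 0 \<gamma> \<alpha> p T t (\<epsilon> *\<^sub>R (\<chi> l. td_of (a l))) (\<chi> l. td_of (f l t))"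
      unfolding is_solution_value_def data by blast
    have "\<epsilon> *\<^sub>R (\<chi> l. td_of (a l)) \<in> LhatN p"
      unfolding data LhatN_def using Lhat_td_of(1)[OF weighted_measurable[OF wa] weighted_bound[OF wa]] by simp
    then have "\<exists>!v. is_solution_value sys \<kappa> 0 \<gamma> \<alpha> p T t (\<epsilon> *\<^sub>R (\<chi> l. td_of (a l))) v"
      using wd unfolding solution_map_well_defined_def by blast
    then have S: "solution_map sys \<kappa> 0 \<gamma> \<alpha> p T t (\<epsilon> *\<^sub>R (\<chi> l. td_of (a l))) = (\<chi> l. td_of (f l t))"
      unfolding solution_map_def using val by (rule the1_equality)
    have fi: "integrable lborel (f k t)" by (rule weighted_integrable[OF weighted_family_weighted[OF f]])
    have i0: "integrable lborel (\<lambda>\<xi>. f k t \<xi> * \<theta> \<xi>)" by (rule integrable_mult_bounded[OF fi th \<theta>(2)])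
    let ?I1 = "LINT \<xi>|lborel. phase ?m t \<xi> * a k \<xi> * \<theta> \<xi>" and ?I2 = "LINT \<xi>|lborel. ?B \<xi> * \<theta> \<xi>"
    let ?r = "\<lambda>\<xi>. f k t \<xi> * \<theta> \<xi> - (of_real \<epsilon> * (phase ?m t \<xi> * a k \<xi> * \<theta> \<xi>) + of_real (\<epsilon> ^ 3) * \<i> * (?B \<xi> * \<theta> \<xi>))"
    have ir: "integrable lborel ?r"
      by (intro Bochner_Integration.integrable_diff Bochner_Integration.integrable_add integrable_mult_right i0 i1 i2)
    have "(LINT \<xi>|lborel. ?r \<xi>) = (LINT \<xi>|lborel. f k t \<xi> * \<theta> \<xi>) - (of_real \<epsilon> * ?I1 + of_real (\<epsilon> ^ 3) * \<i> * ?I2)"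
      by (simp only: Bochner_Integration.integral_diff[OF i0 Bochner_Integration.integrable_add[OF integrable_mult_right[OF i1] integrable_mult_right[OF i2]]]
          Bochner_Integration.integral_add[OF integrable_mult_right[OF i1] integrable_mult_right[OF i2]] integral_mult_right_zero)
    moreover have "norm (LINT \<xi>|lborel. ?r \<xi>) \<le> (LINT \<xi>|lborel. C * \<bar>\<epsilon>\<bar> ^ 5 * weight (\<xi>::'a))"
    proof (rule Bochner_Integration.integral_norm_bound_integral[OF ir])
      show "integrable lborel (\<lambda>\<xi>::'a. C * \<bar>\<epsilon>\<bar> ^ 5 * weight \<xi>)" by (simp add: integrable_weight)
      fix \<xi> :: 'a
      have "?r \<xi> = (f k t \<xi> - (of_real \<epsilon> * (phase ?m t \<xi> * a k \<xi>) + of_real (\<epsilon> ^ 3) * (\<i> * ?B \<xi>))) * \<theta> \<xi>"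
        by (simp add: algebra_simps)
      then have "norm (?r \<xi>) = norm (f k t \<xi> - (of_real \<epsilon> * (phase ?m t \<xi> * a k \<xi>) + of_real (\<epsilon> ^ 3) * (\<i> * ?B \<xi>))) * norm (\<theta> \<xi>)"
        by (simp only: norm_mult)
      also have "\<dots> \<le> (C * \<bar>\<epsilon>\<bar> ^ 5 * weight \<xi>) * 1"
        by (intro mult_mono err \<theta>(2)) (use order_trans[OF norm_ge_zero err] in auto)
      finally show "norm (?r \<xi>) \<le> C * \<bar>\<epsilon>\<bar> ^ 5 * weight \<xi>" by simp
    qed
    ultimately have "norm ((LINT \<xi>|lborel. f k t \<xi> * \<theta> \<xi>) - (of_real \<epsilon> * ?I1 + of_real (\<epsilon> ^ 3) * \<i> * ?I2)) \<le> (C * ?W) * \<bar>\<epsilon>\<bar> ^ 5"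
      by (simp add: mult_ac)
    from order_trans[OF abs_Im_le_cmod this]
    have "\<bar>Im (LINT \<xi>|lborel. f k t \<xi> * \<theta> \<xi>) - (Im ?I1 * \<epsilon> + Re ?I2 * \<epsilon> ^ 3)\<bar> \<le> (C * ?W) * \<bar>\<epsilon>\<bar> ^ 5"
      by (simp add: mult_ac flip: of_real_power)
    then show ?thesis unfolding S by (simp add: apply_td_of_fourier[OF fi \<theta>(1)])
  qed
  show ?thesis
    by (rule exI[of _ \<epsilon>0], rule conjI[OF e0], rule exI[of _ "C * ?W"]) (use main in blast)
qed

end

text \<open>
  In the rescaled frequency variable the cubic term depends on the scale \<^term>\<open>c\<close> only through the
  speed of the phases, so its pairing \<open>J\<close> with a Gaussian tends to a nonzero limit as the scale
  grows. Smoothness would bound the same quantity by a negative power of the scale.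
\<close>

theorem theorem1p10:
  fixes \<alpha> \<gamma> \<kappa> t T :: real and p :: ennreal and sys :: hf_system
  assumes "0 < \<alpha>" and "\<kappa> \<noteq> 0"
    and "2 < p"
    and "0 < \<gamma>" and "\<gamma> < 2 * real DIM('a::euclidean_space) * (1 / 2 - enn2real (inverse p))"
    and "0 < t" and "t \<le> T"
    and "sys = Hartree_Fock \<Longrightarrow> CARD('n::finite) \<ge> 2"
    and "solution_map_well_defined sys \<kappa> 0 \<gamma> \<alpha> p T t TYPE('a tempered ^ 'n)"
  shows "\<not> C_smooth_at 3 (LhatN p :: ('a tempered ^ 'n) set) (LhatN_norm p)
            (solution_map sys \<kappa> 0 \<gamma> \<alpha> p T t) 0"
proof
  assume smooth: "C_smooth_at 3 (LhatN p :: ('a tempered ^ 'n) set) (LhatN_norm p)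
            (solution_map sys \<kappa> 0 \<gamma> \<alpha> p T t) 0"
  define q \<rho> where "q = enn2real (conj_exponent p)" and "\<rho> = enn2real (inverse p)"
  interpret exponent p q \<rho> by unfold_locales (use assms(3) q_def \<rho>_def in auto)
  define d where "d = real DIM('a)"
  have d: "1 \<le> d" unfolding d_def by (simp add: Suc_leI)
  have gam: "\<gamma> < d - 2 * d * \<rho>" using assms(5) by (simp add: d_def \<rho>_def algebra_simps)
  then have "\<gamma> < d" using d inverse_p(2) by (smt (verit) mult_nonneg_nonneg)
  interpret riesz_setting \<gamma> "TYPE('a)" by unfold_locales (use assms(4) \<open>\<gamma> < d\<close> d_def in auto)
  let ?s = "exchange_coeff sys" and ?S = "solution_map sys \<kappa> 0 \<gamma> \<alpha> p T t :: 'a tempered ^ 'n \<Rightarrow> _"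
  have s: "\<bar>?s\<bar> \<le> 1" by (cases sys) (auto simp: exchange_coeff_def)
  obtain C where C: "0 \<le> C" and bound: "\<And>\<Lambda> L v l1 l3 K \<epsilon>0. linear \<Lambda> \<Longrightarrow> \<forall>w\<in>LhatN p. \<bar>\<Lambda> w\<bar> \<le> L * LhatN_norm p w \<Longrightarrow> 0 \<le> L \<Longrightarrow>
      v \<in> (LhatN p :: ('a tempered ^ 'n) set) \<Longrightarrow> 0 < \<epsilon>0 \<Longrightarrow>
      \<forall>\<epsilon>. \<bar>\<epsilon>\<bar> < \<epsilon>0 \<longrightarrow> \<bar>\<Lambda> (?S (\<epsilon> *\<^sub>R v)) - (l1 * \<epsilon> + l3 * \<epsilon> ^ 3)\<bar> \<le> K * \<bar>\<epsilon>\<bar> ^ 5 \<Longrightarrow> \<bar>l3\<bar> \<le> C * L * LhatN_norm p v ^ 3"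
    using C3_smooth_cubic_bound[OF smooth subspace_LhatN LhatN_norm_nonneg LhatN_norm_scaleR] by blast
  obtain F :: "'n \<Rightarrow> 'a \<Rightarrow> complex" and R k x0 P where F: "\<And>l. continuous_on UNIV (F l)" "\<And>l x. norm (F l x) \<le> R * weight x"
    and P: "\<And>\<kappa> \<xi>. nonlin \<kappa> ?s F k \<xi> = of_real (\<kappa> * P \<xi>)" and gapP: "\<And>\<xi>. gap * tent3 (\<xi> - x0) \<le> P \<xi>"
    using exists_datum[OF assms(8)] by blast
  have R: "0 \<le> R" using weighted_family_nonneg[OF weighted_family_const[OF F, of undefined]] .
  have Fm[measurable]: "F l \<in> borel_measurable borel" for l by (rule borel_measurable_continuous[OF F(1)])
  let ?Q = "scaled_cubic \<alpha> (\<kappa> * rc) ?s F k t"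
  obtain CQ where Q: "weighted_family CQ ?Q"
    using weighted_family_scaled_cubic[where F=F and k=k and t=t and \<kappa>="\<kappa> * rc", OF assms(1) F s] less_imp_le[OF assms(6)] by blast
  \<comment> \<open>The rescaled cubic response; at speed 0 it is \<^term>\<open>t\<close> times
      the nonlinearity of the profile, paired with a Gaussian.\<close>
  define J where "J \<mu> = (LINT \<xi>|lborel. ?Q \<mu> \<xi> * of_real (gauss 1 \<xi>))" for \<mu>
  have g1: "norm (complex_of_real (gauss 1 \<xi>)) \<le> 1" for \<xi> :: 'a
    using gauss_le_1[of 1 \<xi>] by simp
  have J_cont: "continuous_on UNIV J"
    unfolding J_def
  proof (rule continuous_LINT[where B="\<lambda>\<xi>. CQ * weight \<xi>"])
    show "(\<lambda>\<xi>. ?Q \<mu> \<xi> * of_real (gauss 1 \<xi>)) \<in> borel_measurable lborel" for \<mu>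
      using weighted_measurable[OF weighted_family_weighted[OF Q]] by measurable
    show "continuous_on UNIV (\<lambda>\<mu>. ?Q \<mu> \<xi> * of_real (gauss 1 \<xi>))" for \<xi>
      by (intro continuous_intros weighted_family_compose[OF Q])
    show "norm (?Q \<mu> \<xi> * of_real (gauss 1 \<xi>)) \<le> CQ * weight \<xi>" for \<mu> \<xi>
    proof -
      have "norm (?Q \<mu> \<xi> * of_real (gauss 1 \<xi>)) \<le> (CQ * weight \<xi>) * 1"
        unfolding norm_mult by (intro mult_mono weighted_bound[OF weighted_family_weighted[OF Q]] g1)
          (use weighted_family_nonneg[OF Q] in auto)
      then show ?thesis by simp
    qed
  qed (use integrable_weight in auto)
  define I where "I = (LINT \<xi>|lborel. P \<xi> * gauss 1 \<xi>)"
  have "0 < I"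
  proof -
    have "weighted_family (nonlin_const 1 TYPE('n) * R ^ 3) (\<lambda>p::real. nonlin 1 ?s F k)"
      by (rule weighted_family_nonlin[where f="\<lambda>l p. F l", OF weighted_family_const[OF F] s])
    then have n: "weighted_family (nonlin_const 1 TYPE('n) * R ^ 3) (\<lambda>(p::real) \<xi>. complex_of_real (P \<xi>))"
      by (simp add: P[of 1, unfolded mult_1, symmetric])
    have "continuous_on UNIV (\<lambda>\<xi>. Re (complex_of_real (P \<xi>)))"
      by (intro continuous_on_Re weighted_family_continuous[OF n])
    then have Pc: "continuous_on UNIV P" by simp
    note Pi = integrable_mult_bounded[OF weighted_integrable[OF weighted_family_weighted[OF n]] _ g1]
    have "integrable lborel (\<lambda>\<xi>. complex_of_real (P \<xi> * gauss 1 \<xi>))" using Pi by simp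
    then have i: "integrable lborel (\<lambda>\<xi>. P \<xi> * gauss 1 \<xi>)" by (simp only: complex_of_real_integrable_eq)
    have P0: "0 \<le> P \<xi>" for \<xi> using order_trans[OF mult_nonneg_nonneg[OF less_imp_le[OF gap_pos] tent3_nonneg] gapP] .
    have "0 < gap * tent3 (x0 - x0)" using gap_pos tent3_0 by simp
    then have "0 < P x0" using gapP[of x0] by linarith
    then show ?thesis unfolding I_def
      by (intro LINT_pos_of_continuous[where z=x0] i continuous_intros Pc) (auto simp: P0 gauss_pos)
  qed
  have J0: "J 0 = of_real (t * (\<kappa> * rc) * I)"
  proof -
    have "J 0 = (LINT \<xi>|lborel. complex_of_real (t * (\<kappa> * rc) * (P \<xi> * gauss 1 \<xi>)))"
      unfolding J_def using assms(6) by (simp add: scaled_cubic_0 P mult_ac)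
    then show ?thesis by (simp only: integral_complex_of_real integral_mult_right_zero I_def)
  qed
  define V where "V = LhatN_norm p (\<chi> l. td_of (F l) :: 'a tempered ^ 'n)"
  note LF = Lhat_td_of[where g="F l" for l, OF Fm F(2)]
  have V: "0 \<le> V" unfolding V_def by (rule LhatN_norm_nonneg) (use LF(1) in \<open>simp add: LhatN_def\<close>)
  \<comment> \<open>The cubic bound from smoothness for data at frequencies of size \<open>1/c\<close>, with all powers of
      the scale moved to the right.\<close>
  have key: "\<bar>Re (J (c powr (- \<alpha>)))\<bar> \<le> (2 * C * V ^ 3) * c powr (- (d - 2 * d * \<rho> - \<gamma>))" if c: "1 \<le> c" for c
  proof -
    have c0: "0 < c" using c by simp
    let ?a = "\<lambda>l \<xi>. F l (c *\<^sub>R \<xi>)" and ?\<theta> = "\<lambda>\<xi>::'a. complex_of_real (gauss 1 (c *\<^sub>R \<xi>))"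
    have a: "continuous_on UNIV (?a l)" "norm (?a l x) \<le> R * weight x" for l x
    proof -
      show "continuous_on UNIV (?a l)" by (intro continuous_on_compose2[OF F(1)] continuous_intros) auto
      show "norm (?a l x) \<le> R * weight x" using order_trans[OF F(2) mult_left_mono[OF weight_dilate[OF c] R]] .
    qed
    have am[measurable]: "?a l \<in> borel_measurable borel" for l by (rule borel_measurable_continuous[OF a(1)])
    note La = Lhat_td_of[OF am a(2)]
    define v where "v = (\<chi> l. td_of (?a l) :: 'a tempered ^ 'n)"
    have v: "v \<in> LhatN p" unfolding LhatN_def v_def using La(1) by simp
    have nv: "LhatN_norm p v \<le> c powr (- d / q) * V"
    proof (rule LhatN_norm_le)
      fix l
      have "(LINT x|lborel. norm (F l x) powr q) = c ^ DIM('a) *\<^sub>R (LINT x|lborel. norm (?a l x) powr q)"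
        using lborel_scale(2)[of "\<lambda>x. norm (F l x) powr q" c 0] c0 by simp
      then have "(LINT x|lborel. norm (?a l x) powr q) = c powr (- d) * (LINT x|lborel. norm (F l x) powr q)"
        using c0 by (simp add: d_def powr_minus powr_realpow field_simps)
      then have "Lhat_norm p (v $ l) = c powr (- d / q) * Lhat_norm p (td_of (F l))"
        unfolding v_def using La(2) LF(2) by (simp add: powr_mult powr_powr)
      also have "\<dots> \<le> c powr (- d / q) * V"
        unfolding V_def using LhatN_norm_ge[of "\<chi> l. td_of (F l)" l] by (intro mult_left_mono) auto
      finally show "Lhat_norm p (v $ l) \<le> c powr (- d / q) * V" .
    qed
    have \<theta>: "?\<theta> \<in> schwartz" "(LINT \<xi>|lborel. norm (?\<theta> \<xi>)) = c powr (- d)"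
      using gauss_test_function[OF c0, where 'a='a] by (simp_all add: d_def)
    have \<theta>1: "norm (?\<theta> \<xi>) \<le> 1" for \<xi> using g1[of "c *\<^sub>R \<xi>"] .
    let ?\<Lambda> = "\<lambda>w :: 'a tempered ^ 'n. Im (apply_td (w $ k) (fourier ?\<theta>))"
    define L where "L = 2 * c powr (d / q - d)"
    have L: "\<bar>?\<Lambda> w\<bar> \<le> L * LhatN_norm p w" if w: "w \<in> LhatN p" for w
    proof -
      have wk: "w $ k \<in> Lhat p" using w unfolding LhatN_def by simp
      have "\<bar>?\<Lambda> w\<bar> \<le> norm (apply_td (w $ k) (fourier ?\<theta>))" by (rule abs_Im_le_cmod)
      \<comment> \<open>The free parameter balances the L1 norm of the dilated Gaussian, of
          order \<^term>\<open>c powr (- d)\<close>, against its sup norm 1.\<close>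
      also have "\<dots> \<le> Lhat_norm p (w $ k) * (c powr (d / q) * (LINT x|lborel. norm (?\<theta> x)) + (c powr (d / q)) powr (1 - q) * 1)"
        by (rule Lhat_pairing_bound[OF wk \<theta>(1) \<theta>1]) (use c0 in simp)
      also have "c powr (d / q) * (LINT x|lborel. norm (?\<theta> x)) + (c powr (d / q)) powr (1 - q) * 1 = L"
      proof -
        have "d / q * (1 - q) = d / q - d" using q_ge_1 by (simp add: right_diff_distrib)
        moreover have "c powr (d / q) * c powr (- d) = c powr (d / q - d)" by (simp flip: powr_add)
        ultimately show ?thesis unfolding \<theta>(2) powr_powr L_def by simp
      qed
      also have "Lhat_norm p (w $ k) * L \<le> LhatN_norm p w * L"
        by (intro mult_right_mono LhatN_norm_ge) (simp add: L_def)
      finally show ?thesis by (simp add: mult.commute)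
    qed
    let ?B = "duh (symbol \<alpha>) (\<lambda>\<tau>. nonlin (\<kappa> * rc) ?s (\<lambda>l \<xi>. phase (symbol \<alpha>) \<tau> \<xi> * ?a l \<xi>) k) t"
    obtain \<epsilon>0 K where "0 < \<epsilon>0" and ex: "\<forall>\<epsilon>. \<bar>\<epsilon>\<bar> < \<epsilon>0 \<longrightarrow> \<bar>?\<Lambda> (?S (\<epsilon> *\<^sub>R v)) - (Im (LINT \<xi>|lborel. phase (symbol \<alpha>) t \<xi> * ?a k \<xi> * ?\<theta> \<xi>) * \<epsilon>
         + Re (LINT \<xi>|lborel. ?B \<xi> * ?\<theta> \<xi>) * \<epsilon> ^ 3)\<bar> \<le> K * \<bar>\<epsilon>\<bar> ^ 5"
      using solution_map_expansion[where a="?a" and k=k, OF assms(3) assms(1) a assms(6,7,9) \<theta>(1) \<theta>1] unfolding v_def by blast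
    have "\<bar>Re (LINT \<xi>|lborel. ?B \<xi> * ?\<theta> \<xi>)\<bar> \<le> C * L * LhatN_norm p v ^ 3"
      by (rule bound[OF linear_Im_apply_td _ _ v \<open>0 < \<epsilon>0\<close> ex]) (use L in \<open>auto simp: L_def\<close>)
    also have "\<dots> \<le> C * L * (c powr (- d / q) * V) ^ 3"
      using C nv LhatN_norm_nonneg[OF v] by (intro mult_left_mono power_mono) (auto simp: L_def)
    also have "(LINT \<xi>|lborel. ?B \<xi> * ?\<theta> \<xi>) = of_real (c powr (- (d + \<gamma>)) * c powr (- d)) * J (c powr (- \<alpha>))"
    proof -
      let ?G = "\<lambda>\<xi>. ?Q (c powr (- \<alpha>)) \<xi> * complex_of_real (gauss 1 \<xi>)"
      have m: "?G \<in> borel_measurable borel"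
        using weighted_measurable[OF weighted_family_weighted[OF Q]] by measurable
      have "(LINT \<xi>|lborel. ?B \<xi> * ?\<theta> \<xi>) = (LINT \<xi>|lborel. of_real (c powr (- (d + \<gamma>))) * ?G (c *\<^sub>R \<xi>))"
        unfolding duh_dilate[where F=F, OF assms(1) Fm c0] d_def by (simp add: mult.assoc)
      also have "\<dots> = of_real (c powr (- (d + \<gamma>))) * (LINT \<xi>|lborel. ?G (c *\<^sub>R \<xi>))" by (rule integral_mult_right_zero)
      also have "(LINT \<xi>|lborel. ?G (c *\<^sub>R \<xi>)) = of_real (c powr (- d)) * J (c powr (- \<alpha>))"
      proof -
        have "J (c powr (- \<alpha>)) = c ^ DIM('a) *\<^sub>R (LINT \<xi>|lborel. ?G (c *\<^sub>R \<xi>))"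
          unfolding J_def using lborel_scale(2)[OF m, of c 0] c0 by simp
        then show ?thesis using c0 by (simp add: d_def scaleR_conv_of_real powr_minus powr_realpow flip: of_real_mult of_real_power)
      qed
      finally show ?thesis by (simp add: mult.assoc)
    qed
    finally have "\<bar>c powr (- (d + \<gamma>)) * c powr (- d) * Re (J (c powr (- \<alpha>)))\<bar> \<le> C * L * (c powr (- d / q) * V) ^ 3"
      by (simp flip: of_real_mult)
    then have "c powr (- (2 * d + \<gamma>)) * \<bar>Re (J (c powr (- \<alpha>)))\<bar> \<le> C * L * (c powr (- d / q) * V) ^ 3"
      by (simp add: abs_mult mult.commute flip: powr_add)
    also have "C * L * (c powr (- d / q) * V) ^ 3 = (2 * C * V ^ 3) * c powr (d / q - d - 3 * d / q)"
    proof -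
      have "(c powr (- d / q)) ^ 3 = c powr (- 3 * d / q)"
        using c0 by (simp add: powr_powr mult.commute flip: powr_numeral)
      moreover have "c powr (d / q - d) * c powr (- 3 * d / q) = c powr (d / q - d - 3 * d / q)" by (simp flip: powr_add)
      ultimately show ?thesis unfolding L_def power_mult_distrib by (simp add: mult_ac)
    qed
    finally have "c powr (2 * d + \<gamma>) * (c powr (- (2 * d + \<gamma>)) * \<bar>Re (J (c powr (- \<alpha>)))\<bar>) \<le> c powr (2 * d + \<gamma>) * ((2 * C * V ^ 3) * c powr (d / q - d - 3 * d / q))"
      by (rule mult_left_mono) simp
    moreover have "c powr (2 * d + \<gamma>) * c powr (- (2 * d + \<gamma>)) = 1" using c0 by (simp flip: powr_add)
    moreover have "c powr (2 * d + \<gamma>) * c powr (d / q - d - 3 * d / q) = c powr (- (d - 2 * d * \<rho> - \<gamma>))"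
    proof -
      have "1 / q = 1 - \<rho>" using conj_p(2) inverse_p(3) by simp
      then have 1: "d / q = d * (1 - \<rho>)" by (metis divide_inverse inverse_eq_divide)
      then have 3: "3 * d / q = 3 * (d * (1 - \<rho>))" by (metis times_divide_eq_right)
      have "(2 * d + \<gamma>) + (d / q - d - 3 * d / q) = - (d - 2 * d * \<rho> - \<gamma>)"
        unfolding 1 3 by (simp add: algebra_simps)
      then show ?thesis by (simp only: powr_add[symmetric])
    qed
    ultimately show ?thesis by (simp only: mult.assoc[symmetric] mult_1) (simp only: mult_ac)
  qed
  let ?e = "d - 2 * d * \<rho> - \<gamma>"
  have lim1: "(\<lambda>n. \<bar>Re (J (real (Suc n) powr (- \<alpha>)))\<bar>) \<longlonglongrightarrow> \<bar>Re (J 0)\<bar>"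
  proof -
    have "(\<lambda>n. real (Suc n) powr (- \<alpha>)) \<longlonglongrightarrow> 0" using assms(1) by real_asymp
    moreover have "isCont J 0" using J_cont by (rule continuous_on_interior) simp
    ultimately have "(\<lambda>n. J (real (Suc n) powr (- \<alpha>))) \<longlonglongrightarrow> J 0" by (rule isCont_tendsto_compose[rotated])
    then show ?thesis by (intro tendsto_rabs tendsto_Re)
  qed
  have lim2: "(\<lambda>n. (2 * C * V ^ 3) * real (Suc n) powr (- ?e)) \<longlonglongrightarrow> (2 * C * V ^ 3) * 0"
  proof (rule tendsto_mult_left)
    have "0 < ?e" using gam by simp
    then show "(\<lambda>n. real (Suc n) powr (- ?e)) \<longlonglongrightarrow> 0" by real_asymp
  qed
  have "\<bar>Re (J 0)\<bar> \<le> (2 * C * V ^ 3) * 0"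
    by (rule LIMSEQ_le[OF lim1 lim2]) (use key in auto)
  moreover have "0 < \<bar>Re (J 0)\<bar>"
    unfolding J0 using assms(2,6) rc_pos \<open>0 < I\<close> by simp
  ultimately show False by simp
qed

end
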